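(* Let $\vec\mu=(\mu_1,\mu_2)$ be an Angelesco system with $\Delta_1<\Delta_2$, let $X\in\mathcal V$, $X\neq O$, and let $\rho_{[X]}$ be the spectral measure of $\delta^{(X)}$ with respect to the operator $\mathcal J_{[X]}$. Then $$d\rho_{[X]}(x)=S_X(x)\,d\omega_{X_{(p)}}(x)+\sum_{E\in E_{X_{(p)}}}Q_X(\{E\})\,L_{X_{(p)}+}^{-1}(E)\,d\delta_E(x),$$ where the numbers $Q_X(\{E\})L_{X_{(p)}+}^{-1}(E)$ are well defined and non-negative for each $E\in E_{X_{(p)}}$. Moreover, for every $Y\in\mathcal V_{[X]}$, $$d\,\Im G(Y,X)^+(x)=\pi\,\Psi_Y(X;x)\,d\rho_{[X]}(x),\qquad \Psi(X;x)=S_X^{-1}(x)\widetilde\Psi(X;x).$$ Furthermore, $$\mathcal J_{[X]}\Psi(X;x)=x\Psi(X;x)\quad\text{and}\quad\delta_Y^{(X)}=\int\Psi_Y(X;x)\,d\rho_{[X]}(x)\quad(Y\in\mathcal V_{[X]}).$$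
   Context: Angelesco system: $\mu_1,\mu_2$ are finite positive Borel measures on $\mathbb R$ with compact supports of infinite cardinality; $\Delta_i=[\alpha_i,\beta_i]$ is the convex hull of $\operatorname{supp}\mu_i$; $\Delta_1\cap\Delta_2=\varnothing$, labelled so that $\beta_1<\alpha_2$ (written $\Delta_1<\Delta_2$). $\widehat\mu(z)=\int\frac{d\mu(x)}{z-x}$. Multiple orthogonality. For $\vec n\in\mathbb Z_+^2\setminus\{(0,0)\}$, $A^{(1)}_{\vec n},A^{(2)}_{\vec n}$ are the polynomials with $\deg A_{\vec n}^{(k)}\le n_k-1$ ($A_{\vec n}^{(k)}=0$ if $n_k=0$), $\int x^m(A_{\vec n}^{(1)}d\mu_1+A_{\vec n}^{(2)}d\mu_2)=0$ for $0\le m\le|\vec n|-2$ and $=1$ for $m=|\vec n|-1$; $P_{\vec n}$ is the monic polynomial of degree $|\vec n|=n_1+n_2$ with $\int P_{\vec n}x^md\mu_k=0$, $0\le m<n_k$, $k=1,2$. Angelesco systems are perfect (these polynomials exist uniquely), and there are uniformly bounded real recurrence coefficients with $xP_{\vec n}=P_{\vec n+\vec e_i}+b_{\vec n,i}P_{\vec n}+a_{\vec n,1}P_{\vec n-\vec e_1}+a_{\vec n,2}P_{\vec n-\vec e_2}$, $i\in\{1,2\}$ ($\vec e_1=(1,0)$, $\vec e_2=(0,1)$; terms with negative indices are $0$), where $a_{\vec n,i}>0$ for $\vec n\in\mathbb N^2$. Set $A_{\vec n}^{(0)}(z)=\sum_{k=1}^2\int\frac{A_{\vec n}^{(k)}(z)-A_{\vec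 n}^{(k)}(x)}{z-x}d\mu_k(x)$, $L_{\vec n}(z)=\int\frac{A^{(1)}_{\vec n}(x)d\mu_1(x)+A^{(2)}_{\vec n}(x)d\mu_2(x)}{z-x}$, and $L_{\vec n+}(E)=\lim_{\epsilon\to0^+}L_{\vec n}(E+i\epsilon)$ when the limit exists. For $\vec n\in\mathbb N^2$, $A_{\vec n}^{(k)}$ has $n_k-1$ simple zeros, all in $\Delta_k$; $E_{\vec n}$ is the set of zeros of $A_{\vec n}^{(1)}A_{\vec n}^{(2)}$. Reference measure. For $\vec n\in\mathbb N^2$ and $\xi\in(\beta_1,\alpha_2)$ let $D_{\vec n,\xi}(z)=(-1)^{n_2}(z-\xi)A_{\vec n}^{(1)}(z)A_{\vec n}^{(2)}(z)$ and $S_{\vec n,\xi}(x)=|x-\xi|^{-1}\big(\chi_{\Delta_1}(x)|A_{\vec n}^{(2)}(x)|^{-1}+\chi_{\Delta_2}(x)|A_{\vec n}^{(1)}(x)|^{-1}\big)$. $\omega_{\vec n}$ is the non-negative measure on $\Delta_1\cup\Delta_2$, independent of $\xi$ and without atoms in $E_{\vec n}$, such that for every such $\xi$ and $\Im z>0$ $$\frac1{D_{\vec n,\xi}(z)L_{\vec n}(z)}=\int\frac{S_{\vec n,\xi}(x)d\omega_{\vec n}(x)}{x-z}+\sum_{E\in E_{\vec n}\cup\{\xi\}}\frac{\zeta_{\vec n,\xi}(E)}{E-z}+a_{\vec n,\xi}+b_{\vec n,\xi}z,$$ with $a_{\vec n,\xi}\in\mathbb R$, $b_{\vec n,\xi}>0$,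 $\zeta_{\vec n,\xi}(E)=-(D_{\vec n,\xi}'(E)L_{\vec n+}(E))^{-1}>0$. Tree and operator. $\mathcal V$ is the vertex set of the infinite rooted binary tree with root $O$: each $Y$ has two children $Y_{(ch),1},Y_{(ch),2}$; $Y_{(p)}$ is the parent of $Y\ne O$. $\Pi(O)=(1,1)$, $\Pi(Y_{(ch),i})=\Pi(Y)+\vec e_i$; $\iota_Y=i$ if $Y$ is the $i$-th child of its parent. Any object indexed by $\vec n\in\mathbb N^2$ is also indexed by vertices via $Y\mapsto\Pi(Y)$ (so $\omega_Y=\omega_{\Pi(Y)}$, $L_Y=L_{\Pi(Y)}$, $E_Y=E_{\Pi(Y)}$). $V_O=\kappa_1b_{(0,1),1}+\kappa_2b_{(1,0),2}$ for a fixed $\vec\kappa\in\mathbb R^2$ with $\kappa_1+\kappa_2=1$, $W_O=1$; $V_Y=b_{\Pi(Y_{(p)}),\iota_Y}$, $W_Y=a_{\Pi(Y_{(p)}),\iota_Y}>0$ for $Y\neq O$; with $f_{O_{(p)}}:=0$, $$(\mathcal J_{\vec\kappa}f)_Y=V_Yf_Y+W_Y^{1/2}f_{Y_{(p)}}+W_{Y_{(ch),1}}^{1/2}f_{Y_{(ch),1}}+W_{Y_{(ch),2}}^{1/2}f_{Y_{(ch),2}},$$ a bounded self-adjoint operator on $\ell^2(\mathcal V)$. $\mathcal V_{[X]}$ is the set consisting of $X$ and all its descendants; $\mathcal J_{[X]}$ is the restriction of $\mathcal J_{\vec\kappa}$ to functions on $\mathcal V_{[X]}$ (same formula, with the term involving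 the parent of $X$ dropped). $\delta^{(X)}$ is the Kronecker delta. $G(Y,X;z)=\langle(\mathcal J_{[X]}-z)^{-1}\delta^{(X)},\delta^{(Y)}\rangle$ for $Y\in\mathcal V_{[X]}$; $\rho_{[X]}$ is defined by $G(X,X;z)=\int\frac{d\rho_{[X]}(x)}{x-z}$; $\Im G(Y,X)^+$ is the weak$^*$ limit of $\Im G(Y,X;x+iy)dx$ as $y\to0^+$. Functions. $m_Y=\prod_{Z\in\mathrm{path}(Y,O)}W_Z^{-1/2}$ (both ends included); $\Lambda^{(k)}_Y=m_Y^{-1}A^{(k)}_{\Pi(Y)}$, $k\in\{0,1,2\}$. For functions $f,g$ on $\mathcal V$ and a vertex $Z$, $[f,g]^{(Z)}=f_Zg-fg_Z$. For $X\ne O$ and $x\in\Delta_1\cup\Delta_2$, $$\widetilde\Psi(X;x)=m_{X_{(p)}}m_X\sum_{k=1}^2\Big([\Lambda^{(k)}(x),\Lambda^{(0)}(x)]^{(X_{(p)})}+[\Lambda^{(3-k)}(x),\Lambda^{(k)}(x)]^{(X_{(p)})}\,\widehat\mu_{3-k}(x)\Big)\chi_{\Delta_k}(x),$$ a function on $\mathcal V$ (considered on $\mathcal V_{[X]}$) with values $\widetilde\Psi_Y(X;x)$, and $S_X(x)=\widetilde\Psi_X(X;x)$, which is positive and continuous on $\Delta_1\cup\Delta_2$. $Q_X(\{E\})=A^{(1)}_{\Pi(X)}(E)\mu_1(\{E\})+A^{(2)}_{\Pi(X)}(E)\mu_2(\{E\})$. *)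

theory Defs
  imports
    "HOL-Analysis.Analysis"
    "HOL-Computational_Algebra.Polynomial"
    "HOL-Library.Sublist"
    "HOL-Library.Nonpos_Ints"
begin

section \<open>Angelesco systems\<close>

datatype side = I1 | I2

lemma UNIV_side: "(UNIV :: side set) = {I1, I2}"
  using side.exhaust by auto

fun other :: "side \<Rightarrow> side" where
  "other I1 = I2"
| "other I2 = I1"

definition supp :: "real measure \<Rightarrow> real set" where
  "supp M = {x. \<forall>U. open U \<longrightarrow> x \<in> U \<longrightarrow> emeasure M U \<noteq> 0}"

definition Delta :: "(side \<Rightarrow> real measure) \<Rightarrow> side \<Rightarrow> real set" where
  "Delta \<mu> k = convex hull (supp (\<mu> k))"

definition left_end :: "(side \<Rightarrow> real measure) \<Rightarrow> side \<Rightarrow> real" where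
  "left_end \<mu> k = Inf (Delta \<mu> k)"

definition right_end :: "(side \<Rightarrow> real measure) \<Rightarrow> side \<Rightarrow> real" where
  "right_end \<mu> k = Sup (Delta \<mu> k)"

definition angelesco :: "(side \<Rightarrow> real measure) \<Rightarrow> bool" where
  "angelesco \<mu> \<longleftrightarrow>
     (\<forall>k. sets (\<mu> k) = sets borel \<and> finite_measure (\<mu> k) \<and>
          compact (supp (\<mu> k)) \<and> infinite (supp (\<mu> k))) \<and>
     Delta \<mu> I1 \<inter> Delta \<mu> I2 = {}"

(* Only used at real points off the support. *)
definition markov :: "real measure \<Rightarrow> real \<Rightarrow> real" where
  "markov M z = (LINT x|M. 1 / (z - x))"


section \<open>Multiple orthogonal polynomials\<close>

type_synonym multi_index = "side \<Rightarrow> nat"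

definition msize :: "multi_index \<Rightarrow> nat" where
  "msize n = n I1 + n I2"

definition inc :: "multi_index \<Rightarrow> side \<Rightarrow> multi_index" where
  "inc n i = n(i := n i + 1)"

definition dec :: "multi_index \<Rightarrow> side \<Rightarrow> multi_index" where
  "dec n i = n(i := n i - 1)"

definition is_typeI :: "(side \<Rightarrow> real measure) \<Rightarrow> multi_index \<Rightarrow> (side \<Rightarrow> real poly) \<Rightarrow> bool" where
  "is_typeI \<mu> n A \<longleftrightarrow>
     (\<forall>k. if n k = 0 then A k = 0 else degree (A k) \<le> n k - 1) \<and>
     (\<forall>m. m + 2 \<le> msize n \<longrightarrow> (\<Sum>k\<in>UNIV. LINT x|\<mu> k. x ^ m * poly (A k) x) = 0) \<and>
     (\<forall>m. m + 1 = msize n \<longrightarrow> (\<Sum>k\<in>UNIV. LINT x|\<mu> k. x ^ m * poly (A k) x) = 1)"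

definition typeI :: "(side \<Rightarrow> real measure) \<Rightarrow> multi_index \<Rightarrow> side \<Rightarrow> real poly" where
  "typeI \<mu> n = (THE A. is_typeI \<mu> n A)"

definition is_typeII :: "(side \<Rightarrow> real measure) \<Rightarrow> multi_index \<Rightarrow> real poly \<Rightarrow> bool" where
  "is_typeII \<mu> n P \<longleftrightarrow>
     lead_coeff P = 1 \<and> degree P = msize n \<and>
     (\<forall>k. \<forall>m < n k. (LINT x|\<mu> k. poly P x * x ^ m) = 0)"

definition typeII :: "(side \<Rightarrow> real measure) \<Rightarrow> multi_index \<Rightarrow> real poly" where
  "typeII \<mu> n = (THE P. is_typeII \<mu> n P)"

(* The coefficients a(n,k) are shared by the recurrences in both directions i.  If n k = 0 the
   corresponding term is absent, and the coefficient is normalized to 0 to make it unique. *)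
definition is_rec_coeffs ::
  "(side \<Rightarrow> real measure) \<Rightarrow> multi_index \<Rightarrow> (side \<Rightarrow> real) \<Rightarrow> (side \<Rightarrow> real) \<Rightarrow> bool" where
  "is_rec_coeffs \<mu> n a b \<longleftrightarrow>
     (\<forall>k. n k = 0 \<longrightarrow> a k = 0) \<and>
     (\<forall>i. [:0, 1:] * typeII \<mu> n =
            typeII \<mu> (inc n i) + smult (b i) (typeII \<mu> n) +
            (\<Sum>k\<in>UNIV. if n k = 0 then 0 else smult (a k) (typeII \<mu> (dec n k))))"

definition rec_a :: "(side \<Rightarrow> real measure) \<Rightarrow> multi_index \<Rightarrow> side \<Rightarrow> real" where
  "rec_a \<mu> n = (THE a. \<exists>b. is_rec_coeffs \<mu> n a b)"

definition rec_b :: "(side \<Rightarrow> real measure) \<Rightarrow> multi_index \<Rightarrow> side \<Rightarrow> real" where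
  "rec_b \<mu> n = (THE b. \<exists>a. is_rec_coeffs \<mu> n a b)"

(* The integrand (A(z) - A(x)) / (z - x) is the polynomial "synthetic_div A x" evaluated at z.
   Writing it as a quotient would give the wrong value at x = z, which matters when z is an atom. *)
definition typeI_0 :: "(side \<Rightarrow> real measure) \<Rightarrow> multi_index \<Rightarrow> real \<Rightarrow> real" where
  "typeI_0 \<mu> n z = (\<Sum>k\<in>UNIV. LINT x|\<mu> k. poly (synthetic_div (typeI \<mu> n k) x) z)"

definition Lfun :: "(side \<Rightarrow> real measure) \<Rightarrow> multi_index \<Rightarrow> complex \<Rightarrow> complex" where
  "Lfun \<mu> n z = (\<Sum>k\<in>UNIV. LINT x|\<mu> k. of_real (poly (typeI \<mu> n k) x) / (z - of_real x))"

(* Meaningful only where the limit exists. *)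
definition Lplus :: "(side \<Rightarrow> real measure) \<Rightarrow> multi_index \<Rightarrow> real \<Rightarrow> complex" where
  "Lplus \<mu> n E = Lim (at_right 0) (\<lambda>\<epsilon>. Lfun \<mu> n (Complex E \<epsilon>))"

definition typeI_zeros :: "(side \<Rightarrow> real measure) \<Rightarrow> multi_index \<Rightarrow> real set" where
  "typeI_zeros \<mu> n = {E. poly (typeI \<mu> n I1 * typeI \<mu> n I2) E = 0}"

definition Qatom :: "(side \<Rightarrow> real measure) \<Rightarrow> multi_index \<Rightarrow> real \<Rightarrow> real" where
  "Qatom \<mu> n E = (\<Sum>k\<in>UNIV. poly (typeI \<mu> n k) E * measure (\<mu> k) {E})"


section \<open>The reference measure\<close>

definition Dpoly :: "(side \<Rightarrow> real measure) \<Rightarrow> multi_index \<Rightarrow> real \<Rightarrow> real poly" where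
  "Dpoly \<mu> n \<xi> = smult ((- 1) ^ n I2) ([:- \<xi>, 1:] * typeI \<mu> n I1 * typeI \<mu> n I2)"

definition Sref :: "(side \<Rightarrow> real measure) \<Rightarrow> multi_index \<Rightarrow> real \<Rightarrow> real \<Rightarrow> real" where
  "Sref \<mu> n \<xi> x = inverse \<bar>x - \<xi>\<bar> *
     (\<Sum>k\<in>UNIV. indicator (Delta \<mu> k) x * inverse \<bar>poly (typeI \<mu> n (other k)) x\<bar>)"

definition zeta :: "(side \<Rightarrow> real measure) \<Rightarrow> multi_index \<Rightarrow> real \<Rightarrow> real \<Rightarrow> complex" where
  "zeta \<mu> n \<xi> E = - inverse (of_real (poly (pderiv (Dpoly \<mu> n \<xi>)) E) * Lplus \<mu> n E)"

(* "Sref \<mu> n \<xi>" is bounded and bounded away from 0 on the two intervals, so finiteness of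
   \<omega> only says that the integral below converges. *)
definition is_reference_measure ::
  "(side \<Rightarrow> real measure) \<Rightarrow> multi_index \<Rightarrow> real measure \<Rightarrow> bool" where
  "is_reference_measure \<mu> n \<omega> \<longleftrightarrow>
     sets \<omega> = sets borel \<and> finite_measure \<omega> \<and>
     emeasure \<omega> (- (Delta \<mu> I1 \<union> Delta \<mu> I2)) = 0 \<and>
     (\<forall>E\<in>typeI_zeros \<mu> n. emeasure \<omega> {E} = 0) \<and>
     (\<forall>\<xi>\<in>{right_end \<mu> I1<..<left_end \<mu> I2}.
        (\<forall>E\<in>typeI_zeros \<mu> n \<union> {\<xi>}. zeta \<mu> n \<xi> E \<in> \<real> \<and> Re (zeta \<mu> n \<xi> E) > 0) \<and>
        (\<exists>a b :: real. b > 0 \<and>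
           (\<forall>z. Im z > 0 \<longrightarrow>
              1 / (poly (map_poly of_real (Dpoly \<mu> n \<xi>)) z * Lfun \<mu> n z) =
                (LINT x|\<omega>. of_real (Sref \<mu> n \<xi> x) / (of_real x - z)) +
                (\<Sum>E\<in>typeI_zeros \<mu> n \<union> {\<xi>}. zeta \<mu> n \<xi> E / (of_real E - z)) +
                of_real a + of_real b * z)))"

definition reference_measure :: "(side \<Rightarrow> real measure) \<Rightarrow> multi_index \<Rightarrow> real measure" where
  "reference_measure \<mu> n = (THE \<omega>. is_reference_measure \<mu> n \<omega>)"


section \<open>The tree and the Jacobi operator\<close>

(* A vertex is the list of the steps leading to it from the root, the most recent step first.
   Hence the i-th child of Y is i # Y, the parent is tl Y, iota is hd Y, and the ancestors of Y
   (Y included) are the suffixes of Y. *)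
type_synonym vertex = "side list"

abbreviation tree_root :: vertex where "tree_root \<equiv> []"

abbreviation child :: "vertex \<Rightarrow> side \<Rightarrow> vertex" where "child Y i \<equiv> i # Y"

abbreviation parent :: "vertex \<Rightarrow> vertex" where "parent Y \<equiv> tl Y"

primrec Pi_ix :: "vertex \<Rightarrow> multi_index" where
  "Pi_ix [] = (\<lambda>_. 1)"
| "Pi_ix (i # Y) = inc (Pi_ix Y) i"

definition subtree :: "vertex \<Rightarrow> vertex set" where
  "subtree X = {Y. suffix X Y}"

(* The two multi-indices at the root are (0,1) for k = I1 and (1,0) for k = I2. *)
definition Vpot :: "(side \<Rightarrow> real measure) \<Rightarrow> (side \<Rightarrow> real) \<Rightarrow> vertex \<Rightarrow> real" where
  "Vpot \<mu> \<kappa> Y =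
     (if Y = tree_root then (\<Sum>k\<in>UNIV. \<kappa> k * rec_b \<mu> (\<lambda>j. if j = k then 0 else 1) k)
      else rec_b \<mu> (Pi_ix (parent Y)) (hd Y))"

definition Wpot :: "(side \<Rightarrow> real measure) \<Rightarrow> vertex \<Rightarrow> real" where
  "Wpot \<mu> Y = (if Y = tree_root then 1 else rec_a \<mu> (Pi_ix (parent Y)) (hd Y))"

(* The operator restricted to subtree X, acting on arbitrary (not only square-summable) functions;
   functions on subtree X are represented by functions on all vertices.  For X = tree_root this is the
   operator on the full tree. *)
definition Jop ::
  "(side \<Rightarrow> real measure) \<Rightarrow> (side \<Rightarrow> real) \<Rightarrow> vertex \<Rightarrow>
   (vertex \<Rightarrow> 'a::real_vector) \<Rightarrow> vertex \<Rightarrow> 'a" where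
  "Jop \<mu> \<kappa> X f Y =
     (if Y \<in> subtree X then
        Vpot \<mu> \<kappa> Y *\<^sub>R f Y +
        (if Y = X then 0 else sqrt (Wpot \<mu> Y) *\<^sub>R f (parent Y)) +
        (\<Sum>i\<in>UNIV. sqrt (Wpot \<mu> (child Y i)) *\<^sub>R f (child Y i))
      else 0)"

definition ell2 :: "vertex set \<Rightarrow> (vertex \<Rightarrow> complex) set" where
  "ell2 S = {f. (\<forall>Y. Y \<notin> S \<longrightarrow> f Y = 0) \<and> (\<lambda>Y. (cmod (f Y))\<^sup>2) summable_on S}"

definition ell2_inner :: "vertex set \<Rightarrow> (vertex \<Rightarrow> complex) \<Rightarrow> (vertex \<Rightarrow> complex) \<Rightarrow> complex" where
  "ell2_inner S f g = (\<Sum>\<^sub>\<infinity>Y\<in>S. f Y * cnj (g Y))"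

definition kron :: "vertex \<Rightarrow> vertex \<Rightarrow> 'a::zero_neq_one" where
  "kron X Y = (if Y = X then 1 else 0)"

definition resolvent ::
  "(side \<Rightarrow> real measure) \<Rightarrow> (side \<Rightarrow> real) \<Rightarrow> vertex \<Rightarrow> complex \<Rightarrow>
   (vertex \<Rightarrow> complex) \<Rightarrow> vertex \<Rightarrow> complex" where
  "resolvent \<mu> \<kappa> X z = inv_into (ell2 (subtree X)) (\<lambda>f Y. Jop \<mu> \<kappa> X f Y - z * f Y)"

definition Green ::
  "(side \<Rightarrow> real measure) \<Rightarrow> (side \<Rightarrow> real) \<Rightarrow> vertex \<Rightarrow> vertex \<Rightarrow> complex \<Rightarrow> complex" where
  "Green \<mu> \<kappa> Y X z = ell2_inner (subtree X) (resolvent \<mu> \<kappa> X z (kron X)) (kron Y)"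

definition is_spectral_measure ::
  "(side \<Rightarrow> real measure) \<Rightarrow> (side \<Rightarrow> real) \<Rightarrow> vertex \<Rightarrow> real measure \<Rightarrow> bool" where
  "is_spectral_measure \<mu> \<kappa> X \<rho> \<longleftrightarrow>
     sets \<rho> = sets borel \<and> finite_measure \<rho> \<and>
     (\<forall>z. Im z \<noteq> 0 \<longrightarrow> Green \<mu> \<kappa> X X z = (LINT x|\<rho>. 1 / (of_real x - z)))"

definition spectral_measure ::
  "(side \<Rightarrow> real measure) \<Rightarrow> (side \<Rightarrow> real) \<Rightarrow> vertex \<Rightarrow> real measure" where
  "spectral_measure \<mu> \<kappa> X = (THE \<rho>. is_spectral_measure \<mu> \<kappa> X \<rho>)"

(* The measures h y x dx converge, as y tends to 0 from the right, to the signed measure g d\<rho>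
   in the weak-star topology of the dual of C_0(R). *)
definition weak_star_limit :: "(real \<Rightarrow> real \<Rightarrow> real) \<Rightarrow> real measure \<Rightarrow> (real \<Rightarrow> real) \<Rightarrow> bool" where
  "weak_star_limit h \<rho> g \<longleftrightarrow>
     integrable \<rho> g \<and>
     (\<forall>f. continuous_on UNIV f \<and> (f \<longlongrightarrow> 0) at_infinity \<longrightarrow>
        (\<forall>y>0. integrable lborel (\<lambda>x. f x * h y x)) \<and>
        ((\<lambda>y. LINT x|lborel. f x * h y x) \<longlongrightarrow> (LINT x|\<rho>. f x * g x)) (at_right 0))"


section \<open>Generalized eigenfunctions\<close>

definition mfac :: "(side \<Rightarrow> real measure) \<Rightarrow> vertex \<Rightarrow> real" where
  "mfac \<mu> Y = (\<Prod>Z | suffix Z Y. Wpot \<mu> Z powr (- 1 / 2))"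

definition Lam :: "(side \<Rightarrow> real measure) \<Rightarrow> side \<Rightarrow> real \<Rightarrow> vertex \<Rightarrow> real" where
  "Lam \<mu> k x Y = inverse (mfac \<mu> Y) * poly (typeI \<mu> (Pi_ix Y) k) x"

definition Lam0 :: "(side \<Rightarrow> real measure) \<Rightarrow> real \<Rightarrow> vertex \<Rightarrow> real" where
  "Lam0 \<mu> x Y = inverse (mfac \<mu> Y) * typeI_0 \<mu> (Pi_ix Y) x"

definition bracket :: "(vertex \<Rightarrow> real) \<Rightarrow> (vertex \<Rightarrow> real) \<Rightarrow> vertex \<Rightarrow> vertex \<Rightarrow> real" where
  "bracket f g Z Y = f Z * g Y - f Y * g Z"

definition Psi_tilde :: "(side \<Rightarrow> real measure) \<Rightarrow> vertex \<Rightarrow> real \<Rightarrow> vertex \<Rightarrow> real" where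
  "Psi_tilde \<mu> X x Y =
     mfac \<mu> (parent X) * mfac \<mu> X *
     (\<Sum>k\<in>UNIV.
        (bracket (Lam \<mu> k x) (Lam0 \<mu> x) (parent X) Y +
         bracket (Lam \<mu> (other k) x) (Lam \<mu> k x) (parent X) Y * markov (\<mu> (other k)) x) *
        indicator (Delta \<mu> k) x)"

definition Sfun :: "(side \<Rightarrow> real measure) \<Rightarrow> vertex \<Rightarrow> real \<Rightarrow> real" where
  "Sfun \<mu> X x = Psi_tilde \<mu> X x X"

definition Psi :: "(side \<Rightarrow> real measure) \<Rightarrow> vertex \<Rightarrow> real \<Rightarrow> vertex \<Rightarrow> real" where
  "Psi \<mu> X x Y = inverse (Sfun \<mu> X x) * Psi_tilde \<mu> X x Y"

end

theory Submission
  imports Defs "HOL-Probability.Probability" "HOL-Complex_Analysis.Complex_Analysis"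
begin

text \<open>
  The linear forms \<open>L\<^sub>n\<close> satisfy the nearest neighbour recurrence of the operator.  No real pencil
  \<open>L\<^bsub>n+e\<^esub> + t L\<^sub>n\<close> vanishes off the real axis, since a polynomial of low degree would make the
  integrand of a vanishing orthogonality relation positive.  Hence \<open>- L\<^bsub>n+e\<^esub> / L\<^sub>n\<close> maps the upper
  half-plane to itself, and it is the Cauchy transform of a measure \<open>\<rho>\<close>.  The same positivity gives a
  sign to the flux of the solution \<open>L\<^sub>Y / m\<^sub>Y\<close> through the edges of the tree, so the solution is square
  summable, while a square summable solution without flux at \<open>X\<close> vanishes.  Therefore
  \<open>G(Y, X; z) = - (m\<^sub>X / m\<^sub>Y) L\<^sub>Y / L\<^sub>P\<close>, where \<open>P\<close> is the parent of \<open>X\<close>, and the spectral measure is \<open>\<rho>\<close>.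

  The functions \<open>s\<^sub>Y = L\<^sub>P A\<^sub>Y - L\<^sub>Y A\<^sub>P\<close>, formed with the polynomials of one interval, continue
  analytically across that interval, and \<open>s\<^sub>X > 0\<close> there.  So \<open>- L\<^sub>Y / L\<^sub>P\<close> differs from
  \<open>- (s\<^sub>Y / s\<^sub>X) L\<^sub>X / L\<^sub>P\<close> near the interval by a function whose only singularities are the zeros of
  \<open>A\<^sub>P\<close>, where one compares the atoms; by Liouville's theorem \<open>- L\<^sub>Y / L\<^sub>P\<close> is the transform of
  \<open>(s\<^sub>Y / s\<^sub>X) d\<rho>\<close>.  The same argument applied to \<open>1 / (D L\<^sub>P)\<close> shows that the reference measure is
  \<open>d\<rho> / s\<^sub>X\<close> off the zeros of \<open>A\<^sub>P\<close>.
\<close>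

section \<open>Cauchy transforms of finite measures\<close>

text \<open>All the positivity comes from one degree count. For a pair \<open>B\<close> some
  polynomial \<open>D\<close> makes \<open>D * B k\<close> nonnegative on the interval of each
  \<open>k\<close>. It keeps the sign changes of both \<open>B k\<close> and has at most one further
  zero, in the gap, since each factor has constant sign on the other interval. Its degree just meets
  the order |n| - 1 of orthogonality of a type I form. Normality, the zeros and leading signs of
  A_n, zero-free pencils and positive residues all follow from this.

  The obstacle is that the measures may have atoms at zeros of A_P. There L_P still has a finite
  nonzero limit, while L_X may blow up: this is the origin of the point masses. Hence local data are
  read off along vertical lines, and singularities at the zeros are cleared by a polynomial factor.

  The flux argument needs bounded weights W. The bound comes from the Riccati form of the recurrence
  at z = i, where Im M is bounded below because M is the transform of a probability measure on a
  fixed compact set.\<close>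

lemma integral_tendsto_at_within:
  fixes f :: "'c::first_countable_topology \<Rightarrow> 'a \<Rightarrow> 'b::{banach, second_countable_topology}"
  assumes "\<And>t. t \<in> S - {a} \<Longrightarrow> f t \<in> borel_measurable M" and "g \<in> borel_measurable M"
    and "integrable M w"
    and "\<And>t. t \<in> S - {a} \<Longrightarrow> AE x in M. norm (f t x) \<le> w x"
    and "AE x in M. ((\<lambda>t. f t x) \<longlongrightarrow> g x) (at a within S)"
  shows "((\<lambda>t. LINT x|M. f t x) \<longlongrightarrow> (LINT x|M. g x)) (at a within S)"
  unfolding tendsto_at_iff_sequentially
proof (intro allI impI)
  fix X assume X: "\<forall>i. X i \<in> S - {a}" "X \<longlonglongrightarrow> a"
  have "(\<lambda>i. LINT x|M. f (X i) x) \<longlonglongrightarrow> (LINT x|M. g x)"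
  proof (rule integral_dominated_convergence[where w=w])
    show "AE x in M. (\<lambda>i. f (X i) x) \<longlonglongrightarrow> g x"
      using assms(5) by eventually_elim (use X in \<open>auto simp: tendsto_at_iff_sequentially comp_def\<close>)
  qed (use assms X in auto)
  then show "((\<lambda>t. LINT x|M. f t x) \<circ> X) \<longlonglongrightarrow> (LINT x|M. g x)"
    by (simp add: comp_def)
qed

text \<open>Cauchy's inequality turns the uniform bound \<open>B\<close> into a bound on derivatives
  near \<open>z\<close>, so the difference quotients are dominated by a constant and dominated
  convergence differentiates under the integral.\<close>

lemma holomorphic_on_lebesgue_integral:
  fixes f :: "'a \<Rightarrow> complex \<Rightarrow> complex"
  assumes M: "finite_measure M" and U: "open U"
    and meas: "\<And>z. z \<in> U \<Longrightarrow> (\<lambda>x. f x z) \<in> borel_measurable M"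
    and hol: "\<And>x. x \<in> space M \<Longrightarrow> f x holomorphic_on U"
    and bd: "\<And>x z. x \<in> space M \<Longrightarrow> z \<in> U \<Longrightarrow> norm (f x z) \<le> B"
  shows "(\<lambda>z. LINT x|M. f x z) holomorphic_on U"
proof -
  interpret finite_measure M by fact
  have "(\<lambda>z. LINT x|M. f x z) field_differentiable at z" if z: "z \<in> U" for z
  proof -
    obtain r where r: "r > 0" "cball z r \<subseteq> U"
      using U z open_contains_cball by blast
    define S where "S = ball z (r/2)"
    have int: "integrable M (\<lambda>x. f x w)" if "w \<in> U" for w
      by (rule integrable_const_bound[where B=B]) (use meas bd that in auto)
    have conv: "((\<lambda>w. (f x w - f x z) / (w - z)) \<longlongrightarrow> deriv (f x) z) (at z within S)"
      if "x \<in> space M" for x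
    proof -
      have "(f x has_field_derivative deriv (f x) z) (at z)"
        using hol[OF that] U z holomorphic_derivI by blast
      then show ?thesis
        unfolding has_field_derivative_iff by (rule tendsto_within_subset) simp
    qed
    have bound: "norm ((f x w - f x z) / (w - z)) \<le> 2 * B / r"
      if x: "x \<in> space M" and w: "w \<in> S - {z}" for x w
    proof -
      have der: "norm (deriv (f x) u) \<le> B / (r/2)" if u: "u \<in> S" for u
      proof -
        have sub: "cball u (r/2) \<subseteq> cball z r"
        proof
          fix v assume "v \<in> cball u (r/2)"
          then show "v \<in> cball z r"
            using u dist_triangle[of z v u] by (auto simp: S_def)
        qed
        have "norm ((deriv ^^ 1) (f x) u) \<le> fact 1 * B / (r/2)^1"
        proof (rule Cauchy_inequality)
          show "f x holomorphic_on ball u (r/2)"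
            using hol[OF x] sub r by (meson ball_subset_cball holomorphic_on_subset order_trans)
          show "continuous_on (cball u (r/2)) (f x)"
            using hol[OF x] sub r
            by (meson holomorphic_on_imp_continuous_on holomorphic_on_subset order_trans)
          show "norm (f x v) \<le> B" if "norm (u - v) = r/2" for v
            using that sub r by (intro bd x) (auto simp: dist_norm subset_iff)
        qed (use r in auto)
        then show ?thesis by simp
      qed
      have "norm (f x w - f x z) \<le> B / (r/2) * norm (w - z)"
      proof (rule field_differentiable_bound[where S=S and f'="deriv (f x)"])
        show "convex S" by (simp add: S_def)
        show "(f x has_field_derivative deriv (f x) u) (at u within S)" if "u \<in> S" for u
        proof -
          have "u \<in> U" using that r by (auto simp: S_def subset_iff)
          then show ?thesis
            using hol[OF x] U holomorphic_derivI has_field_derivative_at_within by blast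
        qed
      qed (use w r der in \<open>auto simp: S_def\<close>)
      then show ?thesis
        using w r by (simp add: norm_divide field_simps)
    qed
    have SU: "S \<subseteq> U" using r by (auto simp: S_def subset_iff)
    have meas': "(\<lambda>x. (f x w - f x z) / (w - z)) \<in> borel_measurable M" if "w \<in> S" for w
      using meas that SU z by (intro borel_measurable_divide borel_measurable_diff) auto
    have "((\<lambda>w. LINT x|M. (f x w - f x z) / (w - z)) \<longlongrightarrow> (LINT x|M. deriv (f x) z)) (at z within S)"
    proof (rule integral_tendsto_at_within[where w="\<lambda>_. 2 * B / r"])
      \<comment> \<open>A concrete sequence in the ball, different from \<open>z\<close> and tending
        to it: the derivative is the pointwise limit of difference quotients along it, hence
        measurable in \<open>x\<close>.\<close>
      define e where "e n = z + of_real (r/2 * inverse (real (Suc (Suc n))))" for n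
      have lim: "e \<longlonglongrightarrow> z"
      proof -
        have "(\<lambda>n. inverse (real (Suc (Suc n)))) \<longlonglongrightarrow> 0"
          using LIMSEQ_inverse_real_of_nat LIMSEQ_Suc by blast
        then have "e \<longlonglongrightarrow> z + of_real (r/2 * 0)"
          unfolding e_def by (intro tendsto_intros)
        then show ?thesis by simp
      qed
      have inS: "e n \<in> S - {z}" for n
      proof -
        have "inverse (real (Suc (Suc n))) < 1" by (simp add: field_simps)
        then show ?thesis using r
          by (simp add: e_def S_def dist_norm del: of_nat_Suc of_real_mult of_real_inverse of_real_divide)
      qed
      show "(\<lambda>x. deriv (f x) z) \<in> borel_measurable M"
      proof (rule borel_measurable_LIMSEQ_metric)
        show "(\<lambda>x. (f x (e n) - f x z) / (e n - z)) \<in> borel_measurable M" for n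
          using inS[of n] by (intro meas') blast
        show "(\<lambda>n. (f x (e n) - f x z) / (e n - z)) \<longlonglongrightarrow> deriv (f x) z" if "x \<in> space M" for x
          using conv[OF that, unfolded tendsto_at_iff_sequentially comp_def, rule_format, of e] inS lim
          by blast
      qed
    qed (use meas' bound conv in auto)
    moreover have "eventually (\<lambda>w. (LINT x|M. (f x w - f x z) / (w - z)) = ((LINT x|M. f x w) - (LINT x|M. f x z)) / (w - z)) (at z within S)"
      unfolding eventually_at_filter
    proof (intro always_eventually allI impI)
      fix w assume "w \<in> S"
      then show "(LINT x|M. (f x w - f x z) / (w - z)) = ((LINT x|M. f x w) - (LINT x|M. f x z)) / (w - z)"
        using int[of w] int[of z] SU z by (subst Bochner_Integration.integral_diff[symmetric]) auto
    qed
    ultimately have "((\<lambda>w. ((LINT x|M. f x w) - (LINT x|M. f x z)) / (w - z)) \<longlongrightarrow> (LINT x|M. deriv (f x) z)) (at z within S)"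
      by (rule Lim_transform_eventually)
    moreover have "at z within S = at z"
      using r by (auto simp: S_def intro!: at_within_open)
    ultimately have "((\<lambda>z. LINT x|M. f x z) has_field_derivative (LINT x|M. deriv (f x) z)) (at z)"
      by (simp add: has_field_derivative_iff)
    then show ?thesis using field_differentiable_def by blast
  qed
  then show ?thesis
    using U by (simp add: holomorphic_on_open field_differentiable_def)
qed


text \<open>The sign of the kernel is that of the Green function, opposite to that of \<open>Lfun\<close> and \<open>markov\<close>.\<close>

definition cauchy_tr :: "real measure \<Rightarrow> (real \<Rightarrow> real) \<Rightarrow> complex \<Rightarrow> complex" where
  "cauchy_tr \<nu> f z = (LINT x|\<nu>. of_real (f x) / (of_real x - z))"

lemma norm_of_real_diff_ge:
  assumes "\<bar>x\<bar> \<le> R"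
  shows "norm (of_real x - z :: complex) \<ge> norm z - R"
  using norm_triangle_ineq2[of z "of_real x"] assms by (simp add: norm_minus_commute)

context finite_borel_measure
begin

text \<open>The kernel is unbounded in \<open>x\<close> when \<open>f\<close> is merely integrable.
  The factor 1 + |f| is therefore moved into the measure, which stays finite, and the remaining
  kernel is bounded locally uniformly off \<open>K\<close>.\<close>

lemma cauchy_tr_holomorphic:
  assumes f: "integrable M f"
    and K: "closed K" "AE x in M. x \<in> K"
  shows "cauchy_tr M f holomorphic_on - (of_real ` K)"
proof -
  have clK: "closed (of_real ` K :: complex set)"
    using K(1) by (intro closed_injective_linear_image) (auto simp: linear_of_real inj_on_def)
  have "cauchy_tr M f field_differentiable at z" if z: "z \<notin> of_real ` K" for z
  proof -
    obtain r where r: "r > 0" "cball z r \<subseteq> - (of_real ` K)"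
      using clK z by (meson ComplI open_Compl open_contains_cball)
    \<comment> \<open>The value 0 outside \<open>K\<close> keeps the bound and holomorphy valid for
      every \<open>x\<close>, not just almost every one.\<close>
    define h where "h x w = (if x \<in> K then of_real (f x) / (of_real x - w) * (of_real (inverse (1 + \<bar>f x\<bar>))) else (0::complex))" for x and w :: complex
    define N where "N = density M (\<lambda>x. ennreal (1 + \<bar>f x\<bar>))"
    have fm: "f \<in> borel_measurable M" using f by auto
    have fin: "finite_measure N"
    proof
      have "emeasure N (space N) = (\<integral>\<^sup>+x. ennreal (1 + \<bar>f x\<bar>) \<partial>M)"
        using fm by (simp add: N_def emeasure_density cong: nn_integral_cong)
      also have "\<dots> = ennreal (LINT x|M. 1 + \<bar>f x\<bar>)"
        using f by (intro nn_integral_eq_integral) auto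
      finally show "emeasure N (space N) \<noteq> \<infinity>" by simp
    qed
    have spM: "space M = UNIV" using M_is_borel sets_eq_imp_space_eq by fastforce
    have [measurable]: "K \<in> sets borel" using K(1) by (rule borel_closed)
    have "(\<lambda>w. LINT x|N. h x w) holomorphic_on ball z (r/2)"
    proof (rule holomorphic_on_lebesgue_integral[OF fin])
      show "(\<lambda>x. h x w) \<in> borel_measurable N" for w
      proof -
        have [measurable]: "f \<in> borel_measurable borel" using fm M_is_borel by (simp cong: measurable_cong_sets)
        have "(\<lambda>x. h x w) \<in> borel_measurable borel" unfolding h_def by measurable
        then show ?thesis by (simp add: N_def M_is_borel cong: measurable_cong_sets)
      qed
      show "h x holomorphic_on ball z (r/2)" for x
      proof (cases "x \<in> K")
        case True
        have "dist z (of_real x) > r" using r(2) True by (force simp: subset_iff)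
        then have "of_real x \<notin> ball z (r/2)" using r(1) by auto
        then show ?thesis unfolding h_def using True by (auto intro!: holomorphic_intros)
      next
        case False
        then have "h x = (\<lambda>_. 0)" by (auto simp: h_def)
        then show ?thesis by simp
      qed
      show "norm (h x w) \<le> 2 / r" if "w \<in> ball z (r/2)" for x w
      proof (cases "x \<in> K")
        case True
        have "dist z (of_real x) > r" using r(2) True by (force simp: subset_iff)
        then have "norm (of_real x - w) \<ge> r/2"
          using that dist_triangle[of z "of_real x" w] by (auto simp: dist_norm norm_minus_commute)
        moreover have "\<bar>f x\<bar> * inverse (1 + \<bar>f x\<bar>) \<le> 1" by (simp add: field_simps)
        ultimately have "\<bar>f x\<bar> * inverse (1 + \<bar>f x\<bar>) / norm (of_real x - w) \<le> 1 / (r/2)"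
          using r(1) by (intro frac_le) auto
        moreover have "norm (h x w) = \<bar>f x\<bar> * inverse (1 + \<bar>f x\<bar>) / norm (of_real x - w)"
          using True by (simp add: h_def norm_mult norm_divide norm_inverse del: of_real_inverse of_real_add)
        ultimately show ?thesis by simp
      qed (use r in \<open>simp add: h_def\<close>)
    qed auto
    moreover have "(LINT x|N. h x w) = cauchy_tr M f w" if "w \<in> ball z (r/2)" for w
    proof -
      have [measurable]: "f \<in> borel_measurable borel" using fm M_is_borel by (simp cong: measurable_cong_sets)
      have "(\<lambda>x. h x w) \<in> borel_measurable borel" unfolding h_def by measurable
      then have hm: "(\<lambda>x. h x w) \<in> borel_measurable M" by (simp add: M_is_borel cong: measurable_cong_sets)
      have "(LINT x|N. h x w) = (LINT x|M. (1 + \<bar>f x\<bar>) *\<^sub>R h x w)"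
        unfolding N_def using hm fm by (intro integral_density) auto
      also have "\<dots> = cauchy_tr M f w"
        unfolding cauchy_tr_def
      proof (rule integral_cong_AE)
        show "AE x in M. (1 + \<bar>f x\<bar>) *\<^sub>R h x w = of_real (f x) / (of_real x - w)"
          using K(2)
        proof eventually_elim
          case (elim x)
          have "1 + \<bar>f x\<bar> \<noteq> 0" by linarith
          then have "complex_of_real (1 + \<bar>f x\<bar>) * of_real (inverse (1 + \<bar>f x\<bar>)) = 1"
            by (metis of_real_1 of_real_mult right_inverse)
          then show ?case using elim
            by (simp add: h_def scaleR_conv_of_real mult.left_commute del: of_real_inverse of_real_add)
        qed
        show "(\<lambda>x. of_real (f x) / (of_real x - w)) \<in> borel_measurable M"
          by (simp add: M_is_borel cong: measurable_cong_sets)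
      qed (use hm fm in measurable)
      finally show ?thesis .
    qed
    ultimately have "cauchy_tr M f holomorphic_on ball z (r/2)"
      by (rule holomorphic_transform)
    then show ?thesis
      using r(1) holomorphic_on_imp_differentiable_at by (metis centre_in_ball half_gt_zero open_ball)
  qed
  then show ?thesis
    unfolding holomorphic_on_def by (auto intro: field_differentiable_at_within)
qed

lemma cauchy_kernel_integrable:
  assumes f: "integrable M f"
    and K: "closed K" "AE x in M. x \<in> K" and z: "z \<notin> of_real ` K"
  shows "integrable M (\<lambda>x. of_real (f x) / (of_real x - z) :: complex)"
proof -
  have clK: "closed (of_real ` K :: complex set)"
    using K(1) by (intro closed_injective_linear_image) (auto simp: linear_of_real inj_on_def)
  obtain r where r: "r > 0" "cball z r \<subseteq> - (of_real ` K)"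
    using clK z by (meson ComplI open_Compl open_contains_cball)
  have [measurable]: "f \<in> borel_measurable borel" using f M_is_borel by (auto cong: measurable_cong_sets)
  show ?thesis
  proof (rule Bochner_Integration.integrable_bound)
    show "integrable M (\<lambda>x. \<bar>f x\<bar> / r)" using f by simp
    show "(\<lambda>x. of_real (f x) / (of_real x - z) :: complex) \<in> borel_measurable M"
      by (simp add: M_is_borel cong: measurable_cong_sets)
    show "AE x in M. norm (of_real (f x) / (of_real x - z) :: complex) \<le> norm (\<bar>f x\<bar> / r)"
      using K(2)
    proof eventually_elim
      case (elim x)
      then have "dist z (of_real x) > r" using r(2) by (force simp: subset_iff)
      then show ?case using r(1) by (auto simp: norm_divide dist_norm norm_minus_commute intro!: frac_le)
    qed
  qed
qed

lemma cauchy_tr_bound: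
  assumes f: "integrable M f" and K: "AE x in M. \<bar>x\<bar> \<le> R" and z: "norm z > R"
  shows "norm (cauchy_tr M f z) \<le> (LINT x|M. \<bar>f x\<bar>) / (norm z - R)"
proof -
  have "z \<notin> of_real ` {-R..R}" using z by (auto simp: abs_le_iff)
  then have i: "integrable M (\<lambda>x. of_real (f x) / (of_real x - z) :: complex)"
    using K by (intro cauchy_kernel_integrable[where K="{-R..R}"] assms) (auto simp: abs_le_iff minus_le_iff)
  have "norm (cauchy_tr M f z) \<le> (LINT x|M. norm (of_real (f x) / (of_real x - z) :: complex))"
    unfolding cauchy_tr_def by (rule integral_norm_bound)
  also have "\<dots> \<le> (LINT x|M. \<bar>f x\<bar> / (norm z - R))"
  proof (rule integral_mono_AE)
    show "AE x in M. norm (of_real (f x) / (of_real x - z) :: complex) \<le> \<bar>f x\<bar> / (norm z - R)"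
      using K
    proof eventually_elim
      case (elim x)
      then show ?case using norm_of_real_diff_ge[OF elim, of z] z by (auto simp: norm_divide intro!: frac_le)
    qed
  qed (use i f in auto)
  finally show ?thesis by simp
qed

lemma cauchy_tr_tendsto_0:
  assumes f: "integrable M f" and K: "AE x in M. \<bar>x\<bar> \<le> R"
  shows "(cauchy_tr M f \<longlongrightarrow> 0) at_infinity"
proof (rule Lim_null_comparison)
  show "eventually (\<lambda>z. norm (cauchy_tr M f z) \<le> (LINT x|M. \<bar>f x\<bar>) / (norm z - R)) at_infinity"
    unfolding eventually_at_infinity
    by (intro exI[of _ "R + 1"]) (use cauchy_tr_bound[OF assms] in auto)
  have "filterlim (\<lambda>z::complex. - R + norm z) at_top at_infinity"
    by (intro filterlim_tendsto_add_at_top[OF tendsto_const] filterlim_norm_at_top)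
  then have "filterlim (\<lambda>z::complex. norm z - R) at_infinity at_infinity"
    by (intro filterlim_at_top_imp_at_infinity) (simp add: algebra_simps)
  then show "((\<lambda>z. (LINT x|M. \<bar>f x\<bar>) / (norm z - R)) \<longlongrightarrow> 0) (at_infinity :: complex filter)"
    by (intro tendsto_divide_0[OF tendsto_const])
qed

text \<open>Integrates z / (x - z) = x / (x - z) - 1.\<close>

lemma cauchy_tr_mult_ident:
  assumes f: "integrable M f" and K: "AE x in M. \<bar>x\<bar> \<le> R" and z: "norm z > R"
  shows "z * cauchy_tr M f z = cauchy_tr M (\<lambda>x. x * f x) z - of_real (LINT x|M. f x)"
proof -
  have zK: "z \<notin> of_real ` {-R..R}" using z by (auto simp: abs_le_iff)
  have [measurable]: "f \<in> borel_measurable borel" using f M_is_borel by (auto cong: measurable_cong_sets)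
  have xf: "integrable M (\<lambda>x. x * f x)"
  proof (rule Bochner_Integration.integrable_bound)
    show "integrable M (\<lambda>x. R * f x)" using f by simp
    show "AE x in M. norm (x * f x) \<le> norm (R * f x)"
      using K by eventually_elim (auto simp: abs_mult intro!: mult_right_mono)
  qed (simp add: M_is_borel cong: measurable_cong_sets)
  have i: "integrable M (\<lambda>x. of_real (g x) / (of_real x - z) :: complex)" if "integrable M g" for g
    using K by (intro cauchy_kernel_integrable[where K="{-R..R}"] that zK) (auto simp: abs_le_iff minus_le_iff)
  have "z * cauchy_tr M f z = (LINT x|M. z * (of_real (f x) / (of_real x - z)))"
    unfolding cauchy_tr_def by (rule integral_mult_right_zero[symmetric])
  also have "\<dots> = (LINT x|M. of_real (x * f x) / (of_real x - z) - of_real (f x))"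
  proof (rule integral_cong_AE)
    show "AE x in M. z * (of_real (f x) / (of_real x - z)) = of_real (x * f x) / (of_real x - z) - of_real (f x)"
      using K
    proof eventually_elim
      case (elim x)
      then have "of_real x - z \<noteq> 0" using norm_of_real_diff_ge[OF elim, of z] z by auto
      then show ?case by (simp add: field_simps)
    qed
  qed (simp_all add: M_is_borel cong: measurable_cong_sets)
  also have "\<dots> = cauchy_tr M (\<lambda>x. x * f x) z - of_real (LINT x|M. f x)"
    unfolding cauchy_tr_def using i[OF f] i[OF xf] f by (subst Bochner_Integration.integral_diff) auto
  finally show ?thesis .
qed

lemma cauchy_tr_asymp:
  assumes f: "integrable M f" and K: "AE x in M. \<bar>x\<bar> \<le> R"
  shows "((\<lambda>z. - z * cauchy_tr M f z) \<longlongrightarrow> of_real (LINT x|M. f x)) at_infinity"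
proof -
  have [measurable]: "f \<in> borel_measurable borel" using f M_is_borel by (auto cong: measurable_cong_sets)
  have xf: "integrable M (\<lambda>x. x * f x)"
  proof (rule Bochner_Integration.integrable_bound)
    show "integrable M (\<lambda>x. R * f x)" using f by simp
    show "AE x in M. norm (x * f x) \<le> norm (R * f x)"
      using K by eventually_elim (auto simp: abs_mult intro!: mult_right_mono)
  qed (simp add: M_is_borel cong: measurable_cong_sets)
  have "((\<lambda>z. of_real (LINT x|M. f x) - cauchy_tr M (\<lambda>x. x * f x) z) \<longlongrightarrow> of_real (LINT x|M. f x) - 0) at_infinity"
    by (intro tendsto_intros cauchy_tr_tendsto_0[OF xf K])
  then show ?thesis
    unfolding diff_0_right
  proof (rule Lim_transform_eventually)
    show "eventually (\<lambda>z. of_real (LINT x|M. f x) - cauchy_tr M (\<lambda>x. x * f x) z = - z * cauchy_tr M f z) at_infinity"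
      unfolding eventually_at_infinity
      by (intro exI[of _ "R + 1"]) (use cauchy_tr_mult_ident[OF assms] in auto)
  qed
qed

text \<open>Recovers a point mass: the factor - i \<epsilon> / (x - E - i \<epsilon>) is 1 at x = E,
  tends to 0 elsewhere and is bounded by 1, so dominated convergence applies.\<close>

lemma cauchy_tr_vertical:
  assumes f: "integrable M f"
  shows "((\<lambda>\<epsilon>. - (\<i> * of_real \<epsilon>) * cauchy_tr M f (Complex E \<epsilon>)) \<longlongrightarrow> of_real (f E * measure M {E})) (at_right 0)"
proof -
  have [measurable]: "f \<in> borel_measurable borel" using f M_is_borel by (auto cong: measurable_cong_sets)
  have "((\<lambda>\<epsilon>. LINT x|M. - (\<i> * of_real \<epsilon>) * (of_real (f x) / (of_real x - Complex E \<epsilon>)))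
      \<longlongrightarrow> (LINT x|M. of_real (f E) * indicator {E} x)) (at_right 0)"
  proof (rule integral_tendsto_at_within[where w="\<lambda>x. \<bar>f x\<bar>"])
    show "AE x in M. norm (- (\<i> * complex_of_real \<epsilon>) * (of_real (f x) / (of_real x - Complex E \<epsilon>))) \<le> \<bar>f x\<bar>"
      if "\<epsilon> \<in> {0<..} - {0}" for \<epsilon>
    proof (rule AE_I2)
      fix x
      have "\<epsilon> \<le> norm (of_real x - Complex E \<epsilon>)"
        using that abs_Im_le_cmod[of "of_real x - Complex E \<epsilon>"] by simp
      then show "norm (- (\<i> * complex_of_real \<epsilon>) * (of_real (f x) / (of_real x - Complex E \<epsilon>))) \<le> \<bar>f x\<bar>"
        using that by (simp add: norm_mult norm_divide divide_le_eq mult.commute) (metis abs_ge_zero mult.commute mult_left_mono)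
    qed
    show "AE x in M. ((\<lambda>\<epsilon>. - (\<i> * complex_of_real \<epsilon>) * (of_real (f x) / (of_real x - Complex E \<epsilon>)))
        \<longlongrightarrow> of_real (f E) * indicator {E} x) (at_right 0)"
    proof (rule AE_I2)
      fix x
      show "((\<lambda>\<epsilon>. - (\<i> * complex_of_real \<epsilon>) * (of_real (f x) / (of_real x - Complex E \<epsilon>)))
        \<longlongrightarrow> of_real (f E) * indicator {E} x) (at_right 0)"
      proof (cases "x = E")
        case True
        have "eventually (\<lambda>\<epsilon>. of_real (f E) = - (\<i> * complex_of_real \<epsilon>) * (of_real (f x) / (of_real x - Complex E \<epsilon>))) (at_right 0)"
          using eventually_at_right_less[of 0]
        proof eventually_elim
          case (elim \<epsilon>)
          have "of_real x - Complex E \<epsilon> = - (\<i> * of_real \<epsilon>)" using True by (simp add: complex_eq_iff)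
          then show ?case using elim True by simp
        qed
        then show ?thesis using True by (intro tendsto_eventually) (auto elim: eventually_mono)
      next
        case False
        have "((\<lambda>\<epsilon>. - (\<i> * complex_of_real \<epsilon>) * (of_real (f x) / (of_real x - (of_real E + \<i> * of_real \<epsilon>))))
          \<longlongrightarrow> - (\<i> * of_real 0) * (of_real (f x) / (of_real x - (of_real E + \<i> * of_real 0)))) (at_right 0)"
          using False by (intro tendsto_intros) auto
        then show ?thesis using False by (simp add: Complex_eq)
      qed
    qed
  qed (use f in \<open>simp_all add: M_is_borel cong: measurable_cong_sets\<close>)
  moreover have "(LINT x|M. of_real (f E) * indicator {E} x) = complex_of_real (f E * measure M {E})"
  proof -
    have "(LINT x|M. complex_of_real (f E) * indicator {E} x) = (LINT x|M. complex_of_real (f E * indicator {E} x))"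
      by (intro Bochner_Integration.integral_cong) (auto simp: indicator_def)
    also have "\<dots> = of_real (LINT x|M. f E * indicator {E} x)" by (rule integral_complex_of_real)
    also have "\<dots> = of_real (f E * measure M {E})" by (simp add: M_is_borel sets_eq_imp_space_eq[OF M_is_borel])
    finally show ?thesis .
  qed
  ultimately show ?thesis by (simp only: cauchy_tr_def integral_mult_right_zero)
qed

end

section \<open>Stieltjes inversion\<close>

lemma
  shows integrable_inverse_1_plus_square: "integrable lborel (\<lambda>s. 1 / (1 + s\<^sup>2) :: real)"
    and integral_inverse_1_plus_square: "(LINT s|lborel. 1 / (1 + s\<^sup>2)) = pi"
proof -
  have *: "(arctan has_real_derivative 1 / (1 + x\<^sup>2)) (at x)" for x
    by (auto intro!: derivative_eq_intros simp: field_simps)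
  have lim: "((arctan \<circ> real_of_ereal) \<longlongrightarrow> - (pi/2)) (at_right (- \<infinity>))"
    "((arctan \<circ> real_of_ereal) \<longlongrightarrow> pi/2) (at_left \<infinity>)"
    using tendsto_arctan_at_bot tendsto_arctan_at_top
    by (simp_all add: ereal_tendsto_simps)
  have 1: "set_integrable lborel (einterval (-\<infinity>) \<infinity>) (\<lambda>s. 1 / (1 + s\<^sup>2) :: real)"
    and 2: "(LBINT x=-\<infinity>..\<infinity>. 1 / (1 + x\<^sup>2)) = pi/2 - (-(pi/2))"
    by (rule interval_integral_FTC_nonneg[where F=arctan, OF _ * _ _ lim(1) lim(2)];
        auto intro!: continuous_intros simp: add_nonneg_eq_0_iff)+
  show "integrable lborel (\<lambda>s. 1 / (1 + s\<^sup>2) :: real)"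
    using 1 by (simp add: set_integrable_def einterval_def)
  show "(LINT s|lborel. 1 / (1 + s\<^sup>2)) = pi"
    using 2 by (simp add: interval_lebesgue_integral_def einterval_def set_lebesgue_integral_def)
qed

lemma poisson_kernel_scaled:
  fixes t y s :: real
  assumes "y > 0"
  shows "y / ((t - (t + y * s))\<^sup>2 + y\<^sup>2) = (1 / (1 + s\<^sup>2)) / y"
proof -
  have "(t - (t + y * s))\<^sup>2 + y\<^sup>2 = y\<^sup>2 * (1 + s\<^sup>2)" by (simp add: algebra_simps power2_eq_square)
  then show ?thesis using assms by (simp add: power2_eq_square)
qed

text \<open>The substitution x = t + y s makes the kernel independent of \<open>y\<close> and
  \<open>t\<close>, so that the limit y to 0 takes place only in the argument of
  \<open>f\<close>.\<close>

lemma poisson_kernel_integral: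
  fixes f :: "real \<Rightarrow> 'a::{banach, second_countable_topology}"
  assumes y: "y > 0"
  shows "(LINT x|lborel. (y / ((t - x)\<^sup>2 + y\<^sup>2)) *\<^sub>R f x) = (LINT s|lborel. (1 / (1 + s\<^sup>2)) *\<^sub>R f (t + y * s))"
    and "integrable lborel (\<lambda>x. (y / ((t - x)\<^sup>2 + y\<^sup>2)) *\<^sub>R f x) \<longleftrightarrow> integrable lborel (\<lambda>s. (1 / (1 + s\<^sup>2)) *\<^sub>R f (t + y * s))"
proof -
  have "(LINT x|lborel. (y / ((t - x)\<^sup>2 + y\<^sup>2)) *\<^sub>R f x)
      = \<bar>y\<bar> *\<^sub>R (LINT s|lborel. (y / ((t - (t + y * s))\<^sup>2 + y\<^sup>2)) *\<^sub>R f (t + y * s))"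
    using y by (intro lborel_integral_real_affine) auto
  also have "\<dots> = (LINT s|lborel. (1 / (1 + s\<^sup>2)) *\<^sub>R f (t + y * s))"
    using y unfolding poisson_kernel_scaled[OF y] by (subst integral_scaleR_right[symmetric]) simp
  finally show "(LINT x|lborel. (y / ((t - x)\<^sup>2 + y\<^sup>2)) *\<^sub>R f x) = (LINT s|lborel. (1 / (1 + s\<^sup>2)) *\<^sub>R f (t + y * s))" .
  have "integrable lborel (\<lambda>x. (y / ((t - x)\<^sup>2 + y\<^sup>2)) *\<^sub>R f x)
     \<longleftrightarrow> integrable lborel (\<lambda>s. (y / ((t - (t + y * s))\<^sup>2 + y\<^sup>2)) *\<^sub>R f (t + y * s))"
    using y by (intro lborel_integrable_real_affine_iff[symmetric]) auto
  also have "\<dots> \<longleftrightarrow> integrable lborel (\<lambda>s. inverse y *\<^sub>R ((1 / (1 + s\<^sup>2)) *\<^sub>R f (t + y * s)))"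
    unfolding poisson_kernel_scaled[OF y] by (simp add: divide_inverse mult.commute)
  also have "\<dots> \<longleftrightarrow> integrable lborel (\<lambda>s. (1 / (1 + s\<^sup>2)) *\<^sub>R f (t + y * s))"
    using integrable_scaleR_right[of y lborel "\<lambda>s. inverse y *\<^sub>R ((1 / (1 + s\<^sup>2)) *\<^sub>R f (t + y * s))"]
      integrable_scaleR_right[of "inverse y" lborel "\<lambda>s. (1 / (1 + s\<^sup>2)) *\<^sub>R f (t + y * s)"] y
    by (intro iffI) simp_all
  finally show "integrable lborel (\<lambda>x. (y / ((t - x)\<^sup>2 + y\<^sup>2)) *\<^sub>R f x) \<longleftrightarrow> integrable lborel (\<lambda>s. (1 / (1 + s\<^sup>2)) *\<^sub>R f (t + y * s))" .
qed

lemma poisson_kernel_integrable: "y > 0 \<Longrightarrow> integrable lborel (\<lambda>x. y / ((t - x)\<^sup>2 + y\<^sup>2) :: real)"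
  and poisson_kernel_integral_1: "y > 0 \<Longrightarrow> (LINT x|lborel. y / ((t - x)\<^sup>2 + y\<^sup>2)) = pi"
  using poisson_kernel_integral[of y t "\<lambda>_. 1::real"] integrable_inverse_1_plus_square
    integral_inverse_1_plus_square by auto

context finite_borel_measure
begin

lemma cauchy_kernel_integrable':
  assumes f: "integrable M f" and z: "Im z \<noteq> 0"
  shows "integrable M (\<lambda>x. of_real (f x) / (of_real x - z) :: complex)"
  using z by (intro cauchy_kernel_integrable[where K=UNIV] f) auto

lemma Im_cauchy_tr:
  assumes f: "integrable M f" and y: "y \<noteq> 0"
  shows "Im (cauchy_tr M f (Complex x y)) = (LINT t|M. f t * (y / ((t - x)\<^sup>2 + y\<^sup>2)))"
proof -
  have "Im (cauchy_tr M f (Complex x y)) = (LINT t|M. Im (of_real (f t) / (of_real t - Complex x y)))"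
    unfolding cauchy_tr_def using y by (intro integral_Im[symmetric] cauchy_kernel_integrable' f) auto
  also have "\<dots> = (LINT t|M. f t * (y / ((t - x)\<^sup>2 + y\<^sup>2)))"
    by (simp add: Im_divide)
  finally show ?thesis .
qed

text \<open>By Fubini the integral becomes that of \<open>g\<close> against the Poisson integral of
  \<open>f\<close>, which is bounded by a constant and tends to pi * f pointwise. Only boundedness
  and continuity of the test function enter, not decay.\<close>

lemma
  fixes f g :: "real \<Rightarrow> real"
  assumes g: "integrable M g" and f: "continuous_on UNIV f" "\<And>x. \<bar>f x\<bar> \<le> B"
  shows integrable_mult_Im_cauchy_tr:
      "\<And>y. y > 0 \<Longrightarrow> integrable lborel (\<lambda>x. f x * Im (cauchy_tr M g (Complex x y)))"
    and stieltjes_inversion: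
      "((\<lambda>y. LINT x|lborel. f x * Im (cauchy_tr M g (Complex x y))) \<longlongrightarrow> pi * (LINT x|M. f x * g x)) (at_right 0)"
proof -
  have [measurable]: "f \<in> borel_measurable borel" "g \<in> borel_measurable borel"
    using f g borel_measurable_continuous_onI M_is_borel by (auto cong: measurable_cong_sets)
  have [measurable_cong]: "sets M = sets borel" by (rule M_is_borel)
  interpret P: pair_sigma_finite M lborel ..
  define h where "h y t x = f x * (g t * (y / ((t - x)\<^sup>2 + y\<^sup>2)))" for y t x :: real
  have hm[measurable]: "case_prod (h y) \<in> borel_measurable (M \<Otimes>\<^sub>M lborel)" for y
    unfolding h_def by measurable
  \<comment> \<open>The Poisson integral of \<open>f\<close> at \<open>t\<close>, up to the factor
    pi, in the scaled variable.\<close>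
  define \<phi> where "\<phi> y t = (LINT s|lborel. (1 / (1 + s\<^sup>2)) * f (t + y * s))" for y t :: real
  have B0: "B \<ge> 0" using f(2)[of 0] by linarith
  have pf_int: "integrable lborel (\<lambda>x. (y / ((t - x)\<^sup>2 + y\<^sup>2)) * f x)" if "y > 0" for y t
  proof (rule Bochner_Integration.integrable_bound)
    show "integrable lborel (\<lambda>x. B * (y / ((t - x)\<^sup>2 + y\<^sup>2)))"
      by (intro integrable_mult_right poisson_kernel_integrable that)
    show "AE x in lborel. norm (y / ((t - x)\<^sup>2 + y\<^sup>2) * f x) \<le> norm (B * (y / ((t - x)\<^sup>2 + y\<^sup>2)))"
      using f(2) B0 that by (intro AE_I2) (auto simp: abs_mult mult.commute intro!: divide_right_mono mult_right_mono)
  qed simp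
  have pf_bd: "(LINT x|lborel. norm (h y t x)) \<le> B * pi * \<bar>g t\<bar>" if "y > 0" for y t
  proof -
    have "(LINT x|lborel. norm (h y t x)) \<le> (LINT x|lborel. (B * \<bar>g t\<bar>) * (y / ((t - x)\<^sup>2 + y\<^sup>2)))"
    proof (rule integral_mono)
      have "integrable lborel (\<lambda>x. g t * ((y / ((t - x)\<^sup>2 + y\<^sup>2)) * f x))"
        by (intro integrable_mult_right pf_int that)
      then show "integrable lborel (\<lambda>x. norm (h y t x))"
        unfolding h_def by (intro integrable_norm) (simp add: mult_ac)
      show "norm (h y t x) \<le> (B * \<bar>g t\<bar>) * (y / ((t - x)\<^sup>2 + y\<^sup>2))" for x
      proof -
        have "norm (h y t x) = \<bar>f x\<bar> * (\<bar>g t\<bar> * (y / ((t - x)\<^sup>2 + y\<^sup>2)))"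
          using that by (simp add: h_def abs_mult)
        also have "\<dots> \<le> B * (\<bar>g t\<bar> * (y / ((t - x)\<^sup>2 + y\<^sup>2)))"
          using that f(2) by (intro mult_right_mono) auto
        finally show ?thesis by simp
      qed
    qed (intro integrable_mult_right poisson_kernel_integrable that)
    then show ?thesis
      by (simp only: integral_mult_right_zero poisson_kernel_integral_1[OF that] mult_ac)
  qed
  have hint: "integrable (M \<Otimes>\<^sub>M lborel) (case_prod (h y))" if "y > 0" for y
  proof (rule P.Fubini_integrable[OF hm])
    show "integrable M (\<lambda>t. LINT x|lborel. norm (case (t, x) of (t, x) \<Rightarrow> h y t x))"
    proof (rule Bochner_Integration.integrable_bound)
      show "integrable M (\<lambda>t. B * pi * \<bar>g t\<bar>)" using g by simp
      show "AE t in M. norm (LINT x|lborel. norm (case (t, x) of (t, x) \<Rightarrow> h y t x)) \<le> norm (B * pi * \<bar>g t\<bar>)"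
        using pf_bd[OF that] B0 by (intro AE_I2) (auto simp: abs_mult)
    qed measurable
    have "integrable lborel (\<lambda>x. g t * ((y / ((t - x)\<^sup>2 + y\<^sup>2)) * f x))" for t
      by (intro integrable_mult_right pf_int that)
    then show "AE t in M. integrable lborel (\<lambda>x. case (t, x) of (t, x) \<Rightarrow> h y t x)"
      by (intro AE_I2) (simp add: h_def mult_ac)
  qed
  have Imeq: "f x * Im (cauchy_tr M g (Complex x y)) = (LINT t|M. h y t x)" if "y > 0" for x y
    unfolding h_def integral_mult_right_zero using Im_cauchy_tr[OF g, of y x] that by simp
  show "integrable lborel (\<lambda>x. f x * Im (cauchy_tr M g (Complex x y)))" if "y > 0" for y
    unfolding Imeq[OF that] by (rule P.integrable_snd[OF hint[OF that]])
  have eq: "(LINT x|lborel. f x * Im (cauchy_tr M g (Complex x y))) = (LINT t|M. g t * \<phi> y t)" if "y > 0" for y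
  proof -
    have "(LINT x|lborel. f x * Im (cauchy_tr M g (Complex x y))) = (LINT t|M. LINT x|lborel. h y t x)"
      unfolding Imeq[OF that] by (rule P.Fubini_integral[OF hint[OF that]])
    moreover have "(LINT x|lborel. h y t x) = g t * \<phi> y t" for t
    proof -
      have "(LINT x|lborel. h y t x) = (LINT x|lborel. g t * ((y / ((t - x)\<^sup>2 + y\<^sup>2)) *\<^sub>R f x))"
        by (simp add: h_def mult_ac)
      also have "\<dots> = g t * \<phi> y t"
        unfolding integral_mult_right_zero poisson_kernel_integral(1)[OF that]
        unfolding \<phi>_def real_scaleR_def ..
      finally show ?thesis .
    qed
    ultimately show ?thesis by simp
  qed
  have \<phi>m[measurable]: "\<phi> y \<in> borel_measurable borel" for y unfolding \<phi>_def by measurable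
  have \<phi>b: "\<bar>\<phi> y t\<bar> \<le> B * pi" for y t
  proof -
    have "\<bar>\<phi> y t\<bar> \<le> (LINT s|lborel. norm ((1 / (1 + s\<^sup>2)) * f (t + y * s)))"
      unfolding \<phi>_def using integral_norm_bound[of lborel "\<lambda>s. (1 / (1 + s\<^sup>2)) * f (t + y * s)"] by simp
    also have "\<dots> \<le> (LINT s|lborel. B * (1 / (1 + s\<^sup>2)))"
    proof (rule Bochner_Integration.integral_mono')
      show "integrable lborel (\<lambda>s. B * (1 / (1 + s\<^sup>2)) :: real)"
        by (intro integrable_mult_right integrable_inverse_1_plus_square)
      show "norm (1 / (1 + s\<^sup>2) * f (t + y * s)) \<le> B * (1 / (1 + s\<^sup>2))" for s
        using f(2)[of "t + y * s"] by (auto simp: abs_mult intro!: divide_right_mono)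
    qed (use B0 in auto)
    also have "\<dots> = B * pi" unfolding integral_mult_right_zero integral_inverse_1_plus_square ..
    finally show ?thesis .
  qed
  have \<phi>lim: "((\<lambda>y. \<phi> y t) \<longlongrightarrow> pi * f t) (at_right 0)" for t
  proof -
    have "((\<lambda>y. LINT s|lborel. (1 / (1 + s\<^sup>2)) * f (t + y * s)) \<longlongrightarrow> (LINT s|lborel. (1 / (1 + s\<^sup>2)) * f t)) (at_right 0)"
    proof (rule integral_tendsto_at_within[where w="\<lambda>s. B * (1 / (1 + s\<^sup>2))"])
      show "integrable lborel (\<lambda>s. B * (1 / (1 + s\<^sup>2)) :: real)"
        by (intro integrable_mult_right integrable_inverse_1_plus_square)
      show "AE s in lborel. norm (1 / (1 + s\<^sup>2) * f (t + y * s)) \<le> B * (1 / (1 + s\<^sup>2))" for y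
        using f(2) by (intro AE_I2) (auto simp: abs_mult intro!: divide_right_mono)
      show "AE s in lborel. ((\<lambda>y. 1 / (1 + s\<^sup>2) * f (t + y * s)) \<longlongrightarrow> 1 / (1 + s\<^sup>2) * f t) (at_right 0)"
      proof (intro AE_I2 tendsto_mult tendsto_const)
        fix s
        have "isCont f t" using f(1) by (simp add: continuous_on_eq_continuous_at)
        moreover have "((\<lambda>y. t + y * s) \<longlongrightarrow> t + 0 * s) (at_right 0)" by (intro tendsto_intros)
        ultimately show "((\<lambda>y. f (t + y * s)) \<longlongrightarrow> f t) (at_right 0)"
          by (intro isCont_tendsto_compose[of t f]) auto
      qed
    qed auto
    moreover have "(LINT s|lborel. (1 / (1 + s\<^sup>2)) * f t) = pi * f t"
      unfolding integral_mult_left_zero integral_inverse_1_plus_square ..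
    ultimately show ?thesis by (simp add: \<phi>_def)
  qed
  have "((\<lambda>y. LINT t|M. g t * \<phi> y t) \<longlongrightarrow> (LINT t|M. g t * (pi * f t))) (at_right 0)"
  proof (rule integral_tendsto_at_within[where w="\<lambda>t. B * pi * \<bar>g t\<bar>"])
    show "AE t in M. norm (g t * \<phi> y t) \<le> B * pi * \<bar>g t\<bar>" for y
      using \<phi>b[of y] by (intro AE_I2) (auto simp: abs_mult mult.commute[of "B * pi"] intro!: mult_left_mono)
    show "AE t in M. ((\<lambda>y. g t * \<phi> y t) \<longlongrightarrow> g t * (pi * f t)) (at_right 0)"
      using \<phi>lim by (intro AE_I2 tendsto_intros)
  qed (use g in auto)
  moreover have "(LINT t|M. g t * (pi * f t)) = pi * (LINT x|M. f x * g x)"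
    unfolding integral_mult_right_zero[symmetric] by (intro Bochner_Integration.integral_cong) auto
  ultimately have "((\<lambda>y. LINT t|M. g t * \<phi> y t) \<longlongrightarrow> pi * (LINT x|M. f x * g x)) (at_right 0)" by simp
  then show "((\<lambda>y. LINT x|lborel. f x * Im (cauchy_tr M g (Complex x y))) \<longlongrightarrow> pi * (LINT x|M. f x * g x)) (at_right 0)"
    by (rule Lim_transform_eventually) (use eventually_at_right_less[of 0] in eventually_elim, simp add: eq)
qed

end

text \<open>Stieltjes inversion makes the integrals of all bounded continuous functions agree;
  half-lines are then reached by monotone approximation with the ramps \<open>f k\<close>.\<close>

lemma cauchy_tr_unique:
  assumes M: "finite_borel_measure M" and N: "finite_borel_measure N"
    and eq: "\<And>z. Im z > 0 \<Longrightarrow> cauchy_tr M (\<lambda>_. 1) z = cauchy_tr N (\<lambda>_. 1) z"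
  shows "M = N"
proof -
  interpret M: finite_borel_measure M by fact
  interpret N: finite_borel_measure N by fact
  have [measurable_cong]: "sets M = sets borel" "sets N = sets borel"
    by (rule M.M_is_borel N.M_is_borel)+
  have int_eq: "(LINT x|M. f x) = (LINT x|N. f x)"
    if "continuous_on UNIV f" "\<And>x. \<bar>f x\<bar> \<le> 1" for f :: "real \<Rightarrow> real"
  proof -
    have "((\<lambda>y. LINT x|lborel. f x * Im (cauchy_tr M (\<lambda>_. 1) (Complex x y))) \<longlongrightarrow> pi * (LINT x|M. f x)) (at_right 0)"
      using M.stieltjes_inversion[of "\<lambda>_. 1" f 1] that by simp
    moreover have "((\<lambda>y. LINT x|lborel. f x * Im (cauchy_tr N (\<lambda>_. 1) (Complex x y))) \<longlongrightarrow> pi * (LINT x|N. f x)) (at_right 0)"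
      using N.stieltjes_inversion[of "\<lambda>_. 1" f 1] that by simp
    then have "((\<lambda>y. LINT x|lborel. f x * Im (cauchy_tr M (\<lambda>_. 1) (Complex x y))) \<longlongrightarrow> pi * (LINT x|N. f x)) (at_right 0)"
      by (rule Lim_transform_eventually) (use eventually_at_right_less[of 0] in eventually_elim, simp add: eq)
    ultimately have "pi * (LINT x|M. f x) = pi * (LINT x|N. f x)"
      by (rule tendsto_unique[OF trivial_limit_at_right_real])
    then show ?thesis by simp
  qed
  show ?thesis
  proof (rule measure_eqI_lessThan)
    show "emeasure M {a<..} = emeasure N {a<..}" for a
    proof -
      define f where "f k t = min 1 (real k * max 0 (t - a))" for k :: nat and t
      have fc: "continuous_on UNIV (f k)" for k unfolding f_def by (intro continuous_intros)
      have [measurable]: "f k \<in> borel_measurable borel" for k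
        by (rule borel_measurable_continuous_onI[OF fc])
      have fb: "\<bar>f k t\<bar> \<le> 1" for k t by (auto simp: f_def)
      have flim: "(\<lambda>k. f k t) \<longlonglongrightarrow> indicator {a<..} t" for t
      proof (cases "t > a")
        case True
        obtain k0 where k0: "real k0 * (t - a) > 1"
          using True reals_Archimedean3[of "t - a"] by auto
        have "eventually (\<lambda>k. f k t = 1) sequentially"
          using eventually_ge_at_top[of k0]
        proof eventually_elim
          case (elim k)
          then have "real k * (t - a) \<ge> real k0 * (t - a)" using True by (intro mult_right_mono) auto
          then have "real k * (t - a) \<ge> 1" using k0 by linarith
          then show ?case using True by (simp add: f_def)
        qed
        then show ?thesis using True by (intro tendsto_eventually) auto
      qed (simp add: f_def max_def)
      have "(\<lambda>k. LINT t|M. f k t) \<longlonglongrightarrow> (LINT t|M. indicator {a<..} t)"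
        by (rule integral_dominated_convergence[where w="\<lambda>_. 1"]) (use flim fb in auto)
      moreover have "(\<lambda>k. LINT t|N. f k t) \<longlonglongrightarrow> (LINT t|N. indicator {a<..} t)"
        by (rule integral_dominated_convergence[where w="\<lambda>_. 1"]) (use flim fb in auto)
      ultimately have "(LINT t|M. indicator {a<..} t) = (LINT t|N. indicator {a<..} t :: real)"
        using int_eq[OF fc fb] LIMSEQ_unique by auto
      then have "measure M {a<..} = measure N {a<..}"
        by (simp add: sets_eq_imp_space_eq[OF M.M_is_borel] sets_eq_imp_space_eq[OF N.M_is_borel])
      then show ?thesis by (simp add: M.emeasure_eq_measure N.emeasure_eq_measure)
    qed
    show "emeasure M {a<..} < \<infinity>" for a
      by (simp add: M.emeasure_eq_measure)
  qed (use M.M_is_borel N.M_is_borel in auto)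
qed

section \<open>Stieltjes representation\<close>

text \<open>On the real axis (t - z) (t - cnj z) is the Poisson denominator. The quotient
  \<open>G\<close> has a removable singularity at \<open>z\<close> and decays like |w| ^ -2, so its
  integral over a segment and a half circle vanishes and the arc contributes nothing in the limit.
  Holomorphy slightly below the axis lets the contour run along it.\<close>

lemma half_plane_poisson:
  assumes d: "d > 0" and f: "f holomorphic_on {w. Im w > - d}"
    and B: "\<And>w. Im w \<ge> 0 \<Longrightarrow> norm (f w) \<le> B" and z: "Im z > 0"
  shows "(LINT t|lborel. (Im z / ((Re z - t)\<^sup>2 + (Im z)\<^sup>2)) *\<^sub>R f (of_real t)) = of_real pi * f z"
proof -
  \<comment> \<open>The depth is limited by Im z so that \<open>cnj z\<close> lies outside.\<close>
  define S where "S = {w. Im w > - min d (Im z)}"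
  have S: "open S" "convex S"
    unfolding S_def using open_halfspace_Im_gt convex_halfspace_Im_gt by auto
  have Sd: "S \<subseteq> {w. Im w > - d}" by (auto simp: S_def)
  define G where "G w = (if w = z then deriv f z else (f w - f z) / (w - z)) / (w - cnj z)" for w
  have "cnj z \<notin> S" using z by (auto simp: S_def)
  then have G: "G holomorphic_on S"
    unfolding G_def by (intro holomorphic_intros pole_lemma_open[OF holomorphic_on_subset[OF f Sd] S(1)]) auto
  have B0: "B \<ge> 0" using order_trans[OF norm_ge_zero B[of 0]] by simp
  define k where "k t = G (of_real t)" for t
  have keq: "k t = (f (of_real t) - f z) / of_real ((Re z - t)\<^sup>2 + (Im z)\<^sup>2)" for t
  proof -
    have "(of_real t - z) * (of_real t - cnj z) = of_real ((Re z - t)\<^sup>2 + (Im z)\<^sup>2)"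
      by (simp add: complex_eq_iff power2_eq_square algebra_simps)
    moreover have "of_real t \<noteq> z" using z by auto
    ultimately show ?thesis by (simp add: k_def G_def)
  qed
  have kcont: "continuous_on UNIV k"
    unfolding k_def using z d
    by (intro continuous_on_compose2[OF holomorphic_on_imp_continuous_on[OF G]] continuous_intros)
       (auto simp: S_def)
  have [measurable]: "k \<in> borel_measurable borel"
    by (rule borel_measurable_continuous_onI[OF kcont])
  have kbd: "norm (k t) \<le> (2 * B / Im z) * (Im z / ((Re z - t)\<^sup>2 + (Im z)\<^sup>2))" for t
  proof -
    have "norm (f (of_real t) - f z) \<le> 2 * B"
      using norm_triangle_ineq4[of "f (of_real t)" "f z"] B[of "of_real t"] B[of z] z by auto
    then have "norm (f (of_real t) - f z) / ((Re z - t)\<^sup>2 + (Im z)\<^sup>2) \<le> 2 * B / ((Re z - t)\<^sup>2 + (Im z)\<^sup>2)"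
      by (intro divide_right_mono) auto
    moreover have "norm (k t) = norm (f (of_real t) - f z) / ((Re z - t)\<^sup>2 + (Im z)\<^sup>2)"
      unfolding keq norm_divide norm_of_real by simp
    ultimately show ?thesis using z by simp
  qed
  have kint: "integrable lborel k"
  proof (rule Bochner_Integration.integrable_bound)
    show "integrable lborel (\<lambda>t. (2 * B / Im z) * (Im z / ((Re z - t)\<^sup>2 + (Im z)\<^sup>2)))"
      by (intro integrable_mult_right poisson_kernel_integrable z)
    show "AE t in lborel. norm (k t) \<le> norm ((2 * B / Im z) * (Im z / ((Re z - t)\<^sup>2 + (Im z)\<^sup>2)))"
      by (intro AE_I2, unfold real_norm_def) (rule order_trans[OF kbd abs_ge_self])
  qed simp
  have bound: "norm (LINT t|lborel. indicator {- R..R} t *\<^sub>R k t) \<le> 2 * B / (R - norm z)\<^sup>2 * R * pi"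
    if R: "R > norm z" for R
  proof -
    have R0: "R > 0" using R norm_ge_zero[of z] by linarith
    let ?\<gamma> = "linepath (- of_real R) (of_real R) +++ part_circlepath 0 R 0 pi"
    have up: "Im w \<ge> 0 \<and> norm w = R" if "w \<in> path_image (part_circlepath 0 R 0 pi)" for w
      using that R0 unfolding path_image_part_circlepath'[of 0 R 0 pi]
      by (auto simp: cis.ctr closed_segment_eq_real_ivl norm_mult sin_ge_zero)
    have li: "path_image (linepath (- of_real R) (of_real R)) \<subseteq> S"
      unfolding path_image_linepath
      by (rule closed_segment_subset) (use S z d in \<open>auto simp: S_def\<close>)
    have ci: "path_image (part_circlepath 0 R 0 pi) \<subseteq> S" using up z d by (force simp: S_def)
    have ends: "pathfinish (part_circlepath 0 R 0 pi) = - of_real R"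
      "pathstart (part_circlepath 0 R 0 pi) = of_real R"
      by (simp_all add: pathfinish_def pathstart_def part_circlepath_def linepath_def exp_Euler)
    have i1: "G contour_integrable_on linepath (- of_real R) (of_real R)"
      using holomorphic_on_subset[OF G] li S G contour_integrable_holomorphic_simple[OF G S(1) _ li] by auto
    have i2: "G contour_integrable_on part_circlepath 0 R 0 pi"
      using contour_integrable_holomorphic_simple[OF G S(1) _ ci] by auto
    have "(G has_contour_integral 0) ?\<gamma>"
      by (rule Cauchy_theorem_convex_simple[OF G S(2)])
         (use li ci ends in \<open>auto simp: path_image_join intro!: valid_path_join\<close>)
    then have "contour_integral (linepath (- of_real R) (of_real R)) G + contour_integral (part_circlepath 0 R 0 pi) G = 0"
      using i1 i2 ends by (subst contour_integral_join[symmetric]) (auto simp: contour_integral_unique)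
    then have "norm (contour_integral (linepath (- of_real R) (of_real R)) G) = norm (contour_integral (part_circlepath 0 R 0 pi) G)"
      by (metis add_eq_0_iff norm_minus_cancel)
    also have "\<dots> \<le> 2 * B / (R - norm z)\<^sup>2 * R * \<bar>pi - 0\<bar>"
    proof (rule contour_integral_bound_part_circlepath[OF i2])
      fix w assume w: "w \<in> path_image (part_circlepath 0 R 0 pi)"
      have n1: "norm (w - z) \<ge> R - norm z" and n2: "norm (w - cnj z) \<ge> R - norm z"
        using up[OF w] norm_triangle_ineq2[of w z] norm_triangle_ineq2[of w "cnj z"] by auto
      have wz: "w \<noteq> z" using up[OF w] R by auto
      have "norm (f w - f z) \<le> 2 * B"
        using norm_triangle_ineq4[of "f w" "f z"] B[of w] B[of z] z up[OF w] by auto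
      moreover have "norm (w - z) * norm (w - cnj z) \<ge> (R - norm z)\<^sup>2"
        unfolding power2_eq_square using n1 n2 R by (intro mult_mono) auto
      ultimately have "norm (f w - f z) / (norm (w - z) * norm (w - cnj z)) \<le> 2 * B / (R - norm z)\<^sup>2"
        using R B0 by (intro frac_le) auto
      then show "norm (G w) \<le> 2 * B / (R - norm z)\<^sup>2"
        using wz by (simp add: G_def norm_divide norm_mult)
    qed (use B0 R0 in auto)
    also have "contour_integral (linepath (- of_real R) (of_real R)) G = integral {- R..R} k"
      using R0 by (subst contour_integral_linepath_Reals_eq) (auto simp: k_def[abs_def])
    also have "integral {- R..R} k = (LINT t|lborel. indicator {- R..R} t *\<^sub>R k t)"
      using kint by (subst set_borel_integral_eq_integral(2)[symmetric])
        (auto simp: set_integrable_def set_lebesgue_integral_def intro!: integrable_mult_indicator)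
    finally show ?thesis by simp
  qed
  have "(\<lambda>n. LINT t|lborel. indicator {- real n..real n} t *\<^sub>R k t) \<longlonglongrightarrow> (LINT t|lborel. k t)"
  proof (rule integral_dominated_convergence[where w="\<lambda>t. norm (k t)"])
    show "AE t in lborel. (\<lambda>n. indicator {- real n..real n} t *\<^sub>R k t) \<longlonglongrightarrow> k t"
    proof (intro AE_I2 tendsto_eventually)
      fix t :: real
      obtain m where "real m > \<bar>t\<bar>" using reals_Archimedean2 by blast
      then show "eventually (\<lambda>n. indicator {- real n..real n} t *\<^sub>R k t = k t) sequentially"
        by (intro eventually_sequentiallyI[of m]) (auto simp: indicator_def)
    qed
  qed (use kint in \<open>auto simp: indicator_def\<close>)
  moreover have "(\<lambda>n. LINT t|lborel. indicator {- real n..real n} t *\<^sub>R k t) \<longlonglongrightarrow> 0"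
  proof (rule Lim_null_comparison)
    obtain m where m: "real m > norm z" using reals_Archimedean2 by blast
    show "eventually (\<lambda>n. norm (LINT t|lborel. indicator {- real n..real n} t *\<^sub>R k t) \<le> 2 * B / (real n - norm z)\<^sup>2 * real n * pi) sequentially"
      using m by (intro eventually_sequentiallyI[of m] bound) auto
    show "(\<lambda>n. 2 * B / (real n - norm z)\<^sup>2 * real n * pi) \<longlonglongrightarrow> 0" by real_asymp
  qed
  ultimately have k0: "(LINT t|lborel. k t) = 0" by (rule LIMSEQ_unique)
  have "(LINT t|lborel. (Im z / ((Re z - t)\<^sup>2 + (Im z)\<^sup>2)) *\<^sub>R f (of_real t))
    = (LINT t|lborel. (Im z) *\<^sub>R k t + (Im z / ((Re z - t)\<^sup>2 + (Im z)\<^sup>2)) *\<^sub>R f z)"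
  proof (rule Bochner_Integration.integral_cong[OF refl])
    fix t
    show "(Im z / ((Re z - t)\<^sup>2 + (Im z)\<^sup>2)) *\<^sub>R f (of_real t) = (Im z) *\<^sub>R k t + (Im z / ((Re z - t)\<^sup>2 + (Im z)\<^sup>2)) *\<^sub>R f z"
      unfolding keq by (simp add: scaleR_conv_of_real diff_divide_distrib algebra_simps)
  qed
  also have "\<dots> = (Im z) *\<^sub>R (LINT t|lborel. k t) + (LINT t|lborel. Im z / ((Re z - t)\<^sup>2 + (Im z)\<^sup>2)) *\<^sub>R f z"
    using kint poisson_kernel_integrable[OF z, of "Re z"]
    by (subst Bochner_Integration.integral_add) (auto simp: integral_scaleR_left)
  also have "\<dots> = of_real pi * f z"
    using poisson_kernel_integral_1[OF z, of "Re z"] k0 by (simp add: scaleR_conv_of_real)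
  finally show ?thesis .
qed

text \<open>By the Lindelof property countably many null open sets cover \<open>U\<close>.\<close>

lemma AE_not_in_locally_null:
  fixes M :: "'a::second_countable_topology measure"
  assumes sets: "sets M = sets borel"
    and null: "\<And>x. x \<in> U \<Longrightarrow> \<exists>V. open V \<and> x \<in> V \<and> emeasure M V = 0"
  shows "AE x in M. x \<notin> U"
proof -
  define F where "F = {V. open V \<and> emeasure M V = 0}"
  obtain F' where F': "F' \<subseteq> F" "countable F'" "\<Union>F' = \<Union>F"
    using Lindelof[of F] by (auto simp: F_def)
  have "(\<Union>V\<in>F'. V) \<in> null_sets M"
    using F' sets by (intro null_sets_UN') (auto simp: F_def null_sets_def)
  moreover have "U \<subseteq> (\<Union>V\<in>F'. V)" using null F'(3) by (fastforce simp: F_def)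
  ultimately show ?thesis
    by (intro AE_I'[of "\<Union>V\<in>F'. V"]) auto
qed


text \<open>The open mapping theorem: the image of a nonconstant function is open and so leaves the
  real line.\<close>

lemma holomorphic_Im_zero_constant:
  assumes f: "f holomorphic_on S" and S: "open S" "connected S" and Im: "\<And>z. z \<in> S \<Longrightarrow> Im (f z) = 0"
  shows "f constant_on S"
proof (rule ccontr)
  assume nc: "\<not> f constant_on S"
  then obtain z where z: "z \<in> S" unfolding constant_on_def by blast
  have "open (f ` S)" by (rule open_mapping_thm[OF f S S(1) order_refl nc])
  then obtain e where e: "e > 0" "cball (f z) e \<subseteq> f ` S"
    using z open_contains_cball by blast
  then have "f z + \<i> * of_real e \<in> f ` S" by (auto simp: subset_iff dist_norm norm_mult)
  then show False using e(1) Im Im[OF z] by (auto simp: complex_eq_iff)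
qed

text \<open>The measures with density Im F(t + i y) / pi on horizontal lines are probability
  measures, because the asymptotics fixes their mass, and are tight as y tends to 0. A weak limit
  has a transform with the imaginary part of \<open>F\<close>; decay at infinity then removes the
  remaining real constant.\<close>

theorem stieltjes_representation:
  assumes K: "closed K" "K \<subseteq> {- R..R}"
    and F: "F holomorphic_on - (of_real ` K)"
    and pos: "\<And>z. Im z > 0 \<Longrightarrow> Im (F z) \<ge> 0"
    and cnj: "\<And>z. F (cnj z) = cnj (F z)"
    and lim: "((\<lambda>z. - z * F z) \<longlongrightarrow> 1) at_infinity"
  obtains \<rho> where "finite_borel_measure \<rho>" "AE x in \<rho>. x \<in> K"
    "measure \<rho> UNIV = 1" "\<And>z. z \<notin> of_real ` K \<Longrightarrow> F z = cauchy_tr \<rho> (\<lambda>_. 1) z"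
proof -
  have clK: "closed (of_real ` K :: complex set)"
    using K(1) by (intro closed_injective_linear_image) (auto simp: linear_of_real inj_on_def)
  have Fcont: "continuous_on (- (of_real ` K)) F" using F holomorphic_on_imp_continuous_on by blast
  have F0: "(F \<longlongrightarrow> 0) at_infinity"
  proof -
    have "((\<lambda>z. (- z * F z) * (- inverse z)) \<longlongrightarrow> 1 * (- 0)) at_infinity"
      by (intro tendsto_mult lim tendsto_minus tendsto_inverse_0)
    moreover have "eventually (\<lambda>z. (- z * F z) * (- inverse z) = F z) at_infinity"
      using eventually_not_equal_at_infinity[of 0] by eventually_elim simp
    ultimately have "(F \<longlongrightarrow> 1 * (- 0)) at_infinity" by (rule Lim_transform_eventually)
    then show ?thesis by simp
  qed
  have vert: "((\<lambda>s. s * Im (F (\<i> * of_real s))) \<longlongrightarrow> 1) at_top"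
  proof -
    have "filterlim (\<lambda>s::real. \<i> * of_real s) at_infinity at_top"
      by (rule filterlim_norm_at_top_imp_at_infinity)
         (simp add: norm_mult filterlim_abs_real)
    then have "((\<lambda>s. - (\<i> * of_real s) * F (\<i> * of_real s)) \<longlongrightarrow> 1) at_top"
      by (rule filterlim_compose[OF lim])
    from tendsto_Re[OF this] show ?thesis by simp
  qed
  have offK: "z \<notin> of_real ` K" if "Im z \<noteq> 0" for z using that by auto
  have bounded: "\<exists>B. \<forall>w. Im w \<ge> y \<longrightarrow> norm (F w) \<le> B" if y: "y > 0" for y
  proof -
    obtain A where A: "\<And>w. norm w \<ge> A \<Longrightarrow> norm (F w) < 1"
      using F0 tendstoD[OF F0, of 1] by (auto simp: eventually_at_infinity)
    have "compact (cball 0 A \<inter> {w. Im w \<ge> y})"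
      by (intro compact_Int_closed compact_cball closed_halfspace_Im_ge)
    moreover have "continuous_on (cball 0 A \<inter> {w. Im w \<ge> y}) F"
      using y by (intro continuous_on_subset[OF Fcont]) (auto intro!: offK)
    ultimately have "bounded (F ` (cball 0 A \<inter> {w. Im w \<ge> y}))"
      by (intro compact_imp_bounded compact_continuous_image)
    then obtain B where "\<And>w. w \<in> cball 0 A \<inter> {w. Im w \<ge> y} \<Longrightarrow> norm (F w) \<le> B"
      unfolding bounded_iff by blast
    then have B: "norm (F w) \<le> B" if "norm w \<le> A" "Im w \<ge> y" for w using that by simp
    have "norm (F w) \<le> max B 1" if "Im w \<ge> y" for w
      using A[of w] B[of w] that by (cases "norm w \<le> A") auto
    then show ?thesis by blast
  qed
  define h where "h y t = Im (F (Complex t y)) / pi" for y t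
  have h0: "h y t \<ge> 0" if "y > 0" for y t using pos[of "Complex t y"] that by (simp add: h_def)
  have hcont: "continuous_on UNIV (h y)" if "y > 0" for y
  proof -
    have "continuous_on UNIV (\<lambda>t. F (of_real t + \<i> * of_real y))"
      using that by (intro continuous_on_compose2[OF Fcont] continuous_intros) (auto simp: complex_eq_iff)
    then show ?thesis
      unfolding h_def Complex_eq by (intro continuous_on_divide continuous_on_Im continuous_on_const) auto
  qed
  have hm[measurable]: "h y \<in> borel_measurable borel" if "y > 0" for y
    by (rule borel_measurable_continuous_onI[OF hcont[OF that]])
  have poisson: "integrable lborel (\<lambda>t. (Im z / ((Re z - t)\<^sup>2 + (Im z)\<^sup>2)) * h y t)
      \<and> (LINT t|lborel. (Im z / ((Re z - t)\<^sup>2 + (Im z)\<^sup>2)) * h y t) = Im (F (z + \<i> * of_real y))"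
    if y: "y > 0" and z: "Im z > 0" for y z
  proof -
    obtain B where B: "\<And>w. Im w \<ge> y \<Longrightarrow> norm (F w) \<le> B" using bounded[OF y] by blast
    define f where "f w = F (w + \<i> * of_real y)" for w
    have hf: "f holomorphic_on {w. Im w > - y}"
    proof -
      have "(F \<circ> (\<lambda>w. w + \<i> * of_real y)) holomorphic_on {w. Im w > - y}"
        by (rule holomorphic_on_compose_gen[OF _ F]) (auto intro!: holomorphic_intros simp: complex_eq_iff)
      then show ?thesis by (simp only: f_def[abs_def] comp_def)
    qed
    have P: "(LINT t|lborel. (Im z / ((Re z - t)\<^sup>2 + (Im z)\<^sup>2)) *\<^sub>R f (of_real t)) = of_real pi * f z"
      by (rule half_plane_poisson[OF y hf _ z]) (auto simp: f_def intro!: B)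
    have fcont: "continuous_on UNIV (\<lambda>t. f (of_real t))"
      unfolding f_def using y by (intro continuous_on_compose2[OF Fcont] continuous_intros) (auto simp: complex_eq_iff)
    then have [measurable]: "(\<lambda>t. f (of_real t)) \<in> borel_measurable borel"
      by (rule borel_measurable_continuous_onI)
    have int: "integrable lborel (\<lambda>t. (Im z / ((Re z - t)\<^sup>2 + (Im z)\<^sup>2)) *\<^sub>R f (of_real t))"
    proof (rule Bochner_Integration.integrable_bound)
      show "integrable lborel (\<lambda>t. B * (Im z / ((Re z - t)\<^sup>2 + (Im z)\<^sup>2)))"
        by (intro integrable_mult_right poisson_kernel_integrable z)
      show "AE t in lborel. norm ((Im z / ((Re z - t)\<^sup>2 + (Im z)\<^sup>2)) *\<^sub>R f (of_real t)) \<le> norm (B * (Im z / ((Re z - t)\<^sup>2 + (Im z)\<^sup>2)))"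
      proof (rule AE_I2)
        fix t
        have "norm (f (of_real t)) \<le> \<bar>B\<bar>" using B[of "of_real t + \<i> * of_real y"] by (auto simp: f_def)
        then show "norm ((Im z / ((Re z - t)\<^sup>2 + (Im z)\<^sup>2)) *\<^sub>R f (of_real t)) \<le> norm (B * (Im z / ((Re z - t)\<^sup>2 + (Im z)\<^sup>2)))"
          unfolding norm_scaleR real_norm_def abs_mult by (subst mult.commute) (intro mult_right_mono, auto)
      qed
    qed simp
    have eq: "(Im z / ((Re z - t)\<^sup>2 + (Im z)\<^sup>2)) * h y t = Im ((Im z / ((Re z - t)\<^sup>2 + (Im z)\<^sup>2)) *\<^sub>R f (of_real t)) / pi" for t
      by (simp add: h_def f_def Complex_eq)
    have "integrable lborel (\<lambda>t. Im ((Im z / ((Re z - t)\<^sup>2 + (Im z)\<^sup>2)) *\<^sub>R f (of_real t)) / pi)"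
      using integrable_Im[OF int] by (rule integrable_divide_zero)
    moreover have "(LINT t|lborel. Im ((Im z / ((Re z - t)\<^sup>2 + (Im z)\<^sup>2)) *\<^sub>R f (of_real t)) / pi) = Im (F (z + \<i> * of_real y))"
      unfolding integral_divide_zero integral_Im[OF int] P by (simp add: f_def)
    ultimately show ?thesis unfolding eq by blast
  qed
  have mass: "integrable lborel (h y) \<and> (LINT t|lborel. h y t) = 1" if y: "y > 0" for y
  proof -
    \<comment> \<open>The weight s^2 / (t^2 + s^2) with s = n + 1 increases to 1, so monotone
      convergence reads the mass of \<open>h y\<close> off the values s * Im (F (i (s +
      y))).\<close>
    define g where "g n t = (real (Suc n))\<^sup>2 / (t\<^sup>2 + (real (Suc n))\<^sup>2) * h y t" for n t
    have g: "integrable lborel (g n)" "(LINT t|lborel. g n t) = real (Suc n) * Im (F (\<i> * of_real (real (Suc n) + y)))" for n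
    proof -
      note p = poisson[OF y, of "\<i> * of_real (real (Suc n))"]
      have eq: "g n t = real (Suc n) * (Im (\<i> * of_real (real (Suc n))) / ((Re (\<i> * of_real (real (Suc n))) - t)\<^sup>2 + (Im (\<i> * of_real (real (Suc n))))\<^sup>2) * h y t)" for t
        by (simp add: g_def power2_eq_square)
      show "integrable lborel (g n)"
        unfolding eq using p by (intro integrable_mult_right) auto
      show "(LINT t|lborel. g n t) = real (Suc n) * Im (F (\<i> * of_real (real (Suc n) + y)))"
        unfolding eq integral_mult_right_zero using p by (simp add: algebra_simps)
    qed
    have lim1: "(\<lambda>n. LINT t|lborel. g n t) \<longlonglongrightarrow> 1"
    proof -
      have sn: "filterlim (\<lambda>n. real (Suc n)) at_top sequentially"
        by (rule filterlim_compose[OF filterlim_real_sequentially filterlim_Suc])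
      then have "filterlim (\<lambda>n. real (Suc n) + y) at_top sequentially"
        using filterlim_tendsto_add_at_top[OF tendsto_const[of y] sn] by (simp add: add.commute)
      from filterlim_compose[OF vert this]
      have "(\<lambda>n. (real (Suc n) + y) * Im (F (\<i> * of_real (real (Suc n) + y)))) \<longlonglongrightarrow> 1" .
      moreover have "(\<lambda>n. real (Suc n) / (real (Suc n) + y)) \<longlonglongrightarrow> 1"
        using y by real_asymp
      ultimately have "(\<lambda>n. real (Suc n) / (real (Suc n) + y) * ((real (Suc n) + y) * Im (F (\<i> * of_real (real (Suc n) + y))))) \<longlonglongrightarrow> 1 * 1"
        by (intro tendsto_mult)
      moreover have "real (Suc n) + y \<noteq> 0" for n using y by linarith
      ultimately show ?thesis unfolding g by (simp del: of_nat_Suc)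
    qed
    have AE1: "AE t in lborel. mono (\<lambda>n. g n t)"
    proof (intro AE_I2 monoI)
      fix t and m n :: nat assume "m \<le> n"
      have "a / (t\<^sup>2 + a) \<le> b / (t\<^sup>2 + b)" if "0 < a" "a \<le> b" for a b :: real
        using that by (simp add: divide_le_eq_1 field_simps add_pos_nonneg mult_right_mono)
      moreover have "(real (Suc m))\<^sup>2 \<le> (real (Suc n))\<^sup>2" using \<open>m \<le> n\<close> by (intro power_mono) auto
      ultimately show "g m t \<le> g n t" unfolding g_def by (intro mult_right_mono h0 y) auto
    qed
    have AE2: "AE t in lborel. (\<lambda>n. g n t) \<longlonglongrightarrow> h y t"
    proof (intro AE_I2)
      fix t
      have "(\<lambda>n. (real (Suc n))\<^sup>2 / (t\<^sup>2 + (real (Suc n))\<^sup>2)) \<longlonglongrightarrow> 1" by real_asymp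
      from tendsto_mult[OF this tendsto_const[of "h y t"]] show "(\<lambda>n. g n t) \<longlonglongrightarrow> h y t"
        by (simp add: g_def)
    qed
    show ?thesis
      using integrable_monotone_convergence[OF g(1) AE1 AE2 lim1] integral_monotone_convergence[OF g(1) AE1 AE2 lim1] hm[OF y]
      by simp
  qed
  define \<nu> where "\<nu> n = density lborel (\<lambda>t. ennreal (h (inverse (real (Suc n))) t))" for n
  have yn: "inverse (real (Suc n)) > 0" for n by simp
  have int\<nu>: "(LINT t|\<nu> n. f t) = (LINT t|lborel. f t * h (inverse (real (Suc n))) t)"
    if [measurable]: "f \<in> borel_measurable borel" for f :: "real \<Rightarrow> real" and n
    unfolding \<nu>_def using hm[OF yn[of n]] h0[OF yn[of n]] by (subst integral_density) (auto simp: mult.commute)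
  have rd: "real_distribution (\<nu> n)" for n
  proof -
    have "emeasure (\<nu> n) (space (\<nu> n)) = (\<integral>\<^sup>+t. ennreal (h (inverse (real (Suc n))) t) \<partial>lborel)"
      using hm[OF yn[of n]] by (simp add: \<nu>_def emeasure_density del: of_nat_Suc)
    also have "\<dots> = 1"
      using mass[OF yn[of n]] h0[OF yn[of n]] by (subst nn_integral_eq_integral) auto
    finally have "prob_space (\<nu> n)" by (rule prob_spaceI)
    then show ?thesis by (simp add: real_distribution_def real_distribution_axioms_def \<nu>_def)
  qed
  have "tight \<nu>"
    unfolding tight_def
  proof (intro conjI allI impI rd)
    fix \<epsilon> :: real assume \<epsilon>: "\<epsilon> > 0"
    \<comment> \<open>Any \<open>\<delta>\<close> below \<epsilon> / 4 works: the estimate below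
      yields mass at least 2 (1 - 2 \<delta>) - 1 = 1 - 4 \<delta>.\<close>
    define \<delta> where "\<delta> = \<epsilon> / 8"
    have "\<delta> > 0" using \<epsilon> by (simp add: \<delta>_def)
    then have "eventually (\<lambda>s. s * Im (F (\<i> * of_real s)) > 1 - \<delta>) at_top"
      using order_tendstoD(1)[OF vert] by simp
    then obtain s0 where s0: "\<And>s. s \<ge> s0 \<Longrightarrow> s * Im (F (\<i> * of_real s)) > 1 - \<delta>"
      by (auto simp: eventually_at_top_linorder)
    have "((\<lambda>s::real. s / (s + 1)) \<longlongrightarrow> 1) at_top" by real_asymp
    then have "eventually (\<lambda>s::real. s / (s + 1) > 1 - \<delta>) at_top"
      using order_tendstoD(1)[of _ 1 at_top "1 - \<delta>"] \<open>\<delta> > 0\<close> by simp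
    then obtain s1 :: real where s1: "\<And>s. s \<ge> s1 \<Longrightarrow> s / (s + 1) > 1 - \<delta>"
      by (auto simp: eventually_at_top_linorder)
    define s where "s = max 1 (max s0 s1)"
    have s: "s > 0" "s \<ge> s0" "s \<ge> s1" by (auto simp: s_def)
    have "measure (\<nu> n) {- s<..s} > 1 - \<epsilon>" for n
    proof -
      define y where "y = inverse (real (Suc n))"
      have y: "y > 0" "y \<le> 1" by (auto simp: y_def field_simps)
      define p where "p = (\<lambda>t. s * (s / ((0 - t)\<^sup>2 + s\<^sup>2) * h y t))"
      have p: "integrable lborel p" "(LINT t|lborel. p t) = s * Im (F (\<i> * of_real (s + y)))"
      proof -
        have q: "integrable lborel (\<lambda>t. s / ((0 - t)\<^sup>2 + s\<^sup>2) * h y t)"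
          "(LINT t|lborel. s / ((0 - t)\<^sup>2 + s\<^sup>2) * h y t) = Im (F (\<i> * of_real (s + y)))"
          using poisson[OF y(1), of "\<i> * of_real s"] s(1) by (simp_all add: distrib_left)
        show "integrable lborel p" unfolding p_def by (intro integrable_mult_right q)
        show "(LINT t|lborel. p t) = s * Im (F (\<i> * of_real (s + y)))"
          unfolding p_def integral_mult_right_zero q(2) ..
      qed
      have "s * Im (F (\<i> * of_real (s + y))) \<ge> 1 - 2 * \<delta>"
      proof (cases "\<delta> < 1")
        case True
        have "(s + y) * Im (F (\<i> * of_real (s + y))) > 1 - \<delta>" using s y by (intro s0) auto
        moreover have "s / (s + y) \<ge> 1 - \<delta>"
          using s1[OF s(3)] divide_left_mono[of "s + y" "s + 1" s] s y by (auto simp: zero_less_mult_iff)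
        ultimately have "s / (s + y) * ((s + y) * Im (F (\<i> * of_real (s + y)))) \<ge> (1 - \<delta>) * (1 - \<delta>)"
          using True by (intro mult_mono) auto
        moreover have "(1 - \<delta>) * (1 - \<delta>) \<ge> 1 - 2 * \<delta>" by (simp add: algebra_simps)
        moreover have "s + y \<noteq> 0" using s y by auto
        ultimately show ?thesis by simp
      next
        case False
        have "Im (F (\<i> * of_real (s + y))) \<ge> 0" using s y by (intro pos) auto
        then have "s * Im (F (\<i> * of_real (s + y))) \<ge> 0" using s by simp
        then show ?thesis using False by linarith
      qed
      then have "1 - \<epsilon> < 2 * (LINT t|lborel. p t) - (LINT t|lborel. h y t)"
        using \<epsilon> mass[OF y(1)] p(2) unfolding \<delta>_def by (simp del: of_real_add)
      also have "\<dots> = (LINT t|lborel. 2 * p t - h y t)"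
        using p(1) mass[OF y(1)] by (subst Bochner_Integration.integral_diff) auto
      also have "\<dots> \<le> (LINT t|lborel. indicator {- s<..s} t * h y t)"
      proof (rule integral_mono)
        show "integrable lborel (\<lambda>t. 2 * p t - h y t)" using p(1) mass[OF y(1)] by auto
        show "integrable lborel (\<lambda>t. indicator {- s<..s} t * h y t)"
          using integrable_real_mult_indicator[of "{- s<..s}" lborel "h y"] mass[OF y(1)] by (simp add: mult.commute)
        show "2 * p t - h y t \<le> indicator {- s<..s} t * h y t" for t
        proof -
          \<comment> \<open>The factor 2 s^2 / (t^2 + s^2) - 1 is at most 1, and at most 0 where |t|
            >= s, so it lies below the indicator of the interval.\<close>
          have eq: "2 * p t - h y t = (2 * (s\<^sup>2 / (t\<^sup>2 + s\<^sup>2)) - 1) * h y t"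
            by (simp add: p_def power2_eq_square algebra_simps)
          have "2 * (s\<^sup>2 / (t\<^sup>2 + s\<^sup>2)) - 1 \<le> indicator {- s<..s} t"
          proof (cases "t \<in> {- s<..s}")
            case True
            have "s\<^sup>2 / (t\<^sup>2 + s\<^sup>2) \<le> 1" using s by (auto simp: divide_le_eq_1 add_nonneg_pos)
            then show ?thesis using True by simp
          next
            case False
            then have "\<bar>t\<bar> \<ge> s" using s by auto
            then have "t\<^sup>2 \<ge> s\<^sup>2" using s by (metis abs_le_square_iff abs_of_pos)
            then have "2 * (s\<^sup>2 / (t\<^sup>2 + s\<^sup>2)) \<le> 1" using s by (simp add: divide_le_eq add_nonneg_pos)
            then show ?thesis using False by simp
          qed
          then show ?thesis unfolding eq by (intro mult_right_mono h0 y)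
        qed
      qed
      also have "\<dots> = measure (\<nu> n) {- s<..s}"
      proof -
        interpret real_distribution "\<nu> n" by (rule rd)
        show ?thesis using int\<nu>[of "indicator {- s<..s}" n] by (simp add: y_def del: of_nat_Suc)
      qed
      finally show ?thesis .
    qed
    then show "\<exists>a b. a < b \<and> (\<forall>n. 1 - \<epsilon> < measure (\<nu> n) {a<..b})"
      using s by (intro exI[of _ "- s"] exI[of _ s]) auto
  qed
  from tight_imp_convergent_subsubsequence[OF this strict_mono_id]
  obtain r \<rho> where r: "strict_mono r" and \<rho>: "real_distribution \<rho>" "weak_conv_m (\<nu> \<circ> id \<circ> r) \<rho>"
    by blast
  interpret \<rho>: real_distribution \<rho> by fact
  have ylim: "(\<lambda>n. inverse (real (Suc (r n)))) \<longlonglongrightarrow> 0"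
    using LIMSEQ_subseq_LIMSEQ[OF LIMSEQ_inverse_real_of_nat r] by (simp add: comp_def)
  have ImF: "Im (F z) = Im (cauchy_tr \<rho> (\<lambda>_. 1) z)" if z: "Im z > 0" for z
  proof -
    let ?p = "\<lambda>t. Im z / ((Re z - t)\<^sup>2 + (Im z)\<^sup>2)"
    have pc: "continuous_on UNIV ?p" using z by (intro continuous_intros) (auto simp: add_nonneg_eq_0_iff)
    have "norm (?p t) \<le> 1 / Im z" for t
    proof -
      have "Im z * Im z \<le> (Re z - t)\<^sup>2 + (Im z)\<^sup>2" by (simp add: power2_eq_square)
      then have "Im z / ((Re z - t)\<^sup>2 + (Im z)\<^sup>2) \<le> Im z / (Im z * Im z)"
        using z by (intro divide_left_mono) (auto simp: add_nonneg_pos)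
      then show ?thesis using z by simp
    qed
    then have "(\<lambda>n. LINT t|(\<nu> \<circ> id \<circ> r) n. ?p t) \<longlonglongrightarrow> (LINT t|\<rho>. ?p t)"
      using pc rd \<rho> by (intro weak_conv_imp_integral_bdd_continuous_conv) (auto simp: continuous_on_eq_continuous_at comp_def)
    moreover have "(LINT t|(\<nu> \<circ> id \<circ> r) n. ?p t) = Im (F (z + \<i> * of_real (inverse (real (Suc (r n))))))" for n
      using int\<nu>[of ?p "r n"] borel_measurable_continuous_onI[OF pc] poisson[OF yn z, of "r n"]
      by (simp del: of_nat_Suc of_real_inverse)
    moreover have "(\<lambda>n. Im (F (z + \<i> * of_real (inverse (real (Suc (r n))))))) \<longlonglongrightarrow> Im (F (z + \<i> * of_real 0))"
    proof (intro tendsto_Im)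
      have "isCont F z"
        using Fcont z offK[of z] by (auto simp: continuous_on_eq_continuous_at[OF open_Compl[OF clK]])
      moreover have "(\<lambda>n. z + \<i> * of_real (inverse (real (Suc (r n))))) \<longlonglongrightarrow> z + \<i> * of_real 0"
        by (intro tendsto_intros ylim)
      ultimately show "(\<lambda>n. F (z + \<i> * of_real (inverse (real (Suc (r n)))))) \<longlonglongrightarrow> F (z + \<i> * of_real 0)"
        by (intro isCont_tendsto_compose[of _ F]) auto
    qed
    ultimately have "Im (F z) = (LINT t|\<rho>. ?p t)" using LIMSEQ_unique by (simp del: of_nat_Suc) 
    also have "\<dots> = Im (cauchy_tr \<rho> (\<lambda>_. 1) z)"
      using \<rho>.Im_cauchy_tr[of "\<lambda>_. 1" "Im z" "Re z"] z by (simp add: power2_commute)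
    finally show ?thesis .
  qed
  have supp: "AE x in \<rho>. x \<in> K"
  proof -
    have "AE x in \<rho>. x \<notin> - K"
    proof (rule AE_not_in_locally_null)
      fix x0 assume "x0 \<in> - K"
      then obtain d where d: "d > 0" "cball x0 d \<subseteq> - K"
        using K(1) by (meson open_Compl open_contains_cball)
      \<comment> \<open>A tent over a ball off \<open>K\<close>. Inversion computes its
        \<open>\<rho>\<close> integral, while Im F tends to 0 boundedly over the ball since
        \<open>F\<close> is real on the real line off \<open>K\<close>; hence the ball is
        null.\<close>
      define f where "f x = max 0 (d - \<bar>x - x0\<bar>)" for x
      have fc: "continuous_on UNIV f" unfolding f_def by (intro continuous_intros)
      have fb: "\<bar>f x\<bar> \<le> d" for x using d by (auto simp: f_def)
      have [measurable]: "f \<in> borel_measurable borel" by (rule borel_measurable_continuous_onI[OF fc])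
      have "((\<lambda>y. LINT x|lborel. f x * Im (cauchy_tr \<rho> (\<lambda>_. 1) (Complex x y))) \<longlongrightarrow> pi * (LINT x|\<rho>. f x * 1)) (at_right 0)"
        by (rule \<rho>.stieltjes_inversion[OF _ fc fb]) simp
      moreover have "((\<lambda>y. LINT x|lborel. f x * Im (cauchy_tr \<rho> (\<lambda>_. 1) (Complex x y))) \<longlongrightarrow> (LINT x|lborel. f x * 0)) (at 0 within {0<..1})"
      proof -
        define Q where "Q = (\<lambda>(x, y). Complex x y) ` (cball x0 d \<times> {0..1})"
        have "compact Q" unfolding Q_def Complex_eq
          by (intro compact_continuous_image compact_Times continuous_intros) (auto simp: case_prod_beta intro!: continuous_intros)
        moreover have QK: "Q \<subseteq> - (of_real ` K)" using d(2) by (auto simp: Q_def complex_eq_iff subset_iff)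
        ultimately have "bounded (F ` Q)"
          using Fcont by (intro compact_imp_bounded compact_continuous_image) (auto intro: continuous_on_subset)
        then obtain B where B: "\<And>z. z \<in> Q \<Longrightarrow> norm (F z) \<le> B" by (auto simp: bounded_iff)
        have B0: "B \<ge> 0" using B[of "Complex x0 0"] d order_trans[OF norm_ge_zero] by (force simp: Q_def)
        show ?thesis
        proof (rule integral_tendsto_at_within[where w="\<lambda>x. d * B * indicator (cball x0 d) x"])
          show "(\<lambda>x. f x * Im (cauchy_tr \<rho> (\<lambda>_. 1) (Complex x y))) \<in> borel_measurable lborel" if "y \<in> {0<..1} - {0}" for y
            using \<rho>.integrable_mult_Im_cauchy_tr[OF _ fc fb, of "\<lambda>_. 1" y] that by auto
          show "integrable lborel (\<lambda>x. d * B * indicator (cball x0 d) x)"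
            using emeasure_compact_finite[OF compact_cball[of x0 d]]
            by (intro integrable_mult_right integrable_real_indicator) (simp_all add: emeasure_lborel_cball_finite less_top)
          show "AE x in lborel. norm (f x * Im (cauchy_tr \<rho> (\<lambda>_. 1) (Complex x y))) \<le> d * B * indicator (cball x0 d) x"
            if "y \<in> {0<..1} - {0}" for y
          proof (rule AE_I2)
            fix x
            show "norm (f x * Im (cauchy_tr \<rho> (\<lambda>_. 1) (Complex x y))) \<le> d * B * indicator (cball x0 d) x"
            proof (cases "x \<in> cball x0 d")
              case True
              have "\<bar>Im (F (Complex x y))\<bar> \<le> B"
                using abs_Im_le_cmod[of "F (Complex x y)"] B[of "Complex x y"] True that by (force simp: Q_def)
              then have "\<bar>f x\<bar> * \<bar>Im (F (Complex x y))\<bar> \<le> d * B" using fb d B0 by (intro mult_mono) auto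
              then show ?thesis using True that ImF[of "Complex x y"] by (simp add: abs_mult)
            next
              case False
              then show ?thesis by (auto simp: f_def dist_real_def)
            qed
          qed
          show "AE x in lborel. ((\<lambda>y. f x * Im (cauchy_tr \<rho> (\<lambda>_. 1) (Complex x y))) \<longlongrightarrow> f x * 0) (at 0 within {0<..1})"
          proof (rule AE_I2)
            fix x
            show "((\<lambda>y. f x * Im (cauchy_tr \<rho> (\<lambda>_. 1) (Complex x y))) \<longlongrightarrow> f x * 0) (at 0 within {0<..1})"
            proof (cases "x \<in> cball x0 d")
              case True
              then have xK: "of_real x \<notin> of_real ` K" using d(2) by auto
              have "isCont F (of_real x)"
                using Fcont xK by (auto simp: continuous_on_eq_continuous_at[OF open_Compl[OF clK]])
              moreover have "((\<lambda>y. of_real x + \<i> * of_real y) \<longlongrightarrow> of_real x + \<i> * of_real 0) (at 0 within {0<..1})"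
                by (intro tendsto_intros)
              ultimately have "((\<lambda>y. F (of_real x + \<i> * of_real y)) \<longlongrightarrow> F (of_real x)) (at 0 within {0<..1})"
                by (intro isCont_tendsto_compose[of _ F]) auto
              moreover have "Im (F (of_real x)) = 0" using cnj[of "of_real x"] by (simp add: complex_eq_iff)
              ultimately have "((\<lambda>y. Im (F (Complex x y))) \<longlongrightarrow> 0) (at 0 within {0<..1})"
                unfolding Complex_eq using tendsto_Im by fastforce
              then have "((\<lambda>y. f x * Im (F (Complex x y))) \<longlongrightarrow> f x * 0) (at 0 within {0<..1})"
                by (intro tendsto_intros)
              then show ?thesis
                by (rule Lim_transform_eventually) (auto simp: eventually_at_filter ImF)
            next
              case False
              then show ?thesis by (auto simp: f_def dist_real_def)
            qed
          qed
        qed simp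
      qed
      moreover have "at (0::real) within {0<..1} = at_right 0"
        by (rule at_within_nhd[of _ "{..<1}"]) auto
      ultimately have "pi * (LINT x|\<rho>. f x * 1) = 0"
        using tendsto_unique[OF trivial_limit_at_right_real] by fastforce
      then have "(LINT x|\<rho>. f x) = 0" by simp
      moreover have "integrable \<rho> f"
        using fb by (intro \<rho>.integrable_const_bound[where B=d]) auto
      moreover have "AE x in \<rho>. 0 \<le> f x" by (simp add: f_def)
      ultimately have AE0: "AE x in \<rho>. f x = 0"
        using integral_nonneg_eq_0_iff_AE[of \<rho> f] by blast
      have "AE x in \<rho>. x \<notin> ball x0 d"
        using AE0 by eventually_elim (auto simp: f_def dist_real_def max_def split: if_splits)
      then have "emeasure \<rho> (ball x0 d) = 0"
        by (subst (asm) AE_iff_measurable[of "ball x0 d"]) auto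
      then show "\<exists>V. open V \<and> x0 \<in> V \<and> emeasure \<rho> V = 0"
        using d by (intro exI[of _ "ball x0 d"]) auto
    qed simp
    then show ?thesis by simp
  qed
  have suppR: "AE x in \<rho>. \<bar>x\<bar> \<le> R" using supp by eventually_elim (use K(2) in \<open>force simp: subset_iff\<close>)
  have C: "cauchy_tr \<rho> (\<lambda>_. 1) holomorphic_on - (of_real ` K)"
    by (rule \<rho>.cauchy_tr_holomorphic[OF _ K(1) supp]) simp
  have upper: "F z = cauchy_tr \<rho> (\<lambda>_. 1) z" if z: "Im z > 0" for z
  proof -
    define H where "H w = F w - cauchy_tr \<rho> (\<lambda>_. 1) w" for w
    have "H constant_on {w. Im w > 0}"
    proof (rule holomorphic_Im_zero_constant)
      show "H holomorphic_on {w. Im w > 0}"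
        unfolding H_def by (intro holomorphic_intros holomorphic_on_subset[OF F] holomorphic_on_subset[OF C]) (auto intro!: offK)
      show "connected {w. Im w > 0}" by (intro convex_connected convex_halfspace_Im_gt)
    qed (use ImF in \<open>auto simp: H_def open_halfspace_Im_gt\<close>)
    then obtain c where c: "\<And>w. Im w > 0 \<Longrightarrow> H w = c" by (auto simp: constant_on_def)
    have "(H \<longlongrightarrow> 0 - 0) at_infinity"
      unfolding H_def by (intro tendsto_diff F0 \<rho>.cauchy_tr_tendsto_0[OF _ suppR]) simp
    moreover have "filterlim (\<lambda>s::real. \<i> * of_real s) at_infinity at_top"
      by (rule filterlim_norm_at_top_imp_at_infinity)
         (simp add: norm_mult filterlim_abs_real)
    ultimately have "((\<lambda>s::real. H (\<i> * of_real s)) \<longlongrightarrow> 0) at_top"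
      using filterlim_compose by fastforce
    moreover have "((\<lambda>s::real. H (\<i> * of_real s)) \<longlongrightarrow> c) at_top"
      by (rule tendsto_eventually) (use eventually_gt_at_top[of 0] in eventually_elim, simp add: c)
    ultimately have "c = 0" using tendsto_unique[OF trivial_limit_at_top_linorder] by blast
    then show ?thesis using c[OF z] by (simp add: H_def)
  qed
  have "F z = cauchy_tr \<rho> (\<lambda>_. 1) z" if z: "z \<notin> of_real ` K" for z
  proof -
    consider "Im z > 0" | "Im z < 0" | "Im z = 0" by linarith
    then show ?thesis
    proof cases
      case 2
      have "cauchy_tr \<rho> (\<lambda>_. 1) z = cnj (cauchy_tr \<rho> (\<lambda>_. 1) (cnj z))"
        unfolding cauchy_tr_def by (subst Bochner_Integration.integral_cnj[symmetric]) simp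
      also have "cauchy_tr \<rho> (\<lambda>_. 1) (cnj z) = cnj (F z)"
        using upper[of "cnj z"] 2 cnj[of z] by simp
      finally show ?thesis by simp
    next
      case 3
      have lim: "((\<lambda>y. f (z + \<i> * of_real y)) \<longlongrightarrow> f z) (at_right 0)" if "f holomorphic_on - (of_real ` K)" for f
      proof -
        have "isCont f z"
          using holomorphic_on_imp_continuous_on[OF that] z by (auto simp: continuous_on_eq_continuous_at[OF open_Compl[OF clK]])
        moreover have "((\<lambda>y. z + \<i> * of_real y) \<longlongrightarrow> z + \<i> * of_real 0) (at_right 0)"
          by (intro tendsto_intros)
        ultimately show ?thesis by (intro isCont_tendsto_compose[of _ f]) auto
      qed
      have "((\<lambda>y. F (z + \<i> * of_real y)) \<longlongrightarrow> cauchy_tr \<rho> (\<lambda>_. 1) z) (at_right 0)"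
        using lim[OF C]
        by (rule Lim_transform_eventually) (use eventually_at_right_less[of 0] in eventually_elim, simp add: upper 3)
      then show ?thesis using lim[OF F] tendsto_unique[OF trivial_limit_at_right_real] by blast
    qed (rule upper)
  qed
  then show ?thesis
    using that[of \<rho>] supp \<rho>.prob_space \<rho>.finite_borel_measure_M by auto
qed

section \<open>Gluing across two intervals\<close>

lemma prod_linear_dvd:
  fixes p :: "'a::field poly"
  assumes "finite S" "\<And>e. e \<in> S \<Longrightarrow> poly p e = 0"
  shows "(\<Prod>e\<in>S. [:- e, 1:]) dvd p"
  using assms
proof (induction S rule: finite_induct)
  case (insert e S)
  then obtain q where q: "p = (\<Prod>e\<in>S. [:- e, 1:]) * q" by auto
  have "poly p e = 0" using insert.prems by simp
  moreover have "poly (\<Prod>e\<in>S. [:- e, 1:]) e \<noteq> 0"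
    using insert.hyps by (auto simp: poly_prod prod_zero_iff)
  ultimately have "poly q e = 0" unfolding q by simp
  then obtain r where "q = [:- e, 1:] * r" by (auto simp: poly_eq_0_iff_dvd)
  then have "p = (\<Prod>e\<in>insert e S. [:- e, 1:]) * r"
    using q by (simp only: prod.insert[OF insert.hyps] mult_ac)
  then show ?case by (rule dvdI)
qed simp

text \<open>Since \<open>g\<close> continues \<open>\<gamma>\<close>, the kernel (g(z) -
  \<gamma>(x)) / (x - z) has only a removable singularity at z = x. Its integral is the holomorphic
  error made when the factor is moved inside the transform.\<close>

lemma difference_kernel_holomorphic:
  assumes \<rho>: "finite_borel_measure \<rho>" and U: "open U" "of_real ` {a..b} \<subseteq> U"
    and g: "g holomorphic_on U" "\<And>x. x \<in> {a..b} \<Longrightarrow> g (of_real x) = of_real (\<gamma> x)"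
    and [measurable]: "\<gamma> \<in> borel_measurable borel"
  obtains V h where "open V" "of_real ` {a..b} \<subseteq> V" "V \<subseteq> U" "h holomorphic_on V"
    "\<And>z. z \<in> V - of_real ` {a..b} \<Longrightarrow> g z * cauchy_tr \<rho> (indicator {a..b}) z =
       cauchy_tr \<rho> (\<lambda>x. indicator {a..b} x * \<gamma> x) z + h z"
proof -
  interpret finite_borel_measure \<rho> by fact
  have [measurable_cong]: "sets \<rho> = sets borel" by (rule M_is_borel)
  have "compact (of_real ` {a..b} :: complex set)"
    by (intro compact_continuous_image continuous_intros) auto
  from compact_subset_open_imp_ball_epsilon_subset[OF this U]
  obtain e where e: "e > 0" "(\<Union>x\<in>of_real ` {a..b}. ball x e) \<subseteq> U" .
  define d where "d = e / 4"
  have d: "d > 0" using e by (simp add: d_def)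
  \<comment> \<open>A rectangle is convex, which the mean value bound on the kernel needs;
    \<open>U\<close> itself need not be. For an empty interval \<open>V\<close> is empty.\<close>
  define V where "V = (if a \<le> b then box (Complex (a - d) (- d)) (Complex (b + d) d) else {})"
  define W where "W = cbox (Complex (a - d) (- d)) (Complex (b + d) d)"
  have WU: "W \<subseteq> U" if "a \<le> b"
  proof
    fix z assume z: "z \<in> W"
    define x where "x = max a (min b (Re z))"
    have x: "x \<in> {a..b}" using that by (auto simp: x_def)
    have "norm (of_real x - z) \<le> \<bar>Re (of_real x - z)\<bar> + \<bar>Im (of_real x - z)\<bar>" by (rule cmod_le)
    also have "\<dots> \<le> d + d" using z that d by (auto simp: W_def in_cbox_complex_iff x_def abs_if)
    also have "\<dots> < e" using e by (simp add: d_def)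
    finally have "z \<in> ball (of_real x) e" by (simp add: dist_norm)
    then show "z \<in> U" using e(2) x by blast
  qed
  have VW: "V \<subseteq> W" by (auto simp: V_def W_def box_subset_cbox subset_iff in_box_complex_iff in_cbox_complex_iff)
  have VU: "V \<subseteq> U" using VW WU by (auto simp: V_def split: if_splits)
  have V: "open V" "convex V" by (auto simp: V_def open_box convex_box)
  have abV: "of_real ` {a..b} \<subseteq> V" using d by (auto simp: V_def in_box_complex_iff)
  obtain B where B: "B \<ge> 0" "\<And>z. z \<in> V \<Longrightarrow> norm (deriv g z) \<le> B"
  proof (cases "a \<le> b")
    case True
    have "bounded (deriv g ` W)"
      using holomorphic_deriv[OF g(1) U(1)] WU[OF True]
      by (intro compact_imp_bounded compact_continuous_image)
         (auto simp: W_def intro: holomorphic_on_imp_continuous_on holomorphic_on_subset)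
    then obtain B where "\<And>z. z \<in> W \<Longrightarrow> norm (deriv g z) \<le> B" by (auto simp: bounded_iff)
    then show ?thesis using that[of "max B 0"] VW by fastforce
  qed (use that[of 0] in \<open>auto simp: V_def\<close>)
  define k where "k x z = (if x \<in> {a..b} then if z = of_real x then - deriv g z else (g z - of_real (\<gamma> x)) / (of_real x - z) else 0)" for x z
  have gV: "g holomorphic_on V" using g(1) VU holomorphic_on_subset by blast
  have khol: "(\<lambda>z. LINT x|\<rho>. k x z) holomorphic_on V"
  proof (rule holomorphic_on_lebesgue_integral[OF finite_measure_axioms V(1)])
    show "(\<lambda>x. k x z) \<in> borel_measurable \<rho>" for z
      unfolding k_def by measurable
    show "k x holomorphic_on V" for x
    proof (cases "x \<in> {a..b}")
      case True
      have "k x = (\<lambda>z. - (if z = of_real x then deriv g (of_real x) else (g z - g (of_real x)) / (z - of_real x)))"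
        using True by (auto simp: k_def g(2) fun_eq_iff minus_divide_right)
      then show ?thesis using pole_lemma_open[OF gV V(1), of "of_real x"] holomorphic_on_minus by simp
    next
      case False
      then have "k x = (\<lambda>_. 0)" by (auto simp: k_def)
      then show ?thesis by simp
    qed
    show "norm (k x z) \<le> B" if "z \<in> V" for x z
    proof (cases "x \<in> {a..b} \<and> z \<noteq> of_real x")
      case True
      have xV: "of_real x \<in> V" using True abV by auto
      have "norm (g z - g (of_real x)) \<le> B * norm (z - of_real x)"
      proof (rule field_differentiable_bound[OF V(2) _ B(2)])
        show "(g has_field_derivative deriv g w) (at w within V)" if "w \<in> V" for w
          using holomorphic_derivI[OF gV V(1) that] has_field_derivative_at_within by blast
      qed (use that xV in auto)
      then show ?thesis
        using True g(2)[of x] by (simp add: k_def norm_divide divide_le_eq norm_minus_commute)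
    qed (use B that in \<open>auto simp: k_def\<close>)
  qed
  have gint: "integrable \<rho> (\<lambda>x. indicator {a..b} x * \<gamma> x)"
  proof -
    have "bounded (g ` of_real ` {a..b})"
      using g(1) U(2) by (intro compact_imp_bounded compact_continuous_image continuous_intros)
         (auto intro: holomorphic_on_imp_continuous_on continuous_on_subset)
    then obtain C where "\<And>x. x \<in> {a..b} \<Longrightarrow> norm (g (of_real x)) \<le> C" by (metis bounded_iff imageI)
    then have C: "\<And>x. x \<in> {a..b} \<Longrightarrow> \<bar>\<gamma> x\<bar> \<le> C" using g(2) by (metis norm_of_real)
    show ?thesis
    proof (rule integrable_const_bound[where B="\<bar>C\<bar>"])
      show "AE x in \<rho>. norm (indicator {a..b} x * \<gamma> x) \<le> \<bar>C\<bar>"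
        using C by (intro AE_I2) (fastforce simp: indicator_def)
    qed measurable
  qed
  show ?thesis
  proof (rule that[of V "\<lambda>z. LINT x|\<rho>. k x z"])
    fix z assume z: "z \<in> V - of_real ` {a..b}"
    have ck: "integrable \<rho> (\<lambda>x. of_real (indicator {a..b} x * f x) / (of_real x - z))"
      if "integrable \<rho> (\<lambda>x. indicator {a..b} x * f x)" for f
    proof -
      let ?f = "\<lambda>x. complex_of_real (indicator {a..b} x * f x) / (of_real x - z)"
      have "closed (of_real ` {a..b} :: complex set)"
        by (intro closed_injective_linear_image) (auto simp: linear_of_real inj_on_def)
      then obtain r where r: "r > 0" "ball z r \<subseteq> - (of_real ` {a..b})"
        using z open_contains_ball by (metis DiffD2 ComplI open_Compl)
      show ?thesis
      proof (rule Bochner_Integration.integrable_bound)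
        show "integrable \<rho> (\<lambda>x. (1 / r) * (indicator {a..b} x * f x))" using that by (rule integrable_mult_right)
        have "(\<lambda>x. indicator {a..b} x * f x) \<in> borel_measurable \<rho>" using that by auto
        then have [measurable]: "(\<lambda>x. indicator {a..b} x * f x) \<in> borel_measurable borel"
          by (simp add: M_is_borel cong: measurable_cong_sets)
        show "?f \<in> borel_measurable \<rho>" by measurable
        show "AE x in \<rho>. norm (?f x) \<le> norm ((1 / r) * (indicator {a..b} x * f x))"
        proof (rule AE_I2)
          fix x
          show "norm (?f x) \<le> norm ((1 / r) * (indicator {a..b} x * f x))"
          proof (cases "x \<in> {a..b}")
            case True
            then have "of_real x \<notin> ball z r" using r by auto
            then have "norm (of_real x - z) \<ge> r" by (simp add: dist_norm norm_minus_commute)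
            then show ?thesis using r(1) True by (auto simp: norm_divide intro!: frac_le)
          qed simp
        qed
      qed
    qed
    have i1: "integrable \<rho> (\<lambda>x. of_real (indicator {a..b} x) / (of_real x - z))"
    proof -
      have "integrable \<rho> (\<lambda>x. indicator {a..b} x * (1::real))"
        by (simp add: integrable_real_indicator M_is_borel emeasure_eq_measure)
      from ck[OF this] show ?thesis by simp
    qed
    have "g z * cauchy_tr \<rho> (indicator {a..b}) z = (LINT x|\<rho>. g z * (of_real (indicator {a..b} x) / (of_real x - z)))"
      unfolding cauchy_tr_def by (rule integral_mult_right_zero[symmetric])
    also have "\<dots> - cauchy_tr \<rho> (\<lambda>x. indicator {a..b} x * \<gamma> x) z
      = (LINT x|\<rho>. g z * (of_real (indicator {a..b} x) / (of_real x - z)) - of_real (indicator {a..b} x * \<gamma> x) / (of_real x - z))"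
      unfolding cauchy_tr_def using i1 ck[OF gint]
      by (intro Bochner_Integration.integral_diff[symmetric] integrable_mult_right)
    also have "\<dots> = (LINT x|\<rho>. k x z)"
      using z by (intro Bochner_Integration.integral_cong refl)
        (auto simp: k_def indicator_def diff_divide_distrib)
    finally show "g z * cauchy_tr \<rho> (indicator {a..b}) z = cauchy_tr \<rho> (\<lambda>x. indicator {a..b} x * \<gamma> x) z + (LINT x|\<rho>. k x z)"
      by (simp add: algebra_simps)
  qed (use V abV VU khol in auto)
qed

text \<open>The difference of the two sides, multiplied by the product over \<open>Es\<close>, extends to an entire
  function of polynomial growth.  The vertical limits make it vanish on \<open>Es\<close>, so the difference is
  a polynomial that tends to 0 at infinity.\<close>

theorem stieltjes_glue:
  fixes a b :: "side \<Rightarrow> real"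
  defines "K \<equiv> \<Union>k. {a k..b k}"
  assumes \<rho>: "finite_borel_measure \<rho>" "AE x in \<rho>. x \<in> K"
    and disj: "{a I1..b I1} \<inter> {a I2..b I2} = {}"
    and U: "\<And>k. open (U k)" "\<And>k. of_real ` {a k..b k} \<subseteq> U k"
    and g: "\<And>k. g k holomorphic_on U k" "\<And>k x. x \<in> {a k..b k} \<Longrightarrow> g k (of_real x) = of_real (\<gamma> x)"
    and \<gamma>m[measurable]: "\<gamma> \<in> borel_measurable borel"
    and Es: "finite Es"
    and r: "\<And>k. r k holomorphic_on U k"
      "\<And>k z. z \<in> U k \<Longrightarrow> z \<notin> of_real ` (K \<union> Es) \<Longrightarrow>
        (\<Prod>E\<in>Es. z - of_real E) * F z = (\<Prod>E\<in>Es. z - of_real E) * g k z * cauchy_tr \<rho> (\<lambda>_. 1) z + r k z"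
    and r0: "r0 holomorphic_on - (of_real ` K)"
      "\<And>z. z \<notin> of_real ` (K \<union> Es) \<Longrightarrow> (\<Prod>E\<in>Es. z - of_real E) * F z = r0 z"
    and inf: "(F \<longlongrightarrow> 0) at_infinity"
    and vert: "\<And>E. E \<in> Es \<Longrightarrow>
      ((\<lambda>\<epsilon>. - (\<i> * of_real \<epsilon>) * F (Complex E \<epsilon>)) \<longlongrightarrow> of_real (\<gamma> E * measure \<rho> {E})) (at_right 0)"
    and z: "z \<notin> of_real ` (K \<union> Es)"
  shows "F z = cauchy_tr \<rho> \<gamma> z"
proof -
  interpret finite_borel_measure \<rho> by fact
  have [measurable_cong]: "sets \<rho> = sets borel" by (rule M_is_borel)
  have K2: "K = {a I1..b I1} \<union> {a I2..b I2}" by (auto simp: K_def UNIV_side)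
  have Kc: "compact K" unfolding K2 by (intro compact_Un) auto
  then obtain R where R: "\<And>x. x \<in> K \<Longrightarrow> \<bar>x\<bar> \<le> R" using compact_imp_bounded[of K] unfolding bounded_iff real_norm_def by blast
  have clI: "closed (of_real ` S :: complex set)" if "closed S" for S :: "real set"
    using that by (intro closed_injective_linear_image) (auto simp: linear_of_real inj_on_def)
  have bnd: "\<exists>C. \<forall>x\<in>{a k..b k}. \<bar>\<gamma> x\<bar> \<le> C" for k
  proof -
    have "bounded (g k ` of_real ` {a k..b k})"
      using g(1)[of k] U(2)[of k] by (intro compact_imp_bounded compact_continuous_image continuous_intros)
         (auto intro: holomorphic_on_imp_continuous_on continuous_on_subset)
    then obtain C where "\<And>x. x \<in> {a k..b k} \<Longrightarrow> norm (g k (of_real x)) \<le> C" by (metis bounded_iff imageI)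
    then have "\<And>x. x \<in> {a k..b k} \<Longrightarrow> \<bar>\<gamma> x\<bar> \<le> C" using g(2) by (metis norm_of_real)
    then show ?thesis by blast
  qed
  obtain C where C: "\<And>k x. x \<in> {a k..b k} \<Longrightarrow> \<bar>\<gamma> x\<bar> \<le> C k" using bnd by metis
  have gint: "integrable \<rho> \<gamma>"
  proof (rule integrable_const_bound[where B="max (C I1) (C I2)"])
    show "AE x in \<rho>. norm (\<gamma> x) \<le> max (C I1) (C I2)"
      using \<rho>(2) by eventually_elim (use C in \<open>fastforce simp: K2\<close>)
  qed measurable
  have igint: "integrable \<rho> (\<lambda>x. indicator {a k..b k} x * \<gamma> x)" for k
    using integrable_real_mult_indicator[OF _ gint, of "{a k..b k}"] by (simp add: mult.commute)
  define D where "D z = (\<Prod>E\<in>Es. z - of_real E)" for z :: complex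
  have Dhol: "D holomorphic_on S" for S unfolding D_def by (intro holomorphic_intros)
  \<comment> \<open>With the other interval and the points of \<open>Es\<close> outside
    \<open>K\<close> removed, only points of the k-th interval can be singular in the patch. At the
    points of \<open>Es\<close> off \<open>K\<close> the function \<open>r0\<close> serves
    instead.\<close>
  define U' where "U' k = U k - of_real ` ({a (other k)..b (other k)} \<union> (Es - K))" for k
  have U': "open (U' k)" "of_real ` {a k..b k} \<subseteq> U' k" for k
  proof -
    have "closed ({a (other k)..b (other k)} \<union> (Es - K))" by (intro closed_Un closed_atLeastAtMost finite_imp_closed finite_Diff Es)
    then show "open (U' k)" unfolding U'_def by (intro open_Diff U clI)
    show "of_real ` {a k..b k} \<subseteq> U' k"
      using U(2)[of k] disj by (cases k) (auto simp: U'_def K2)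
  qed
  define P where "P k V h \<longleftrightarrow> open V \<and> of_real ` {a k..b k} \<subseteq> V \<and> V \<subseteq> U' k \<and> h holomorphic_on V \<and>
    (\<forall>z \<in> V - of_real ` {a k..b k}. g k z * cauchy_tr \<rho> (indicator {a k..b k}) z =
       cauchy_tr \<rho> (\<lambda>x. indicator {a k..b k} x * \<gamma> x) z + h z)" for k V h
  have "\<exists>V h. P k V h" for k
  proof -
    have "g k holomorphic_on U' k" using g(1)[of k] by (rule holomorphic_on_subset) (auto simp: U'_def)
    from difference_kernel_holomorphic[OF \<rho>(1) U' this g(2) \<gamma>m] show ?thesis unfolding P_def by metis
  qed
  then obtain V h where Ph: "\<And>k. P k (V k) (h k)" by metis
  then have V: "\<And>k. open (V k)" "\<And>k. of_real ` {a k..b k} \<subseteq> V k" "\<And>k. V k \<subseteq> U' k"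
    and h: "\<And>k. h k holomorphic_on V k"
    "\<And>k z. z \<in> V k - of_real ` {a k..b k} \<Longrightarrow> g k z * cauchy_tr \<rho> (indicator {a k..b k}) z =
       cauchy_tr \<rho> (\<lambda>x. indicator {a k..b k} x * \<gamma> x) z + h k z"
    unfolding P_def by auto
  have VU: "V k \<subseteq> U k" for k using V(3)[of k] by (auto simp: U'_def)
  let ?J = "\<lambda>k. {a (other k)..b (other k)}"
  have Jhol: "cauchy_tr \<rho> (\<lambda>x. indicator (?J k) x * f x) holomorphic_on V k"
    if that: "integrable \<rho> (\<lambda>x. indicator (?J k) x * f x)" and [measurable]: "f \<in> borel_measurable borel" for f k
  proof -
    \<comment> \<open>Restricting the measure instead of the integrand yields a measure carried by
      the other interval, so its transform is holomorphic across interval k.\<close>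
    define \<sigma> where "\<sigma> = density \<rho> (\<lambda>x. ennreal (indicator (?J k) x))"
    have \<sigma>fin: "finite_borel_measure \<sigma>"
    proof (intro finite_borel_measure.intro finite_borel_measure_axioms.intro finite_measureI)
      have "emeasure \<sigma> (space \<sigma>) = (\<integral>\<^sup>+x. ennreal (indicator (?J k) x) \<partial>\<rho>)"
        by (simp add: \<sigma>_def emeasure_density cong: nn_integral_cong)
      also have "\<dots> \<le> (\<integral>\<^sup>+x. 1 \<partial>\<rho>)" by (intro nn_integral_mono) (auto simp: indicator_def)
      finally show "emeasure \<sigma> (space \<sigma>) \<noteq> \<infinity>" by (auto simp: top_unique)
    qed (simp add: \<sigma>_def M_is_borel)
    interpret S: finite_borel_measure \<sigma> by fact
    have "integrable \<sigma> (\<lambda>x. indicator (?J k) x * f x)"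
    proof -
      have "integrable \<rho> (\<lambda>x. indicator (?J k) x *\<^sub>R (indicator (?J k) x * f x))"
        using that by (rule Bochner_Integration.integrable_cong[THEN iffD1, rotated 2]) (auto simp: indicator_def)
      then show ?thesis unfolding \<sigma>_def by (subst integrable_density) auto
    qed
    moreover have "AE x in \<sigma>. x \<in> ?J k"
      unfolding \<sigma>_def by (subst AE_density) (auto simp: indicator_def)
    ultimately have "cauchy_tr \<sigma> (\<lambda>x. indicator (?J k) x * f x) holomorphic_on - (of_real ` ?J k)"
      by (intro S.cauchy_tr_holomorphic) auto
    moreover have "cauchy_tr \<sigma> (\<lambda>x. indicator (?J k) x * f x) = cauchy_tr \<rho> (\<lambda>x. indicator (?J k) x * f x)"
    proof
      fix w
      have "cauchy_tr \<sigma> (\<lambda>x. indicator (?J k) x * f x) w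
        = (LINT x|\<rho>. indicator (?J k) x *\<^sub>R (of_real (indicator (?J k) x * f x) / (of_real x - w)))"
        unfolding \<sigma>_def cauchy_tr_def by (subst integral_density) (auto simp: M_is_borel cong: measurable_cong_sets)
      also have "\<dots> = cauchy_tr \<rho> (\<lambda>x. indicator (?J k) x * f x) w"
        unfolding cauchy_tr_def by (intro Bochner_Integration.integral_cong) (auto simp: indicator_def)
      finally show "cauchy_tr \<sigma> (\<lambda>x. indicator (?J k) x * f x) w = cauchy_tr \<rho> (\<lambda>x. indicator (?J k) x * f x) w" .
    qed
    ultimately show ?thesis
      using V(3)[of k] by (auto simp: U'_def intro: holomorphic_on_subset)
  qed
  have split: "cauchy_tr \<rho> f w = cauchy_tr \<rho> (\<lambda>x. indicator {a k..b k} x * f x) w + cauchy_tr \<rho> (\<lambda>x. indicator (?J k) x * f x) w"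
    if f: "integrable \<rho> f" and w: "w \<notin> of_real ` K" for f k w
  proof -
    have i: "integrable \<rho> (\<lambda>x. indicator {a j..b j} x * f x)" for j
      using integrable_real_mult_indicator[OF _ f, of "{a j..b j}"] by (simp add: mult.commute)
    have fm: "f \<in> borel_measurable \<rho>" using f by auto
    have ci: "integrable \<rho> (\<lambda>x. of_real (indicator {a j..b j} x * f x) / (of_real x - w) :: complex)" for j
      by (rule cauchy_kernel_integrable[OF i compact_imp_closed[OF Kc] \<rho>(2) w])
    have "cauchy_tr \<rho> (\<lambda>x. indicator {a k..b k} x * f x) w + cauchy_tr \<rho> (\<lambda>x. indicator (?J k) x * f x) w
      = (LINT x|\<rho>. of_real (indicator {a k..b k} x * f x) / (of_real x - w) + of_real (indicator (?J k) x * f x) / (of_real x - w))"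
      unfolding cauchy_tr_def using ci by (intro Bochner_Integration.integral_add[symmetric])
    also have "\<dots> = cauchy_tr \<rho> f w"
      unfolding cauchy_tr_def
    proof (rule integral_cong_AE)
      show "AE x in \<rho>. complex_of_real (indicator {a k..b k} x * f x) / (of_real x - w) + of_real (indicator (?J k) x * f x) / (of_real x - w) = of_real (f x) / (of_real x - w)"
        using \<rho>(2)
      proof eventually_elim
        case (elim x)
        then show ?case using disj by (cases k) (auto simp: K2 indicator_def)
      qed
      show "(\<lambda>x. complex_of_real (indicator {a k..b k} x * f x) / (of_real x - w) + of_real (indicator (?J k) x * f x) / (of_real x - w)) \<in> borel_measurable \<rho>"
        using ci[of k] ci[of "other k"] by (intro borel_measurable_add borel_measurable_integrable)
    qed (use fm in measurable)
    finally show ?thesis by simp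
  qed
  \<comment> \<open>The cleared difference off \<open>K\<close>. Its version \<open>e k\<close> near
    the k-th interval has lost the transform over that interval by cancellation and is holomorphic
    across it; \<open>eq0\<close> shows that both agree on the overlap.\<close>
  define H0 where "H0 w = r0 w - D w * cauchy_tr \<rho> \<gamma> w" for w
  define e where "e k w = r k w + D w * (h k w + g k w * cauchy_tr \<rho> (indicator (?J k)) w - cauchy_tr \<rho> (\<lambda>x. indicator (?J k) x * \<gamma> x) w)" for k w
  have H0hol: "H0 holomorphic_on - (of_real ` K)"
    unfolding H0_def by (intro holomorphic_intros r0 Dhol cauchy_tr_holomorphic gint compact_imp_closed[OF Kc] \<rho>(2))
  have ehol: "e k holomorphic_on V k" for k
  proof -
    have "cauchy_tr \<rho> (\<lambda>x. indicator (?J k) x * 1) holomorphic_on V k" by (rule Jhol) (simp_all add: integrable_real_indicator M_is_borel emeasure_eq_measure)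
    then have "cauchy_tr \<rho> (indicator (?J k)) holomorphic_on V k" by simp
    then show ?thesis unfolding e_def
      by (intro holomorphic_intros Dhol h Jhol igint \<gamma>m holomorphic_on_subset[OF r(1)] holomorphic_on_subset[OF g(1)] VU)
  qed
  have eq0: "e k w = H0 w" if "w \<in> V k" "w \<notin> of_real ` K" for k w
  proof -
    have wE: "w \<notin> of_real ` (K \<union> Es)" using that V(3)[of k] by (auto simp: U'_def)
    have wk: "w \<in> V k - of_real ` {a k..b k}" using that by (auto simp: K_def)
    have "r0 w = D w * g k w * cauchy_tr \<rho> (\<lambda>_. 1) w + r k w"
      using r0(2)[OF wE] r(2)[OF _ wE] that VU unfolding D_def by (metis subsetD)
    also have "cauchy_tr \<rho> (\<lambda>_. 1) w = cauchy_tr \<rho> (indicator {a k..b k}) w + cauchy_tr \<rho> (indicator (?J k)) w"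
      using split[of "\<lambda>_. 1" w k] that by simp
    also have "D w * g k w * \<dots> = D w * (g k w * cauchy_tr \<rho> (indicator {a k..b k}) w + g k w * cauchy_tr \<rho> (indicator (?J k)) w)"
      by (simp add: algebra_simps)
    also have "g k w * cauchy_tr \<rho> (indicator {a k..b k}) w = cauchy_tr \<rho> (\<lambda>x. indicator {a k..b k} x * \<gamma> x) w + h k w"
      by (rule h(2)[OF wk])
    finally show ?thesis
      unfolding H0_def e_def split[OF gint that(2), of k] by (simp add: algebra_simps)
  qed
  define H where "H w = (if w \<in> V I1 then e I1 w else if w \<in> V I2 then e I2 w else H0 w)" for w
  have HH0: "H w = H0 w" if "w \<notin> of_real ` K" for w using that eq0 by (auto simp: H_def)
  have HV: "H w = e k w" if "w \<in> V k" for k w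
  proof (cases "w \<in> of_real ` K")
    case False
    then show ?thesis using HH0 eq0 that by metis
  next
    case True
    then have "w \<notin> V (other k)" using that V(3)[of I1] V(3)[of I2] by (cases k) (auto simp: K2 U'_def)
    then show ?thesis using that by (cases k) (auto simp: H_def)
  qed
  have "H holomorphic_on - (of_real ` K)" using H0hol by (rule holomorphic_transform) (simp add: HH0)
  moreover have "H holomorphic_on V k" for k using ehol[of k] by (rule holomorphic_transform) (simp add: HV)
  ultimately have "H holomorphic_on - (of_real ` K) \<union> (V I1 \<union> V I2)"
    using V(1) clI[OF compact_imp_closed[OF Kc]] by (intro holomorphic_on_Un) auto
  moreover have "- (of_real ` K) \<union> (V I1 \<union> V I2) = UNIV" using V(2) unfolding K2 by blast
  ultimately have Hhol: "H holomorphic_on UNIV" by simp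
  have diff: "H w = D w * (F w - cauchy_tr \<rho> \<gamma> w)" if "w \<notin> of_real ` (K \<union> Es)" for w
    using that HH0[of w] r0(2)[OF that] by (auto simp: H0_def D_def algebra_simps)
  have Q0: "((\<lambda>w. F w - cauchy_tr \<rho> \<gamma> w) \<longlongrightarrow> 0) at_infinity"
  proof -
    have "AE x in \<rho>. \<bar>x\<bar> \<le> R" using \<rho>(2) by eventually_elim (rule R)
    from tendsto_diff[OF inf cauchy_tr_tendsto_0[OF gint this]] show ?thesis by simp
  qed
  define R' where "R' = max 1 (max R (Max (insert 0 (abs ` Es)))) + 1"
  have far: "w \<notin> of_real ` (K \<union> Es)" if "norm w \<ge> R'" for w :: complex
  proof
    assume "w \<in> of_real ` (K \<union> Es)"
    then obtain x where x: "w = of_real x" "x \<in> K \<union> Es" by auto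
    have "\<bar>x\<bar> \<le> max R (Max (insert 0 (abs ` Es)))"
      using x(2) R[of x] Es by (auto simp: le_max_iff_disj)
    then show False using that x(1) by (auto simp: R'_def)
  qed
  have evfar: "eventually (\<lambda>w::complex. w \<notin> of_real ` (K \<union> Es)) at_infinity"
    using far unfolding eventually_at_infinity by blast
  obtain A where A: "\<And>w. norm w \<ge> A \<Longrightarrow> norm (F w - cauchy_tr \<rho> \<gamma> w) < 1"
    using tendstoD[OF Q0, of 1] by (auto simp: eventually_at_infinity)
  have growth: "norm (H w) \<le> 2 ^ card Es * norm w ^ card Es" if "norm w \<ge> max A R'" for w
  proof -
    have "norm (D w) \<le> (\<Prod>E\<in>Es. 2 * norm w)"
      unfolding D_def prod_norm[symmetric]
    proof (intro prod_mono conjI norm_ge_zero)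
      fix E assume "E \<in> Es"
      then have "\<bar>E\<bar> \<le> Max (insert 0 (abs ` Es))" using Es by (intro Max_ge) auto
      then have "\<bar>E\<bar> \<le> norm w" using that unfolding R'_def by linarith
      then show "norm (w - of_real E) \<le> 2 * norm w" using norm_triangle_ineq4[of w "of_real E"] by simp
    qed
    then have "norm (D w) * norm (F w - cauchy_tr \<rho> \<gamma> w) \<le> (\<Prod>E\<in>Es. 2 * norm w) * 1"
      using A[of w] that by (intro mult_mono) (auto intro: prod_nonneg)
    then show ?thesis using diff[OF far, of w] that by (simp add: norm_mult power_mult_distrib)
  qed
  define p :: "complex poly" where "p = (\<Sum>k\<le>card Es. monom ((deriv ^^ k) H 0 / fact k) k)"
  have Hp: "H w = poly p w" for w :: complex
  proof -
    have "H w = (\<Sum>k\<le>card Es. (deriv ^^ k) H 0 / fact k * w ^ k)"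
      by (rule Liouville_polynomial[OF Hhol, where A="max A R'"]) (rule growth)
    then show ?thesis by (simp add: p_def poly_sum poly_monom)
  qed
  \<comment> \<open>Near \<open>E\<close> the factor \<open>D\<close> contributes one power of
    \<epsilon>, and \<open>vert\<close> says that \<epsilon> times \<open>F\<close> and \<epsilon>
    times the transform have the same limit.\<close>
  have HE: "H (of_real E) = 0" if E: "E \<in> Es" for E
  proof -
    have "((\<lambda>\<epsilon>. H (Complex E \<epsilon>)) \<longlongrightarrow> H (of_real E)) (at_right 0)"
    proof -
      have "isCont H (of_real E)"
        using holomorphic_on_imp_continuous_on[OF Hhol] by (simp add: continuous_on_eq_continuous_at)
      moreover have "((\<lambda>\<epsilon>. of_real E + \<i> * of_real \<epsilon>) \<longlongrightarrow> of_real E + \<i> * of_real 0) (at_right 0)"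
        by (intro tendsto_intros)
      ultimately show ?thesis unfolding Complex_eq by (intro isCont_tendsto_compose[of _ H]) auto
    qed
    moreover have "((\<lambda>\<epsilon>. H (Complex E \<epsilon>)) \<longlongrightarrow> - (\<Prod>E'\<in>Es - {E}. of_real E + \<i> * of_real 0 - of_real E') * (of_real (\<gamma> E * measure \<rho> {E}) - of_real (\<gamma> E * measure \<rho> {E}))) (at_right 0)"
    proof (rule Lim_transform_eventually)
      show "((\<lambda>\<epsilon>. - (\<Prod>E'\<in>Es - {E}. of_real E + \<i> * of_real \<epsilon> - of_real E') *
          (- (\<i> * of_real \<epsilon>) * F (Complex E \<epsilon>) - (- (\<i> * of_real \<epsilon>) * cauchy_tr \<rho> \<gamma> (Complex E \<epsilon>))))
        \<longlongrightarrow> - (\<Prod>E'\<in>Es - {E}. of_real E + \<i> * of_real 0 - of_real E') * (of_real (\<gamma> E * measure \<rho> {E}) - of_real (\<gamma> E * measure \<rho> {E}))) (at_right 0)"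
        by (intro tendsto_mult tendsto_diff tendsto_minus tendsto_prod tendsto_add tendsto_const tendsto_of_real tendsto_ident_at vert E cauchy_tr_vertical gint)
      show "eventually (\<lambda>\<epsilon>. - (\<Prod>E'\<in>Es - {E}. of_real E + \<i> * of_real \<epsilon> - of_real E') *
          (- (\<i> * of_real \<epsilon>) * F (Complex E \<epsilon>) - (- (\<i> * of_real \<epsilon>) * cauchy_tr \<rho> \<gamma> (Complex E \<epsilon>))) = H (Complex E \<epsilon>)) (at_right 0)"
        using eventually_at_right_less[of 0]
      proof eventually_elim
        case (elim \<epsilon>)
        have "Complex E \<epsilon> \<notin> of_real ` (K \<union> Es)" using elim by (auto simp: complex_eq_iff)
        from diff[OF this] show ?case
          using E Es by (simp add: D_def prod.remove[of Es E] Complex_eq algebra_simps)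
      qed
    qed
    ultimately show ?thesis using tendsto_unique[OF trivial_limit_at_right_real] by fastforce
  qed
  have "(\<Prod>e\<in>of_real ` Es. [:- e, 1:]) dvd p"
    using HE Es by (intro prod_linear_dvd) (auto simp: Hp)
  then obtain q where q: "p = (\<Prod>e\<in>of_real ` Es. [:- e, 1:]) * q" by auto
  have Dp: "poly p w = D w * poly q w" for w
    unfolding q D_def by (simp add: poly_prod prod.reindex inj_on_def)
  have qeq: "poly q w = F w - cauchy_tr \<rho> \<gamma> w" if "w \<notin> of_real ` (K \<union> Es)" for w
  proof -
    have "D w \<noteq> 0" using that Es by (auto simp: D_def)
    then show ?thesis using diff[OF that] Hp[of w] Dp[of w] by simp
  qed
  have "(poly q \<longlongrightarrow> 0) at_infinity"
    using Q0 by (rule Lim_transform_eventually) (use evfar in eventually_elim, simp add: qeq)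
  then have "poly q z = 0" by (intro Liouville_weak_0 holomorphic_intros)
  then show ?thesis using qeq[OF z] by simp
qed

section \<open>Normality of Angelesco systems\<close>

text \<open>Gaussian elimination: an equation with a nonzero coefficient is solved for that unknown
  and substituted into the others, leaving one equation and one unknown fewer.\<close>

lemma homogeneous_system_nontrivial:
  fixes a :: "nat \<Rightarrow> 'j \<Rightarrow> 'a::field"
  assumes "finite J" "m < card J"
  shows "\<exists>c. (\<exists>j\<in>J. c j \<noteq> 0) \<and> (\<forall>i<m. (\<Sum>j\<in>J. a i j * c j) = 0)"
  using assms
proof (induction m arbitrary: J a)
  case 0
  then obtain j where "j \<in> J" by (metis card.empty ex_in_conv less_irrefl)
  then show ?case by (intro exI[of _ "\<lambda>_. 1"]) auto
next
  case (Suc m)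
  show ?case
  proof (cases "\<exists>j0\<in>J. a m j0 \<noteq> 0")
    case False
    with Suc.IH[of J a] Suc.prems show ?thesis by (auto simp: less_Suc_eq)
  next
    case True
    then obtain j0 where j0: "j0 \<in> J" "a m j0 \<noteq> 0" by blast
    let ?J = "J - {j0}"
    have "m < card ?J" using Suc.prems j0 by simp
    from Suc.IH[OF _ this, of "\<lambda>i j. a i j - a i j0 * a m j / a m j0"] Suc.prems
    obtain c where c: "\<exists>j\<in>?J. c j \<noteq> 0" "\<And>i. i < m \<Longrightarrow> (\<Sum>j\<in>?J. (a i j - a i j0 * a m j / a m j0) * c j) = 0"
      by auto
    define d where "d j = (if j = j0 then - (\<Sum>j\<in>?J. a m j * c j) / a m j0 else c j)" for j
    have sum: "(\<Sum>j\<in>J. a i j * d j) = (\<Sum>j\<in>?J. (a i j - a i j0 * a m j / a m j0) * c j)" for i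
    proof -
      have "(\<Sum>j\<in>J. a i j * d j) = a i j0 * d j0 + (\<Sum>j\<in>?J. a i j * d j)"
        using Suc.prems j0 by (simp add: sum.remove)
      also have "(\<Sum>j\<in>?J. a i j * d j) = (\<Sum>j\<in>?J. a i j * c j)"
        by (intro sum.cong) (auto simp: d_def)
      also have "a i j0 * d j0 = - (\<Sum>j\<in>?J. a i j0 * a m j / a m j0 * c j)"
        by (simp add: d_def sum_distrib_left sum_divide_distrib sum_negf mult_ac)
      finally show ?thesis by (simp add: left_diff_distrib sum_subtractf)
    qed
    have "(\<Sum>j\<in>J. a i j * d j) = 0" if "i < Suc m" for i
    proof (cases "i = m")
      case True
      then show ?thesis unfolding sum using j0(2) by (simp add: left_diff_distrib)
    next
      case False
      then show ?thesis unfolding sum using c(2)[of i] that by simp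
    qed
    moreover have "\<exists>j\<in>J. d j \<noteq> 0" using c(1) by (auto simp: d_def)
    ultimately show ?thesis by blast
  qed
qed

text \<open>With the column - b appended there are more unknowns than equations. Injectivity forces
  the last coordinate of a nontrivial solution to be nonzero, and dividing by it solves the
  system.\<close>

lemma square_system_solvable:
  fixes a :: "nat \<Rightarrow> nat \<Rightarrow> 'a::field"
  assumes inj: "\<And>c. (\<And>i. i < n \<Longrightarrow> (\<Sum>j<n. a i j * c j) = 0) \<Longrightarrow> (\<forall>j<n. c j = 0)"
  shows "\<exists>c. \<forall>i<n. (\<Sum>j<n. a i j * c j) = b i"
proof -
  obtain c where c: "\<exists>j\<in>{..n}. c j \<noteq> 0"
      "\<And>i. i < n \<Longrightarrow> (\<Sum>j\<in>{..n}. (if j = n then - b i else a i j) * c j) = 0"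
    using homogeneous_system_nontrivial[of "{..n}" n "\<lambda>i j. if j = n then - b i else a i j"] by auto
  have eq: "(\<Sum>j<n. a i j * c j) = b i * c n" if "i < n" for i
    using c(2)[OF that] by (simp add: lessThan_Suc_atMost[symmetric])
  have "c n \<noteq> 0"
  proof
    assume "c n = 0"
    then have "(\<Sum>j<n. a i j * c j) = 0" if "i < n" for i using eq[OF that] by simp
    then have "\<forall>j<n. c j = 0" by (rule inj)
    then show False using c(1) \<open>c n = 0\<close> by (metis atMost_iff le_neq_implies_less)
  qed
  then have "(\<Sum>j<n. a i j * (c j / c n)) = b i" if "i < n" for i
    using eq[OF that] by (simp add: sum_divide_distrib[symmetric])
  then show ?thesis by (intro exI[of _ "\<lambda>j. c j / c n"]) auto
qed

text \<open>If \<open>c\<close> is in the kernel of the transpose and c = a d, then the sum of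
  squares of \<open>c\<close> is d applied to the transpose of \<open>a\<close> at \<open>c\<close>,
  hence 0.\<close>

lemma square_system_transpose_solvable:
  fixes a :: "nat \<Rightarrow> nat \<Rightarrow> real"
  assumes inj: "\<And>c. (\<And>i. i < n \<Longrightarrow> (\<Sum>j<n. a i j * c j) = 0) \<Longrightarrow> (\<forall>j<n. c j = 0)"
  shows "\<exists>c. \<forall>j<n. (\<Sum>i<n. a i j * c i) = b j"
proof (rule square_system_solvable)
  fix c assume c: "\<And>j. j < n \<Longrightarrow> (\<Sum>i<n. a i j * c i) = 0"
  obtain d where d: "\<And>i. i < n \<Longrightarrow> (\<Sum>j<n. a i j * d j) = c i"
    using square_system_solvable[OF inj, where b=c] by auto
  have "(\<Sum>i<n. c i * c i) = (\<Sum>i<n. \<Sum>j<n. a i j * d j * c i)"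
    by (intro sum.cong refl) (simp add: d[symmetric] sum_distrib_right)
  also have "\<dots> = (\<Sum>j<n. d j * (\<Sum>i<n. a i j * c i))"
    by (subst sum.swap) (simp add: sum_distrib_left mult_ac)
  also have "\<dots> = 0" using c by simp
  finally show "\<forall>j<n. c j = 0" by (simp add: sum_nonneg_eq_0_iff)
qed

lemma sum_lessThan_add:
  fixes f :: "nat \<Rightarrow> 'a::comm_monoid_add"
  shows "(\<Sum>j<m + n. f j) = (\<Sum>j<m. f j) + (\<Sum>j<n. f (m + j))"
  by (induction n) (auto simp: add_ac)

section \<open>Sign patterns of real polynomials on an interval\<close>

lemma poly_constant_sign:
  fixes p :: "real poly"
  assumes nz: "\<And>x. x \<in> {a..b} \<Longrightarrow> poly p x \<noteq> 0"
  shows "(\<forall>x\<in>{a..b}. poly p x > 0) \<or> (\<forall>x\<in>{a..b}. poly p x < 0)"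
proof (rule ccontr)
  assume "\<not> ?thesis"
  then obtain x y where xy: "x \<in> {a..b}" "y \<in> {a..b}" "poly p x < 0" "poly p y > 0"
    using nz by (metis linorder_neqE_linordered_idom)
  then have "x \<noteq> y" by auto
  moreover have "poly p x * poly p y < 0" "poly p y * poly p x < 0"
    using xy by (auto simp: mult_neg_pos mult_pos_neg)
  ultimately obtain z where "poly p z = 0" "min x y < z" "z < max x y"
    using poly_IVT[of x y p] poly_IVT[of y x p] by (cases "x < y") auto
  then show False using nz[of z] xy by (auto simp: min_def max_def split: if_splits)
qed

text \<open>\<open>q\<close> keeps one copy of each root of odd multiplicity in the interval: a
  single root is kept, a double one is dropped as a square. No degree is lost only if all roots are
  simple and lie in the interval, which the last disjunct records for locating zeros.\<close>

lemma sign_pattern_poly: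
  fixes p :: "real poly"
  assumes "p \<noteq> 0" "a \<le> b"
  shows "\<exists>q. q \<noteq> 0 \<and> degree q \<le> degree p \<and> (\<forall>x\<in>{a..b}. poly q x * poly p x \<ge> 0) \<and>
    (\<forall>x. poly q x = 0 \<longrightarrow> x \<in> {a..b}) \<and>
    (degree q < degree p \<or> (\<exists>Z. finite Z \<and> Z \<subseteq> {a..b} \<and> p = smult (lead_coeff p) (\<Prod>r\<in>Z. [:- r, 1:])))"
  using assms
proof (induction "degree p" arbitrary: p rule: less_induct)
  case less
  show ?case
  proof (cases "\<exists>r\<in>{a..b}. poly p r = 0")
    case False
    then obtain s :: real where s: "s \<noteq> 0" "\<And>x. x \<in> {a..b} \<Longrightarrow> s * poly p x > 0"
      using poly_constant_sign[of a b p] by (metis mult_1 mult_minus1 neg_0_less_iff_less zero_neq_neg_one zero_neq_one)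
    show ?thesis
    proof (intro exI[of _ "[:s:]"] conjI)
      show "degree [:s:] < degree p \<or> (\<exists>Z. finite Z \<and> Z \<subseteq> {a..b} \<and> p = smult (lead_coeff p) (\<Prod>r\<in>Z. [:- r, 1:]))"
      proof (cases "degree p = 0")
        case True
        then have "p = smult (lead_coeff p) (\<Prod>r\<in>{}. [:- r, 1:])" by (auto elim: degree_eq_zeroE)
        then show ?thesis by blast
      qed simp
    qed (use s in \<open>auto intro: less_imp_le\<close>)
  next
    case True
    then obtain r where r: "r \<in> {a..b}" "poly p r = 0" by blast
    then obtain p1 where p1: "p = [:- r, 1:] * p1" by (auto simp: poly_eq_0_iff_dvd)
    have p1nz: "p1 \<noteq> 0" using less.prems p1 by auto
    have deg1: "degree p = Suc (degree p1)" using p1nz unfolding p1 by (subst degree_mult_eq) auto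
    show ?thesis
    proof (cases "poly p1 r = 0")
      case True
      then obtain p2 where p2: "p1 = [:- r, 1:] * p2" by (auto simp: poly_eq_0_iff_dvd)
      have p2nz: "p2 \<noteq> 0" using p1nz p2 by auto
      have deg2: "degree p1 = Suc (degree p2)" using p2nz unfolding p2 by (subst degree_mult_eq) auto
      obtain q where q: "q \<noteq> 0" "degree q \<le> degree p2" "\<And>x. x \<in> {a..b} \<Longrightarrow> poly q x * poly p2 x \<ge> 0"
          "\<And>x. poly q x = 0 \<Longrightarrow> x \<in> {a..b}"
        using less.hyps[of p2] p2nz deg1 deg2 less.prems by auto
      have "poly q x * poly p x \<ge> 0" if "x \<in> {a..b}" for x
      proof -
        have "poly q x * poly p x = (x - r)\<^sup>2 * (poly q x * poly p2 x)"
          unfolding p1 p2 by (simp add: power2_eq_square algebra_simps)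
        then show ?thesis using q(3)[OF that] by (simp only: mult_nonneg_nonneg zero_le_power2)
      qed
      then show ?thesis using q deg1 deg2 by (intro exI[of _ q]) auto
    next
      case False
      obtain q where q: "q \<noteq> 0" "degree q \<le> degree p1" "\<And>x. x \<in> {a..b} \<Longrightarrow> poly q x * poly p1 x \<ge> 0"
          "\<And>x. poly q x = 0 \<Longrightarrow> x \<in> {a..b}"
          "degree q < degree p1 \<or> (\<exists>Z. finite Z \<and> Z \<subseteq> {a..b} \<and> p1 = smult (lead_coeff p1) (\<Prod>r\<in>Z. [:- r, 1:]))"
        using less.hyps[OF _ p1nz less.prems(2)] deg1 lessI by metis
      have degq: "degree ([:- r, 1:] * q) = Suc (degree q)" using q(1) by (subst degree_mult_eq) auto
      show ?thesis
      proof (intro exI[of _ "[:- r, 1:] * q"] conjI ballI allI impI)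
        show "poly ([:- r, 1:] * q) x * poly p x \<ge> 0" if "x \<in> {a..b}" for x
        proof -
          have "poly ([:- r, 1:] * q) x * poly p x = (x - r)\<^sup>2 * (poly q x * poly p1 x)"
            unfolding p1 by (simp add: power2_eq_square algebra_simps)
          then show ?thesis using q(3)[OF that] by (simp only: mult_nonneg_nonneg zero_le_power2)
        qed
        show "degree ([:- r, 1:] * q) < degree p \<or>
          (\<exists>Z. finite Z \<and> Z \<subseteq> {a..b} \<and> p = smult (lead_coeff p) (\<Prod>r\<in>Z. [:- r, 1:]))"
          using q(5)
        proof
          assume "\<exists>Z. finite Z \<and> Z \<subseteq> {a..b} \<and> p1 = smult (lead_coeff p1) (\<Prod>r\<in>Z. [:- r, 1:])"
          then obtain Z where Z: "finite Z" "Z \<subseteq> {a..b}" "p1 = smult (lead_coeff p1) (\<Prod>r\<in>Z. [:- r, 1:])"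
            by blast
          have "r \<notin> Z"
          proof
            assume "r \<in> Z"
            then have "poly (\<Prod>r\<in>Z. [:- r, 1:]) r = 0" using Z(1) by (auto simp: poly_prod prod_zero_iff)
            then show False using False Z(3) by (metis mult_zero_right poly_smult)
          qed
          moreover have "lead_coeff p = lead_coeff p1" unfolding p1 by (subst lead_coeff_mult) simp
          ultimately have "p = smult (lead_coeff p) (\<Prod>r\<in>insert r Z. [:- r, 1:])"
            using Z(1,3) p1 by (simp only: prod.insert mult_smult_right[symmetric] not_False_eq_True)
          then show ?thesis using Z r by (metis finite_insert insert_subset)
        qed (use degq deg1 in simp)
        show "x \<in> {a..b}" if "poly ([:- r, 1:] * q) x = 0" for x
          using that q(4)[of x] r by (auto simp: poly_mult)
      qed (use q degq deg1 in auto)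
    qed
  qed
qed

lemma sum_side: "(\<Sum>k\<in>UNIV. f k) = f I1 + f I2"
  by (simp add: UNIV_side)

lemma other_neq [simp]: "other k \<noteq> k" "k \<noteq> other k" and other_other [simp]: "other (other k) = k"
  by (cases k; simp)+

lemma side_other_cases: "j = k \<or> j = other k"
  by (cases j; cases k; simp)

lemma sum_side': "(\<Sum>k\<in>UNIV. f k) = f k + (f (other k) :: 'a::comm_monoid_add)"
  by (cases k) (auto simp: sum_side add.commute)

text \<open>The linear form B_1 d\<mu>_1 + B_2 d\<mu>_2 as a functional on polynomials; the type I
  conditions prescribe its moments.\<close>

definition pairing :: "(side \<Rightarrow> real measure) \<Rightarrow> (side \<Rightarrow> real poly) \<Rightarrow> real poly \<Rightarrow> real" where
  "pairing \<mu> B p = (\<Sum>k\<in>UNIV. LINT x|\<mu> k. poly p x * poly (B k) x)"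

text \<open>Stated by coefficients so that \<open>n k = 0\<close> forces the zero polynomial without
  a case distinction.\<close>

definition deg_bounded :: "multi_index \<Rightarrow> (side \<Rightarrow> real poly) \<Rightarrow> bool" where
  "deg_bounded n B \<longleftrightarrow> (\<forall>k i. n k \<le> i \<longrightarrow> coeff (B k) i = 0)"

lemma deg_bounded_iff:
  "deg_bounded n B \<longleftrightarrow> (\<forall>k. if n k = 0 then B k = 0 else degree (B k) \<le> n k - 1)"
proof -
  have "(\<forall>i. m \<le> i \<longrightarrow> coeff p i = 0) \<longleftrightarrow> (if m = 0 then p = 0 else degree p \<le> m - 1)" for m and p :: "real poly"
  proof (cases m)
    case (Suc m')
    then show ?thesis by (auto intro: degree_le coeff_eq_0 simp: Suc_le_eq)
  qed (simp add: poly_eq_iff)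
  then show ?thesis by (simp add: deg_bounded_def)
qed

section \<open>Positive pairings in an Angelesco system\<close>

locale angelesco_system =
  fixes \<mu> :: "side \<Rightarrow> real measure"
  assumes ang: "angelesco \<mu>" and ord: "right_end \<mu> I1 < left_end \<mu> I2"
begin

lemma sets_mu [simp, measurable_cong]: "sets (\<mu> k) = sets borel"
  and finite_mu: "finite_measure (\<mu> k)"
  and compact_supp: "compact (supp (\<mu> k))"
  and infinite_supp: "infinite (supp (\<mu> k))"
  using ang by (auto simp: angelesco_def)

lemma space_mu [simp]: "space (\<mu> k) = UNIV"
  using sets_eq_imp_space_eq[OF sets_mu[of k]] by simp

sublocale M: finite_borel_measure "\<mu> k" for k
  using finite_mu by (simp add: finite_borel_measure_def finite_borel_measure_axioms_def)

lemma Delta_eq: "Delta \<mu> k = {left_end \<mu> k..right_end \<mu> k}"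
  and ends_le: "left_end \<mu> k \<le> right_end \<mu> k"
proof -
  have "connected (Delta \<mu> k) \<and> compact (Delta \<mu> k)"
    unfolding Delta_def using compact_supp by (auto intro: compact_convex_hull convex_connected)
  then obtain a b where ab: "Delta \<mu> k = {a..b}"
    using connected_compact_interval_1[of "Delta \<mu> k"] by auto
  have "supp (\<mu> k) \<noteq> {}" using infinite_supp[of k] by auto
  then have "Delta \<mu> k \<noteq> {}" unfolding Delta_def by simp
  then have "a \<le> b" using ab by auto
  then show "Delta \<mu> k = {left_end \<mu> k..right_end \<mu> k}" "left_end \<mu> k \<le> right_end \<mu> k"
    using ab by (auto simp: left_end_def right_end_def)
qed

lemma compact_Delta: "compact (Delta \<mu> k)" by (simp add: Delta_eq)

lemma AE_Delta: "AE x in \<mu> k. x \<in> Delta \<mu> k"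
proof -
  have "AE x in \<mu> k. x \<notin> - supp (\<mu> k)"
    by (rule AE_not_in_locally_null) (auto simp: supp_def)
  then show ?thesis
    by eventually_elim (auto simp: Delta_def hull_inc)
qed

lemma Delta_disjoint: "x \<in> Delta \<mu> k \<Longrightarrow> x \<notin> Delta \<mu> (other k)"
  using ord by (cases k) (auto simp: Delta_eq)

lemma integrable_continuous_Delta:
  fixes f :: "real \<Rightarrow> 'b::{banach, second_countable_topology}"
  assumes "f \<in> borel_measurable borel" "continuous_on (Delta \<mu> k) f"
  shows "integrable (\<mu> k) f"
proof -
  have "bounded (f ` Delta \<mu> k)"
    using assms compact_Delta by (intro compact_imp_bounded compact_continuous_image)
  then obtain B where B: "\<And>x. x \<in> Delta \<mu> k \<Longrightarrow> norm (f x) \<le> B" by (metis bounded_iff imageI)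
  have "AE x in \<mu> k. norm (f x) \<le> B" using AE_Delta by eventually_elim (rule B)
  then show ?thesis
    using assms(1) by (intro M.integrable_const_bound[where B=B]) auto
qed

lemma poly_measurable [measurable]: "poly p \<in> borel_measurable borel" for p :: "real poly"
  by (intro borel_measurable_continuous_onI continuous_intros)

lemma integrable_poly [simp]: "integrable (\<mu> k) (poly p)"
  by (intro integrable_continuous_Delta continuous_intros) auto

lemma integrable_poly_mult [simp]: "integrable (\<mu> k) (\<lambda>x. poly p x * poly q x)"
proof -
  have "poly (p * q) = (\<lambda>x. poly p x * poly q x)" by (simp add: fun_eq_iff)
  then show ?thesis using integrable_poly[of k "p * q"] by simp
qed

text \<open>A vanishing integral would make the complement of a finite set null and so confine the
  infinite support to that set.\<close>

lemma integral_positive: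
  assumes int: "integrable (\<mu> k) f" and nn: "\<And>x. x \<in> Delta \<mu> k \<Longrightarrow> f x \<ge> (0::real)"
    and fin: "finite {x \<in> Delta \<mu> k. f x = 0}"
  shows "(LINT x|\<mu> k. f x) > 0"
proof -
  have AE: "AE x in \<mu> k. 0 \<le> f x" using AE_Delta by eventually_elim (rule nn)
  then have "(LINT x|\<mu> k. f x) \<ge> 0" by (rule Bochner_Integration.integral_nonneg_AE)
  moreover have "(LINT x|\<mu> k. f x) \<noteq> 0"
  proof
    assume "(LINT x|\<mu> k. f x) = 0"
    then have AE0: "AE x in \<mu> k. f x = 0" using integral_nonneg_eq_0_iff_AE[OF int AE] by simp
    let ?F = "{x \<in> Delta \<mu> k. f x = 0}"
    have "AE x in \<mu> k. x \<notin> - ?F" using AE0 AE_Delta by eventually_elim auto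
    then have "emeasure (\<mu> k) (- ?F) = 0"
      using finite_imp_closed[OF fin] by (subst (asm) AE_iff_measurable[of "- ?F"]) auto
    then have "supp (\<mu> k) \<subseteq> ?F"
      using finite_imp_closed[OF fin] unfolding supp_def by (auto dest!: spec[of _ "- ?F"])
    then show False using fin infinite_supp finite_subset by blast
  qed
  ultimately show ?thesis by simp
qed

lemma integral_nonneg_Delta:
  assumes "\<And>x. x \<in> Delta \<mu> k \<Longrightarrow> f x \<ge> (0::real)"
  shows "(LINT x|\<mu> k. f x) \<ge> 0"
  by (rule Bochner_Integration.integral_nonneg_AE) (use AE_Delta in eventually_elim, rule assms)

lemma sum_integral_positive:
  fixes f :: "side \<Rightarrow> real \<Rightarrow> real"
  assumes int: "\<And>k. integrable (\<mu> k) (f k)" and nn: "\<And>k x. x \<in> Delta \<mu> k \<Longrightarrow> f k x \<ge> 0"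
    and fin: "finite {x \<in> Delta \<mu> k. f k x = 0}"
  shows "(\<Sum>k\<in>UNIV. LINT x|\<mu> k. f k x) > 0"
  unfolding sum_side'[of _ k] using integral_positive[OF int nn fin] integral_nonneg_Delta[of "other k" "f (other k)"] nn
  by (simp add: add_pos_nonneg)

lemma pairing_add: "pairing \<mu> (\<lambda>k. A k + B k) p = pairing \<mu> A p + pairing \<mu> B p"
  and pairing_diff: "pairing \<mu> (\<lambda>k. A k - B k) p = pairing \<mu> A p - pairing \<mu> B p"
  and pairing_smult: "pairing \<mu> (\<lambda>k. smult c (A k)) p = c * pairing \<mu> A p"
  and pairing_add_right: "pairing \<mu> B (p + q) = pairing \<mu> B p + pairing \<mu> B q"
  and pairing_smult_right: "pairing \<mu> B (smult c p) = c * pairing \<mu> B p"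
  and pairing_zero_right [simp]: "pairing \<mu> B 0 = 0"
  by (simp_all add: pairing_def sum_side algebra_simps)

lemma pairing_mult_right: "pairing \<mu> B (p * q) = pairing \<mu> (\<lambda>k. q * B k) p"
  by (simp add: pairing_def mult_ac)

lemma pairing_sum: "pairing \<mu> (\<lambda>k. \<Sum>j\<in>S. A j k) p = (\<Sum>j\<in>S. pairing \<mu> (A j) p)"
proof (induction S rule: infinite_finite_induct)
  case (insert x F)
  then show ?case using pairing_add[of "A x" "\<lambda>k. \<Sum>j\<in>F. A j k" p] by simp
qed (simp_all add: pairing_def)

lemma pairing_sum_right: "pairing \<mu> B (\<Sum>j\<in>S. p j) = (\<Sum>j\<in>S. pairing \<mu> B (p j))"
  by (induction S rule: infinite_finite_induct) (simp_all add: pairing_add_right)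

lemma pairing_expand: "pairing \<mu> B p = (\<Sum>i\<le>degree p. coeff p i * pairing \<mu> B (monom 1 i))"
proof -
  have "pairing \<mu> B p = pairing \<mu> B (\<Sum>i\<le>degree p. smult (coeff p i) (monom 1 i))"
    by (simp add: smult_monom poly_as_sum_of_monoms)
  then show ?thesis by (simp only: pairing_sum_right pairing_smult_right)
qed

lemma pairing_eq_0:
  assumes "\<And>m. m < N \<Longrightarrow> pairing \<mu> B (monom 1 m) = 0" "degree p < N"
  shows "pairing \<mu> B p = 0"
  using assms by (subst pairing_expand) (intro sum.neutral, auto)

text \<open>\<open>q k\<close> has its zeros in interval k, so it has constant sign on the other
  one. A constant \<open>u\<close> corrects equal signs; for opposite signs \<open>u\<close> is
  linear with its zero at the midpoint of the gap.\<close>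

lemma sign_multiplier:
  assumes q: "\<And>k. q k \<noteq> 0" "\<And>k x. poly (q k) x = 0 \<Longrightarrow> x \<in> Delta \<mu> k"
  shows "\<exists>u. u \<noteq> 0 \<and> degree u \<le> 1 \<and> (\<forall>k. \<forall>x\<in>Delta \<mu> k. poly u x * poly (q (other k)) x > 0)"
proof -
  define \<xi> where "\<xi> = (right_end \<mu> I1 + left_end \<mu> I2) / 2"
  have "poly (q (other k)) x \<noteq> 0" if "x \<in> Delta \<mu> k" for k x
    using q(2)[of "other k" x] Delta_disjoint[OF that] by auto
  then have c: "(\<forall>x\<in>Delta \<mu> k. poly (q (other k)) x > 0) \<or> (\<forall>x\<in>Delta \<mu> k. poly (q (other k)) x < 0)" for k
    unfolding Delta_eq using poly_constant_sign[of "left_end \<mu> k" "right_end \<mu> k" "q (other k)"] by blast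
  show ?thesis
  proof -
    consider (pp) "\<forall>x\<in>Delta \<mu> I1. poly (q I2) x > 0" "\<forall>x\<in>Delta \<mu> I2. poly (q I1) x > 0"
      | (nn) "\<forall>x\<in>Delta \<mu> I1. poly (q I2) x < 0" "\<forall>x\<in>Delta \<mu> I2. poly (q I1) x < 0"
      | (pn) "\<forall>x\<in>Delta \<mu> I1. poly (q I2) x > 0" "\<forall>x\<in>Delta \<mu> I2. poly (q I1) x < 0"
      | (np) "\<forall>x\<in>Delta \<mu> I1. poly (q I2) x < 0" "\<forall>x\<in>Delta \<mu> I2. poly (q I1) x > 0"
      using c[of I1] c[of I2] by auto
    moreover have side_all: "(\<forall>k. P k) \<longleftrightarrow> P I1 \<and> P I2" for P :: "side \<Rightarrow> bool" by (metis side.exhaust)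
    moreover have l: "x < \<xi>" if "x \<in> Delta \<mu> I1" for x using that ord by (auto simp: Delta_eq \<xi>_def)
    moreover have r: "x > \<xi>" if "x \<in> Delta \<mu> I2" for x using that ord by (auto simp: Delta_eq \<xi>_def)
    ultimately show ?thesis
    proof cases
      case pp then show ?thesis by (intro exI[of _ "[:1:]"]) (simp add: side_all)
    next
      case nn then show ?thesis by (intro exI[of _ "[:-1:]"]) (simp add: side_all)
    next
      case pn then show ?thesis using l r
        by (intro exI[of _ "[:\<xi>, -1:]"]) (auto simp: side_all intro!: mult_pos_pos mult_neg_neg)
    next
      case np then show ?thesis using l r
        by (intro exI[of _ "[:- \<xi>, 1:]"]) (auto simp: side_all intro!: mult_pos_pos mult_neg_neg)
    qed
  qed
qed

text \<open>The product of the two sign patterns and the multiplier in the gap. If one component is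
  zero, the pattern of the other suffices and the extra degree is saved, which matters when some
  \<open>n k\<close> is 0.\<close>

lemma sign_polynomial:
  assumes B: "B k0 \<noteq> 0"
  obtains D where "D \<noteq> 0" "degree D \<le> degree (B I1) + degree (B I2) + (if B I1 = 0 \<or> B I2 = 0 then 0 else 1)"
    "\<And>k x. x \<in> Delta \<mu> k \<Longrightarrow> poly D x * poly (B k) x \<ge> 0"
proof -
  have "\<exists>q. q \<noteq> 0 \<and> degree q \<le> degree (B k) \<and> (\<forall>x\<in>Delta \<mu> k. poly q x * poly (B k) x \<ge> 0) \<and>
    (\<forall>x. poly q x = 0 \<longrightarrow> x \<in> Delta \<mu> k)" for k
  proof (cases "B k = 0")
    case False
    from sign_pattern_poly[OF this ends_le[of k]] show ?thesis unfolding Delta_eq by blast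
  qed (auto intro!: exI[of _ 1])
  then obtain q where q: "\<And>k. q k \<noteq> 0" "\<And>k. degree (q k) \<le> degree (B k)"
    "\<And>k x. x \<in> Delta \<mu> k \<Longrightarrow> poly (q k) x * poly (B k) x \<ge> 0" "\<And>k x. poly (q k) x = 0 \<Longrightarrow> x \<in> Delta \<mu> k"
    by metis
  show ?thesis
  proof (cases "B I1 = 0 \<or> B I2 = 0")
    case True
    then have "poly (q k0) x * poly (B k) x \<ge> 0" if "x \<in> Delta \<mu> k" for k x
      using B q(3)[OF that] by (cases k; cases k0) auto
    moreover have "degree (q k0) \<le> degree (B I1) + degree (B I2)" using q(2)[of k0] by (cases k0) auto
    ultimately show ?thesis using that[of "q k0"] q(1) True by auto
  next
    case False
    obtain u where u: "u \<noteq> 0" "degree u \<le> 1" "\<And>k x. x \<in> Delta \<mu> k \<Longrightarrow> poly u x * poly (q (other k)) x > 0"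
      using sign_multiplier[of q, OF q(1) q(4)] by auto
    have "poly (u * q I1 * q I2) x * poly (B k) x \<ge> 0" if "x \<in> Delta \<mu> k" for k x
    proof -
      have "poly (u * q I1 * q I2) x * poly (B k) x = (poly u x * poly (q (other k)) x) * (poly (q k) x * poly (B k) x)"
        by (cases k) (auto simp: mult_ac)
      also have "\<dots> \<ge> 0" 
        by (rule mult_nonneg_nonneg[OF less_imp_le[OF u(3)[OF that]] q(3)[OF that]])
      finally show ?thesis .
    qed
    moreover have "u * q I1 * q I2 \<noteq> 0" using u q by simp
    moreover have "degree (u * q I1 * q I2) \<le> degree (B I1) + degree (B I2) + 1"
      using u(2) q(2)[of I1] q(2)[of I2] by (simp add: degree_mult_eq u(1) q(1))
    ultimately show ?thesis using that[of "u * q I1 * q I2"] False by auto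
  qed
qed

lemma pairing_positive:
  assumes "B k0 \<noteq> 0" "D \<noteq> 0" "\<And>k x. x \<in> Delta \<mu> k \<Longrightarrow> poly D x * poly (B k) x \<ge> 0"
  shows "pairing \<mu> B D > 0"
  unfolding pairing_def
proof (rule sum_integral_positive[where k=k0])
  have "{x \<in> Delta \<mu> k0. poly D x * poly (B k0) x = 0} \<subseteq> {x. poly (D * B k0) x = 0}" by auto
  then show "finite {x \<in> Delta \<mu> k0. poly D x * poly (B k0) x = 0}"
    using assms poly_roots_finite[of "D * B k0"] finite_subset by auto
qed (use assms in auto)

text \<open>A nonzero pair has a sign polynomial of degree at most (n_1 - 1) + (n_2 - 1) + 1, below
  |n|, so the positive pairing would have to vanish.\<close>

lemma normality:
  assumes "deg_bounded n B" "\<And>m. m < msize n \<Longrightarrow> pairing \<mu> B (monom 1 m) = 0"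
  shows "B k = 0"
proof (rule ccontr)
  assume nz: "B k \<noteq> 0"
  obtain D where D: "D \<noteq> 0" "degree D \<le> degree (B I1) + degree (B I2) + (if B I1 = 0 \<or> B I2 = 0 then 0 else 1)"
    "\<And>k x. x \<in> Delta \<mu> k \<Longrightarrow> poly D x * poly (B k) x \<ge> 0"
    using sign_polynomial[of B, OF nz] by blast
  have "B j \<noteq> 0 \<Longrightarrow> n j > 0 \<and> degree (B j) \<le> n j - 1" for j
    using assms(1) unfolding deg_bounded_iff by (metis neq0_conv)
  from this[of I1] this[of I2] have "degree D < msize n"
    using D(2) nz unfolding msize_def by (cases k; cases "B I1 = 0"; cases "B I2 = 0") auto
  then have "pairing \<mu> B D = 0" using assms(2) pairing_eq_0 by blast
  then show False using pairing_positive[of B, OF nz D(1,3)] by simp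
qed

end

section \<open>Recurrence relations\<close>

lemma coeff_sum_monom: "coeff (\<Sum>j<N. monom (c j) j) i = (if i < N then c i else 0)"
  by (simp add: coeff_sum)

lemma poly_altdef_lessThan:
  fixes p :: "real poly"
  assumes "\<And>i. N \<le> i \<Longrightarrow> coeff p i = 0"
  shows "poly p x = (\<Sum>i<N. coeff p i * x ^ i)"
proof -
  have "p = (\<Sum>i<N. monom (coeff p i) i)"
    using assms by (auto simp: poly_eq_iff coeff_sum_monom)
  then have "poly p x = poly (\<Sum>i<N. monom (coeff p i) i) x" by simp
  also have "\<dots> = (\<Sum>i<N. coeff p i * x ^ i)" by (simp add: poly_sum poly_monom)
  finally show ?thesis .
qed

context angelesco_system
begin

lemma integrable_power [simp]: "integrable (\<mu> k) (\<lambda>x. x ^ m)"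
proof -
  have "poly (monom 1 m) = (\<lambda>x::real. x ^ m)" by (simp add: fun_eq_iff poly_monom)
  then show ?thesis using integrable_poly[of k "monom 1 m"] by simp
qed

text \<open>Matrix from the stacked coefficients of a pair, those of \<open>I1\<close> first, to its
  moments. Its injectivity is normality; its transpose governs the type II polynomials.\<close>

definition moment :: "multi_index \<Rightarrow> nat \<Rightarrow> nat \<Rightarrow> real" where
  "moment n m j = (if j < n I1 then LINT x|\<mu> I1. x ^ (m + j) else LINT x|\<mu> I2. x ^ (m + (j - n I1)))"

definition poly_pair :: "multi_index \<Rightarrow> (nat \<Rightarrow> real) \<Rightarrow> side \<Rightarrow> real poly" where
  "poly_pair n c k = (case k of I1 \<Rightarrow> \<Sum>j<n I1. monom (c j) j | I2 \<Rightarrow> \<Sum>j<n I2. monom (c (n I1 + j)) j)"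

lemma poly_pair_simps [simp]:
  "poly_pair n c I1 = (\<Sum>j<n I1. monom (c j) j)" "poly_pair n c I2 = (\<Sum>j<n I2. monom (c (n I1 + j)) j)"
  by (simp_all add: poly_pair_def)

lemma deg_bounded_poly_pair: "deg_bounded n (poly_pair n c)"
  unfolding deg_bounded_def by (intro allI, rename_tac k i, case_tac k) (auto simp: coeff_sum_monom)

lemma integral_monom_sum:
  "(LINT x|\<mu> k. x ^ m * poly (\<Sum>j<N. monom (c j) j) x) = (\<Sum>j<N. c j * (LINT x|\<mu> k. x ^ (m + j)))"
proof -
  have "(LINT x|\<mu> k. x ^ m * poly (\<Sum>j<N. monom (c j) j) x) = (LINT x|\<mu> k. (\<Sum>j<N. c j * x ^ (m + j)))"
    by (simp add: poly_sum poly_monom sum_distrib_left power_add mult_ac)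
  then show ?thesis by simp
qed

lemma pairing_poly_pair: "pairing \<mu> (poly_pair n c) (monom 1 m) = (\<Sum>j<msize n. moment n m j * c j)"
  unfolding pairing_def sum_side msize_def sum_lessThan_add
  by (simp add: poly_monom integral_monom_sum moment_def mult.commute)

lemma moment_injective:
  assumes "\<And>m. m < msize n \<Longrightarrow> (\<Sum>j<msize n. moment n m j * c j) = 0"
  shows "\<forall>j<msize n. c j = 0"
proof (intro allI impI)
  fix j assume j: "j < msize n"
  have z: "poly_pair n c k = 0" for k
    by (rule normality[OF deg_bounded_poly_pair]) (simp add: pairing_poly_pair assms)
  show "c j = 0"
  proof (cases "j < n I1")
    case True
    then show ?thesis using z[of I1] coeff_sum_monom[of c "n I1" j] by simp
  next
    case False
    then show ?thesis using z[of I2] coeff_sum_monom[of "\<lambda>j. c (n I1 + j)" "n I2" "j - n I1"] j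
      by (auto simp: msize_def split: if_split_asm)
  qed
qed

lemma moment_problem_solvable:
  "\<exists>B. deg_bounded n B \<and> (\<forall>m<msize n. pairing \<mu> B (monom 1 m) = b m)"
proof -
  obtain c where "\<forall>m<msize n. (\<Sum>j<msize n. moment n m j * c j) = b m"
    using square_system_solvable[of "msize n" "moment n" b, OF moment_injective] by blast
  then show ?thesis
    by (intro exI[of _ "poly_pair n c"]) (simp add: deg_bounded_poly_pair pairing_poly_pair)
qed

section \<open>Existence and uniqueness of the multiple orthogonal polynomials\<close>

lemma is_typeI_iff:
  "is_typeI \<mu> n A \<longleftrightarrow> deg_bounded n A \<and>
     (\<forall>m. m + 2 \<le> msize n \<longrightarrow> pairing \<mu> A (monom 1 m) = 0) \<and>
     (\<forall>m. m + 1 = msize n \<longrightarrow> pairing \<mu> A (monom 1 m) = 1)"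
  by (simp add: is_typeI_def deg_bounded_iff pairing_def poly_monom)

lemma typeI: 
  assumes n: "msize n > 0"
  shows "is_typeI \<mu> n (typeI \<mu> n)"
  unfolding typeI_def
proof (rule theI'[of "is_typeI \<mu> n"])
  obtain B where B: "deg_bounded n B" "\<And>m. m < msize n \<Longrightarrow> pairing \<mu> B (monom 1 m) = (if m + 1 = msize n then 1 else 0)"
    using moment_problem_solvable[of n "\<lambda>m. if m + 1 = msize n then 1 else 0"] by blast
  show "\<exists>!A. is_typeI \<mu> n A"
  proof
    show "is_typeI \<mu> n B" using B by (auto simp: is_typeI_iff)
    fix A assume A: "is_typeI \<mu> n A"
    have "A k - B k = 0" for k
    proof (rule normality[of n "\<lambda>k. A k - B k"])
      show "deg_bounded n (\<lambda>k. A k - B k)" using A B by (auto simp: is_typeI_iff deg_bounded_def)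
      show "pairing \<mu> (\<lambda>k. A k - B k) (monom 1 m) = 0" if "m < msize n" for m
        using A B(2)[OF that] that unfolding pairing_diff is_typeI_iff by (cases "m + 1 = msize n") auto
    qed
    then show "A = B" by auto
  qed
qed

lemma typeI_deg_bounded: "msize n > 0 \<Longrightarrow> deg_bounded n (typeI \<mu> n)"
  using typeI is_typeI_iff by blast

lemma typeI_coeff_0: "msize n > 0 \<Longrightarrow> n k \<le> i \<Longrightarrow> coeff (typeI \<mu> n k) i = 0"
  using typeI_deg_bounded deg_bounded_def by blast

lemma pairing_typeI:
  assumes "msize n > 0" "degree p < msize n"
  shows "pairing \<mu> (typeI \<mu> n) p = coeff p (msize n - 1)"
proof -
  have "pairing \<mu> (typeI \<mu> n) p = (\<Sum>i\<le>degree p. coeff p i * (if i = msize n - 1 then 1 else 0))"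
    unfolding pairing_expand[of _ p]
  proof (rule sum.cong[OF refl])
    fix i assume "i \<in> {..degree p}"
    then show "coeff p i * pairing \<mu> (typeI \<mu> n) (monom 1 i) = coeff p i * (if i = msize n - 1 then 1 else 0)"
      using typeI[OF assms(1)] assms unfolding is_typeI_iff by (cases "i + 1 = msize n") auto
  qed
  also have "\<dots> = coeff p (msize n - 1)"
    by (simp add: if_distrib[of "\<lambda>x. _ * x"] coeff_eq_0 not_le cong: if_cong)
  finally show ?thesis .
qed

lemma orthogonal_pairing:
  assumes P: "\<And>k m. m < n k \<Longrightarrow> (LINT x|\<mu> k. poly P x * x ^ m) = 0" and B: "deg_bounded n B"
  shows "pairing \<mu> B P = 0"
proof -
  have "(LINT x|\<mu> k. poly P x * poly (B k) x) = 0" for k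
  proof -
    have i: "integrable (\<mu> k) (\<lambda>x. poly P x * x ^ i)" for i
      using integrable_poly_mult[of k P "monom 1 i"] by (simp add: poly_monom)
    have "poly P x * poly (B k) x = (\<Sum>i<n k. coeff (B k) i * (poly P x * x ^ i))" for x
      using B poly_altdef_lessThan[of "n k" "B k" x]
      by (simp add: deg_bounded_def sum_distrib_left mult_ac)
    then show ?thesis using i P by simp
  qed
  then show ?thesis by (simp add: pairing_def)
qed

text \<open>The moment problem has a solution \<open>B\<close> whose moments are the coefficients of
  \<open>P\<close>. The pairing of \<open>B\<close> with \<open>P\<close> is 0 by orthogonality and
  is the sum of squares of those coefficients.\<close>

lemma orthogonal_eq_0:
  assumes P: "\<And>k m. m < n k \<Longrightarrow> (LINT x|\<mu> k. poly P x * x ^ m) = 0"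
    and deg: "\<And>i. msize n \<le> i \<Longrightarrow> coeff P i = 0"
  shows "P = 0"
proof -
  obtain B where B: "deg_bounded n B" "\<And>m. m < msize n \<Longrightarrow> pairing \<mu> B (monom 1 m) = coeff P m"
    using moment_problem_solvable by blast
  have "0 = pairing \<mu> B P" using orthogonal_pairing[OF P B(1)] by simp
  also have "\<dots> = (\<Sum>i\<le>degree P. coeff P i * coeff P i)"
    unfolding pairing_expand[of _ P]
  proof (rule sum.cong[OF refl])
    fix i show "coeff P i * pairing \<mu> B (monom 1 i) = coeff P i * coeff P i"
      using B(2)[of i] deg[of i] by (cases "i < msize n") auto
  qed
  finally have "coeff P (degree P) * coeff P (degree P) = 0"
    by (simp add: sum_nonneg_eq_0_iff)
  then show ?thesis by simp
qed

lemma is_typeII_unique: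
  assumes "is_typeII \<mu> n P" "is_typeII \<mu> n Q"
  shows "P = Q"
proof -
  have "P - Q = 0"
  proof (rule orthogonal_eq_0[of n])
    show "(LINT x|\<mu> k. poly (P - Q) x * x ^ m) = 0" if "m < n k" for k m
    proof -
      have "integrable (\<mu> k) (\<lambda>x. poly R x * x ^ m)" for R
        using integrable_poly_mult[of k R "monom 1 m"] by (simp add: poly_monom)
      then show ?thesis using assms that by (simp add: is_typeII_def left_diff_distrib)
    qed
    show "coeff (P - Q) i = 0" if "msize n \<le> i" for i
      using assms that by (cases "i = msize n") (auto simp: is_typeII_def coeff_eq_0)
  qed
  then show ?thesis by simp
qed

text \<open>The lower coefficients solve the system with the transposed moment matrix, whose
  right-hand side comes from the leading monomial.\<close>

lemma typeII: "is_typeII \<mu> n (typeII \<mu> n)"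
  unfolding typeII_def
proof (rule theI'[of "is_typeII \<mu> n"])
  let ?N = "msize n"
  obtain p where p: "\<And>j. j < ?N \<Longrightarrow> (\<Sum>m<?N. moment n m j * p m) = - moment n ?N j"
    using square_system_transpose_solvable[of ?N "moment n" "\<lambda>j. - moment n ?N j", OF moment_injective] by blast
  define P where "P = monom 1 ?N + (\<Sum>m<?N. monom (p m) m)"
  have cP: "coeff P i = (if i = ?N then 1 else if i < ?N then p i else 0)" for i
    by (auto simp: P_def coeff_sum_monom)
  have dP: "degree P = ?N"
    by (intro antisym degree_le le_degree) (auto simp: cP)
  have orth: "(LINT x|\<mu> k. poly P x * x ^ j) = (LINT x|\<mu> k. x ^ (?N + j)) + (\<Sum>m<?N. p m * (LINT x|\<mu> k. x ^ (m + j)))" for k j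
  proof -
    have "poly P x * x ^ j = x ^ (?N + j) + (\<Sum>m<?N. p m * x ^ (m + j))" for x
      by (simp add: P_def poly_monom poly_sum algebra_simps power_add sum_distrib_left)
    then show ?thesis by simp
  qed
  have "is_typeII \<mu> n P"
    unfolding is_typeII_def
  proof (intro conjI allI impI)
    fix k m assume m: "m < n k"
    show "(LINT x|\<mu> k. poly P x * x ^ m) = 0"
    proof (cases k)
      case I1
      then show ?thesis using orth[of k m] p[of m] m by (simp add: moment_def msize_def mult.commute)
    next
      case I2
      then show ?thesis using orth[of k m] p[of "n I1 + m"] m by (simp add: moment_def msize_def mult.commute)
    qed
  qed (use dP cP in auto)
  then show "\<exists>!P. is_typeII \<mu> n P" using is_typeII_unique by blast
qed

lemma lead_coeff_typeII [simp]: "coeff (typeII \<mu> n) (msize n) = 1"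
  and degree_typeII [simp]: "degree (typeII \<mu> n) = msize n"
  and typeII_orthogonal: "m < n k \<Longrightarrow> (LINT x|\<mu> k. poly (typeII \<mu> n) x * x ^ m) = 0"
  using typeII[of n] unfolding is_typeII_def by auto

lemma typeII_pairing: "deg_bounded n B \<Longrightarrow> pairing \<mu> B (typeII \<mu> n) = 0"
  using orthogonal_pairing typeII_orthogonal by blast

lemma msize_inc [simp]: "msize (inc n k) = Suc (msize n)"
  by (cases k) (auto simp: msize_def inc_def)

lemma inc_apply: "inc n k j = (if j = k then Suc (n k) else n j)"
  by (simp add: inc_def)

lemma msize_dec: "n k > 0 \<Longrightarrow> msize (dec n k) = msize n - 1"
  by (cases k) (auto simp: msize_def dec_def)

lemma dec_inc [simp]: "dec (inc n k) k = n"
  by (auto simp: dec_def inc_def)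

lemma msize_pos: "n k > 0 \<Longrightarrow> msize n > 0"
  by (cases k) (auto simp: msize_def)

definition typeI_top :: "multi_index \<Rightarrow> side \<Rightarrow> real" where
  "typeI_top n k = coeff (typeI \<mu> n k) (n k - 1)"

text \<open>Pair A_n with P_{n - e_k}: the value is the leading coefficient 1, and orthogonality
  kills every term except the one with the top coefficient of the k-th component. In particular that
  coefficient is nonzero.\<close>

lemma typeI_top_mult:
  assumes n: "n k > 0"
  shows "typeI_top n k * (LINT x|\<mu> k. poly (typeII \<mu> (dec n k)) x * x ^ (n k - 1)) = 1"
proof -
  let ?P = "typeII \<mu> (dec n k)"
  have N: "msize n > 0" using msize_pos[of n k, OF n] .
  have "1 = pairing \<mu> (typeI \<mu> n) ?P"
    using N lead_coeff_typeII[of "dec n k"] by (subst pairing_typeI) (auto simp: msize_dec[of n k, OF n])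
  also have "\<dots> = (\<Sum>j\<in>UNIV. \<Sum>i<n j. coeff (typeI \<mu> n j) i * (LINT x|\<mu> j. poly ?P x * x ^ i))"
    unfolding pairing_def
  proof (rule sum.cong[OF refl])
    fix j
    have i: "integrable (\<mu> j) (\<lambda>x. poly ?P x * x ^ i)" for i
      using integrable_poly_mult[of j ?P "monom 1 i"] by (simp add: poly_monom)
    have "poly ?P x * poly (typeI \<mu> n j) x = (\<Sum>i<n j. coeff (typeI \<mu> n j) i * (poly ?P x * x ^ i))" for x
      using poly_altdef_lessThan[of "n j" "typeI \<mu> n j" x] typeI_coeff_0[OF N, of j]
      by (simp add: sum_distrib_left mult_ac)
    then show "(LINT x|\<mu> j. poly ?P x * poly (typeI \<mu> n j) x) = (\<Sum>i<n j. coeff (typeI \<mu> n j) i * (LINT x|\<mu> j. poly ?P x * x ^ i))"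
      using i by simp
  qed
  also have "\<dots> = (\<Sum>i<n k. coeff (typeI \<mu> n k) i * (LINT x|\<mu> k. poly ?P x * x ^ i))"
    unfolding sum_side'[of _ k] by (auto simp: dec_def typeII_orthogonal intro!: sum.neutral)
  also have "\<dots> = (\<Sum>i\<in>{n k - 1}. coeff (typeI \<mu> n k) i * (LINT x|\<mu> k. poly ?P x * x ^ i))"
    using n by (intro sum.mono_neutral_right) (auto simp: dec_def typeII_orthogonal)
  finally show ?thesis by (simp add: typeI_top_def)
qed

lemma typeI_top_neq_0: "n k > 0 \<Longrightarrow> typeI_top n k \<noteq> 0"
  using typeI_top_mult[of n k] by auto

lemma typeII_moment: "n k > 0 \<Longrightarrow> (LINT x|\<mu> k. poly (typeII \<mu> (dec n k)) x * x ^ (n k - 1)) = 1 / typeI_top n k"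
  using typeI_top_mult[of n k] typeI_top_neq_0[of n k] by (simp add: eq_divide_eq mult.commute)

text \<open>Candidate for a_{n,k}: comparing the moments of order \<open>n k - 1\<close> in the
  recurrence gives the quotient of the two normalizing integrals, which
  \<open>typeI_top_mult\<close> turns into this quotient of leading coefficients.\<close>

definition rec_a_val :: "multi_index \<Rightarrow> side \<Rightarrow> real" where
  "rec_a_val n k = typeI_top n k / typeI_top (inc n k) k"

lemma integrable_poly_power [simp]: "integrable (\<mu> k) (\<lambda>x. poly R x * x ^ m)"
  using integrable_poly_mult[of k R "monom 1 m"] by (simp add: poly_monom)

text \<open>Only the moment of order \<open>n k - 1\<close> is not killed by orthogonality, and
  there only x P_n and the k-th lower neighbour contribute. The shift \<open>i\<close> has dropped
  out, which is why both directions share the \<open>a k\<close>.\<close>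

lemma integral_rec_remainder:
  assumes n: "\<And>k. n k > 0" and m: "m < n k"
  shows "(LINT x|\<mu> k. poly ([:0, 1:] * typeII \<mu> n - typeII \<mu> (inc n i) - smult c (typeII \<mu> n)
           - (\<Sum>j\<in>UNIV. smult (a j) (typeII \<mu> (dec n j)))) x * x ^ m)
       = (if m = n k - 1 then 1 / typeI_top (inc n k) k - a k / typeI_top n k else 0)"
proof -
  let ?I = "\<lambda>R m. LINT x|\<mu> k. poly R x * x ^ m"
  have "?I ([:0, 1:] * typeII \<mu> n - typeII \<mu> (inc n i) - smult c (typeII \<mu> n)
           - (\<Sum>j\<in>UNIV. smult (a j) (typeII \<mu> (dec n j)))) m
    = ?I (typeII \<mu> n) (Suc m) - ?I (typeII \<mu> (inc n i)) m - c * ?I (typeII \<mu> n) m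
      - (a k * ?I (typeII \<mu> (dec n k)) m + a (other k) * ?I (typeII \<mu> (dec n (other k))) m)"
  proof -
    have "poly ([:0, 1:] * typeII \<mu> n - typeII \<mu> (inc n i) - smult c (typeII \<mu> n)
           - (\<Sum>j\<in>UNIV. smult (a j) (typeII \<mu> (dec n j)))) x * x ^ m
      = poly (typeII \<mu> n) x * x ^ Suc m - poly (typeII \<mu> (inc n i)) x * x ^ m - c * (poly (typeII \<mu> n) x * x ^ m)
       - (a k * (poly (typeII \<mu> (dec n k)) x * x ^ m) + a (other k) * (poly (typeII \<mu> (dec n (other k))) x * x ^ m))" for x
      unfolding sum_side'[of _ k] by (simp add: algebra_simps)
    then show ?thesis by (simp del: power_Suc)
  qed
  moreover have "?I (typeII \<mu> (inc n i)) m = 0" using m by (intro typeII_orthogonal) (auto simp: inc_def)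
  moreover have "?I (typeII \<mu> n) m = 0" using m by (intro typeII_orthogonal)
  moreover have "?I (typeII \<mu> (dec n (other k))) m = 0"
    using m by (intro typeII_orthogonal) (auto simp: dec_def)
  moreover have "?I (typeII \<mu> n) (Suc m) = (if m = n k - 1 then 1 / typeI_top (inc n k) k else 0)"
  proof (cases "m = n k - 1")
    case True
    then show ?thesis using typeII_moment[of "inc n k" k] n[of k] by (simp add: inc_apply del: power_Suc)
  next
    case False
    then show ?thesis using m by (auto intro!: typeII_orthogonal simp del: power_Suc)
  qed
  moreover have "?I (typeII \<mu> (dec n k)) m = (if m = n k - 1 then 1 / typeI_top n k else 0)"
  proof (cases "m = n k - 1")
    case True
    then show ?thesis using typeII_moment[of n k, OF n] by simp
  next
    case False
    then show ?thesis using m by (auto intro!: typeII_orthogonal simp: dec_def)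
  qed
  ultimately show ?thesis by (simp del: power_Suc)
qed

text \<open>The recurrence says that the remainder is 0. Its moment of order \<open>n k - 1\<close>
  determines \<open>a k\<close> and its coefficient of degree |n| determines \<open>b i\<close>;
  conversely these choices give it degree below |n| and full orthogonality.\<close>

lemma is_rec_coeffs_iff:
  assumes n: "\<And>k. n k > 0"
  shows "is_rec_coeffs \<mu> n a b \<longleftrightarrow> a = rec_a_val n \<and>
    b = (\<lambda>i. coeff ([:0, 1:] * typeII \<mu> n - typeII \<mu> (inc n i)) (msize n))"
proof -
  let ?R = "\<lambda>i. [:0, 1:] * typeII \<mu> n - typeII \<mu> (inc n i) - smult (b i) (typeII \<mu> n) - (\<Sum>j\<in>UNIV. smult (a j) (typeII \<mu> (dec n j)))"
  let ?b = "\<lambda>i. coeff ([:0, 1:] * typeII \<mu> n - typeII \<mu> (inc n i)) (msize n)"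
  have top: "coeff (typeII \<mu> (dec n j)) (msize n) = 0" for j
    using msize_pos[of n j, OF n] n[of j] by (intro coeff_eq_0) (simp add: msize_dec)
  have cR: "coeff (?R i) (msize n) = ?b i - b i" for i
    by (simp add: coeff_sum top)
  have "is_rec_coeffs \<mu> n a b \<longleftrightarrow> (\<forall>i. ?R i = 0)"
    using n unfolding is_rec_coeffs_def by (simp add: n[THEN gr_implies_not0] algebra_simps)
  also have "\<dots> \<longleftrightarrow> a = rec_a_val n \<and> b = ?b"
  proof
    assume R: "\<forall>i. ?R i = 0"
    have "a k = rec_a_val n k" for k
    proof -
      have "1 / typeI_top (inc n k) k - a k / typeI_top n k = 0"
      proof -
        have "(LINT x|\<mu> k. poly (?R I1) x * x ^ (n k - 1)) = 0"
          unfolding R[rule_format, of I1] by simp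
        moreover have "n k - 1 < n k" using n[of k] by simp
        note integral_rec_remainder[where n=n, OF n this, where i=I1 and c="b I1" and a=a]
        ultimately show ?thesis by simp
      qed
      then show ?thesis using typeI_top_neq_0[of n k] n[of k] by (simp add: rec_a_val_def field_simps)
    qed
    moreover have "b i = ?b i" for i using cR[of i] unfolding R[rule_format, of i] by simp
    ultimately show "a = rec_a_val n \<and> b = ?b" by auto
  next
    assume ab: "a = rec_a_val n \<and> b = ?b"
    show "\<forall>i. ?R i = 0"
    proof
      fix i show "?R i = 0"
      proof (rule orthogonal_eq_0[of n])
        show "(LINT x|\<mu> k. poly (?R i) x * x ^ m) = 0" if "m < n k" for k m
          unfolding integral_rec_remainder[where n=n, OF n that] using ab typeI_top_neq_0[of n k] n
          by (auto simp: rec_a_val_def)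
        show "coeff (?R i) l = 0" if l: "msize n \<le> l" for l
        proof -
          consider "l = msize n" | "l = Suc (msize n)" | "l > Suc (msize n)" using l by linarith
          then show ?thesis
          proof cases
            case 1
            then show ?thesis using cR[of i] ab by simp
          next
            case 2
            have "coeff (typeII \<mu> (dec n j)) l = 0" for j
              using n[of j] 2 by (intro coeff_eq_0) (simp add: msize_dec)
            moreover have "coeff (typeII \<mu> n) l = 0" using 2 by (intro coeff_eq_0) simp
            moreover have "coeff (typeII \<mu> (inc n i)) l = 1" using 2 lead_coeff_typeII[of "inc n i"] by simp
            ultimately show ?thesis using 2 by (simp add: coeff_sum)
          next
            case 3
            have "coeff (typeII \<mu> (dec n j)) l = 0" for j
              using n[of j] 3 by (intro coeff_eq_0) (simp add: msize_dec)
            moreover have "coeff (typeII \<mu> n) l = 0" "coeff (typeII \<mu> n) (l - 1) = 0" "coeff (typeII \<mu> (inc n i)) l = 0"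
              using 3 by (auto intro!: coeff_eq_0)
            ultimately show ?thesis using 3 by (cases l) (simp_all add: coeff_sum)
          qed
        qed
      qed
    qed
  qed
  finally show ?thesis .
qed

lemma rec_coeffs:
  assumes n: "\<And>k. n k > 0"
  shows "is_rec_coeffs \<mu> n (rec_a \<mu> n) (rec_b \<mu> n)" and "rec_a \<mu> n = rec_a_val n"
proof -
  show a: "rec_a \<mu> n = rec_a_val n"
    unfolding rec_a_def is_rec_coeffs_iff[OF n] by (rule the_equality) auto
  have b: "rec_b \<mu> n = (\<lambda>i. coeff ([:0, 1:] * typeII \<mu> n - typeII \<mu> (inc n i)) (msize n))"
    unfolding rec_b_def is_rec_coeffs_iff[OF n] by (rule the_equality) auto
  show "is_rec_coeffs \<mu> n (rec_a \<mu> n) (rec_b \<mu> n)"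
    unfolding is_rec_coeffs_iff[OF n] using a b by simp
qed

text \<open>The defect \<open>G\<close> of the relation without the \<open>b\<close> term satisfies
  the degree bounds of index \<open>n\<close> and has vanishing moments below |n| - 1. By normality
  it is a multiple of A_n, and pairing with the type II polynomial of \<open>n0\<close> identifies
  the factor as \<open>b\<close>.\<close>

lemma typeI_recurrence:
  fixes i k :: side
  assumes n0: "\<And>k. n0 k > 0"
  defines "n \<equiv> inc n0 i"
  shows "[:0, 1:] * typeI \<mu> n k = typeI \<mu> n0 k + smult (rec_b \<mu> n0 i) (typeI \<mu> n k)
    + (\<Sum>j\<in>UNIV. smult (rec_a \<mu> n j) (typeI \<mu> (inc n j) k))"
proof -
  have n: "n k > 0" for k using n0[of k] by (simp add: n_def inc_def)
  have N: "msize n > 0" "msize n0 > 0" using msize_pos[of n k] msize_pos[of n0 k] n n0 by auto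
  have Nn: "msize n = Suc (msize n0)" by (simp add: n_def)
  define F where "F k = [:0, 1:] * typeI \<mu> n k - (\<Sum>j\<in>UNIV. smult (rec_a \<mu> n j) (typeI \<mu> (inc n j) k))" for k
  define G where "G k = F k - typeI \<mu> n0 k" for k
  have pF: "pairing \<mu> F p = pairing \<mu> (typeI \<mu> n) (p * [:0, 1:]) - (\<Sum>j\<in>UNIV. rec_a \<mu> n j * pairing \<mu> (typeI \<mu> (inc n j)) p)" for p
    unfolding F_def pairing_diff pairing_sum pairing_smult pairing_mult_right ..
  have inc0: "pairing \<mu> (typeI \<mu> (inc n j)) p = 0" if "degree p < msize n" for p j
    using that by (subst pairing_typeI) (auto intro: coeff_eq_0)
  \<comment> \<open>Multiplication by x creates one coefficient too high; as a quotient of leading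
    coefficients, \<open>rec_a\<close> cancels exactly that one.\<close>
  have dF: "coeff (F k) l = 0" if "n k \<le> l" for k l
  proof (cases "l = n k")
    case True
    have a: "rec_a \<mu> n k * coeff (typeI \<mu> (inc n k) k) (n k) = coeff (typeI \<mu> n k) (n k - 1)"
      using typeI_top_neq_0[of "inc n k" k] rec_coeffs(2)[OF n]
      by (simp add: rec_a_val_def typeI_top_def inc_def)
    have "coeff (typeI \<mu> (inc n (other k)) k) (n k) = 0"
      by (rule typeI_coeff_0) (simp_all add: inc_apply)
    then show ?thesis using a n[of k] True unfolding F_def sum_side'[of _ k] by (cases "n k") auto
  next
    case False
    then have l: "n k < l" using that by simp
    have "coeff (typeI \<mu> (inc n j) k) l = 0" for j
      using l by (intro typeI_coeff_0) (auto simp: inc_apply)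
    moreover have "coeff (typeI \<mu> n k) l = 0" "coeff (typeI \<mu> n k) (l - 1) = 0"
      using l by (auto intro!: typeI_coeff_0 N)
    ultimately show ?thesis using l unfolding F_def by (cases l) (auto simp: coeff_sum)
  qed
  have dG: "deg_bounded n G"
    unfolding deg_bounded_def G_def using dF typeI_coeff_0[OF N(2)]
    by (auto simp: n_def inc_def split: if_splits)
  have mG: "pairing \<mu> G (monom 1 m) = 0" if m: "m + 1 < msize n" for m
  proof -
    have "pairing \<mu> (typeI \<mu> n) (monom 1 m * [:0, 1:]) = (if m + 2 = msize n then 1 else 0)"
      using m by (subst pairing_typeI) (auto simp: N monom_Suc[symmetric] degree_monom_eq mult.commute)
    moreover have "pairing \<mu> (typeI \<mu> n0) (monom 1 m) = (if m + 2 = msize n then 1 else 0)"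
      using m Nn by (subst pairing_typeI) (auto simp: N degree_monom_eq)
    moreover have "pairing \<mu> (typeI \<mu> (inc n j)) (monom 1 m) = 0" for j
      using m by (intro inc0) (simp add: degree_monom_eq)
    ultimately show ?thesis unfolding G_def pairing_diff pF by simp
  qed
  define c where "c = pairing \<mu> G (monom 1 (msize n - 1))"
  have G: "G k = smult c (typeI \<mu> n k)" for k
  proof -
    have "G k - smult c (typeI \<mu> n k) = 0"
    proof (rule normality[of n "\<lambda>k. G k - smult c (typeI \<mu> n k)"])
      show "deg_bounded n (\<lambda>k. G k - smult c (typeI \<mu> n k))"
        using dG typeI_deg_bounded[OF N(1)] by (auto simp: deg_bounded_def)
      show "pairing \<mu> (\<lambda>k. G k - smult c (typeI \<mu> n k)) (monom 1 m) = 0" if "m < msize n" for m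
      proof (cases "m + 1 = msize n")
        case True
        then have "m = msize n - 1" by simp
        then show ?thesis unfolding pairing_diff pairing_smult using N
          by (subst pairing_typeI) (auto simp: c_def degree_monom_eq)
      next
        case False
        then show ?thesis unfolding pairing_diff pairing_smult using N that mG[of m]
          by (subst pairing_typeI) (auto simp: degree_monom_eq)
      qed
    qed
    then show ?thesis by simp
  qed
  have "c = rec_b \<mu> n0 i"
  proof -
    \<comment> \<open>A_n pairs with \<open>?P\<close> to 1 and A_{n0} to 0, so the pairing of
      \<open>G\<close> with \<open>?P\<close> is \<open>c\<close>. The type II recurrence for x
      \<open>?P\<close> evaluates it as \<open>rec_b\<close>.\<close>
    let ?P = "typeII \<mu> n0"
    have rec: "[:0, 1:] * ?P = typeII \<mu> n + smult (rec_b \<mu> n0 i) ?P + (\<Sum>k\<in>UNIV. smult (rec_a \<mu> n0 k) (typeII \<mu> (dec n0 k)))"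
      using rec_coeffs(1)[OF n0] n0 unfolding is_rec_coeffs_def n_def by (simp add: neq0_conv[symmetric] del: neq0_conv)
    have P1: "pairing \<mu> (typeI \<mu> n) ?P = 1"
      using N Nn by (subst pairing_typeI) (auto)
    have Pd: "pairing \<mu> (typeI \<mu> n) (typeII \<mu> (dec n0 k)) = 0" for k
    proof -
      have "msize (dec n0 k) < msize n0" using msize_dec[of n0 k] n0 N by simp
      then show ?thesis using N Nn by (subst pairing_typeI) (auto intro!: coeff_eq_0)
    qed
    have "pairing \<mu> F ?P = pairing \<mu> (typeI \<mu> n) ([:0, 1:] * ?P)"
      unfolding pF using inc0[of ?P] Nn by (simp add: mult.commute)
    also have "\<dots> = rec_b \<mu> n0 i"
      unfolding rec pairing_add_right pairing_sum_right pairing_smult_right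
      using typeII_pairing[OF typeI_deg_bounded[OF N(1)]] P1 Pd by simp
    finally have "pairing \<mu> G ?P = rec_b \<mu> n0 i"
      unfolding G_def pairing_diff using typeII_pairing[OF typeI_deg_bounded[OF N(2)]] by simp
    moreover have "pairing \<mu> G ?P = c"
      unfolding G[abs_def] pairing_smult P1 by simp
    ultimately show ?thesis by simp
  qed
  then show ?thesis using G[of k] unfolding G_def F_def by (simp add: algebra_simps)
qed

end

section \<open>Zeros of the type I polynomials\<close>

lemma prod_linear_sign:
  fixes x :: real
  assumes "finite Z"
  shows "\<forall>r\<in>Z. r < x \<Longrightarrow> poly (\<Prod>r\<in>Z. [:- r, 1:]) x > 0"
    and "\<forall>r\<in>Z. x < r \<Longrightarrow> (-1) ^ card Z * poly (\<Prod>r\<in>Z. [:- r, 1:]) x > 0"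
proof -
  show "poly (\<Prod>r\<in>Z. [:- r, 1:]) x > 0" if "\<forall>r\<in>Z. r < x"
    using that by (auto simp: poly_prod intro!: prod_pos)
  show "(-1) ^ card Z * poly (\<Prod>r\<in>Z. [:- r, 1:]) x > 0" if "\<forall>r\<in>Z. x < r"
  proof -
    have "(-1) ^ card Z * poly (\<Prod>r\<in>Z. [:- r, 1:]) x = (\<Prod>r\<in>Z. (-1) * (x - r))"
      using assms by (simp only: prod.distrib prod_constant) (simp add: poly_prod)
    also have "\<dots> > 0" using that by (intro prod_pos) auto
    finally show ?thesis .
  qed
qed

text \<open>Horner's scheme: a coefficient of the quotient is the tail of \<open>p\<close> above it,
  evaluated at \<open>c\<close>. Thus each is polynomial in \<open>c\<close>, and integrating over
  \<open>c\<close> leaves a polynomial in the other variable.\<close>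

lemma coeff_synthetic_div: "coeff (synthetic_div p c) i = poly (poly_shift (Suc i) p) c"
proof (induction p arbitrary: i)
  case (pCons a p)
  have sh: "poly_shift (Suc n) (pCons a p) = poly_shift n p" for n
    by (simp add: poly_eq_iff coeff_poly_shift)
  show ?case using pCons.IH by (cases i) (auto simp: sh)
qed simp

lemma poly_shift_eq_0: "degree p < n \<Longrightarrow> poly_shift n p = 0"
  by (simp add: poly_eq_iff coeff_poly_shift coeff_eq_0)

lemma degree_poly_shift: "degree (poly_shift n p) \<le> degree p - n"
  by (rule degree_le) (auto simp: coeff_poly_shift intro!: coeff_eq_0)

lemma poly_synthetic_div_sum:
  fixes p :: "'a::comm_ring_1 poly"
  shows "poly (synthetic_div p c) z = (\<Sum>i<degree p. poly (poly_shift (Suc i) p) c * z ^ i)"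
proof (cases "degree p = 0")
  case False
  have "poly (synthetic_div p c) z = (\<Sum>i\<le>degree p - 1. coeff (synthetic_div p c) i * z ^ i)"
    by (simp add: poly_altdef degree_synthetic_div)
  also have "{..degree p - 1} = {..<degree p}" using False by auto
  finally show ?thesis by (simp add: coeff_synthetic_div)
qed (use synthetic_div_eq_0_iff[of p c] in simp)

lemma poly_diff_synthetic_div:
  fixes p :: "'a::comm_ring_1 poly"
  shows "poly p z - poly p c = (z - c) * poly (synthetic_div p c) z"
proof -
  have "poly p z = poly ([:- c, 1:] * synthetic_div p c + [:poly p c:]) z"
    by (simp only: synthetic_div_correct')
  then show ?thesis by (simp add: algebra_simps)
qed

lemma poly_synthetic_div_commute:
  fixes p :: "real poly"
  shows "poly (synthetic_div p c) z = poly (synthetic_div p z) c"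
proof (cases "c = z")
  case False
  have "(z - c) * poly (synthetic_div p c) z = (z - c) * poly (synthetic_div p z) c"
    using poly_diff_synthetic_div[of p z c] poly_diff_synthetic_div[of p c z] by (simp add: algebra_simps)
  then show ?thesis using False by simp
qed simp

definition cpoly :: "real poly \<Rightarrow> complex \<Rightarrow> complex" where
  "cpoly p z = poly (map_poly of_real p) z"

lemma cpoly_0 [simp]: "cpoly 0 z = 0"
  and cpoly_pCons [simp]: "cpoly (pCons a p) z = of_real a + z * cpoly p z"
  and cpoly_add [simp]: "cpoly (p + q) z = cpoly p z + cpoly q z"
  and cpoly_diff [simp]: "cpoly (p - q) z = cpoly p z - cpoly q z"
  and cpoly_smult [simp]: "cpoly (smult c p) z = of_real c * cpoly p z"
proof -
  have "map_poly of_real (p + q) = map_poly of_real p + (map_poly of_real q :: complex poly)"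
    "map_poly of_real (p - q) = map_poly of_real p - (map_poly of_real q :: complex poly)"
    "map_poly of_real (smult c p) = smult (of_real c) (map_poly of_real p :: complex poly)"
    by (simp_all add: poly_eq_iff coeff_map_poly)
  then show "cpoly (p + q) z = cpoly p z + cpoly q z" "cpoly (p - q) z = cpoly p z - cpoly q z"
    "cpoly (smult c p) z = of_real c * cpoly p z"
    by (simp_all add: cpoly_def)
qed (simp_all add: cpoly_def map_poly_pCons)

lemma cpoly_1 [simp]: "cpoly 1 z = 1"
  by (simp add: cpoly_def)

lemma cpoly_of_real [simp]: "cpoly p (of_real x) = of_real (poly p x)"
  by (induction p) auto

lemma cpoly_mult [simp]: "cpoly (p * q) z = cpoly p z * cpoly q z"
  by (induction p) (auto simp: algebra_simps)

lemma cpoly_sum: "cpoly (\<Sum>i\<in>S. f i) z = (\<Sum>i\<in>S. cpoly (f i) z)"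
  by (induction S rule: infinite_finite_induct) auto

lemma cpoly_prod: "cpoly (\<Prod>i\<in>S. f i) z = (\<Prod>i\<in>S. cpoly (f i) z)"
  by (induction S rule: infinite_finite_induct) auto

lemma cpoly_monom: "cpoly (monom c n) z = of_real c * z ^ n"
  by (simp add: cpoly_def map_poly_monom poly_monom)

lemma cpoly_holomorphic [holomorphic_intros]: "cpoly p holomorphic_on S"
  unfolding cpoly_def[abs_def] by (intro holomorphic_intros)

lemma cpoly_diff_synthetic_div: "cpoly p z - of_real (poly p c) = (z - of_real c) * cpoly (synthetic_div p c) z"
  using cpoly_add[of "[:- c, 1:] * synthetic_div p c" "[:poly p c:]" z]
  by (simp only: synthetic_div_correct') (simp add: algebra_simps)

lemma cpoly_synthetic_div_sum:
  "cpoly (synthetic_div p c) z = (\<Sum>i<degree p. of_real (poly (poly_shift (Suc i) p) c) * z ^ i)"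
proof -
  have "synthetic_div p c = (\<Sum>i<degree p. monom (poly (poly_shift (Suc i) p) c) i)"
    by (auto simp: poly_eq_iff coeff_sum_monom coeff_synthetic_div poly_shift_eq_0)
  then have "cpoly (synthetic_div p c) z = cpoly (\<Sum>i<degree p. monom (poly (poly_shift (Suc i) p) c) i) z"
    by (rule arg_cong)
  then show ?thesis by (simp add: cpoly_sum cpoly_monom)
qed

context angelesco_system
begin

lemma msize_eq: "msize n = n k + n (other k)"
  by (cases k) (auto simp: msize_def)

lemma degree_typeI_le: "msize n > 0 \<Longrightarrow> degree (typeI \<mu> n k) \<le> n k - 1"
  by (rule degree_le) (auto intro!: typeI_coeff_0)

lemma degree_typeI: "n k > 0 \<Longrightarrow> degree (typeI \<mu> n k) = n k - 1"
  using degree_typeI_le[of n k] msize_pos[of n k] typeI_top_neq_0[of n k]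
  by (intro antisym le_degree) (auto simp: typeI_top_def)

lemma typeI_neq_0: "n k > 0 \<Longrightarrow> typeI \<mu> n k \<noteq> 0"
  using typeI_top_neq_0[of n k] by (auto simp: typeI_top_def)

text \<open>The sign polynomial u q_1 q_2 pairs positively with A_n, so its degree is at least |n| -
  1. Since \<open>u\<close> has degree at most 1, no degree is lost in either \<open>q k\<close>,
  and then all zeros are simple and in the interval.\<close>

lemma typeI_factorization:
  assumes n: "\<And>k. n k > 0"
  shows "\<exists>Z. \<forall>k. finite (Z k) \<and> Z k \<subseteq> Delta \<mu> k \<and> card (Z k) = n k - 1 \<and>
    typeI \<mu> n k = smult (typeI_top n k) (\<Prod>r\<in>Z k. [:- r, 1:])"
proof -
  let ?A = "typeI \<mu> n"
  have N: "msize n > 0" by (rule msize_pos[of n I1, OF n])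
  have "\<exists>q. q \<noteq> 0 \<and> degree q \<le> degree (?A k) \<and> (\<forall>x\<in>Delta \<mu> k. poly q x * poly (?A k) x \<ge> 0) \<and>
    (\<forall>x. poly q x = 0 \<longrightarrow> x \<in> Delta \<mu> k) \<and>
    (degree q < degree (?A k) \<or> (\<exists>Z. finite Z \<and> Z \<subseteq> Delta \<mu> k \<and> ?A k = smult (lead_coeff (?A k)) (\<Prod>r\<in>Z. [:- r, 1:])))" for k
    using sign_pattern_poly[OF typeI_neq_0[of n k, OF n] ends_le[of k]] unfolding Delta_eq by blast
  then obtain q where q: "\<And>k. q k \<noteq> 0" "\<And>k. degree (q k) \<le> degree (?A k)"
    "\<And>k x. x \<in> Delta \<mu> k \<Longrightarrow> poly (q k) x * poly (?A k) x \<ge> 0" "\<And>k x. poly (q k) x = 0 \<Longrightarrow> x \<in> Delta \<mu> k"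
    "\<And>k. degree (q k) < degree (?A k) \<or> (\<exists>Z. finite Z \<and> Z \<subseteq> Delta \<mu> k \<and> ?A k = smult (lead_coeff (?A k)) (\<Prod>r\<in>Z. [:- r, 1:]))"
    by metis
  obtain u where u: "u \<noteq> 0" "degree u \<le> 1" "\<And>k x. x \<in> Delta \<mu> k \<Longrightarrow> poly u x * poly (q (other k)) x > 0"
    using sign_multiplier[of q, OF q(1) q(4)] by auto
  have "poly (u * q I1 * q I2) x * poly (?A k) x \<ge> 0" if "x \<in> Delta \<mu> k" for k x
  proof -
    have "poly (u * q I1 * q I2) x * poly (?A k) x = (poly u x * poly (q (other k)) x) * (poly (q k) x * poly (?A k) x)"
      by (cases k) (auto simp: mult_ac)
    also have "\<dots> \<ge> 0"
      by (rule mult_nonneg_nonneg[OF less_imp_le[OF u(3)[OF that]] q(3)[OF that]])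
    finally show ?thesis .
  qed
  then have "pairing \<mu> ?A (u * q I1 * q I2) > 0"
    using pairing_positive[of ?A I1 "u * q I1 * q I2"] typeI_neq_0[of n I1, OF n] u(1) q(1) by simp
  then have "\<not> degree (u * q I1 * q I2) < msize n - 1"
    using pairing_typeI[OF N, of "u * q I1 * q I2"] by (auto simp: coeff_eq_0)
  then have "degree u + degree (q I1) + degree (q I2) \<ge> n I1 - 1 + (n I2 - 1) + 1"
    using n[of I1] n[of I2] by (simp add: degree_mult_eq u(1) q(1) msize_def)
  then have "degree (q k) \<ge> n k - 1" for k
    using u(2) q(2)[of I1] q(2)[of I2] by (cases k) (simp_all add: degree_typeI n)
  then have "\<exists>Z. finite Z \<and> Z \<subseteq> Delta \<mu> k \<and> ?A k = smult (lead_coeff (?A k)) (\<Prod>r\<in>Z. [:- r, 1:])" for k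
    using q(5)[of k] degree_typeI[of n k, OF n] by (metis not_le)
  then obtain Z where Z: "\<And>k. finite (Z k)" "\<And>k. Z k \<subseteq> Delta \<mu> k"
    "\<And>k. ?A k = smult (lead_coeff (?A k)) (\<Prod>r\<in>Z k. [:- r, 1:])"
    by metis
  have eq: "typeI \<mu> n k = smult (typeI_top n k) (\<Prod>r\<in>Z k. [:- r, 1:])" for k
    using Z(3)[of k] by (simp add: typeI_top_def degree_typeI[of n k, OF n])
  have "card (Z k) = n k - 1" for k
  proof -
    have "degree (\<Prod>r\<in>Z k. [:- r, 1:]) = card (Z k)"
      using Z(1) by (subst degree_prod_eq_sum_degree) auto
    then show ?thesis
      using arg_cong[OF eq[of k], of degree] typeI_top_neq_0[of n k] n[of k] by (simp add: degree_typeI)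
  qed
  then show ?thesis using Z(1,2) eq by blast
qed

lemma typeI_zeros_in_Delta:
  assumes n: "\<And>k. n k > 0" and z: "poly (typeI \<mu> n k) x = 0"
  shows "x \<in> Delta \<mu> k"
proof -
  obtain Z where Z: "\<And>k. finite (Z k)" "\<And>k. Z k \<subseteq> Delta \<mu> k"
    "\<And>k. typeI \<mu> n k = smult (typeI_top n k) (\<Prod>r\<in>Z k. [:- r, 1:])"
    using typeI_factorization[of n, OF n] by blast
  show ?thesis
    using z typeI_top_neq_0[of n k] n[of k] Z(1,2)[of k] unfolding Z(3)[of k]
    by (auto simp: poly_prod prod_zero_iff)
qed

lemma typeI_prod_zeros:
  assumes n: "\<And>k. n k > 0"
  shows "finite {x. poly (typeI \<mu> n k) x = 0}"
    and "typeI \<mu> n k = smult (typeI_top n k) (\<Prod>r | poly (typeI \<mu> n k) r = 0. [:- r, 1:])"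
proof -
  obtain Z where Z: "\<And>k. finite (Z k)"
    "\<And>k. typeI \<mu> n k = smult (typeI_top n k) (\<Prod>r\<in>Z k. [:- r, 1:])"
    using typeI_factorization[of n, OF n] by blast
  have "{x. poly (typeI \<mu> n k) x = 0} = Z k"
    using typeI_top_neq_0[of n k] n[of k] Z(1)[of k] unfolding Z(2)[of k]
    by (auto simp: poly_prod prod_zero_iff)
  then show "finite {x. poly (typeI \<mu> n k) x = 0}"
    "typeI \<mu> n k = smult (typeI_top n k) (\<Prod>r | poly (typeI \<mu> n k) r = 0. [:- r, 1:])"
    using Z by auto
qed

text \<open>Two test polynomials settle the signs of the leading coefficients. The polynomial s_1
  A_1 A_2 has degree |n| - 2 and pairs to 0, which fixes the sign of s_1 s_2; with the factor x -
  \<xi> the degree is |n| - 1 and the pairing is the leading coefficient.\<close>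

lemma gap_sign:
  assumes n: "\<And>k. n k > 0" and \<xi>: "right_end \<mu> I1 < \<xi>" "\<xi> < left_end \<mu> I2"
  shows typeI_top_I2_pos: "typeI_top n I2 > 0"
    and typeI_top_I1_sign: "(-1) ^ n I2 * typeI_top n I1 > 0"
    and typeI_other_sign: "\<And>k x. x \<in> Delta \<mu> k \<Longrightarrow> (-1) ^ n I2 * (x - \<xi>) * poly (typeI \<mu> n (other k)) x > 0"
proof -
  let ?A = "typeI \<mu> n"
  have N: "msize n > 0" by (rule msize_pos[of n I1, OF n])
  obtain Z where Z: "\<And>k. finite (Z k)" "\<And>k. Z k \<subseteq> Delta \<mu> k" "\<And>k. card (Z k) = n k - 1"
    "\<And>k. ?A k = smult (typeI_top n k) (\<Prod>r\<in>Z k. [:- r, 1:])"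
    using typeI_factorization[of n, OF n] by blast
  let ?p = "\<lambda>k x. poly (\<Prod>r\<in>Z k. [:- r, 1:]) x"
  let ?s1 = "typeI_top n I1" and ?s2 = "typeI_top n I2"
  define \<sigma> :: real where "\<sigma> = (-1) ^ n I2"
  have \<sigma>2: "\<sigma> * \<sigma> = 1" by (simp add: \<sigma>_def flip: power_mult_distrib)
  have p1: "?p I1 x > 0" if "x \<in> Delta \<mu> I2" for x
    using Z(1,2)[of I1] that ord by (intro prod_linear_sign(1)) (auto simp: Delta_eq)
  have p2: "- \<sigma> * ?p I2 x > 0" if "x \<in> Delta \<mu> I1" for x
  proof -
    have "(-1) ^ card (Z I2) * ?p I2 x > 0"
      using Z(1,2)[of I2] that ord by (intro prod_linear_sign(2)) (auto simp: Delta_eq)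
    moreover have "(-1) ^ card (Z I2) = - \<sigma>" using n[of I2] Z(3)[of I2] unfolding \<sigma>_def by (cases "n I2") auto
    ultimately show ?thesis by simp
  qed
  have A1: "poly (?A I1) x = ?s1 * ?p I1 x" and A2: "poly (?A I2) x = ?s2 * ?p I2 x" for x
    using Z(4)[of I1] Z(4)[of I2] by (metis poly_smult)+
  have nz: "?s1 \<noteq> 0" "?s2 \<noteq> 0" using typeI_top_neq_0 n by auto
  have dA: "degree (?A I1 * ?A I2) = msize n - 2"
    using n[of I1] n[of I2] by (simp add: degree_mult_eq typeI_neq_0[of n, OF n] degree_typeI[of n, OF n] msize_def)
  have N2: "msize n \<ge> 2" using n[of I1] n[of I2] by (simp add: msize_def)
  \<comment> \<open>With the opposite sign s_1 A_1 A_2 would already be a sign polynomial,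
    contradicting its zero pairing. The factor - \<open>\<sigma>\<close> is the sign on the left
    interval of a product over \<open>n I2 - 1\<close> zeros to its right.\<close>
  have s12: "\<sigma> * ?s1 * ?s2 > 0"
  proof (rule ccontr)
    assume "\<not> ?thesis"
    moreover have "\<sigma> * ?s1 * ?s2 \<noteq> 0" using nz by (simp add: \<sigma>_def)
    ultimately have lt: "\<sigma> * ?s1 * ?s2 < 0" by linarith
    have "pairing \<mu> ?A (smult ?s1 (?A I1 * ?A I2)) > 0"
    proof (rule pairing_positive[of ?A I1])
      show "0 \<le> poly (smult ?s1 (?A I1 * ?A I2)) x * poly (?A k) x" if x: "x \<in> Delta \<mu> k" for k x
      proof (cases k)
        case I1
        have "poly (smult ?s1 (?A I1 * ?A I2)) x * poly (?A k) x
          = (- (\<sigma> * ?s1 * ?s2)) * (- \<sigma> * ?p I2 x) * (poly (?A I1) x)\<^sup>2"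
          using \<sigma>2 unfolding I1 poly_smult poly_mult A2 by algebra
        also have "\<dots> \<ge> 0" 
          by (rule mult_nonneg_nonneg[OF mult_nonneg_nonneg[OF _ less_imp_le[OF p2]] zero_le_power2])
             (use lt x I1 in auto)
        finally show ?thesis .
      next
        case I2
        have "poly (smult ?s1 (?A I1 * ?A I2)) x * poly (?A k) x = ?s1\<^sup>2 * ?p I1 x * (poly (?A I2) x)\<^sup>2"
          unfolding I2 poly_smult poly_mult A1 by algebra
        also have "\<dots> \<ge> 0" 
          by (rule mult_nonneg_nonneg[OF mult_nonneg_nonneg[OF zero_le_power2 less_imp_le[OF p1]] zero_le_power2])
             (use x I2 in auto)
        finally show ?thesis .
      qed
    qed (use nz typeI_neq_0[of n, OF n] in auto)
    moreover have "pairing \<mu> ?A (smult ?s1 (?A I1 * ?A I2)) = 0"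
      using dA N2 nz by (subst pairing_typeI[OF N]) (auto intro!: coeff_eq_0)
    ultimately show False by simp
  qed
  have lin: "poly [:- \<xi>, 1:] x = x - \<xi>" for x by simp
  \<comment> \<open>Now the signs agree on both intervals; the pairing is evaluated below as s_1^2
    s_2, whence s_2 > 0.\<close>
  have "pairing \<mu> ?A (smult ?s1 ([:- \<xi>, 1:] * ?A I1 * ?A I2)) > 0"
  proof (rule pairing_positive[of ?A I1])
    show "0 \<le> poly (smult ?s1 ([:- \<xi>, 1:] * ?A I1 * ?A I2)) x * poly (?A k) x" if x: "x \<in> Delta \<mu> k" for k x
    proof (cases k)
      case I1
      have "poly (smult ?s1 ([:- \<xi>, 1:] * ?A I1 * ?A I2)) x * poly (?A k) x
        = (\<sigma> * ?s1 * ?s2) * ((\<xi> - x) * (- \<sigma> * ?p I2 x)) * (poly (?A I1) x)\<^sup>2"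
        using \<sigma>2 unfolding I1 poly_smult poly_mult A2 lin by algebra
      also have "\<dots> \<ge> 0" 
        by (rule mult_nonneg_nonneg[OF mult_nonneg_nonneg[OF less_imp_le[OF s12] mult_nonneg_nonneg[OF _ less_imp_le[OF p2]]] zero_le_power2])
           (use x I1 \<xi> in \<open>auto simp: Delta_eq\<close>)
      finally show ?thesis .
    next
      case I2
      have "poly (smult ?s1 ([:- \<xi>, 1:] * ?A I1 * ?A I2)) x * poly (?A k) x = ?s1\<^sup>2 * ((x - \<xi>) * ?p I1 x) * (poly (?A I2) x)\<^sup>2"
        unfolding I2 poly_smult poly_mult A1 lin by algebra
      also have "\<dots> \<ge> 0" 
        by (rule mult_nonneg_nonneg[OF mult_nonneg_nonneg[OF zero_le_power2 mult_nonneg_nonneg[OF _ less_imp_le[OF p1]]] zero_le_power2])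
           (use x I2 \<xi> in \<open>auto simp: Delta_eq\<close>)
      finally show ?thesis .
    qed
  qed (use nz typeI_neq_0[of n, OF n] in \<open>auto simp del: mult_pCons_left\<close>)
  moreover have "pairing \<mu> ?A (smult ?s1 ([:- \<xi>, 1:] * ?A I1 * ?A I2)) = ?s1\<^sup>2 * ?s2"
  proof -
    let ?D = "[:- \<xi>, 1:] * (?A I1 * ?A I2)"
    have "degree ?D = msize n - 1"
      using dA N2 by (subst degree_mult_eq) (auto simp: typeI_neq_0[of n, OF n])
    moreover have "lead_coeff ?D = ?s1 * ?s2"
      unfolding lead_coeff_mult by (simp add: typeI_top_def degree_typeI[of n, OF n])
    ultimately have "coeff ?D (msize n - 1) = ?s1 * ?s2" "degree ?D < msize n" using N by auto
    then show ?thesis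
      unfolding pairing_smult_right mult.assoc by (subst pairing_typeI[OF N]) (auto simp: power2_eq_square)
  qed
  ultimately show s2: "?s2 > 0" using nz by (simp add: zero_less_mult_iff)
  have s1: "\<sigma> * ?s1 > 0" using s12 s2 by (simp add: zero_less_mult_iff)
  then show "(-1) ^ n I2 * ?s1 > 0" by (simp add: \<sigma>_def)
  show "(-1) ^ n I2 * (x - \<xi>) * poly (?A (other k)) x > 0" if x: "x \<in> Delta \<mu> k" for k x
  proof (cases k)
    case I1
    have "\<sigma> * (x - \<xi>) * poly (?A (other k)) x = ?s2 * (\<xi> - x) * (- \<sigma> * ?p I2 x)"
      unfolding I1 by (simp add: A2 algebra_simps)
    also have "\<dots> > 0" 
      by (rule mult_pos_pos[OF mult_pos_pos[OF s2] p2]) (use x I1 \<xi> in \<open>auto simp: Delta_eq\<close>)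
    finally show ?thesis unfolding \<sigma>_def .
  next
    case I2
    have "\<sigma> * (x - \<xi>) * poly (?A (other k)) x = (\<sigma> * ?s1) * (x - \<xi>) * ?p I1 x"
      unfolding I2 by (simp add: A1 algebra_simps)
    also have "\<dots> > 0" 
      by (rule mult_pos_pos[OF mult_pos_pos[OF s1] p1]) (use x I2 \<xi> in \<open>auto simp: Delta_eq\<close>)
    finally show ?thesis unfolding \<sigma>_def .
  qed
qed

lemma typeI_top_signs:
  assumes n: "\<And>k. n k > 0"
  shows "typeI_top n I2 > 0" "(-1) ^ n I2 * typeI_top n I1 > 0"
proof -
  obtain \<xi> where \<xi>: "right_end \<mu> I1 < \<xi>" "\<xi> < left_end \<mu> I2" using ord dense by blast
  show "typeI_top n I2 > 0" "(-1) ^ n I2 * typeI_top n I1 > 0"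
    using gap_sign(1,2)[of n, OF n \<xi>] by auto
qed

text \<open>Both leading coefficients in the quotient have the same sign: positive for
  \<open>I2\<close>, and for \<open>I1\<close> dependent only on \<open>n I2\<close>, which the
  increment leaves alone.\<close>

lemma rec_a_pos:
  assumes n: "\<And>k. n k > 0"
  shows "rec_a \<mu> n k > 0"
proof -
  have n': "inc n k j > 0" for j using n[of j] by (simp add: inc_apply)
  have a: "rec_a \<mu> n k = typeI_top n k / typeI_top (inc n k) k"
    using rec_coeffs(2)[of n, OF n] by (simp add: rec_a_val_def)
  show ?thesis
  proof (cases k)
    case I1
    have "(-1) ^ n I2 * typeI_top n k > 0" "(-1) ^ n I2 * typeI_top (inc n k) k > 0"
      using typeI_top_signs(2)[of n, OF n] typeI_top_signs(2)[of "inc n k", OF n'] I1 by (auto simp: inc_apply)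
    then have "((-1) ^ n I2 * typeI_top n k) / ((-1) ^ n I2 * typeI_top (inc n k) k) > 0" by (rule divide_pos_pos)
    then show ?thesis unfolding a by simp
  next
    case I2
    then show ?thesis unfolding a
      using typeI_top_signs(1)[of n, OF n] typeI_top_signs(1)[of "inc n k", OF n'] by simp
  qed
qed

text \<open>For a sign polynomial \<open>D\<close> of the quotients B / (x - x0), write D(x) = D(x0)
  + (x - x0) times a quotient of lower degree. The second part pairs with \<open>B\<close> to 0, so
  a positive number equals D(x0) times the sum in question. \<open>S\<close> collects the components
  in which \<open>x0\<close> is a root and the division is polynomial; on the others x - x0 has the
  constant sign \<open>\<sigma>\<close>.\<close>

lemma real_pole_nonzero:
  fixes x0 :: real
  assumes orth: "\<And>p. degree p < N \<Longrightarrow> pairing \<mu> B p = 0"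
    and B: "B k0 \<noteq> 0"
    and S: "\<And>k. k \<in> S \<Longrightarrow> poly (B k) x0 = 0" "\<And>k. k \<notin> S \<Longrightarrow> x0 \<notin> Delta \<mu> k"
    and deg: "(\<Sum>k\<in>UNIV. degree (B k) - (if k \<in> S then 1 else 0)) + (if B I1 = 0 \<or> B I2 = 0 then 0 else 1) \<le> N"
  shows "(\<Sum>k\<in>UNIV. LINT x|\<mu> k. (if k \<in> S then poly (synthetic_div (B k) x0) x else poly (B k) x / (x - x0))) \<noteq> 0"
proof -
  define g where "g k x = (if k \<in> S then poly (synthetic_div (B k) x0) x else poly (B k) x / (x - x0))" for k x
  define \<sigma> where "\<sigma> k = (if left_end \<mu> k < x0 then -1 else 1 :: real)" for k
  define B' where "B' k = (if k \<in> S then synthetic_div (B k) x0 else smult (\<sigma> k) (B k))" for k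
  have B'nz: "B' k \<noteq> 0 \<longleftrightarrow> B k \<noteq> 0" for k
  proof (cases "k \<in> S")
    case True
    have "degree (B k) = 0 \<longleftrightarrow> B k = 0" using S(1)[OF True] by (metis degree_0 degree_eq_zeroE mult_zero_right poly_0 poly_pCons add.right_neutral)
    then show ?thesis using True by (simp add: B'_def synthetic_div_eq_0_iff)
  qed (auto simp: B'_def \<sigma>_def)
  have B'deg: "degree (B' k) = degree (B k) - (if k \<in> S then 1 else 0)" for k
    by (auto simp: B'_def degree_synthetic_div \<sigma>_def)
  have gx: "g k x * (x - x0) = poly (B k) x" if "x \<in> Delta \<mu> k" for k x
  proof (cases "k \<in> S")
    case True
    then show ?thesis using poly_diff_synthetic_div[of "B k" x x0] S(1)[OF True] by (simp add: g_def mult.commute)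
  next
    case False
    then have "x \<noteq> x0" using S(2) that by auto
    then show ?thesis using False by (simp add: g_def)
  qed
  have sg: "\<exists>c>0. g k x = c * poly (B' k) x" if "x \<in> Delta \<mu> k" for k x
  proof (cases "k \<in> S")
    case False
    have x0: "x0 < left_end \<mu> k \<or> right_end \<mu> k < x0" using S(2)[OF False] by (auto simp: Delta_eq)
    have "g k x = (\<sigma> k / (x - x0)) * poly (B' k) x"
      using False by (simp add: g_def B'_def \<sigma>_def)
    moreover have "\<sigma> k / (x - x0) > 0" using x0 that ends_le[of k] by (auto simp: \<sigma>_def Delta_eq divide_simps)
    ultimately show ?thesis by blast
  qed (auto simp: g_def B'_def intro: exI[of _ 1])
  have gcont: "continuous_on (Delta \<mu> k) (g k)" for k
  proof (cases "k \<in> S")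
    case True
    then have "g k = poly (synthetic_div (B k) x0)" by (auto simp: g_def)
    then show ?thesis by (simp add: continuous_intros)
  next
    case False
    then have "g k = (\<lambda>x. poly (B k) x / (x - x0))" by (auto simp: g_def)
    moreover have "x - x0 \<noteq> 0" if "x \<in> Delta \<mu> k" for x using S(2)[OF False] that by auto
    ultimately show ?thesis by (auto intro!: continuous_intros)
  qed
  have [measurable]: "g k \<in> borel_measurable borel" for k unfolding g_def by measurable
  have gint: "integrable (\<mu> k) (\<lambda>x. poly p x * g k x)" for p k
    by (intro integrable_continuous_Delta continuous_intros gcont) measurable
  obtain D where D: "D \<noteq> 0" "degree D \<le> degree (B' I1) + degree (B' I2) + (if B' I1 = 0 \<or> B' I2 = 0 then 0 else 1)"
    "\<And>k x. x \<in> Delta \<mu> k \<Longrightarrow> poly D x * poly (B' k) x \<ge> 0"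
    using sign_polynomial[of B' k0] B B'nz by blast
  have degD: "degree D \<le> N"
    using D(2) deg B'nz[of I1] B'nz[of I2] unfolding B'deg sum_side by auto
  have pos: "(\<Sum>k\<in>UNIV. LINT x|\<mu> k. poly D x * g k x) > 0"
  proof (rule sum_integral_positive[where k=k0])
    show "0 \<le> poly D x * g k x" if "x \<in> Delta \<mu> k" for k x
    proof -
      obtain c where c: "c > 0" "g k x = c * poly (B' k) x" using sg[OF \<open>x \<in> Delta \<mu> k\<close>] by blast
      have "0 \<le> c * (poly D x * poly (B' k) x)" 
        by (rule mult_nonneg_nonneg[OF less_imp_le[OF c(1)] D(3)[OF that]])
      then show ?thesis unfolding c(2) by (simp only: mult_ac)
    qed
    have "{x \<in> Delta \<mu> k0. poly D x * g k0 x = 0} \<subseteq> {x. poly (D * B' k0) x = 0}"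
      using sg[of _ k0] by fastforce
    then show "finite {x \<in> Delta \<mu> k0. poly D x * g k0 x = 0}"
      using poly_roots_finite[of "D * B' k0"] D(1) B B'nz by (meson finite_subset mult_eq_0_iff)
  qed (rule gint)
  have split: "(LINT x|\<mu> k. poly D x * g k x) = poly D x0 * (LINT x|\<mu> k. g k x) + (LINT x|\<mu> k. poly (synthetic_div D x0) x * poly (B k) x)" for k
  proof -
    have "(LINT x|\<mu> k. poly D x * g k x) = (LINT x|\<mu> k. poly D x0 * g k x + poly (synthetic_div D x0) x * poly (B k) x)"
    proof (rule integral_cong_AE)
      show "AE x in \<mu> k. poly D x * g k x = poly D x0 * g k x + poly (synthetic_div D x0) x * poly (B k) x"
        using AE_Delta
      proof eventually_elim
        case (elim x)
        have "poly D x = poly D x0 + (x - x0) * poly (synthetic_div D x0) x"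
          using poly_diff_synthetic_div[of D x x0] by simp
        then show ?case using gx[OF elim, symmetric] by algebra
      qed
    qed measurable
    then show ?thesis using gint[of k 1] gint[of k "[:poly D x0:]"] by simp
  qed
  have "(\<Sum>k\<in>UNIV. LINT x|\<mu> k. poly D x * g k x) = poly D x0 * (\<Sum>k\<in>UNIV. LINT x|\<mu> k. g k x) + pairing \<mu> B (synthetic_div D x0)"
    unfolding split sum.distrib sum_distrib_left pairing_def ..
  also have "pairing \<mu> B (synthetic_div D x0) = 0"
  proof (cases "degree D = 0")
    case True
    then have "synthetic_div D x0 = 0" by (simp add: synthetic_div_eq_0_iff)
    then show ?thesis by simp
  next
    case False
    then show ?thesis using degD by (intro orth) (simp add: degree_synthetic_div)
  qed
  finally show ?thesis using pos unfolding g_def[symmetric] by auto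
qed

end

section \<open>Linear forms off the intervals\<close>

lemma cauchy_tr_cnj: "cauchy_tr \<nu> f (cnj z) = cnj (cauchy_tr \<nu> f z)"
  unfolding cauchy_tr_def by (subst Bochner_Integration.integral_cnj[symmetric]) simp

context angelesco_system
begin

definition support_hull :: "real set" where
  "support_hull = Delta \<mu> I1 \<union> Delta \<mu> I2"

lemma support_hull_eq: "support_hull = (\<Union>k. Delta \<mu> k)"
  by (auto simp: support_hull_def UNIV_side)

lemma compact_support_hull: "compact support_hull"
  unfolding support_hull_def by (intro compact_Un compact_Delta)

lemma Delta_subset_hull: "Delta \<mu> k \<subseteq> support_hull"
  by (auto simp: support_hull_eq)

lemma not_in_hull_imp: "z \<notin> of_real ` support_hull \<Longrightarrow> z \<notin> of_real ` Delta \<mu> k"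
  using Delta_subset_hull by auto

lemma kernel_integrable:
  "z \<notin> of_real ` Delta \<mu> k \<Longrightarrow> integrable (\<mu> k) f \<Longrightarrow> integrable (\<mu> k) (\<lambda>x. of_real (f x) / (of_real x - z) :: complex)"
  by (rule M.cauchy_kernel_integrable[OF _ _ AE_Delta]) (auto simp: compact_imp_closed compact_Delta)

lemma cauchy_tr_mu_holomorphic:
  "integrable (\<mu> k) f \<Longrightarrow> cauchy_tr (\<mu> k) f holomorphic_on - (of_real ` Delta \<mu> k)"
  by (rule M.cauchy_tr_holomorphic[OF _ _ AE_Delta]) (auto simp: compact_imp_closed compact_Delta)

definition hull_bound :: real where
  "hull_bound = (SOME R. R > 0 \<and> (\<forall>x\<in>support_hull. \<bar>x\<bar> \<le> R))"

lemma hull_bound: "hull_bound > 0" "x \<in> support_hull \<Longrightarrow> \<bar>x\<bar> \<le> hull_bound"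
proof -
  obtain R where "\<forall>x\<in>support_hull. \<bar>x\<bar> \<le> R"
    using compact_imp_bounded[OF compact_support_hull] unfolding bounded_iff real_norm_def by blast
  then have "\<exists>R. R > 0 \<and> (\<forall>x\<in>support_hull. \<bar>x\<bar> \<le> R)" by (intro exI[of _ "max R 1"]) auto
  from someI_ex[OF this] show "hull_bound > 0" "x \<in> support_hull \<Longrightarrow> \<bar>x\<bar> \<le> hull_bound"
    by (auto simp: hull_bound_def)
qed

lemma AE_hull_bound: "AE x in \<mu> k. \<bar>x\<bar> \<le> hull_bound"
  using AE_Delta by eventually_elim (use hull_bound Delta_subset_hull in blast)

text \<open>The sign returns to the kernel 1 / (z - x), making this the complex extension of
  \<open>markov\<close>.\<close>

definition mhat :: "side \<Rightarrow> complex \<Rightarrow> complex" where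
  "mhat k z = - cauchy_tr (\<mu> k) (\<lambda>_. 1) z"

lemma mhat_holomorphic: "mhat k holomorphic_on - (of_real ` Delta \<mu> k)"
  unfolding mhat_def[abs_def] by (intro holomorphic_intros cauchy_tr_mu_holomorphic) simp

lemma mhat_of_real: "mhat k (of_real x) = of_real (markov (\<mu> k) x)"
proof -
  have "mhat k (of_real x) = (LINT t|\<mu> k. of_real (1 / (x - t)))"
    unfolding mhat_def cauchy_tr_def Bochner_Integration.integral_minus[symmetric]
    by (intro Bochner_Integration.integral_cong refl) (simp add: minus_divide_right)
  then show ?thesis by (simp only: integral_complex_of_real markov_def)
qed

text \<open>\<open>Lfun\<close> with an arbitrary pair in place of A_n, so that it applies to
  pencils.\<close>

definition cform :: "(side \<Rightarrow> real poly) \<Rightarrow> complex \<Rightarrow> complex" where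
  "cform B z = - (\<Sum>k\<in>UNIV. cauchy_tr (\<mu> k) (poly (B k)) z)"

lemma Lfun_eq: "Lfun \<mu> n z = cform (typeI \<mu> n) z"
proof -
  have "(LINT x|\<mu> k. of_real (poly p x) / (z - of_real x)) = - cauchy_tr (\<mu> k) (poly p) z" for k p
    unfolding cauchy_tr_def Bochner_Integration.integral_minus[symmetric]
    by (intro Bochner_Integration.integral_cong refl) (metis minus_diff_eq minus_divide_right)
  then show ?thesis by (simp add: Lfun_def cform_def sum_negf)
qed

lemma cform_holomorphic: "cform B holomorphic_on - (of_real ` support_hull)"
  unfolding cform_def[abs_def]
  by (intro holomorphic_intros holomorphic_on_subset[OF cauchy_tr_mu_holomorphic]) (use Delta_subset_hull in auto)

lemma cform_cnj: "cform B (cnj z) = cnj (cform B z)"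
  by (simp add: cform_def cauchy_tr_cnj)

lemma cauchy_tr_mu_linear:
  assumes "z \<notin> of_real ` Delta \<mu> k" "integrable (\<mu> k) f" "integrable (\<mu> k) g"
  shows "cauchy_tr (\<mu> k) (\<lambda>x. f x + c * g x) z = cauchy_tr (\<mu> k) f z + of_real c * cauchy_tr (\<mu> k) g z"
proof -
  have "cauchy_tr (\<mu> k) (\<lambda>x. f x + c * g x) z
    = (LINT x|\<mu> k. of_real (f x) / (of_real x - z) + of_real c * (of_real (g x) / (of_real x - z)))"
    unfolding cauchy_tr_def by (intro Bochner_Integration.integral_cong refl) (simp add: add_divide_distrib)
  also have "\<dots> = cauchy_tr (\<mu> k) f z + of_real c * cauchy_tr (\<mu> k) g z"
    unfolding cauchy_tr_def integral_mult_right_zero[symmetric]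
    by (intro Bochner_Integration.integral_add integrable_mult_right kernel_integrable assms)
  finally show ?thesis .
qed

lemma cform_linear:
  assumes z: "z \<notin> of_real ` support_hull"
  shows "cform (\<lambda>k. A k + smult c (B k)) z = cform A z + of_real c * cform B z"
proof -
  have "poly (A k + smult c (B k)) = (\<lambda>x. poly (A k) x + c * poly (B k) x)" for k by (simp add: fun_eq_iff)
  then show ?thesis
    using cauchy_tr_mu_linear[OF not_in_hull_imp[OF z] integrable_poly integrable_poly]
    by (simp add: cform_def sum_side algebra_simps)
qed

text \<open>The associated polynomial of the second kind. It is given by its coefficients, so that
  it is visibly a polynomial and can be evaluated at complex points.\<close>

definition second_kind :: "side \<Rightarrow> real poly \<Rightarrow> real poly" where
  "second_kind k p = (\<Sum>i<degree p. monom (LINT x|\<mu> k. poly (poly_shift (Suc i) p) x) i)"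

lemma integral_synthetic_div: "(LINT x|\<mu> k. poly (synthetic_div p x) y) = poly (second_kind k p) y"
  unfolding poly_synthetic_div_sum second_kind_def
  by (subst Bochner_Integration.integral_sum) (auto simp: poly_sum poly_monom)

lemma integral_cpoly_synthetic_div:
  "(LINT x|\<mu> k. cpoly (synthetic_div p x) z * of_real (poly q x))
    = (\<Sum>i<degree p. of_real (LINT x|\<mu> k. poly (poly_shift (Suc i) p) x * poly q x) * z ^ i)"
  and integrable_cpoly_synthetic_div:
  "integrable (\<mu> k) (\<lambda>x. cpoly (synthetic_div p x) z * of_real (poly q x))"
proof -
  have eq: "cpoly (synthetic_div p x) z * of_real (poly q x)
    = (\<Sum>i<degree p. of_real (poly (poly_shift (Suc i) p) x * poly q x) * z ^ i)" for x
    unfolding cpoly_synthetic_div_sum by (simp add: sum_distrib_left mult_ac)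
  have i: "integrable (\<mu> k) (\<lambda>x. of_real (poly (poly_shift (Suc i) p) x * poly q x) * z ^ i)" for i
    by (intro integrable_mult_left integrable_of_real integrable_poly_mult)
  show "integrable (\<mu> k) (\<lambda>x. cpoly (synthetic_div p x) z * of_real (poly q x))"
    unfolding eq by (intro Bochner_Integration.integrable_sum i)
  show "(LINT x|\<mu> k. cpoly (synthetic_div p x) z * of_real (poly q x))
    = (\<Sum>i<degree p. of_real (LINT x|\<mu> k. poly (poly_shift (Suc i) p) x * poly q x) * z ^ i)"
    unfolding eq using i
    by (subst Bochner_Integration.integral_sum) (auto simp only: integral_mult_left_zero integral_complex_of_real)
qed

text \<open>Replaces D(z) under the integral by D(x) - (x - z) times the divided difference; the
  second part cancels the kernel and leaves a polynomial.\<close>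

lemma cauchy_tr_poly_mult:
  assumes z: "z \<notin> of_real ` Delta \<mu> k"
  shows "cpoly D z * cauchy_tr (\<mu> k) (poly p) z = cauchy_tr (\<mu> k) (\<lambda>x. poly D x * poly p x) z
    - (\<Sum>i<degree D. of_real (LINT x|\<mu> k. poly (poly_shift (Suc i) D) x * poly p x) * z ^ i)"
proof -
  have "cpoly D z * cauchy_tr (\<mu> k) (poly p) z = (LINT x|\<mu> k. cpoly D z * (of_real (poly p x) / (of_real x - z)))"
    unfolding cauchy_tr_def by (rule integral_mult_right_zero[symmetric])
  also have "\<dots> = (LINT x|\<mu> k. of_real (poly D x * poly p x) / (of_real x - z) - cpoly (synthetic_div D x) z * of_real (poly p x))"
  proof (rule integral_cong_AE)
    show "AE x in \<mu> k. cpoly D z * (of_real (poly p x) / (of_real x - z))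
      = of_real (poly D x * poly p x) / (of_real x - z) - cpoly (synthetic_div D x) z * of_real (poly p x)"
      using AE_Delta
    proof eventually_elim
      case (elim x)
      then have nz: "of_real x - z \<noteq> 0" using z by auto
      have eqD: "cpoly D z = of_real (poly D x) - (of_real x - z) * cpoly (synthetic_div D x) z"
        using cpoly_diff_synthetic_div[of D z x] by (simp add: algebra_simps)
      have "(a - w * s) * (p / w) = a * p / w - s * p" if "w \<noteq> 0" for a w s p :: complex
        using that by (simp add: field_simps)
      from this[OF nz] show ?case unfolding eqD by simp
    qed
  qed (use integrable_cpoly_synthetic_div in \<open>simp_all\<close>)
  also have "\<dots> = cauchy_tr (\<mu> k) (\<lambda>x. poly D x * poly p x) z - (LINT x|\<mu> k. cpoly (synthetic_div D x) z * of_real (poly p x))"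
    unfolding cauchy_tr_def
    by (intro Bochner_Integration.integral_diff kernel_integrable z integrable_poly_mult integrable_cpoly_synthetic_div)
  finally show ?thesis unfolding integral_cpoly_synthetic_div .
qed

lemma cform_expand:
  assumes z: "z \<notin> of_real ` support_hull"
  shows "cform B z = (\<Sum>k\<in>UNIV. cpoly (B k) z * mhat k z - cpoly (second_kind k (B k)) z)"
proof -
  have "cauchy_tr (\<mu> k) (poly p) z = - (cpoly p z * mhat k z - cpoly (second_kind k p) z)" for k p
  proof -
    have "cpoly p z * cauchy_tr (\<mu> k) (poly 1) z = cauchy_tr (\<mu> k) (\<lambda>x. poly p x * poly 1 x) z
      - (\<Sum>i<degree p. of_real (LINT x|\<mu> k. poly (poly_shift (Suc i) p) x * poly 1 x) * z ^ i)"
      by (rule cauchy_tr_poly_mult[OF not_in_hull_imp[OF z]])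
    moreover have "poly 1 = (\<lambda>_. 1 :: real)" by (simp add: fun_eq_iff)
    ultimately show ?thesis
      by (simp add: mhat_def second_kind_def cpoly_sum cpoly_monom algebra_simps)
  qed
  then show ?thesis by (simp add: cform_def sum_negf[symmetric] cong: sum.cong)
qed

lemma cform_mult:
  assumes z: "z \<notin> of_real ` support_hull"
  shows "cpoly D z * cform B z = - (\<Sum>k\<in>UNIV. cauchy_tr (\<mu> k) (\<lambda>x. poly D x * poly (B k) x) z)
    + (\<Sum>i<degree D. of_real (pairing \<mu> B (poly_shift (Suc i) D)) * z ^ i)"
proof -
  have "cpoly D z * cform B z = - (\<Sum>k\<in>UNIV. cauchy_tr (\<mu> k) (\<lambda>x. poly D x * poly (B k) x) z
    - (\<Sum>i<degree D. of_real (LINT x|\<mu> k. poly (poly_shift (Suc i) D) x * poly (B k) x) * z ^ i))"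
    unfolding cform_def mult_minus_right sum_distrib_left cauchy_tr_poly_mult[OF not_in_hull_imp[OF z]] ..
  also have "\<dots> = - (\<Sum>k\<in>UNIV. cauchy_tr (\<mu> k) (\<lambda>x. poly D x * poly (B k) x) z)
    + (\<Sum>k\<in>UNIV. \<Sum>i<degree D. of_real (LINT x|\<mu> k. poly (poly_shift (Suc i) D) x * poly (B k) x) * z ^ i)"
    by (simp add: sum_subtractf)
  also have "(\<Sum>k\<in>UNIV. \<Sum>i<degree D. of_real (LINT x|\<mu> k. poly (poly_shift (Suc i) D) x * poly (B k) x) * z ^ i)
    = (\<Sum>i<degree D. of_real (pairing \<mu> B (poly_shift (Suc i) D)) * z ^ i)"
    unfolding pairing_def of_real_sum sum_distrib_right by (rule sum.swap)
  finally show ?thesis .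
qed

text \<open>The coefficients of the polynomial correction are pairings with shifts of
  \<open>D\<close>. Up to degree \<open>N\<close> all vanish; one degree more leaves a single real
  constant, which is invisible to imaginary parts.\<close>

lemma cform_mult_orthogonal:
  assumes z: "z \<notin> of_real ` support_hull"
    and orth: "\<And>p. degree p < N \<Longrightarrow> pairing \<mu> B p = 0"
  shows "degree D \<le> N \<Longrightarrow> cpoly D z * cform B z = - (\<Sum>k\<in>UNIV. cauchy_tr (\<mu> k) (\<lambda>x. poly D x * poly (B k) x) z)"
    and "degree D \<le> Suc N \<Longrightarrow> cpoly D z * cform B z = - (\<Sum>k\<in>UNIV. cauchy_tr (\<mu> k) (\<lambda>x. poly D x * poly (B k) x) z)
       + of_real (pairing \<mu> B (poly_shift 1 D))"
proof -
  have 0: "pairing \<mu> B (poly_shift (Suc i) D) = 0" if "i < degree D" "degree D \<le> N + i" for i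
    using degree_poly_shift[of "Suc i" D] that by (intro orth) linarith
  show "cpoly D z * cform B z = - (\<Sum>k\<in>UNIV. cauchy_tr (\<mu> k) (\<lambda>x. poly D x * poly (B k) x) z)" if "degree D \<le> N"
    unfolding cform_mult[OF z] using that by (simp add: 0)
  show "cpoly D z * cform B z = - (\<Sum>k\<in>UNIV. cauchy_tr (\<mu> k) (\<lambda>x. poly D x * poly (B k) x) z)
       + of_real (pairing \<mu> B (poly_shift 1 D))" if "degree D \<le> Suc N"
  proof (cases "degree D")
    case 0
    then show ?thesis unfolding cform_mult[OF z] by (simp add: poly_shift_eq_0)
  next
    case (Suc m)
    have "(\<Sum>i<degree D. of_real (pairing \<mu> B (poly_shift (Suc i) D)) * z ^ i)
      = (\<Sum>i\<in>{0}. of_real (pairing \<mu> B (poly_shift (Suc i) D)) * z ^ i)"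
      using Suc that by (intro sum.mono_neutral_right) (auto simp: 0)
    then show ?thesis unfolding cform_mult[OF z] by simp
  qed
qed

text \<open>Multiply by a sign polynomial \<open>D\<close>, of degree at most N + 1: up to a real
  constant the product is a sum of transforms of nonnegative densities, whose imaginary part is Im z
  times a positive number.\<close>

lemma cform_nonzero_upper:
  assumes orth: "\<And>p. degree p < N \<Longrightarrow> pairing \<mu> B p = 0"
    and B: "B k0 \<noteq> 0"
    and deg: "degree (B I1) + degree (B I2) \<le> N"
    and z: "Im z \<noteq> 0"
  shows "cform B z \<noteq> 0"
proof
  assume 0: "cform B z = 0"
  have zK: "z \<notin> of_real ` support_hull" using z by auto
  obtain D where D: "D \<noteq> 0" "degree D \<le> degree (B I1) + degree (B I2) + (if B I1 = 0 \<or> B I2 = 0 then 0 else 1)"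
    "\<And>k x. x \<in> Delta \<mu> k \<Longrightarrow> poly D x * poly (B k) x \<ge> 0"
    using sign_polynomial[of B, OF B] by blast
  have dD: "degree D \<le> Suc N" using D(2) deg by (auto split: if_splits)
  let ?y = "\<lambda>x. 1 / ((x - Re z)\<^sup>2 + (Im z)\<^sup>2)"
  have den: "(x - Re z)\<^sup>2 + (Im z)\<^sup>2 > 0" for x using z by (simp add: add_nonneg_pos)
  have den': "(x - Re z)\<^sup>2 + (Im z)\<^sup>2 \<noteq> 0" for x using den[of x] by linarith
  have int: "integrable (\<mu> k) (\<lambda>x. (poly D x * poly (B k) x) * ?y x)" for k
    by (intro integrable_continuous_Delta continuous_intros) (use den' in auto)
  have "(\<Sum>k\<in>UNIV. LINT x|\<mu> k. (poly D x * poly (B k) x) * ?y x) > 0"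
  proof (rule sum_integral_positive[where k=k0, OF int])
    show "0 \<le> poly D x * poly (B k) x * ?y x" if "x \<in> Delta \<mu> k" for k x
      by (rule mult_nonneg_nonneg[OF D(3)[OF that]]) (use den[of x] in simp)
    have "{x \<in> Delta \<mu> k0. poly D x * poly (B k0) x * ?y x = 0} \<subseteq> {x. poly (D * B k0) x = 0}"
      using den' by auto
    then show "finite {x \<in> Delta \<mu> k0. poly D x * poly (B k0) x * ?y x = 0}"
      using poly_roots_finite[of "D * B k0"] D(1) B by (meson finite_subset mult_eq_0_iff)
  qed
  moreover have "Im (cauchy_tr (\<mu> k) (\<lambda>x. poly D x * poly (B k) x) z) = Im z * (LINT x|\<mu> k. (poly D x * poly (B k) x) * ?y x)" for k
  proof -
    have "Im (cauchy_tr (\<mu> k) (\<lambda>x. poly D x * poly (B k) x) z)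
      = (LINT x|\<mu> k. (poly D x * poly (B k) x) * (Im z / ((x - Re z)\<^sup>2 + (Im z)\<^sup>2)))"
      using M.Im_cauchy_tr[of k "\<lambda>x. poly D x * poly (B k) x" "Im z" "Re z"] z by simp
    also have "\<dots> = (LINT x|\<mu> k. Im z * ((poly D x * poly (B k) x) * ?y x))" by (simp add: mult_ac)
    finally show ?thesis by (simp only: integral_mult_right_zero)
  qed
  ultimately have "Im (\<Sum>k\<in>UNIV. cauchy_tr (\<mu> k) (\<lambda>x. poly D x * poly (B k) x) z) \<noteq> 0"
    using z by (simp only: Im_sum sum_distrib_left[symmetric]) simp
  moreover have "0 = - (\<Sum>k\<in>UNIV. cauchy_tr (\<mu> k) (\<lambda>x. poly D x * poly (B k) x) z) + of_real (pairing \<mu> B (poly_shift 1 D))"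
    using cform_mult_orthogonal(2)[OF zK orth dD] 0 by simp
  from arg_cong[OF this, of Im] have "Im (\<Sum>k\<in>UNIV. cauchy_tr (\<mu> k) (\<lambda>x. poly D x * poly (B k) x) z) = 0" by simp
  ultimately show False by simp
qed

text \<open>With D = z^N no correction appears, and the leading term of the transform is the N-th
  moment.\<close>

lemma cform_asymp:
  assumes orth: "\<And>p. degree p < N \<Longrightarrow> pairing \<mu> B p = 0"
  shows "((\<lambda>z. z ^ Suc N * cform B z) \<longlongrightarrow> of_real (pairing \<mu> B (monom 1 N))) at_infinity"
proof -
  have "((\<lambda>z. \<Sum>k\<in>UNIV. - z * cauchy_tr (\<mu> k) (\<lambda>x. poly (monom 1 N) x * poly (B k) x) z)
    \<longlongrightarrow> (\<Sum>k\<in>UNIV. of_real (LINT x|\<mu> k. poly (monom 1 N) x * poly (B k) x))) at_infinity"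
    by (intro tendsto_sum M.cauchy_tr_asymp[where R=hull_bound] integrable_poly_mult AE_hull_bound)
  also have "(\<Sum>k\<in>UNIV. of_real (LINT x|\<mu> k. poly (monom 1 N) x * poly (B k) x)) = complex_of_real (pairing \<mu> B (monom 1 N))"
    by (simp add: pairing_def)
  finally show ?thesis
  proof (rule Lim_transform_eventually)
    have "z ^ Suc N * cform B z = (\<Sum>k\<in>UNIV. - z * cauchy_tr (\<mu> k) (\<lambda>x. poly (monom 1 N) x * poly (B k) x) z)"
      if "norm z \<ge> hull_bound + 1" for z
    proof -
      have zK: "z \<notin> of_real ` support_hull" using that hull_bound(2) by fastforce
      have "z ^ N * cform B z = - (\<Sum>k\<in>UNIV. cauchy_tr (\<mu> k) (\<lambda>x. poly (monom 1 N) x * poly (B k) x) z)"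
        using cform_mult_orthogonal(1)[OF zK orth, where D="monom 1 N"] by (simp add: cpoly_monom degree_monom_eq)
      then show ?thesis by (simp add: sum_distrib_left sum_negf mult.assoc)
    qed
    then show "eventually (\<lambda>z. (\<Sum>k\<in>UNIV. - z * cauchy_tr (\<mu> k) (\<lambda>x. poly (monom 1 N) x * poly (B k) x) z) = z ^ Suc N * cform B z) at_infinity"
      unfolding eventually_at_infinity by (intro exI[of _ "hull_bound + 1"]) auto
  qed
qed

lemma cform_real:
  "cform B (of_real x0) = of_real (- (\<Sum>k\<in>UNIV. LINT x|\<mu> k. poly (B k) x / (x - x0)))"
proof -
  have "cauchy_tr (\<mu> k) f (of_real x0) = of_real (LINT x|\<mu> k. f x / (x - x0))" for k f
    unfolding cauchy_tr_def integral_complex_of_real[symmetric]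
    by (intro Bochner_Integration.integral_cong refl) simp
  then show ?thesis by (simp add: cform_def)
qed

section \<open>Asymptotics and zero-freeness of the linear forms\<close>

lemma typeI_orthogonal: "msize n > 0 \<Longrightarrow> degree p < msize n - 1 \<Longrightarrow> pairing \<mu> (typeI \<mu> n) p = 0"
  by (subst pairing_typeI) (auto intro: coeff_eq_0)

lemma Lfun_asymp: "msize n > 0 \<Longrightarrow> ((\<lambda>z. z ^ msize n * Lfun \<mu> n z) \<longlongrightarrow> 1) at_infinity"
  using cform_asymp[of "msize n - 1" "typeI \<mu> n"] typeI_orthogonal[of n]
  by (simp add: Lfun_eq pairing_typeI degree_monom_eq)

text \<open>Here the two degrees add up to |n| - 2. Off the real axis this leaves room in
  \<open>cform_nonzero_upper\<close>; at a real point outside the hull the count of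
  \<open>real_pole_nonzero\<close> with empty \<open>S\<close> is met with equality.\<close>

lemma Lfun_nonzero:
  assumes n: "\<And>k. n k > 0" and z: "z \<notin> of_real ` support_hull"
  shows "Lfun \<mu> n z \<noteq> 0"
proof -
  have N: "msize n > 0" by (rule msize_pos[of n I1, OF n])
  have deg: "degree (typeI \<mu> n I1) + degree (typeI \<mu> n I2) + 1 = msize n - 1"
    using n[of I1] n[of I2] by (simp add: degree_typeI[of n, OF n] msize_def)
  show ?thesis
  proof (cases "Im z = 0")
    case False
    then show ?thesis unfolding Lfun_eq using deg typeI_neq_0[of n I1, OF n]
      by (intro cform_nonzero_upper[of "msize n - 1"] typeI_orthogonal N) auto
  next
    case True
    then obtain x where x: "z = of_real x" by (metis complex_is_Real_iff Reals_cases)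
    have "x \<notin> support_hull" using z x by auto
    then have "x \<notin> Delta \<mu> k" for k using Delta_subset_hull by blast
    then have "(\<Sum>k\<in>UNIV. LINT t|\<mu> k. (if k \<in> {} then poly (synthetic_div (typeI \<mu> n k) x) t else poly (typeI \<mu> n k) t / (t - x))) \<noteq> 0"
      using deg typeI_neq_0[of n I1, OF n]
      by (intro real_pole_nonzero[of "msize n - 1" "typeI \<mu> n" I1 "{}" x] typeI_orthogonal N) (auto simp: sum_side)
    then show ?thesis unfolding Lfun_eq x cform_real by (simp del: of_real_sum)
  qed
qed

lemma inc_pos: "(\<And>k. n k > 0) \<Longrightarrow> inc n i k > 0"
  by (simp add: inc_apply)

text \<open>The moment of order |n| - 1 isolates the coefficient \<open>a\<close>, because the
  larger index is still orthogonal there; this excludes a zero pencil. The degrees sum to at most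
  |n| - 1, the order of orthogonality.\<close>

lemma typeI_pencil:
  fixes n i
  assumes n: "\<And>k. n k > 0" and ab: "a \<noteq> 0 \<or> b \<noteq> 0"
  defines "B \<equiv> \<lambda>k. smult a (typeI \<mu> n k) + smult b (typeI \<mu> (inc n i) k)"
  shows "\<exists>k. B k \<noteq> 0" and "\<And>p. degree p < msize n - 1 \<Longrightarrow> pairing \<mu> B p = 0"
    and "\<And>k. degree (B k) \<le> (if k = i then n k else n k - 1)"
proof -
  have N: "msize n > 0" by (rule msize_pos[of n I1, OF n])
  have p: "pairing \<mu> B p = a * pairing \<mu> (typeI \<mu> n) p + b * pairing \<mu> (typeI \<mu> (inc n i)) p" for p
    unfolding B_def pairing_add pairing_smult ..
  have 1: "pairing \<mu> B (monom 1 (msize n - 1)) = a"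
    using N unfolding p by (simp add: pairing_typeI degree_monom_eq coeff_eq_0)
  show "\<exists>k. B k \<noteq> 0"
  proof (rule ccontr)
    assume "\<not> ?thesis"
    then have B0: "B k = 0" for k by blast
    then have "a = 0" using 1 by (simp add: pairing_def)
    then have "b \<noteq> 0" using ab by simp
    then have "typeI \<mu> (inc n i) I1 = 0" using B0[of I1] \<open>a = 0\<close> by (simp add: B_def)
    then show False using typeI_neq_0[of "inc n i" I1, OF inc_pos[of n, OF n]] by simp
  qed
  show "pairing \<mu> B p = 0" if "degree p < msize n - 1" for p
    using that N unfolding p by (simp add: pairing_typeI coeff_eq_0)
  show "degree (B k) \<le> (if k = i then n k else n k - 1)" for k
    using degree_typeI_le[of n k] degree_typeI_le[of "inc n i" k] N unfolding B_def
    by (intro degree_add_le order_trans[OF degree_smult_le]) (auto simp: inc_apply)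
qed

lemma Lfun_pencil_nonzero:
  assumes n: "\<And>k. n k > 0" and z: "Im z \<noteq> 0"
  shows "Lfun \<mu> (inc n i) z + of_real t * Lfun \<mu> n z \<noteq> 0"
proof -
  let ?B = "\<lambda>k. smult t (typeI \<mu> n k) + smult 1 (typeI \<mu> (inc n i) k)"
  note P = typeI_pencil[where n=n and i=i and a=t and b=1, OF n disjI2[OF one_neq_zero]]
  have "n I1 > 0" "n I2 > 0" using n by auto
  then have d: "degree (?B I1) + degree (?B I2) \<le> msize n - 1"
    using P(3)[of I1] P(3)[of I2] by (cases i) (auto simp: msize_def)
  obtain k where "?B k \<noteq> 0" using P(1) by auto
  then have "cform ?B z \<noteq> 0" using P(2) d z by (intro cform_nonzero_upper[of "msize n - 1" ?B k]) auto
  moreover have "z \<notin> of_real ` support_hull" using z by auto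
  then have "cform ?B z = Lfun \<mu> (inc n i) z + of_real t * Lfun \<mu> n z"
    using cform_linear[of z "typeI \<mu> (inc n i)" t "typeI \<mu> n"] by (simp add: Lfun_eq add.commute)
  ultimately show ?thesis by simp
qed

text \<open>The diagonal Green function of the subtree entered along the edge from \<open>n\<close>
  in direction \<open>i\<close>.\<close>

definition Mfun :: "multi_index \<Rightarrow> side \<Rightarrow> complex \<Rightarrow> complex" where
  "Mfun n i z = - Lfun \<mu> (inc n i) z / Lfun \<mu> n z"

lemma Lfun_holomorphic: "Lfun \<mu> n holomorphic_on - (of_real ` support_hull)"
  using cform_holomorphic[of "typeI \<mu> n"] by (simp add: Lfun_eq[abs_def])

lemma Mfun_holomorphic:
  assumes n: "\<And>k. n k > 0"
  shows "Mfun n i holomorphic_on - (of_real ` support_hull)"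
  unfolding Mfun_def[abs_def] using Lfun_nonzero[of n, OF n] by (intro holomorphic_intros Lfun_holomorphic) auto

lemma Mfun_asymp:
  assumes n: "\<And>k. n k > 0"
  shows "((\<lambda>z. - z * Mfun n i z) \<longlongrightarrow> 1) at_infinity"
proof -
  have N: "msize n > 0" by (rule msize_pos[of n I1, OF n])
  have "((\<lambda>z. (z ^ msize (inc n i) * Lfun \<mu> (inc n i) z) / (z ^ msize n * Lfun \<mu> n z)) \<longlongrightarrow> 1 / 1) at_infinity"
    by (intro tendsto_divide Lfun_asymp) (auto simp: N)
  moreover have "eventually (\<lambda>z. (z ^ msize (inc n i) * Lfun \<mu> (inc n i) z) / (z ^ msize n * Lfun \<mu> n z) = - z * Mfun n i z) at_infinity"
    using eventually_not_equal_at_infinity[of 0] by eventually_elim (simp add: Mfun_def)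
  ultimately have "((\<lambda>z. - z * Mfun n i z) \<longlongrightarrow> 1 / 1) at_infinity" by (rule Lim_transform_eventually)
  then show ?thesis by simp
qed

text \<open>A real value would produce a zero of a real pencil, so the imaginary part has one sign
  on the connected half-plane; the asymptotics - 1 / z along the imaginary axis shows that it is
  positive.\<close>

lemma Im_Mfun_pos:
  assumes n: "\<And>k. n k > 0" and z: "Im z > 0"
  shows "Im (Mfun n i z) > 0"
proof (rule ccontr)
  assume neg: "\<not> ?thesis"
  let ?U = "{z. Im z > 0}"
  have nz: "Im (Mfun n i w) \<noteq> 0" if "w \<in> ?U" for w
  proof
    assume "Im (Mfun n i w) = 0"
    then have M: "Mfun n i w = of_real (Re (Mfun n i w))" by (simp add: complex_eq_iff)
    have L: "Lfun \<mu> n w \<noteq> 0" using that by (intro Lfun_nonzero[of n, OF n]) auto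
    then have "Lfun \<mu> (inc n i) w + of_real (Re (Mfun n i w)) * Lfun \<mu> n w = 0"
      unfolding M[symmetric] by (simp add: Mfun_def)
    then show False using Lfun_pencil_nonzero[of n w i, OF n] that by simp
  qed
  have "continuous_on ?U (Mfun n i)"
    by (intro holomorphic_on_imp_continuous_on holomorphic_on_subset[OF Mfun_holomorphic[of n, OF n]]) auto
  then have "connected ((\<lambda>w. Im (Mfun n i w)) ` ?U)"
    by (intro connected_continuous_image continuous_intros) (auto intro!: convex_connected convex_halfspace_Im_gt)
  moreover obtain s :: real where s: "s > 0" "Im (Mfun n i (\<i> * of_real s)) > 0"
  proof -
    have "filterlim (\<lambda>s::real. \<i> * of_real s) at_infinity at_top"
      by (rule filterlim_norm_at_top_imp_at_infinity) (simp add: norm_mult filterlim_abs_real)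
    from tendsto_Re[OF filterlim_compose[OF Mfun_asymp[of n, OF n] this]]
    have "((\<lambda>s. s * Im (Mfun n i (\<i> * of_real s))) \<longlongrightarrow> 1) at_top" by simp
    then have "eventually (\<lambda>s. s * Im (Mfun n i (\<i> * of_real s)) > 0) at_top"
      by (rule order_tendstoD) simp
    then have "eventually (\<lambda>s. s > 0 \<and> s * Im (Mfun n i (\<i> * of_real s)) > 0) at_top"
      using eventually_gt_at_top[of 0] by eventually_elim simp
    then obtain s where "s > 0 \<and> s * Im (Mfun n i (\<i> * of_real s)) > 0"
      using eventually_happens'[OF trivial_limit_at_top_linorder] by blast
    then show ?thesis using that[of s] by (auto simp: zero_less_mult_iff)
  qed
  moreover have "Im (Mfun n i (\<i> * of_real s)) \<in> (\<lambda>w. Im (Mfun n i w)) ` ?U"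
    "Im (Mfun n i z) \<in> (\<lambda>w. Im (Mfun n i w)) ` ?U"
    using s z by (intro imageI; simp)+
  moreover have "Im (Mfun n i z) \<le> 0" using neg by simp
  ultimately have "0 \<in> (\<lambda>w. Im (Mfun n i w)) ` ?U"
    using connectedD_interval less_imp_le by metis
  then show False using nz by force
qed

lemma Mfun_representation:
  assumes n: "\<And>k. n k > 0"
  obtains \<rho> where "finite_borel_measure \<rho>" "AE x in \<rho>. x \<in> support_hull" "measure \<rho> UNIV = 1"
    "\<And>z. z \<notin> of_real ` support_hull \<Longrightarrow> Mfun n i z = cauchy_tr \<rho> (\<lambda>_. 1) z"
proof (rule stieltjes_representation[of support_hull hull_bound "Mfun n i"])
  show "support_hull \<subseteq> {- hull_bound..hull_bound}" using hull_bound(2) by (force simp: abs_le_iff)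
  show "Mfun n i (cnj z) = cnj (Mfun n i z)" for z by (simp add: Mfun_def Lfun_eq cform_cnj)
  show "0 \<le> Im (Mfun n i z)" if "0 < Im z" for z using Im_Mfun_pos[of n, OF n that] by (simp add: less_imp_le)
qed (use compact_imp_closed[OF compact_support_hull] Mfun_holomorphic[of n, OF n] Mfun_asymp[of n, OF n] in auto)

lemma cform_mult_ident:
  assumes z: "z \<notin> of_real ` support_hull"
  shows "cform (\<lambda>k. [:0, 1:] * B k) z = z * cform B z - of_real (pairing \<mu> B 1)"
proof -
  have "poly ([:0, 1:] * p) = (\<lambda>x::real. poly [:0, 1:] x * poly p x)" for p by (simp add: fun_eq_iff)
  then have "cform (\<lambda>k. [:0, 1:] * B k) z = - (\<Sum>k\<in>UNIV. cauchy_tr (\<mu> k) (\<lambda>x. poly [:0, 1:] x * poly (B k) x) z)"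
    by (simp only: cform_def)
  moreover have "poly_shift 1 [:0, 1::real:] = 1" by (simp add: poly_eq_iff coeff_poly_shift coeff_pCons split: nat.split)
  ultimately show ?thesis using cform_mult[OF z, of "[:0, 1:]" B] by simp
qed

lemma Lfun_recurrence:
  assumes n0: "\<And>k. n0 k > 0" and z: "z \<notin> of_real ` support_hull"
  shows "z * Lfun \<mu> (inc n0 i) z = Lfun \<mu> n0 z + of_real (rec_b \<mu> n0 i) * Lfun \<mu> (inc n0 i) z
    + (\<Sum>j\<in>UNIV. of_real (rec_a \<mu> (inc n0 i) j) * Lfun \<mu> (inc (inc n0 i) j) z)"
proof -
  let ?n = "inc n0 i"
  have N: "msize n0 > 0" by (rule msize_pos[of n0 I1, OF n0])
  have "(\<lambda>k. [:0, 1:] * typeI \<mu> ?n k) = (\<lambda>k. typeI \<mu> n0 k + smult (rec_b \<mu> n0 i) (typeI \<mu> ?n k)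
      + smult (rec_a \<mu> ?n I1) (typeI \<mu> (inc ?n I1) k) + smult (rec_a \<mu> ?n I2) (typeI \<mu> (inc ?n I2) k))"
    using typeI_recurrence[of n0, OF n0] by (intro ext) (simp add: sum_side add.assoc)
  then have "cform (\<lambda>k. [:0, 1:] * typeI \<mu> ?n k) z = cform (\<lambda>k. typeI \<mu> n0 k + smult (rec_b \<mu> n0 i) (typeI \<mu> ?n k)
      + smult (rec_a \<mu> ?n I1) (typeI \<mu> (inc ?n I1) k) + smult (rec_a \<mu> ?n I2) (typeI \<mu> (inc ?n I2) k)) z"
    by (rule arg_cong)
  moreover have "pairing \<mu> (typeI \<mu> ?n) 1 = 0" using N by (intro typeI_orthogonal) auto
  ultimately show ?thesis
    unfolding cform_mult_ident[OF z] cform_linear[OF z] Lfun_eq sum_side by (simp add: add.assoc)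
qed

text \<open>At z = i each Im M is at least 1 / c, as M is the transform of a probability measure on
  the hull. The imaginary part of the Riccati relation gives a * Im M <= Im (-1 / M) <= c. The index
  has the form \<open>inc n0 i\<close> because the relation needs a predecessor.\<close>

lemma rec_a_bounded: "\<exists>C. \<forall>n0 i j. (\<forall>k. n0 k > 0) \<longrightarrow> rec_a \<mu> (inc n0 i) j \<le> C"
proof -
  \<comment> \<open>The imaginary part of the kernel at i is 1 / (t^2 + 1), which is at least 1 / c
    on the hull.\<close>
  define c where "c = hull_bound\<^sup>2 + 1"
  have c: "c > 0" by (simp add: c_def add_nonneg_pos)
  have iK: "\<i> \<notin> of_real ` support_hull" by (auto simp: complex_eq_iff)
  have low: "Im (Mfun n i \<i>) \<ge> 1 / c" if n: "\<And>k. n k > 0" for n i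
  proof -
    obtain \<rho> where \<rho>: "finite_borel_measure \<rho>" "AE x in \<rho>. x \<in> support_hull" "measure \<rho> UNIV = 1"
      "\<And>z. z \<notin> of_real ` support_hull \<Longrightarrow> Mfun n i z = cauchy_tr \<rho> (\<lambda>_. 1) z"
      by (rule Mfun_representation[of n i, OF n]) blast
    interpret finite_borel_measure \<rho> by fact
    have sp: "space \<rho> = UNIV" using sets_eq_imp_space_eq[OF M_is_borel] by simp
    have [measurable_cong]: "sets \<rho> = sets borel" by (rule M_is_borel)
    have "Im (Mfun n i \<i>) = (LINT t|\<rho>. 1 / (t\<^sup>2 + 1))"
      using Im_cauchy_tr[of "\<lambda>_. 1" 1 0] \<rho>(4)[OF iK] by (simp add: Complex_eq)
    also have "\<dots> \<ge> (LINT t|\<rho>. 1 / c)"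
    proof (rule integral_mono_AE)
      show "integrable \<rho> (\<lambda>t. 1 / (t\<^sup>2 + 1))"
        by (rule integrable_const_bound[where B=1]) (auto simp: divide_le_eq_1 add_nonneg_pos)
      show "AE t in \<rho>. 1 / c \<le> 1 / (t\<^sup>2 + 1)"
        using \<rho>(2)
      proof eventually_elim
        case (elim t)
        have "t\<^sup>2 \<le> hull_bound\<^sup>2" using hull_bound(2)[OF elim] by (metis abs_ge_zero power2_abs power_mono)
        then show ?case unfolding c_def by (intro divide_left_mono) (auto intro!: mult_pos_pos add_nonneg_pos)
      qed
    qed simp
    finally show ?thesis using \<rho>(3) sp by simp
  qed
  have "rec_a \<mu> (inc n0 i) j \<le> c * c" if n0: "\<forall>k. n0 k > 0" for n0 i j
  proof -
    let ?n = "inc n0 i"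
    have n0': "n0 k > 0" for k using n0 by simp
    have n: "?n k > 0" for k by (rule inc_pos[of n0, OF n0'])
    have L: "Lfun \<mu> ?n \<i> \<noteq> 0" "Lfun \<mu> n0 \<i> \<noteq> 0"
      using Lfun_nonzero[of ?n, OF n iK] Lfun_nonzero[of n0, OF n0' iK] by auto
    let ?M = "Mfun n0 i \<i>"
    \<comment> \<open>Riccati form: the recurrence at z = i divided by the form of the middle
      index.\<close>
    have "\<i> = - 1 / ?M + of_real (rec_b \<mu> n0 i) - (\<Sum>j\<in>UNIV. of_real (rec_a \<mu> ?n j) * Mfun ?n j \<i>)"
    proof -
      have "\<i> = (Lfun \<mu> n0 \<i> + of_real (rec_b \<mu> n0 i) * Lfun \<mu> ?n \<i>
        + (\<Sum>j\<in>UNIV. of_real (rec_a \<mu> ?n j) * Lfun \<mu> (inc ?n j) \<i>)) / Lfun \<mu> ?n \<i>"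
        using Lfun_recurrence[of n0, OF n0' iK, of i] L by (simp add: eq_divide_eq)
      also have "\<dots> = Lfun \<mu> n0 \<i> / Lfun \<mu> ?n \<i> + of_real (rec_b \<mu> n0 i)
        + (\<Sum>j\<in>UNIV. of_real (rec_a \<mu> ?n j) * (Lfun \<mu> (inc ?n j) \<i> / Lfun \<mu> ?n \<i>))"
        using L by (simp add: add_divide_distrib sum_side)
      also have "\<dots> = - 1 / ?M + of_real (rec_b \<mu> n0 i) - (\<Sum>j\<in>UNIV. of_real (rec_a \<mu> ?n j) * Mfun ?n j \<i>)"
        by (simp add: Mfun_def sum_side)
      finally show ?thesis .
    qed
    then have "- 1 / ?M = \<i> - of_real (rec_b \<mu> n0 i) + (\<Sum>j\<in>UNIV. of_real (rec_a \<mu> ?n j) * Mfun ?n j \<i>)"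
      by (simp add: algebra_simps)
    from arg_cong[OF this, of Im]
    have eq: "Im (- 1 / ?M) = 1 + (\<Sum>j\<in>UNIV. rec_a \<mu> ?n j * Im (Mfun ?n j \<i>))" by simp
    have nn: "rec_a \<mu> ?n j' * Im (Mfun ?n j' \<i>) \<ge> 0" for j'
      using rec_a_pos[of ?n j', OF n] Im_Mfun_pos[of ?n \<i> j', OF n] by simp
    have "rec_a \<mu> ?n j * (1 / c) \<le> rec_a \<mu> ?n j * Im (Mfun ?n j \<i>)"
      using rec_a_pos[of ?n j, OF n] low[of ?n j, OF n] by (intro mult_left_mono) auto
    also have "\<dots> \<le> Im (- 1 / ?M)" unfolding eq sum_side'[of _ j] using nn[of "other j"] by simp
    also have "\<dots> \<le> norm (- 1 / ?M)" using abs_Im_le_cmod[of "- 1 / ?M"] by linarith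
    also have "\<dots> = 1 / norm ?M" by (simp add: norm_divide)
    also have "\<dots> \<le> 1 / (1 / c)"
    proof -
      have "1 / c \<le> norm ?M" using low[of n0 i, OF n0'] abs_Im_le_cmod[of ?M] by linarith
      moreover have "1 / c > 0" using c by simp
      ultimately show ?thesis by (intro divide_left_mono mult_pos_pos) linarith+
    qed
    finally have "rec_a \<mu> ?n j / c \<le> c" using c by simp
    then show ?thesis using c by (simp add: divide_le_eq)
  qed
  then show ?thesis by blast
qed

end

section \<open>Continuation across an interval\<close>

lemma cpoly_div_power_tendsto:
  assumes "degree p \<le> d"
  shows "((\<lambda>z. cpoly p z / z ^ d) \<longlongrightarrow> of_real (coeff p d)) at_infinity"
proof -
  have eq: "cpoly p z / z ^ d = (\<Sum>i\<le>d. of_real (coeff p i) * inverse z ^ (d - i))" if "z \<noteq> 0" for z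
  proof -
    have "p = (\<Sum>i\<le>d. monom (coeff p i) i)"
      using poly_as_sum_of_monoms'[OF assms] by simp
    then have "cpoly p z = (\<Sum>i\<le>d. of_real (coeff p i) * z ^ i)"
      by (metis (no_types, lifting) cpoly_sum cpoly_monom sum.cong)
    then show ?thesis
      using that by (auto simp: sum_divide_distrib power_diff power_inverse divide_simps intro!: sum.cong)
  qed
  have "((\<lambda>z. \<Sum>i\<le>d. of_real (coeff p i) * inverse z ^ (d - i)) \<longlongrightarrow> (\<Sum>i\<le>d. of_real (coeff p i) * 0 ^ (d - i))) (at_infinity :: complex filter)"
    by (intro tendsto_intros tendsto_inverse_0)
  also have "(\<Sum>i\<le>d. of_real (coeff p i) * 0 ^ (d - i)) = (\<Sum>i\<in>{d}. complex_of_real (coeff p i) * 0 ^ (d - i))"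
    by (intro sum.mono_neutral_right) auto
  finally have "((\<lambda>z. \<Sum>i\<le>d. of_real (coeff p i) * inverse z ^ (d - i)) \<longlongrightarrow> complex_of_real (coeff p d)) at_infinity" by simp
  then show ?thesis
    by (rule Lim_transform_eventually) (use eventually_not_equal_at_infinity[of 0] in eventually_elim, simp add: eq)
qed

lemma synthetic_div_add: "synthetic_div (p + q) c = synthetic_div p c + synthetic_div q c"
  and synthetic_div_smult: "synthetic_div (smult a p) c = smult a (synthetic_div p c)"
  by (auto simp: poly_eq_iff coeff_synthetic_div algebra_simps)
    (simp_all add: poly_add[symmetric] poly_smult[symmetric] poly_eq_iff coeff_poly_shift arg_cong[of _ _ "\<lambda>p. poly p c"] del: poly_add poly_smult)

context angelesco_system
begin

definition typeI_0_poly :: "multi_index \<Rightarrow> real poly" where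
  "typeI_0_poly n = (\<Sum>k\<in>UNIV. second_kind k (typeI \<mu> n k))"

lemma typeI_0_eq: "typeI_0 \<mu> n x = poly (typeI_0_poly n) x"
  by (simp add: typeI_0_def typeI_0_poly_def integral_synthetic_div poly_sum)

lemma second_kind_linear:
  "poly (second_kind k (smult a p + smult b q)) x = a * poly (second_kind k p) x + b * poly (second_kind k q) x"
proof -
  have "integrable (\<mu> k) (\<lambda>t. poly (synthetic_div p t) x)" for p
    unfolding poly_synthetic_div_sum by simp
  then show ?thesis
    by (simp add: integral_synthetic_div[symmetric] synthetic_div_add synthetic_div_smult)
qed

text \<open>The transform of \<open>\<mu> k\<close> cancels in \<open>L\<^sub>n A\<^sub>m - L\<^sub>m A\<^sub>n\<close>; what remains is analytic across
  \<open>Delta \<mu> k\<close>.\<close>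

definition sfun :: "multi_index \<Rightarrow> multi_index \<Rightarrow> side \<Rightarrow> complex \<Rightarrow> complex" where
  "sfun n m k z = cpoly (typeI \<mu> n k) z * cpoly (typeI_0_poly m) z - cpoly (typeI \<mu> m k) z * cpoly (typeI_0_poly n) z
    + (cpoly (typeI \<mu> n (other k)) z * cpoly (typeI \<mu> m k) z - cpoly (typeI \<mu> m (other k)) z * cpoly (typeI \<mu> n k) z)
      * mhat (other k) z"

definition sfun_real :: "multi_index \<Rightarrow> multi_index \<Rightarrow> side \<Rightarrow> real \<Rightarrow> real" where
  "sfun_real n m k x = poly (typeI \<mu> n k) x * typeI_0 \<mu> m x - poly (typeI \<mu> m k) x * typeI_0 \<mu> n x
    + (poly (typeI \<mu> n (other k)) x * poly (typeI \<mu> m k) x - poly (typeI \<mu> m (other k)) x * poly (typeI \<mu> n k) x)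
      * markov (\<mu> (other k)) x"

lemma sfun_of_real: "sfun n m k (of_real x) = of_real (sfun_real n m k x)"
  by (simp add: sfun_def sfun_real_def mhat_of_real typeI_0_eq)

lemma sfun_holomorphic: "sfun n m k holomorphic_on - (of_real ` Delta \<mu> (other k))"
  unfolding sfun_def[abs_def] by (intro holomorphic_intros mhat_holomorphic)

text \<open>Insert L = A_k mhat_k + A_other mhat_other - A_0 for both indices: the terms with mhat_k
  cancel.\<close>

lemma sfun_eq:
  assumes z: "z \<notin> of_real ` support_hull"
  shows "sfun n m k z = Lfun \<mu> n z * cpoly (typeI \<mu> m k) z - Lfun \<mu> m z * cpoly (typeI \<mu> n k) z"
proof -
  have L: "Lfun \<mu> n z = cpoly (typeI \<mu> n k) z * mhat k z + cpoly (typeI \<mu> n (other k)) z * mhat (other k) z - cpoly (typeI_0_poly n) z" for n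
    unfolding Lfun_eq cform_expand[OF z] typeI_0_poly_def cpoly_sum sum_side'[of _ k] by simp
  show ?thesis unfolding sfun_def L[of n] L[of m] by (simp add: algebra_simps)
qed

text \<open>The value of - L_B at \<open>x\<close> when the term \<open>B k\<close> times the
  transform of \<open>\<mu> k\<close> is dropped, as it should be at a root of
  \<open>B k\<close>.\<close>

definition pole_value :: "(side \<Rightarrow> real poly) \<Rightarrow> side \<Rightarrow> real \<Rightarrow> real" where
  "pole_value B k x = (\<Sum>j\<in>UNIV. poly (second_kind j (B j)) x) - poly (B (other k)) x * markov (\<mu> (other k)) x"

lemma pole_value_linear:
  "pole_value (\<lambda>j. smult a (A j) + smult b (B j)) k x = a * pole_value A k x + b * pole_value B k x"
  by (simp add: pole_value_def second_kind_linear sum_side algebra_simps)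

text \<open>Off the other interval the divided difference splits into a quotient and a Markov term.
  This puts the value into the shape treated by \<open>real_pole_nonzero\<close>.\<close>

lemma pole_value_eq:
  assumes x: "x \<notin> Delta \<mu> (other k)"
  shows "pole_value B k x = (\<Sum>j\<in>UNIV. LINT t|\<mu> j. (if j \<in> {k} then poly (synthetic_div (B j) x) t else poly (B j) t / (t - x)))"
proof -
  have nz: "t - x \<noteq> 0" if "t \<in> Delta \<mu> (other k)" for t using x that by auto
  have i1: "integrable (\<mu> (other k)) (\<lambda>t. 1 / (x - t))"
    by (intro integrable_continuous_Delta continuous_intros) (use nz in auto)
  have i2: "integrable (\<mu> (other k)) (\<lambda>t. poly (synthetic_div p t) x)" for p
    unfolding poly_synthetic_div_sum by simp
  have "(LINT t|\<mu> (other k). poly (B (other k)) t / (t - x))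
    = (LINT t|\<mu> (other k). poly (synthetic_div (B (other k)) t) x - poly (B (other k)) x * (1 / (x - t)))"
  proof (rule integral_cong_AE)
    show "AE t in \<mu> (other k). poly (B (other k)) t / (t - x) = poly (synthetic_div (B (other k)) t) x - poly (B (other k)) x * (1 / (x - t))"
      using AE_Delta
    proof eventually_elim
      case (elim t)
      have "poly (B (other k)) x - poly (B (other k)) t = (x - t) * poly (synthetic_div (B (other k)) t) x"
        by (rule poly_diff_synthetic_div)
      then show ?case using nz[OF elim] by (simp add: field_simps)
    qed
  qed (use i2 i1 in auto)
  also have "\<dots> = poly (second_kind (other k) (B (other k))) x - poly (B (other k)) x * markov (\<mu> (other k)) x"
    unfolding Bochner_Integration.integral_diff[OF i2 integrable_mult_right[OF i1]] markov_def integral_mult_right_zero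
      integral_synthetic_div ..
  finally show ?thesis
    unfolding pole_value_def sum_side'[of _ k]
    by (simp add: integral_synthetic_div[symmetric] poly_synthetic_div_commute)
qed

text \<open>The root of \<open>B k\<close> at \<open>x\<close> lowers the degree of the divided
  component by one, which pays for the extra zero in the gap; otherwise a pencil would be one degree
  too large.\<close>

lemma pencil_pole_nonzero:
  fixes n i
  assumes n: "\<And>k. n k > 0" and ab: "a \<noteq> 0 \<or> b \<noteq> 0" and x: "x \<notin> Delta \<mu> (other k)"
  defines "B \<equiv> \<lambda>j. smult a (typeI \<mu> n j) + smult b (typeI \<mu> (inc n i) j)"
  assumes root: "poly (B k) x = 0"
  shows "pole_value B k x \<noteq> 0"
proof -
  have P: "\<exists>k. B k \<noteq> 0" "\<And>p. degree p < msize n - 1 \<Longrightarrow> pairing \<mu> B p = 0"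
    "\<And>k. degree (B k) \<le> (if k = i then n k else n k - 1)"
    using typeI_pencil[where n=n and i=i and a=a and b=b, OF n ab] by (simp_all only: B_def)
  obtain k0 where k0: "B k0 \<noteq> 0" using P(1) by blast
  have npos: "n I1 > 0" "n I2 > 0" "n k > 0" "n (other k) > 0" using n by auto
  have dk: "B k \<noteq> 0 \<Longrightarrow> degree (B k) > 0"
    using root by (cases "degree (B k) = 0") (auto elim!: degree_eq_zeroE)
  have dd: "degree (B k) + degree (B (other k)) \<le> msize n - 1"
    using P(3)[of k] P(3)[of "other k"] npos side_other_cases[of i k] by (auto simp: msize_eq[of n k])
  have Bo: "(B I1 = 0 \<or> B I2 = 0) \<longleftrightarrow> (B k = 0 \<or> B (other k) = 0)" by (cases k) auto
  have "(\<Sum>j\<in>UNIV. LINT t|\<mu> j. (if j \<in> {k} then poly (synthetic_div (B j) x) t else poly (B j) t / (t - x))) \<noteq> 0"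
  proof (rule real_pole_nonzero[of "msize n - 1" B k0 "{k}" x])
    show "x \<notin> Delta \<mu> j" if "j \<notin> {k}" for j using that x side_other_cases[of j k] by auto
    show "(\<Sum>j\<in>UNIV. degree (B j) - (if j \<in> {k} then 1 else 0)) + (if B I1 = 0 \<or> B I2 = 0 then 0 else 1) \<le> msize n - 1"
      unfolding sum_side'[of _ k] Bo using dk dd by auto
  qed (use k0 P(2) root in auto)
  then show ?thesis using pole_value_eq[OF x, of B] by simp
qed

text \<open>Up to sign this is the pole value of the pencil A'(x) A - A(x) A', formed with the k-th
  components and hence vanishing at \<open>x\<close> on side k.\<close>

lemma sfun_real_nonzero:
  assumes n: "\<And>k. n k > 0" and x: "x \<notin> Delta \<mu> (other k)"
  shows "sfun_real n (inc n i) k x \<noteq> 0"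
proof -
  let ?A = "typeI \<mu> n" and ?A' = "typeI \<mu> (inc n i)"
  have lin: "pole_value (\<lambda>j. smult a (?A j) + smult b (?A' j)) k x = a * pole_value ?A k x + b * pole_value ?A' k x" for a b
    by (rule pole_value_linear)
  have nz: "poly (?A' k) x \<noteq> 0 \<or> - poly (?A k) x \<noteq> 0"
  proof (rule ccontr)
    assume "\<not> ?thesis"
    then have 0: "poly (?A' k) x = 0" "poly (?A k) x = 0" by auto
    \<comment> \<open>If both k-th components vanished at \<open>x\<close>, every pencil would have
      a root there. These coefficients give a nontrivial one with pole value 0, which is
      impossible.\<close>
    define a where "a = (if pole_value ?A' k x = 0 then if pole_value ?A k x = 0 then 1 else 0 else pole_value ?A' k x)"
    define b where "b = (if pole_value ?A' k x = 0 \<and> pole_value ?A k x \<noteq> 0 then 1 else - pole_value ?A k x)"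
    have "a \<noteq> 0 \<or> b \<noteq> 0" by (auto simp: a_def b_def)
    moreover have "a * pole_value ?A k x + b * pole_value ?A' k x = 0" by (auto simp: a_def b_def)
    ultimately show False
      using pencil_pole_nonzero[where n=n and i=i and a=a and b=b and x=x and k=k, OF n] x 0 lin[of a b] by auto
  qed
  have "pole_value (\<lambda>j. smult (poly (?A' k) x) (?A j) + smult (- poly (?A k) x) (?A' j)) k x \<noteq> 0"
    by (rule pencil_pole_nonzero[where n=n and i=i, OF n nz x]) simp
  moreover have "sfun_real n (inc n i) k x = - (poly (?A' k) x * pole_value ?A k x + (- poly (?A k) x) * pole_value ?A' k x)"
    by (simp add: sfun_real_def pole_value_def typeI_0_eq typeI_0_poly_def poly_sum algebra_simps)
  ultimately show ?thesis unfolding lin by simp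
qed

text \<open>The product L_n A_m leads; L_m A_n is at least one power smaller, since A_n has no
  larger degree than A_m in component k.\<close>

lemma sfun_asymp:
  fixes n i
  assumes n: "\<And>k. n k > 0"
  defines "m \<equiv> inc n i"
  shows "((\<lambda>z. z ^ m (other k) * sfun n m k z) \<longlongrightarrow> of_real (typeI_top m k)) at_infinity"
proof -
  have N: "msize n > 0" by (rule msize_pos[of n I1, OF n])
  have m: "m k > 0" for k unfolding m_def by (rule inc_pos[of n, OF n])
  define d where "d = m k - 1"
  have sz: "msize m = Suc (msize n)" by (simp add: m_def)
  have e1: "m (other k) + d = msize n" using m[of k] sz by (simp add: d_def msize_eq[of m k])
  have dm: "degree (typeI \<mu> m k) \<le> d" using degree_typeI[of m k, OF m] by (simp add: d_def)
  have dn: "degree (typeI \<mu> n k) \<le> d"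
    using degree_typeI[of n k, OF n] by (auto simp: d_def m_def inc_apply)
  have "((\<lambda>z. (z ^ msize n * Lfun \<mu> n z) * (cpoly (typeI \<mu> m k) z / z ^ d)
      - (z ^ msize m * Lfun \<mu> m z) * (cpoly (typeI \<mu> n k) z / z ^ Suc d))
    \<longlongrightarrow> 1 * of_real (coeff (typeI \<mu> m k) d) - 1 * of_real (coeff (typeI \<mu> n k) (Suc d))) at_infinity"
    by (intro tendsto_intros Lfun_asymp cpoly_div_power_tendsto dm) (use N sz dn in auto)
  moreover have "coeff (typeI \<mu> n k) (Suc d) = 0" using dn by (intro coeff_eq_0) simp
  ultimately have "((\<lambda>z. (z ^ msize n * Lfun \<mu> n z) * (cpoly (typeI \<mu> m k) z / z ^ d)
      - (z ^ msize m * Lfun \<mu> m z) * (cpoly (typeI \<mu> n k) z / z ^ Suc d))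
    \<longlongrightarrow> of_real (typeI_top m k)) at_infinity"
    by (simp add: typeI_top_def d_def)
  then show ?thesis
  proof (rule Lim_transform_eventually)
    show "eventually (\<lambda>z. (z ^ msize n * Lfun \<mu> n z) * (cpoly (typeI \<mu> m k) z / z ^ d)
      - (z ^ msize m * Lfun \<mu> m z) * (cpoly (typeI \<mu> n k) z / z ^ Suc d) = z ^ m (other k) * sfun n m k z) at_infinity"
      unfolding eventually_at_infinity
    proof (intro exI[of _ "hull_bound + 1"] allI impI)
      fix z :: complex assume z: "hull_bound + 1 \<le> norm z"
      have zK: "z \<notin> of_real ` support_hull" using z hull_bound(2) by fastforce
      have z0: "z \<noteq> 0" using z hull_bound(1) by auto
      have "z ^ msize n = z ^ m (other k) * z ^ d" "z ^ msize m = z ^ m (other k) * z ^ Suc d"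
        using e1 sz by (simp_all flip: power_add)
      then show "(z ^ msize n * Lfun \<mu> n z) * (cpoly (typeI \<mu> m k) z / z ^ d)
        - (z ^ msize m * Lfun \<mu> m z) * (cpoly (typeI \<mu> n k) z / z ^ Suc d) = z ^ m (other k) * sfun n m k z"
        unfolding sfun_eq[OF zK] using z0 by (simp add: algebra_simps)
    qed
  qed
qed

text \<open>The function has no zeros off the other interval, so its sign on the ray through Delta k
  is its sign at the infinite end, which is governed by the leading coefficient of the larger
  index.\<close>

lemma sfun_real_pos:
  assumes n: "\<And>k. n k > 0" and x: "x \<in> Delta \<mu> k"
  shows "sfun_real n (inc n i) k x > 0"
proof -
  let ?m = "inc n i" and ?f = "sfun_real n (inc n i) k"
  have m: "?m k > 0" for k by (rule inc_pos[of n, OF n])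
  have lim: "((\<lambda>x. x ^ ?m (other k) * ?f x) \<longlongrightarrow> typeI_top ?m k) F" if "filterlim (of_real :: real \<Rightarrow> complex) at_infinity F" for F
  proof -
    from tendsto_Re[OF filterlim_compose[OF sfun_asymp[of n i k, OF n] that]]
    show ?thesis by (simp add: sfun_of_real flip: of_real_power of_real_mult)
  qed
  have cont: "continuous_on S ?f" if "S \<inter> Delta \<mu> (other k) = {}" for S
  proof -
    have "continuous_on S (\<lambda>x. sfun n ?m k (of_real x))"
      using that by (intro continuous_on_compose2[OF holomorphic_on_imp_continuous_on[OF sfun_holomorphic]] continuous_intros) auto
    from continuous_on_Re[OF this] show ?thesis by (simp add: sfun_of_real)
  qed
  \<comment> \<open>The ray that contains Delta k and stops at the other interval.\<close>
  define I where "I = (if k = I1 then {..<left_end \<mu> I2} else {right_end \<mu> I1<..})"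
  have I: "I \<inter> Delta \<mu> (other k) = {}" by (cases k) (auto simp: I_def Delta_eq)
  have xI: "x \<in> I" using x ord by (cases k) (auto simp: I_def Delta_eq)
  have "\<exists>y\<in>I. ?f y > 0"
  proof (cases k)
    case I1
    have "filterlim (of_real :: real \<Rightarrow> complex) at_infinity at_bot"
      by (rule filterlim_norm_at_top_imp_at_infinity) (use filterlim_at_infinity_imp_norm_at_top[OF filterlim_at_bot_imp_at_infinity[OF filterlim_ident]] in simp)
    from tendsto_mult[OF tendsto_const[of "(-1) ^ ?m I2"] lim[OF this]]
    have "((\<lambda>x. (-1) ^ ?m I2 * (x ^ ?m I2 * ?f x)) \<longlongrightarrow> (-1) ^ ?m I2 * typeI_top ?m I1) at_bot"
      using I1 by simp
    from order_tendstoD(1)[OF this typeI_top_signs(2)[of ?m, OF m]]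
    have "eventually (\<lambda>x. (-1) ^ ?m I2 * (x ^ ?m I2 * ?f x) > 0) at_bot" .
    then have "eventually (\<lambda>x. (-1) ^ ?m I2 * (x ^ ?m I2 * ?f x) > 0 \<and> x < min 0 (left_end \<mu> I2)) at_bot"
      using eventually_gt_at_bot[of "min 0 (left_end \<mu> I2)"] by (rule eventually_conj)
    then obtain y where y: "(-1) ^ ?m I2 * (y ^ ?m I2 * ?f y) > 0" "y < min 0 (left_end \<mu> I2)"
      using eventually_happens'[OF trivial_limit_at_bot_linorder] by blast
    have "(-1) ^ ?m I2 * (y ^ ?m I2 * ?f y) = (- y) ^ ?m I2 * ?f y"
      by (subst power_minus) (simp add: mult_ac)
    then have "0 < (- y) ^ ?m I2 * ?f y" using y(1) by (simp only:)
    moreover have "0 < (- y) ^ ?m I2" using y(2) by (intro zero_less_power) simp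
    ultimately have "?f y > 0" by (rule zero_less_mult_pos)
    then show ?thesis using y I1 by (auto simp: I_def)
  next
    case I2
    have "filterlim (of_real :: real \<Rightarrow> complex) at_infinity at_top"
      by (rule filterlim_norm_at_top_imp_at_infinity) (simp add: filterlim_abs_real)
    from order_tendstoD(1)[OF lim[OF this], of 0] typeI_top_signs(1)[of ?m, OF m]
    have "eventually (\<lambda>x. x ^ ?m I1 * ?f x > 0) at_top" using I2 by simp
    then have "eventually (\<lambda>x. x ^ ?m I1 * ?f x > 0 \<and> x > max 0 (right_end \<mu> I1)) at_top"
      using eventually_gt_at_top[of "max 0 (right_end \<mu> I1)"] by (rule eventually_conj)
    then obtain y where y: "y ^ ?m I1 * ?f y > 0" "y > max 0 (right_end \<mu> I1)"
      using eventually_happens'[OF trivial_limit_at_top_linorder] by blast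
    then have "?f y > 0" by (simp add: zero_less_mult_iff)
    then show ?thesis using y I2 by (auto simp: I_def)
  qed
  then obtain y where y: "y \<in> I" "?f y > 0" by blast
  show ?thesis
  proof (rule ccontr)
    assume "\<not> ?thesis"
    then have neg: "?f x \<le> 0" by simp
    have "connected (?f ` I)"
      using cont[OF I] by (intro connected_continuous_image) (auto simp: I_def)
    then have "0 \<in> ?f ` I"
      using connectedD_interval[of "?f ` I" "?f x" "?f y" 0] xI y neg by (simp add: imageI)
    then obtain w where "w \<in> I" "?f w = 0" by auto
    then show False using sfun_real_nonzero[of n w k i, OF n] I by auto
  qed
qed

text \<open>Used where the polynomial on the interval of \<open>E\<close> vanishes at \<open>E\<close>, so that the value \<open>0\<close> of the
  quotient at \<open>x = E\<close> agrees with the limit of \<open>L\<close> even if \<open>E\<close> is an atom.\<close>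

definition Lreal :: "multi_index \<Rightarrow> real \<Rightarrow> real" where
  "Lreal n E = - (\<Sum>k\<in>UNIV. LINT x|\<mu> k. poly (typeI \<mu> n k) x / (x - E))"

lemma pole_quotient_integrable:
  assumes root: "\<And>k. E \<in> Delta \<mu> k \<Longrightarrow> poly (typeI \<mu> n k) E = 0"
  shows "integrable (\<mu> k) (\<lambda>x. poly p x * (poly (typeI \<mu> n k) x / (x - E)))"
proof (rule Bochner_Integration.integrable_bound)
  have eq: "poly (typeI \<mu> n k) x / (x - E) = (if x = E then 0 else poly (synthetic_div (typeI \<mu> n k) E) x + poly (typeI \<mu> n k) E / (x - E))" for x
    using poly_diff_synthetic_div[of "typeI \<mu> n k" x E] by (auto simp: field_simps)
  have "continuous_on (Delta \<mu> k) (\<lambda>x. poly p x * (poly (synthetic_div (typeI \<mu> n k) E) x + poly (typeI \<mu> n k) E / (x - E)))"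
  proof (cases "E \<in> Delta \<mu> k")
    case True
    then show ?thesis using root by (simp add: continuous_intros)
  qed (auto intro!: continuous_intros)
  then show "integrable (\<mu> k) (\<lambda>x. poly p x * (poly (synthetic_div (typeI \<mu> n k) E) x + poly (typeI \<mu> n k) E / (x - E)))"
    by (intro integrable_continuous_Delta) auto
  show "AE x in \<mu> k. norm (poly p x * (poly (typeI \<mu> n k) x / (x - E))) \<le> norm (poly p x * (poly (synthetic_div (typeI \<mu> n k) E) x + poly (typeI \<mu> n k) E / (x - E)))"
    unfolding eq by (intro AE_I2) auto
qed simp

text \<open>Since |x - E - i \<epsilon>| >= |x - E|, the quotient A(x) / (x - E) dominates, and it
  is integrable because A vanishes at \<open>E\<close> or \<open>E\<close> is off the interval. An
  atom at \<open>E\<close> contributes 0 on both sides.\<close>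

lemma Lfun_vertical:
  assumes root: "\<And>k. E \<in> Delta \<mu> k \<Longrightarrow> poly (typeI \<mu> n k) E = 0"
  shows "((\<lambda>\<epsilon>. Lfun \<mu> n (Complex E \<epsilon>)) \<longlongrightarrow> of_real (Lreal n E)) (at_right 0)"
proof -
  have "((\<lambda>\<epsilon>. cauchy_tr (\<mu> k) (poly (typeI \<mu> n k)) (Complex E \<epsilon>)) \<longlongrightarrow> (LINT x|\<mu> k. of_real (poly (typeI \<mu> n k) x / (x - E)))) (at_right 0)" for k
    unfolding cauchy_tr_def
  proof (rule integral_tendsto_at_within[where w="\<lambda>x. \<bar>poly (typeI \<mu> n k) x / (x - E)\<bar>"])
    show "integrable (\<mu> k) (\<lambda>x. \<bar>poly (typeI \<mu> n k) x / (x - E)\<bar>)"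
      using integrable_abs[OF pole_quotient_integrable[OF root, where p=1]] by simp
    show "AE x in \<mu> k. norm (complex_of_real (poly (typeI \<mu> n k) x) / (of_real x - Complex E \<epsilon>)) \<le> \<bar>poly (typeI \<mu> n k) x / (x - E)\<bar>" for \<epsilon>
      using AE_Delta
    proof eventually_elim
      case (elim x)
      show ?case
      proof (cases "x = E")
        case True
        then show ?thesis using root elim by simp
      next
        case False
        have "\<bar>x - E\<bar> \<le> norm (of_real x - Complex E \<epsilon>)" using abs_Re_le_cmod[of "of_real x - Complex E \<epsilon>"] by simp
        then show ?thesis using False by (simp add: norm_divide frac_le)
      qed
    qed
    show "AE x in \<mu> k. ((\<lambda>\<epsilon>. complex_of_real (poly (typeI \<mu> n k) x) / (of_real x - Complex E \<epsilon>)) \<longlongrightarrow> of_real (poly (typeI \<mu> n k) x / (x - E))) (at_right 0)"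
      using AE_Delta
    proof eventually_elim
      case (elim x)
      show ?case
      proof (cases "x = E")
        case True
        then show ?thesis using root elim by simp
      next
        case False
        have "((\<lambda>\<epsilon>. complex_of_real (poly (typeI \<mu> n k) x) / (of_real x - (of_real E + \<i> * of_real \<epsilon>)))
          \<longlongrightarrow> of_real (poly (typeI \<mu> n k) x) / (of_real x - (of_real E + \<i> * of_real 0))) (at_right 0)"
          using False by (intro tendsto_intros) auto
        then show ?thesis by (simp add: Complex_eq)
      qed
    qed
  qed simp_all
  then have "((\<lambda>\<epsilon>. - (\<Sum>k\<in>UNIV. cauchy_tr (\<mu> k) (poly (typeI \<mu> n k)) (Complex E \<epsilon>))) \<longlongrightarrow> - (\<Sum>k\<in>UNIV. (LINT x|\<mu> k. of_real (poly (typeI \<mu> n k) x / (x - E))))) (at_right 0)"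
    by (intro tendsto_intros)
  then show ?thesis unfolding Lfun_eq cform_def Lreal_def integral_complex_of_real by simp
qed

lemma Lplus_eq:
  assumes "\<And>k. E \<in> Delta \<mu> k \<Longrightarrow> poly (typeI \<mu> n k) E = 0"
  shows "Lplus \<mu> n E = of_real (Lreal n E)"
  unfolding Lplus_def by (intro tendsto_Lim Lfun_vertical assms) auto

text \<open>The product of D and A_k is nonnegative on Delta k. With D = (x - E) p the integral of p
  A / (x - E) = D A / (x - E)^2 is positive; orthogonality reduces it to p(E) times minus
  \<open>Lreal n E\<close>, and p(E) is the derivative of D. This is the sign of
  \<open>zeta\<close>.\<close>

lemma Dpoly_derivative_Lreal_neg:
  assumes n: "\<And>k. n k > 0" and \<xi>: "right_end \<mu> I1 < \<xi>" "\<xi> < left_end \<mu> I2"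
    and E: "poly (Dpoly \<mu> n \<xi>) E = 0"
  shows "poly (pderiv (Dpoly \<mu> n \<xi>)) E * Lreal n E < 0"
    and "\<And>k. E \<in> Delta \<mu> k \<Longrightarrow> poly (typeI \<mu> n k) E = 0"
proof -
  let ?D = "Dpoly \<mu> n \<xi>" and ?A = "typeI \<mu> n"
  have N: "msize n > 0" by (rule msize_pos[of n I1, OF n])
  show root: "poly (?A k) E = 0" if "E \<in> Delta \<mu> k" for k
  proof -
    have "(-1) ^ n I2 * (E - \<xi>) * poly (?A (other k)) E > 0" by (rule gap_sign(3)[of n, OF n \<xi> that])
    then have "E - \<xi> \<noteq> 0" "poly (?A (other k)) E \<noteq> 0" by auto
    then show ?thesis using E by (cases k) (auto simp: Dpoly_def)
  qed
  have Dnz: "?D \<noteq> 0" using typeI_neq_0[of n, OF n] by (simp add: Dpoly_def del: mult_pCons_left)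
  have degD: "degree ?D = msize n - 1"
    using n[of I1] n[of I2] by (simp add: Dpoly_def degree_mult_eq typeI_neq_0[of n, OF n] degree_typeI[of n, OF n] msize_def del: mult_pCons_left)
  let ?p = "synthetic_div ?D E"
  have Dp: "?D = [:- E, 1:] * ?p" using synthetic_div_correct'[of E ?D] E by simp
  have pE: "poly ?p E = poly (pderiv ?D) E"
    by (subst (2) Dp) (simp add: pderiv_mult pderiv_pCons del: mult_pCons_left)
  have Dx: "poly ?D x = (x - E) * poly ?p x" for x using poly_diff_synthetic_div[of ?D x E] E by simp
  have Dpos: "poly ?D x * poly (?A k) x \<ge> 0" if "x \<in> Delta \<mu> k" for x k
  proof -
    have "poly ?D x * poly (?A k) x = ((-1) ^ n I2 * (x - \<xi>) * poly (?A (other k)) x) * (poly (?A k) x)\<^sup>2"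
      by (cases k) (auto simp: Dpoly_def power2_eq_square algebra_simps)
    then show ?thesis using gap_sign(3)[of n, OF n \<xi> that] by (metis less_imp_le mult_nonneg_nonneg zero_le_power2)
  qed
  have split: "(LINT x|\<mu> k. poly ?p x * (poly (?A k) x / (x - E)))
    = poly ?p E * (LINT x|\<mu> k. poly (?A k) x / (x - E)) + (LINT x|\<mu> k. poly (synthetic_div ?p E) x * poly (?A k) x)" for k
  proof -
    have i: "integrable (\<mu> k) (\<lambda>x. poly (?A k) x / (x - E))"
      using pole_quotient_integrable[where p=1, OF root] by simp
    have "(LINT x|\<mu> k. poly ?p x * (poly (?A k) x / (x - E)))
      = (LINT x|\<mu> k. poly ?p E * (poly (?A k) x / (x - E)) + poly (synthetic_div ?p E) x * poly (?A k) x)"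
    proof (rule integral_cong_AE)
      show "AE x in \<mu> k. poly ?p x * (poly (?A k) x / (x - E)) = poly ?p E * (poly (?A k) x / (x - E)) + poly (synthetic_div ?p E) x * poly (?A k) x"
        using AE_Delta
      proof eventually_elim
        case (elim x)
        have "poly ?p x = poly ?p E + (x - E) * poly (synthetic_div ?p E) x"
          using poly_diff_synthetic_div[of ?p x E] by simp
        moreover have "(x - E) * (poly (?A k) x / (x - E)) = poly (?A k) x" using root elim by (cases "x = E") auto
        ultimately show ?case by algebra
      qed
    qed simp_all
    also have "\<dots> = poly ?p E * (LINT x|\<mu> k. poly (?A k) x / (x - E)) + (LINT x|\<mu> k. poly (synthetic_div ?p E) x * poly (?A k) x)"
      unfolding integral_mult_right_zero[symmetric]
      by (rule Bochner_Integration.integral_add) (rule integrable_mult_right[OF i], rule integrable_poly_mult)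
    finally show ?thesis .
  qed
  have "(\<Sum>k\<in>UNIV. LINT x|\<mu> k. poly ?p x * (poly (?A k) x / (x - E))) > 0"
  proof (rule sum_integral_positive[where k=I1])
    have eq: "poly ?p x * (poly (?A k) x / (x - E)) = (poly ?D x * poly (?A k) x) / (x - E)\<^sup>2" for k x
      unfolding Dx by (simp add: power2_eq_square)
    show "0 \<le> poly ?p x * (poly (?A k) x / (x - E))" if "x \<in> Delta \<mu> k" for k x
      unfolding eq using Dpos[OF that] by simp
    have "{x \<in> Delta \<mu> I1. poly ?p x * (poly (?A I1) x / (x - E)) = 0} \<subseteq> {x. poly (?D * ?A I1 * [:- E, 1:]) x = 0}"
      unfolding eq by auto
    moreover have "finite {x. poly (?D * ?A I1 * [:- E, 1:]) x = 0}"
      using Dnz typeI_neq_0[of n I1, OF n] by (intro poly_roots_finite) (simp del: mult_pCons_right)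
    ultimately show "finite {x \<in> Delta \<mu> I1. poly ?p x * (poly (?A I1) x / (x - E)) = 0}" by (rule finite_subset)
  qed (rule pole_quotient_integrable[OF root])
  also have "(\<Sum>k\<in>UNIV. LINT x|\<mu> k. poly ?p x * (poly (?A k) x / (x - E)))
    = poly ?p E * (\<Sum>k\<in>UNIV. LINT x|\<mu> k. poly (?A k) x / (x - E)) + pairing \<mu> ?A (synthetic_div ?p E)"
    unfolding split sum.distrib sum_distrib_left pairing_def ..
  also have "pairing \<mu> ?A (synthetic_div ?p E) = 0"
  proof (cases "degree ?p = 0")
    case True
    then have "synthetic_div ?p E = 0" by (simp add: synthetic_div_eq_0_iff)
    then show ?thesis by simp
  next
    case False
    then show ?thesis using degD by (intro typeI_orthogonal N) (simp add: degree_synthetic_div)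
  qed
  finally show "poly (pderiv ?D) E * Lreal n E < 0" unfolding pE Lreal_def by simp
qed

end

section \<open>Quotients of linear forms as Cauchy transforms\<close>

context angelesco_system
begin

lemma markov_measurable [measurable]: "markov (\<mu> k) \<in> borel_measurable borel"
proof -
  have "(\<lambda>z. LINT x|\<mu> k. 1 / (z - x)) \<in> borel_measurable borel"
    by (rule M.borel_measurable_lebesgue_integral) measurable
  then show ?thesis by (simp add: markov_def[abs_def])
qed

lemma sfun_real_measurable [measurable]: "sfun_real p q k \<in> borel_measurable borel"
  unfolding sfun_real_def[abs_def] typeI_0_eq by measurable

lemma sfun_real_continuous: "continuous_on (Delta \<mu> k) (sfun_real p q k)"
proof -
  have "continuous_on (Delta \<mu> k) (\<lambda>x. sfun p q k (of_real x))"
    using Delta_disjoint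
    by (intro continuous_on_compose2[OF holomorphic_on_imp_continuous_on[OF sfun_holomorphic]] continuous_intros) auto
  from continuous_on_Re[OF this] show ?thesis by (simp add: sfun_of_real)
qed

lemma Delta_measurable [measurable]: "Delta \<mu> k \<in> sets borel"
  by (simp add: Delta_eq)

lemma sum_indicator_Delta:
  "x \<in> Delta \<mu> k \<Longrightarrow> (\<Sum>j\<in>UNIV. indicator (Delta \<mu> j) x * f j) = (f k :: real)"
  using Delta_disjoint[of x k] by (simp add: sum_side'[of _ k])

lemma sum_indicator_Delta_bounded:
  fixes f :: "side \<Rightarrow> real \<Rightarrow> real"
  assumes "\<And>k. continuous_on (Delta \<mu> k) (f k)"
  shows "\<exists>B. \<forall>x. \<bar>\<Sum>k\<in>UNIV. indicator (Delta \<mu> k) x * f k x\<bar> \<le> B"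
proof -
  have "\<exists>C. \<forall>x\<in>Delta \<mu> k. \<bar>f k x\<bar> \<le> C" for k
    using compact_imp_bounded[OF compact_continuous_image[OF assms[of k] compact_Delta]]
    unfolding bounded_iff by auto
  then obtain C where C: "\<And>k x. x \<in> Delta \<mu> k \<Longrightarrow> \<bar>f k x\<bar> \<le> C k" by metis
  have "\<bar>indicator (Delta \<mu> k) x * f k x\<bar> \<le> \<bar>C k\<bar>" for k x
    using C[of x k] by (auto simp: indicator_def)
  then have "\<bar>\<Sum>k\<in>UNIV. indicator (Delta \<mu> k) x * f k x\<bar> \<le> (\<Sum>k\<in>UNIV. \<bar>C k\<bar>)" for x
    by (intro order_trans[OF sum_abs] sum_mono)
  then show ?thesis by blast
qed

lemma Lfun_atom:
  "((\<lambda>\<epsilon>. \<i> * of_real \<epsilon> * Lfun \<mu> p (Complex E \<epsilon>)) \<longlongrightarrow> of_real (Qatom \<mu> p E)) (at_right 0)"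
proof -
  have "((\<lambda>\<epsilon>. \<Sum>k\<in>UNIV. - (\<i> * of_real \<epsilon>) * cauchy_tr (\<mu> k) (poly (typeI \<mu> p k)) (Complex E \<epsilon>))
    \<longlongrightarrow> (\<Sum>k\<in>UNIV. of_real (poly (typeI \<mu> p k) E * measure (\<mu> k) {E}))) (at_right 0)"
    by (intro tendsto_sum M.cauchy_tr_vertical integrable_poly)
  then show ?thesis by (simp add: Lfun_eq cform_def Qatom_def sum_distrib_left sum_negf)
qed

lemma Qatom_eq: "E \<in> Delta \<mu> k \<Longrightarrow> Qatom \<mu> p E = poly (typeI \<mu> p k) E * measure (\<mu> k) {E}"
proof -
  assume E: "E \<in> Delta \<mu> k"
  have "AE x in \<mu> (other k). x \<notin> {E}"
    using AE_Delta by eventually_elim (use E Delta_disjoint in auto)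
  then have "emeasure (\<mu> (other k)) {E} = 0"
    by (subst (asm) AE_iff_measurable[of "{E}"]) auto
  then show ?thesis by (simp add: Qatom_def sum_side'[of _ k] measure_def)
qed

end

text \<open>One edge of the tree together with a measure representing its \<open>Mfun\<close>; it
  will turn out to be the spectral measure of the subtree below.\<close>

locale angelesco_edge = angelesco_system \<mu> for \<mu> +
  fixes n :: multi_index and i :: side and \<rho> :: "real measure"
  assumes n_pos: "\<And>k. n k > 0"
    and rho: "finite_borel_measure \<rho>"
    and AE_rho: "AE x in \<rho>. x \<in> support_hull"
    and Mfun_rho: "\<And>z. z \<notin> of_real ` support_hull \<Longrightarrow> Mfun n i z = cauchy_tr \<rho> (\<lambda>_. 1) z"
begin

sublocale R: finite_borel_measure \<rho> by (rule rho)

lemma sets_rho [simp, measurable_cong]: "sets \<rho> = sets borel" by (rule R.M_is_borel)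

lemma space_rho [simp]: "space \<rho> = UNIV" using sets_eq_imp_space_eq[OF sets_rho] by simp

lemma AE_rho_bound: "AE x in \<rho>. \<bar>x\<bar> \<le> hull_bound"
  using AE_rho by eventually_elim (rule hull_bound)

lemma mem_typeI_zeros: "E \<in> typeI_zeros \<mu> n \<longleftrightarrow> (\<exists>k. poly (typeI \<mu> n k) E = 0)"
  unfolding typeI_zeros_def by (auto, metis side.exhaust)

lemma typeI_zeros_finite: "finite (typeI_zeros \<mu> n)"
  and typeI_zeros_prod: "cpoly (typeI \<mu> n k) z * cpoly (typeI \<mu> n (other k)) z
    = of_real (typeI_top n I1 * typeI_top n I2) * (\<Prod>E\<in>typeI_zeros \<mu> n. z - of_real E)"
proof -
  let ?Z = "\<lambda>k. {x. poly (typeI \<mu> n k) x = 0}"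
  have fin: "finite (?Z k)" for k by (rule typeI_prod_zeros(1)[of n, OF n_pos])
  have eq: "typeI_zeros \<mu> n = ?Z I1 \<union> ?Z I2" by (auto simp: typeI_zeros_def)
  show "finite (typeI_zeros \<mu> n)" unfolding eq using fin by simp
  have disj: "?Z I1 \<inter> ?Z I2 = {}"
    using typeI_zeros_in_Delta[of n, OF n_pos] Delta_disjoint[of _ I1] by fastforce
  have c: "cpoly (typeI \<mu> n k) z = of_real (typeI_top n k) * (\<Prod>E\<in>?Z k. z - of_real E)" for k
    using arg_cong[OF typeI_prod_zeros(2)[of n k, OF n_pos], of "\<lambda>p. cpoly p z"] by (simp only: cpoly_smult cpoly_prod) simp
  have "(\<Prod>E\<in>typeI_zeros \<mu> n. z - of_real E) = (\<Prod>E\<in>?Z I1. z - of_real E) * (\<Prod>E\<in>?Z I2. z - of_real E)"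
    unfolding eq by (rule prod.union_disjoint[OF fin fin disj])
  then show "cpoly (typeI \<mu> n k) z * cpoly (typeI \<mu> n (other k)) z
    = of_real (typeI_top n I1 * typeI_top n I2) * (\<Prod>E\<in>typeI_zeros \<mu> n. z - of_real E)"
    unfolding c by (cases k) simp_all
qed

lemma typeI_zeros_hull: "typeI_zeros \<mu> n \<subseteq> support_hull"
  using mem_typeI_zeros typeI_zeros_in_Delta[of n, OF n_pos] Delta_subset_hull by blast

lemma typeI_zeros_Delta:
  assumes "E \<in> typeI_zeros \<mu> n"
  shows "\<exists>k. E \<in> Delta \<mu> k \<and> poly (typeI \<mu> n k) E = 0"
  using assms typeI_zeros_in_Delta[of n, OF n_pos] by (auto simp: mem_typeI_zeros)

lemma typeI_zeros_root:
  assumes "E \<in> typeI_zeros \<mu> n" "E \<in> Delta \<mu> k"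
  shows "poly (typeI \<mu> n k) E = 0"
proof -
  obtain j where j: "E \<in> Delta \<mu> j" "poly (typeI \<mu> n j) E = 0" using typeI_zeros_Delta[OF assms(1)] by blast
  then have "j = k" using assms(2) Delta_disjoint[of E k] side_other_cases[of j k] by auto
  then show ?thesis using j by simp
qed

lemma Lreal_zeros_neq_0:
  assumes E: "E \<in> typeI_zeros \<mu> n"
  shows "Lreal n E \<noteq> 0"
proof -
  obtain \<xi> where \<xi>: "right_end \<mu> I1 < \<xi>" "\<xi> < left_end \<mu> I2" using ord dense by blast
  have "poly (Dpoly \<mu> n \<xi>) E = 0" using E by (auto simp: Dpoly_def typeI_zeros_def)
  from Dpoly_derivative_Lreal_neg(1)[of n, OF n_pos \<xi> this] show ?thesis by auto
qed

lemma Lquot_vertical: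
  assumes E: "E \<in> typeI_zeros \<mu> n"
  shows "((\<lambda>\<epsilon>. - (\<i> * of_real \<epsilon>) * (- Lfun \<mu> p (Complex E \<epsilon>) / Lfun \<mu> n (Complex E \<epsilon>)))
    \<longlongrightarrow> of_real (Qatom \<mu> p E / Lreal n E)) (at_right 0)"
  using tendsto_divide[OF Lfun_atom[of p E] Lfun_vertical[OF typeI_zeros_root[OF E]]] Lreal_zeros_neq_0[OF E] by simp

text \<open>Compares two vertical limits of the same function: the quotient of forms, with a finite
  nonzero denominator limit, and its Cauchy transform.\<close>

lemma rho_atom:
  assumes E: "E \<in> typeI_zeros \<mu> n"
  shows "measure \<rho> {E} = Qatom \<mu> (inc n i) E / Lreal n E"
proof -
  have "((\<lambda>\<epsilon>. - (\<i> * of_real \<epsilon>) * cauchy_tr \<rho> (\<lambda>_. 1) (Complex E \<epsilon>)) \<longlongrightarrow> of_real (Qatom \<mu> (inc n i) E / Lreal n E)) (at_right 0)"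
  proof (rule Lim_transform_eventually[OF Lquot_vertical[OF E, of "inc n i"]])
    show "eventually (\<lambda>\<epsilon>. - (\<i> * of_real \<epsilon>) * (- Lfun \<mu> (inc n i) (Complex E \<epsilon>) / Lfun \<mu> n (Complex E \<epsilon>))
      = - (\<i> * of_real \<epsilon>) * cauchy_tr \<rho> (\<lambda>_. 1) (Complex E \<epsilon>)) (at_right 0)"
      using eventually_at_right_less[of 0]
    proof eventually_elim
      case (elim \<epsilon>)
      then have "Complex E \<epsilon> \<notin> of_real ` support_hull" by (auto simp: complex_eq_iff)
      then show ?case using Mfun_rho by (simp add: Mfun_def)
    qed
  qed
  moreover have "((\<lambda>\<epsilon>. - (\<i> * of_real \<epsilon>) * cauchy_tr \<rho> (\<lambda>_. 1) (Complex E \<epsilon>)) \<longlongrightarrow> of_real (1 * measure \<rho> {E})) (at_right 0)"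
    by (rule R.cauchy_tr_vertical) simp
  ultimately have "complex_of_real (Qatom \<mu> (inc n i) E / Lreal n E) = of_real (1 * measure \<rho> {E})"
    by (rule tendsto_unique[rotated]) simp
  then show ?thesis by (simp only: of_real_eq_iff)
qed

lemma sfun_pos: "x \<in> Delta \<mu> k \<Longrightarrow> sfun_real n (inc n i) k x > 0"
  by (rule sfun_real_pos[of n, OF n_pos])

text \<open>The generalized eigenfunction before the factors \<open>mfac\<close> are
  restored.\<close>

definition psi :: "multi_index \<Rightarrow> real \<Rightarrow> real" where
  "psi p x = (\<Sum>k\<in>UNIV. indicator (Delta \<mu> k) x * (sfun_real n p k x / sfun_real n (inc n i) k x))"

lemma psi_measurable [measurable]: "psi p \<in> borel_measurable borel"
  unfolding psi_def[abs_def] by measurable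

lemma psi_eq: "x \<in> Delta \<mu> k \<Longrightarrow> psi p x = sfun_real n p k x / sfun_real n (inc n i) k x"
  unfolding psi_def by (rule sum_indicator_Delta)

lemma psi_bounded: "\<exists>B. \<forall>x. \<bar>psi p x\<bar> \<le> B"
  unfolding psi_def using sfun_pos
  by (intro sum_indicator_Delta_bounded continuous_intros sfun_real_continuous) (metis less_irrefl)

lemma psi_integrable: "integrable \<rho> (psi p)"
proof -
  obtain B where "\<And>x. \<bar>psi p x\<bar> \<le> B" using psi_bounded by blast
  then show ?thesis by (intro R.integrable_const_bound[where B=B]) auto
qed

text \<open>At a zero of A_n on interval k every s_q equals A_q(E) times the same constant. That
  constant cancels in \<open>psi\<close>, and the ratio that remains converts the atom of
  \<open>Mfun\<close> into that of the quotient for \<open>p\<close>.\<close>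

lemma psi_atom:
  assumes E: "E \<in> typeI_zeros \<mu> n"
  shows "psi p E * measure \<rho> {E} = Qatom \<mu> p E / Lreal n E"
proof -
  obtain k where k: "E \<in> Delta \<mu> k" "poly (typeI \<mu> n k) E = 0" using typeI_zeros_Delta[OF E] by blast
  let ?c = "poly (typeI \<mu> n (other k)) E * markov (\<mu> (other k)) E - typeI_0 \<mu> n E"
  have s: "sfun_real n q k E = poly (typeI \<mu> q k) E * ?c" for q
    using k by (simp add: sfun_real_def algebra_simps)
  have "psi p E = poly (typeI \<mu> p k) E / poly (typeI \<mu> (inc n i) k) E" "poly (typeI \<mu> (inc n i) k) E \<noteq> 0"
    using sfun_pos[OF k(1)] unfolding psi_eq[OF k(1)] s by auto
  then show ?thesis unfolding rho_atom[OF E] Qatom_eq[OF k(1)] by simp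
qed

lemma hull_Un_zeros: "support_hull \<union> typeI_zeros \<mu> n = support_hull"
  using typeI_zeros_hull by blast

lemma sfun_Mfun:
  assumes z: "z \<notin> of_real ` support_hull"
  shows "sfun n (inc n i) k z = Lfun \<mu> n z * (cpoly (typeI \<mu> (inc n i) k) z + Mfun n i z * cpoly (typeI \<mu> n k) z)"
  using Lfun_nonzero[of n z, OF n_pos z] unfolding sfun_eq[OF z] Mfun_def by (simp add: field_simps)

text \<open>The quotient s_p / s_{n + e_i} continues \<open>psi p\<close> analytically across each
  interval, and the larger size of \<open>p\<close> gives decay at infinity, so the gluing theorem
  applies.\<close>

lemma Lfun_quotient_representation:
  assumes p: "msize p > msize n" and z: "z \<notin> of_real ` support_hull"
  shows "- Lfun \<mu> p z / Lfun \<mu> n z = cauchy_tr \<rho> (psi p) z"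
proof -
  let ?A = "typeI \<mu> n" and ?m = "inc n i"
  let ?F = "\<lambda>z. - Lfun \<mu> p z / Lfun \<mu> n z" and ?D = "\<lambda>z. \<Prod>E\<in>typeI_zeros \<mu> n. z - complex_of_real E"
  define c where "c = complex_of_real (typeI_top n I1 * typeI_top n I2)"
  have c0: "c \<noteq> 0" using typeI_top_neq_0[OF n_pos] by (simp add: c_def)
  have L0: "w \<notin> of_real ` support_hull \<Longrightarrow> Lfun \<mu> n w \<noteq> 0" for w by (rule Lfun_nonzero[of n, OF n_pos])
  define g where "g k z = sfun n p k z / sfun n ?m k z" for k z
  \<comment> \<open>Where s_{n + e_i} is holomorphic and nonzero; positivity on Delta k puts the
    interval inside.\<close>
  define U where "U k = - (of_real ` Delta \<mu> (other k)) \<inter> sfun n ?m k -` (- {0})" for k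
  have Uo: "open (U k)" for k
    unfolding U_def
    by (intro continuous_open_preimage holomorphic_on_imp_continuous_on sfun_holomorphic)
       (auto intro!: closed_injective_linear_image simp: linear_of_real inj_on_def Delta_eq)
  have Us: "of_real ` Delta \<mu> k \<subseteq> U k" for k
    using sfun_pos[of _ k] Delta_disjoint by (fastforce simp: U_def sfun_of_real)
  have gh: "g k holomorphic_on U k" for k
    unfolding g_def[abs_def]
    by (intro holomorphic_intros holomorphic_on_subset[OF sfun_holomorphic]) (auto simp: U_def)
  have Fh: "?F holomorphic_on - (of_real ` support_hull)"
    by (intro holomorphic_intros Lfun_holomorphic) (auto dest: L0)
  show ?thesis
  proof (rule stieltjes_glue[where a="left_end \<mu>" and b="right_end \<mu>" and \<rho>=\<rho> and U=U and g=g and \<gamma>="psi p"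
        and Es="typeI_zeros \<mu> n" and F="?F" and ?r0.0="\<lambda>z. ?D z * ?F z" and z=z
        and r="\<lambda>k z. cpoly (?A (other k)) z / c * (g k z * cpoly (typeI \<mu> ?m k) z - cpoly (typeI \<mu> p k) z)",
        folded Delta_eq, folded support_hull_eq, unfolded hull_Un_zeros])
    show "Delta \<mu> I1 \<inter> Delta \<mu> I2 = {}" using Delta_disjoint[of _ I1] by auto
    show "g k (of_real x) = of_real (psi p x)" if "x \<in> Delta \<mu> k" for k x
      by (simp add: g_def sfun_of_real psi_eq[OF that])
    show "(\<lambda>z. cpoly (?A (other k)) z / c * (g k z * cpoly (typeI \<mu> ?m k) z - cpoly (typeI \<mu> p k) z)) holomorphic_on U k" for k
      by (intro holomorphic_intros gh c0)
    show "?D w * ?F w = ?D w * g k w * cauchy_tr \<rho> (\<lambda>_. 1) w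
        + cpoly (?A (other k)) w / c * (g k w * cpoly (typeI \<mu> ?m k) w - cpoly (typeI \<mu> p k) w)"
      if w: "w \<in> U k" "w \<notin> of_real ` support_hull" for k w
    proof -
      have s0: "sfun n ?m k w \<noteq> 0" using w(1) by (simp add: U_def)
      \<comment> \<open>Both s_p and s_{n + e_i} are L_n times an expression affine in the
        respective quotient, so L_n drops out of their ratio. The remainder involves only
        polynomials and \<open>g k\<close>.\<close>
      have "cpoly (typeI \<mu> p k) w + ?F w * cpoly (?A k) w = g k w * (cpoly (typeI \<mu> ?m k) w + Mfun n i w * cpoly (?A k) w)"
        using s0 L0[OF w(2)] unfolding g_def sfun_Mfun[OF w(2)] unfolding sfun_eq[OF w(2)] by (simp add: field_simps)
      then have "cpoly (?A k) w * ?F w = g k w * (cpoly (?A k) w * Mfun n i w) + (g k w * cpoly (typeI \<mu> ?m k) w - cpoly (typeI \<mu> p k) w)"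
        by algebra
      moreover have "?D w = cpoly (?A (other k)) w / c * cpoly (?A k) w"
        using typeI_zeros_prod[of k w] c0 by (simp add: c_def field_simps)
      ultimately show ?thesis unfolding Mfun_rho[OF w(2), symmetric] by algebra
    qed
    show "(\<lambda>z. ?D z * ?F z) holomorphic_on - (of_real ` support_hull)" by (intro holomorphic_intros Fh)
    show "(?F \<longlongrightarrow> 0) at_infinity"
    proof -
      have N: "msize n > 0" by (rule msize_pos[of n I1, OF n_pos])
      define e where "e = msize p - msize n"
      have e: "e > 0" "msize p = msize n + e" using p by (auto simp: e_def)
      have "((\<lambda>z. - ((z ^ msize p * Lfun \<mu> p z) / (z ^ msize n * Lfun \<mu> n z)) * inverse z ^ e) \<longlongrightarrow> - (1 / 1) * 0 ^ e) at_infinity"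
        by (intro tendsto_intros Lfun_asymp tendsto_inverse_0) (use N p in auto)
      then have "((\<lambda>z. - ((z ^ msize p * Lfun \<mu> p z) / (z ^ msize n * Lfun \<mu> n z)) * inverse z ^ e) \<longlongrightarrow> 0) at_infinity"
        using e by (simp add: power_0_left)
      then show ?thesis
        by (rule Lim_transform_eventually)
          (use eventually_not_equal_at_infinity[of 0] in eventually_elim, simp add: e power_add power_inverse field_simps)
    qed
    show "((\<lambda>\<epsilon>. - (\<i> * of_real \<epsilon>) * ?F (Complex E \<epsilon>)) \<longlongrightarrow> of_real (psi p E * measure \<rho> {E})) (at_right 0)"
      if "E \<in> typeI_zeros \<mu> n" for E
      unfolding psi_atom[OF that] by (rule Lquot_vertical[OF that])
  qed (use rho AE_rho Uo Us gh typeI_zeros_finite z in auto)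
qed

end

section \<open>The reference measure\<close>

context angelesco_edge
begin

text \<open>The density 1 / s_X with the zeros of A_n removed, since the reference measure has no
  atoms there; those masses reappear as separate point masses.\<close>

definition zero_free_weight :: "real \<Rightarrow> real" where
  "zero_free_weight x = indicator (- typeI_zeros \<mu> n) x *
     (\<Sum>k\<in>UNIV. indicator (Delta \<mu> k) x * (1 / sfun_real n (inc n i) k x))"

definition omega :: "real measure" where
  "omega = density \<rho> (\<lambda>x. ennreal (zero_free_weight x))"

lemma typeI_zeros_measurable [measurable]: "typeI_zeros \<mu> n \<in> sets borel"
  using finite_imp_closed[OF typeI_zeros_finite] by simp

lemma zero_free_weight_measurable [measurable]: "zero_free_weight \<in> borel_measurable borel"
  unfolding zero_free_weight_def[abs_def] by measurable

lemma zero_free_weight_eq: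
  "x \<in> Delta \<mu> k \<Longrightarrow> zero_free_weight x = indicator (- typeI_zeros \<mu> n) x / sfun_real n (inc n i) k x"
  unfolding zero_free_weight_def by (subst sum_indicator_Delta) auto

lemma not_in_hull_Delta: "x \<notin> support_hull \<Longrightarrow> x \<notin> Delta \<mu> k"
  using Delta_subset_hull by blast

lemma zero_free_weight_0: "x \<notin> support_hull \<Longrightarrow> zero_free_weight x = 0"
  by (simp add: zero_free_weight_def not_in_hull_Delta)

lemma in_hull_cases: "x \<notin> support_hull \<or> (\<exists>k. x \<in> Delta \<mu> k)"
  by (auto simp: support_hull_eq)

lemma zero_free_weight_nonneg: "zero_free_weight x \<ge> 0"
  using in_hull_cases[of x] zero_free_weight_0[of x] zero_free_weight_eq[of x] sfun_pos[of x]
  by (force simp: less_imp_le)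

lemma zero_free_weight_integrable: "integrable \<rho> zero_free_weight"
proof -
  obtain B where "\<And>x. \<bar>\<Sum>k\<in>UNIV. indicator (Delta \<mu> k) x * (1 / sfun_real n (inc n i) k x)\<bar> \<le> B"
    using sum_indicator_Delta_bounded[of "\<lambda>k x. 1 / sfun_real n (inc n i) k x"] sfun_pos
    by (fastforce intro!: continuous_intros sfun_real_continuous)
  then have B: "\<bar>\<Sum>k\<in>UNIV. indicator (Delta \<mu> k) x * (1 / sfun_real n (inc n i) k x)\<bar> \<le> \<bar>B\<bar>" for x
    by (rule order_trans) simp
  have "norm (zero_free_weight x) \<le> \<bar>B\<bar>" for x
    using B[of x] by (cases "x \<in> typeI_zeros \<mu> n") (simp_all add: zero_free_weight_def)
  then show ?thesis by (intro R.integrable_const_bound[where B="\<bar>B\<bar>"]) auto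
qed

lemma sets_omega [simp, measurable_cong]: "sets omega = sets borel"
  and space_omega [simp]: "space omega = UNIV"
  by (simp_all add: omega_def)

lemma finite_omega: "finite_measure omega"
proof (rule finite_measureI)
  have "emeasure omega (space omega) = (\<integral>\<^sup>+x. ennreal (zero_free_weight x) \<partial>\<rho>)"
    unfolding omega_def by (subst emeasure_density) auto
  also have "\<dots> = ennreal (LINT x|\<rho>. zero_free_weight x)"
    by (rule nn_integral_eq_integral[OF zero_free_weight_integrable]) (simp add: zero_free_weight_nonneg)
  finally show "emeasure omega (space omega) \<noteq> \<infinity>" by simp
qed

lemma emeasure_omega_0:
  assumes "A \<in> sets borel" "\<And>x. x \<in> A \<Longrightarrow> zero_free_weight x = 0"
  shows "emeasure omega A = 0"
proof -
  have "emeasure omega A = (\<integral>\<^sup>+x. ennreal (zero_free_weight x) * indicator A x \<partial>\<rho>)"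
    unfolding omega_def using assms(1) by (subst emeasure_density) auto
  also have "\<dots> = (\<integral>\<^sup>+x. 0 \<partial>\<rho>)"
    using assms(2) by (intro nn_integral_cong) (auto simp: indicator_def)
  finally show ?thesis by simp
qed

text \<open>Multiplying the weight by \<open>S\<close> leaves the indicator of the complement of the
  zeros. \<open>S\<close> is abstract so that \<open>Sfun\<close> can be inserted once it is
  identified.\<close>

lemma emeasure_rho_decomposition:
  assumes B: "B \<in> sets borel" and S: "S \<in> borel_measurable borel"
    and S_eq: "\<And>k x. x \<in> Delta \<mu> k \<Longrightarrow> S x = sfun_real n (inc n i) k x"
  shows "emeasure \<rho> B = emeasure (density omega (\<lambda>x. ennreal (S x))) B
    + (\<Sum>E\<in>typeI_zeros \<mu> n. ennreal (measure \<rho> {E}) * indicator B E)"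
proof -
  note [measurable] = S B
  let ?Z = "typeI_zeros \<mu> n"
  have "density omega (\<lambda>x. ennreal (S x)) = density \<rho> (\<lambda>x. ennreal (zero_free_weight x) * ennreal (S x))"
    unfolding omega_def by (rule density_density_eq) auto
  also have "\<dots> = density \<rho> (indicator (- ?Z))"
  proof (rule density_cong)
    show "AE x in \<rho>. ennreal (zero_free_weight x) * ennreal (S x) = indicator (- ?Z) x"
      using AE_rho
    proof eventually_elim
      case (elim x)
      then obtain k where k: "x \<in> Delta \<mu> k" using in_hull_cases[of x] by blast
      show ?case using sfun_pos[OF k]
        by (auto simp: zero_free_weight_eq[OF k] S_eq[OF k] ennreal_mult[symmetric] indicator_def)
    qed
  qed auto
  finally have "emeasure (density omega (\<lambda>x. ennreal (S x))) B = (\<integral>\<^sup>+x. indicator (- ?Z) x * indicator B x \<partial>\<rho>)"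
    by (simp add: emeasure_density)
  also have "\<dots> = (\<integral>\<^sup>+x. indicator (B - ?Z) x \<partial>\<rho>)"
    by (intro nn_integral_cong) (auto simp: indicator_def)
  also have "\<dots> = emeasure \<rho> (B - ?Z)" by simp
  finally have 1: "emeasure (density omega (\<lambda>x. ennreal (S x))) B = emeasure \<rho> (B - ?Z)" .
  have fin: "finite (B \<inter> ?Z)" using typeI_zeros_finite by simp
  have "emeasure \<rho> (B \<inter> ?Z) = (\<Sum>E\<in>B \<inter> ?Z. emeasure \<rho> {E})"
    using fin by (intro emeasure_eq_sum_singleton) auto
  also have "\<dots> = (\<Sum>E\<in>?Z. ennreal (measure \<rho> {E}) * indicator B E)"
    using typeI_zeros_finite by (intro sum.mono_neutral_cong_left) (auto simp: R.emeasure_eq_measure indicator_def split: if_splits)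
  finally have 2: "emeasure \<rho> (B \<inter> ?Z) = (\<Sum>E\<in>?Z. ennreal (measure \<rho> {E}) * indicator B E)" .
  have "emeasure \<rho> (B - ?Z) + emeasure \<rho> (B \<inter> ?Z) = emeasure \<rho> ((B - ?Z) \<union> (B \<inter> ?Z))"
    by (intro plus_emeasure) auto
  also have "(B - ?Z) \<union> (B \<inter> ?Z) = B" by blast
  finally show ?thesis unfolding 1 2[symmetric] by simp
qed

end

locale angelesco_edge_gap = angelesco_edge \<mu> n i \<rho> for \<mu> n i \<rho> +
  fixes \<xi> :: real
  assumes gap: "right_end \<mu> I1 < \<xi>" "\<xi> < left_end \<mu> I2"
begin

text \<open>This is D / A_k. On Delta k it is positive, so there the absolute values in
  \<open>Sref\<close> disappear and 1 / \<open>refq\<close> continues \<open>Sref\<close>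
  analytically.\<close>

definition refq :: "side \<Rightarrow> real \<Rightarrow> real" where
  "refq k x = (- 1) ^ n I2 * (x - \<xi>) * poly (typeI \<mu> n (other k)) x"

lemma refq_pos: "x \<in> Delta \<mu> k \<Longrightarrow> refq k x > 0"
  unfolding refq_def by (rule typeI_other_sign[of n, OF n_pos gap])

lemma Sref_eq:
  assumes x: "x \<in> Delta \<mu> k"
  shows "Sref \<mu> n \<xi> x = 1 / refq k x"
proof -
  have "refq k x = \<bar>refq k x\<bar>" using refq_pos[OF x] by simp
  also have "\<dots> = \<bar>x - \<xi>\<bar> * \<bar>poly (typeI \<mu> n (other k)) x\<bar>" by (simp add: refq_def abs_mult power_abs)
  finally show ?thesis unfolding Sref_def sum_indicator_Delta[OF x] by (simp add: divide_inverse)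
qed

lemma Sref_measurable [measurable]: "Sref \<mu> n \<xi> \<in> borel_measurable borel"
  unfolding Sref_def[abs_def] by measurable

lemma Sref_nonneg: "Sref \<mu> n \<xi> x \<ge> 0"
  by (simp add: Sref_def sum_nonneg)

lemma xi_not_in_hull: "\<xi> \<notin> support_hull"
  using gap by (simp add: support_hull_def Delta_eq)

lemma Sref_bounded: "\<exists>B. \<forall>x. \<bar>Sref \<mu> n \<xi> x\<bar> \<le> B"
proof -
  obtain B where B: "\<And>x. \<bar>\<Sum>k\<in>UNIV. indicator (Delta \<mu> k) x * (1 / refq k x)\<bar> \<le> B"
    using sum_indicator_Delta_bounded[of "\<lambda>k x. 1 / refq k x"] refq_pos
    by (fastforce intro!: continuous_intros simp: refq_def)
  have "Sref \<mu> n \<xi> x = (\<Sum>k\<in>UNIV. indicator (Delta \<mu> k) x * (1 / refq k x))" for x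
  proof (cases "x \<in> support_hull")
    case True
    then obtain k where k: "x \<in> Delta \<mu> k" using in_hull_cases[of x] by blast
    show ?thesis unfolding Sref_eq[OF k] sum_indicator_Delta[OF k] ..
  next
    case False
    then have "x \<notin> Delta \<mu> k" for k using Delta_subset_hull by blast
    then show ?thesis by (simp add: Sref_def)
  qed
  then show ?thesis using B by (intro exI[of _ B]) simp
qed

text \<open>The density, relative to \<open>\<rho>\<close>, of the measure whose transform is 1 / (D
  L) up to poles and an affine term.\<close>

definition gam :: "real \<Rightarrow> real" where
  "gam x = (\<Sum>k\<in>UNIV. indicator (Delta \<mu> k) x * (1 / (refq k x * sfun_real n (inc n i) k x)))"

lemma refq_measurable [measurable]: "refq k \<in> borel_measurable borel"
  unfolding refq_def[abs_def] by measurable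

lemma gam_measurable [measurable]: "gam \<in> borel_measurable borel"
  unfolding gam_def[abs_def] by measurable

lemma gam_eq: "x \<in> Delta \<mu> k \<Longrightarrow> gam x = 1 / (refq k x * sfun_real n (inc n i) k x)"
  unfolding gam_def by (rule sum_indicator_Delta)

lemma gam_0: "x \<notin> support_hull \<Longrightarrow> gam x = 0"
  by (simp add: gam_def not_in_hull_Delta)

lemma gam_integrable: "integrable \<rho> gam"
proof -
  have "continuous_on (Delta \<mu> k) (\<lambda>x. 1 / (refq k x * sfun_real n (inc n i) k x))" for k
    using refq_pos[of _ k] sfun_pos[of _ k]
    by (intro continuous_intros sfun_real_continuous) (auto simp: refq_def intro!: continuous_intros, fastforce+)
  then obtain B where "\<And>x. \<bar>gam x\<bar> \<le> B"
    using sum_indicator_Delta_bounded[of "\<lambda>k x. 1 / (refq k x * sfun_real n (inc n i) k x)"] unfolding gam_def by blast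
  then show ?thesis by (intro R.integrable_const_bound[where B=B]) auto
qed

lemma weight_Sref: "zero_free_weight x * Sref \<mu> n \<xi> x = indicator (- typeI_zeros \<mu> n) x * gam x"
proof (cases "x \<in> support_hull")
  case True
  then obtain k where k: "x \<in> Delta \<mu> k" using in_hull_cases[of x] by blast
  show ?thesis by (simp add: zero_free_weight_eq[OF k] Sref_eq[OF k] gam_eq[OF k])
qed (simp add: zero_free_weight_0 gam_0)

text \<open>\<open>zero_free_weight\<close> times \<open>Sref\<close> equals \<open>gam\<close> off
  the zeros, so the two transforms differ by the finitely many point masses of \<open>gam\<close>
  d\<open>\<rho>\<close> at the zeros.\<close>

lemma omega_transform:
  assumes z: "Im z > 0"
  shows "(LINT x|omega. of_real (Sref \<mu> n \<xi> x) / (of_real x - z))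
    = cauchy_tr \<rho> gam z - (\<Sum>E\<in>typeI_zeros \<mu> n. of_real (gam E * measure \<rho> {E}) / (of_real E - z))"
proof -
  let ?Z = "typeI_zeros \<mu> n"
  let ?c = "\<lambda>x. complex_of_real (gam x) / (of_real x - z)"
  have "(LINT x|omega. of_real (Sref \<mu> n \<xi> x) / (of_real x - z))
    = (LINT x|\<rho>. zero_free_weight x *\<^sub>R (complex_of_real (Sref \<mu> n \<xi> x) / (of_real x - z)))"
    unfolding omega_def by (rule integral_density) (auto simp: zero_free_weight_nonneg)
  also have "\<dots> = (LINT x|\<rho>. ?c x - (\<Sum>E\<in>?Z. indicator {E} x *\<^sub>R ?c E))"
  proof (rule Bochner_Integration.integral_cong[OF refl])
    fix x
    have s: "(\<Sum>E\<in>?Z. indicator {E} x *\<^sub>R ?c E) = (if x \<in> ?Z then ?c x else 0)"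
    proof -
      have "(\<Sum>E\<in>?Z. indicator {E} x *\<^sub>R ?c E) = (\<Sum>E\<in>?Z. if E = x then ?c x else 0)"
        by (intro sum.cong) auto
      then show ?thesis using typeI_zeros_finite by simp
    qed
    have "zero_free_weight x *\<^sub>R (complex_of_real (Sref \<mu> n \<xi> x) / (of_real x - z))
      = of_real (zero_free_weight x * Sref \<mu> n \<xi> x) / (of_real x - z)" by (simp add: scaleR_conv_of_real)
    also have "\<dots> = ?c x - (\<Sum>E\<in>?Z. indicator {E} x *\<^sub>R ?c E)"
      unfolding weight_Sref s by simp
    finally show "zero_free_weight x *\<^sub>R (complex_of_real (Sref \<mu> n \<xi> x) / (of_real x - z))
      = ?c x - (\<Sum>E\<in>?Z. indicator {E} x *\<^sub>R ?c E)" .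
  qed
  also have "\<dots> = cauchy_tr \<rho> gam z - (\<Sum>E\<in>?Z. LINT x|\<rho>. indicator {E} x *\<^sub>R ?c E)"
  proof -
    have i1: "integrable \<rho> ?c" using z by (intro R.cauchy_kernel_integrable' gam_integrable) simp
    have i2: "integrable \<rho> (\<lambda>x. indicator {E} x *\<^sub>R ?c E)" for E
      by (intro integrable_scaleR_left) (auto simp: R.emeasure_eq_measure)
    show ?thesis unfolding cauchy_tr_def
      by (subst Bochner_Integration.integral_diff[OF i1 Bochner_Integration.integrable_sum[OF i2]],
          subst Bochner_Integration.integral_sum[OF i2]) simp
  qed
  also have "(\<Sum>E\<in>?Z. LINT x|\<rho>. indicator {E} x *\<^sub>R ?c E) = (\<Sum>E\<in>?Z. of_real (gam E * measure \<rho> {E}) / (of_real E - z))"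
  proof (rule sum.cong[OF refl])
    fix E
    have "(LINT x|\<rho>. indicator {E} x *\<^sub>R ?c E) = (LINT x|\<rho>. indicator {E} x) *\<^sub>R ?c E"
      by (rule integral_scaleR_left) (auto simp: R.emeasure_eq_measure)
    then show "(LINT x|\<rho>. indicator {E} x *\<^sub>R ?c E) = of_real (gam E * measure \<rho> {E}) / (of_real E - z)"
      by (simp add: scaleR_conv_of_real)
  qed
  finally show ?thesis .
qed

section \<open>Poles and asymptotics of 1 / (D L)\<close>

abbreviation "D \<equiv> Dpoly \<mu> n \<xi>"

definition poles :: "real set" where
  "poles = typeI_zeros \<mu> n \<union> {\<xi>}"

lemma poles_finite: "finite poles"
  by (simp add: poles_def typeI_zeros_finite)

lemma poles_root: "E \<in> poles \<Longrightarrow> poly D E = 0"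
  by (auto simp: poles_def Dpoly_def typeI_zeros_def)

lemma lead_coeff_D: "degree D = msize n - 1" "coeff D (msize n - 1) > 0"
proof -
  show d: "degree D = msize n - 1"
    using n_pos[of I1] n_pos[of I2]
    by (simp add: Dpoly_def degree_mult_eq typeI_neq_0[of n, OF n_pos] degree_typeI[of n, OF n_pos] msize_def del: mult_pCons_left)
  have lc: "lead_coeff (typeI \<mu> n k) = typeI_top n k" for k
    by (simp add: typeI_top_def degree_typeI[of n, OF n_pos])
  have "lead_coeff D = (-1) ^ n I2 * typeI_top n I1 * typeI_top n I2"
    by (simp add: Dpoly_def lead_coeff_mult lc del: mult_pCons_left)
  also have "\<dots> > 0" using typeI_top_signs[of n, OF n_pos] by simp
  finally show "coeff D (msize n - 1) > 0" unfolding d .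
qed

lemma D_prod: "cpoly D z = of_real ((-1) ^ n I2 * (typeI_top n I1 * typeI_top n I2)) * (\<Prod>E\<in>poles. z - of_real E)"
proof -
  have "cpoly D z = (-1) ^ n I2 * (z - of_real \<xi>) * (cpoly (typeI \<mu> n I1) z * cpoly (typeI \<mu> n (other I1)) z)"
    by (simp add: Dpoly_def algebra_simps del: mult_pCons_left)
  moreover have "\<xi> \<notin> typeI_zeros \<mu> n" using xi_not_in_hull typeI_zeros_hull by blast
  ultimately show ?thesis
    unfolding typeI_zeros_prod poles_def by (simp add: typeI_zeros_finite mult_ac)
qed

text \<open>D L = s0 / z + s1 / z^2 + ..., where s0 is the leading coefficient of D and hence
  positive. Inverting gives z / s0 - s1 / s0^2 + o(1); \<open>T\<close> is the quantity whose limit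
  is the second coefficient.\<close>

lemma inverse_DL_asymp:
  "\<exists>a b. b > 0 \<and> ((\<lambda>z. 1 / (cpoly D z * Lfun \<mu> n z) - (of_real a + of_real b * z)) \<longlongrightarrow> 0) at_infinity"
proof -
  have N: "msize n > 0" by (rule msize_pos[of n I1, OF n_pos])
  define s0 where "s0 = pairing \<mu> (typeI \<mu> n) D"
  define h where "h k x = poly (D * typeI \<mu> n k) x" for k x
  define s1 where "s1 = (\<Sum>k\<in>UNIV. LINT x|\<mu> k. x * h k x)"
  define G where "G z = z * (cpoly D z * Lfun \<mu> n z)" for z
  define T where "T z = z * (G z - of_real s0)" for z
  have s0: "s0 > 0" unfolding s0_def using lead_coeff_D N by (subst pairing_typeI) auto
  have s0h: "s0 = (\<Sum>k\<in>UNIV. LINT x|\<mu> k. h k x)" by (simp add: s0_def pairing_def h_def)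
  have xh: "(\<lambda>x. x * h k x) = poly ([:0, 1:] * (D * typeI \<mu> n k))" for k
    by (simp add: h_def fun_eq_iff)
  have int: "integrable (\<mu> k) (h k)" "integrable (\<mu> k) (\<lambda>x. x * h k x)" for k
    unfolding xh unfolding h_def by (rule integrable_poly)+
  have G: "G z - of_real s0 = - (\<Sum>k\<in>UNIV. cauchy_tr (\<mu> k) (\<lambda>x. x * h k x) z)" if z: "norm z > hull_bound" for z
  proof -
    have zK: "z \<notin> of_real ` support_hull" using z hull_bound(2) by fastforce
    have "cpoly D z * Lfun \<mu> n z = - (\<Sum>k\<in>UNIV. cauchy_tr (\<mu> k) (\<lambda>x. poly D x * poly (typeI \<mu> n k) x) z)"
      unfolding Lfun_eq using N lead_coeff_D(1)
      by (intro cform_mult_orthogonal(1)[OF zK, of "msize n - 1"] typeI_orthogonal) auto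
    then have "G z = - (\<Sum>k\<in>UNIV. z * cauchy_tr (\<mu> k) (h k) z)"
      by (simp add: G_def h_def[abs_def] sum_distrib_left)
    also have "\<dots> = - (\<Sum>k\<in>UNIV. cauchy_tr (\<mu> k) (\<lambda>x. x * h k x) z - of_real (LINT x|\<mu> k. h k x))"
      by (simp only: M.cauchy_tr_mult_ident[OF int(1) AE_hull_bound z])
    finally show ?thesis by (simp add: s0h sum_subtractf)
  qed
  have T: "(T \<longlongrightarrow> of_real s1) at_infinity"
  proof -
    have "((\<lambda>z. \<Sum>k\<in>UNIV. - z * cauchy_tr (\<mu> k) (\<lambda>x. x * h k x) z) \<longlongrightarrow> (\<Sum>k\<in>UNIV. of_real (LINT x|\<mu> k. x * h k x))) at_infinity"
      by (intro tendsto_sum M.cauchy_tr_asymp[OF int(2) AE_hull_bound])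
    then have "((\<lambda>z. \<Sum>k\<in>UNIV. - z * cauchy_tr (\<mu> k) (\<lambda>x. x * h k x) z) \<longlongrightarrow> of_real s1) at_infinity"
      by (simp add: s1_def)
    then show ?thesis
    proof (rule Lim_transform_eventually)
      show "eventually (\<lambda>z. (\<Sum>k\<in>UNIV. - z * cauchy_tr (\<mu> k) (\<lambda>x. x * h k x) z) = T z) at_infinity"
        unfolding eventually_at_infinity
        by (intro exI[of _ "hull_bound + 1"]) (auto simp: T_def G sum_distrib_left sum_negf)
    qed
  qed
  have "((\<lambda>z. of_real s0 + T z * inverse z) \<longlongrightarrow> of_real s0 + of_real s1 * 0) at_infinity"
    by (intro tendsto_intros T tendsto_inverse_0)
  then have "((\<lambda>z. of_real s0 + T z * inverse z) \<longlongrightarrow> of_real s0) at_infinity" by simp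
  then have Gl: "(G \<longlongrightarrow> of_real s0) at_infinity"
    by (rule Lim_transform_eventually) (use eventually_not_equal_at_infinity[of 0] in eventually_elim, simp add: T_def divide_inverse[symmetric])
  have "((\<lambda>z. - T z / (G z * of_real s0) - of_real (- s1 / s0\<^sup>2)) \<longlongrightarrow> - of_real s1 / (of_real s0 * of_real s0) - of_real (- s1 / s0\<^sup>2)) at_infinity"
    using s0 by (intro tendsto_intros T Gl) auto
  then have "((\<lambda>z. - T z / (G z * of_real s0) - of_real (- s1 / s0\<^sup>2)) \<longlongrightarrow> 0) at_infinity"
    by (simp add: power2_eq_square)
  then have "((\<lambda>z. 1 / (cpoly D z * Lfun \<mu> n z) - (of_real (- s1 / s0\<^sup>2) + of_real (1 / s0) * z)) \<longlongrightarrow> 0) at_infinity"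
  proof (rule Lim_transform_eventually)
    have "eventually (\<lambda>z. G z \<noteq> 0) at_infinity"
      using tendsto_imp_eventually_ne[OF Gl] s0 by simp
    then show "eventually (\<lambda>z. - T z / (G z * of_real s0) - of_real (- s1 / s0\<^sup>2)
      = 1 / (cpoly D z * Lfun \<mu> n z) - (of_real (- s1 / s0\<^sup>2) + of_real (1 / s0) * z)) at_infinity"
    proof eventually_elim
      case (elim z)
      then have nz: "z \<noteq> 0" "cpoly D z * Lfun \<mu> n z \<noteq> 0" by (auto simp: G_def)
      have "- (z * (z * q - s)) / (z * q * s) = 1 / q - 1 / s * z" if "z \<noteq> 0" "q \<noteq> 0" "s \<noteq> 0" for z q s :: complex
        using that by (simp add: field_simps)
      from this[OF nz, of "of_real s0"] show ?case using s0 unfolding T_def G_def by simp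
    qed
  qed
  then show ?thesis using s0 by (intro exI[of _ "- s1 / s0\<^sup>2"] exI[of _ "1 / s0"]) simp
qed

definition residue_at :: "real \<Rightarrow> real" where
  "residue_at E = - inverse (poly (pderiv D) E * Lreal n E)"

lemma residue_at_pos: "E \<in> poles \<Longrightarrow> residue_at E > 0"
  using Dpoly_derivative_Lreal_neg(1)[of n, OF n_pos gap poles_root]
  by (simp only: residue_at_def neg_0_less_iff_less inverse_negative_iff_negative)

lemma zeta_eq: "E \<in> poles \<Longrightarrow> zeta \<mu> n \<xi> E = of_real (residue_at E)"
  using Lplus_eq[OF Dpoly_derivative_Lreal_neg(2)[of n, OF n_pos gap poles_root]]
  by (simp add: zeta_def residue_at_def)

lemma Complex_vertical_tendsto: "((\<lambda>\<epsilon>. Complex E \<epsilon>) \<longlongrightarrow> of_real E) (at_right 0)"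
proof -
  have "((\<lambda>\<epsilon>. of_real E + \<i> * of_real \<epsilon>) \<longlongrightarrow> of_real E + \<i> * of_real 0) (at_right 0)"
    by (intro tendsto_intros)
  then show ?thesis by (simp add: Complex_eq)
qed

lemma inverse_DL_vertical:
  assumes E: "E \<in> poles"
  shows "((\<lambda>\<epsilon>. - (\<i> * of_real \<epsilon>) * (1 / (cpoly D (Complex E \<epsilon>) * Lfun \<mu> n (Complex E \<epsilon>)))) \<longlongrightarrow> of_real (residue_at E)) (at_right 0)"
proof -
  note root = poles_root[OF E]
  let ?p = "synthetic_div D E"
  have Dp: "D = [:- E, 1:] * ?p" using synthetic_div_correct'[of E D] root by simp
  have pE: "poly ?p E = poly (pderiv D) E"
    by (subst (2) Dp) (simp add: pderiv_mult pderiv_pCons del: mult_pCons_left)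
  have "continuous_on UNIV (cpoly ?p)" by (intro holomorphic_on_imp_continuous_on cpoly_holomorphic)
  then have "isCont (cpoly ?p) (of_real E)" by (simp add: continuous_on_eq_continuous_at)
  from isCont_tendsto_compose[OF this Complex_vertical_tendsto]
  have "((\<lambda>\<epsilon>. cpoly ?p (Complex E \<epsilon>)) \<longlongrightarrow> of_real (poly (pderiv D) E)) (at_right 0)" by (simp add: pE)
  moreover have "poly (pderiv D) E * Lreal n E \<noteq> 0"
    by (rule less_imp_neq[OF Dpoly_derivative_Lreal_neg(1)[of n, OF n_pos gap root]])
  ultimately have "((\<lambda>\<epsilon>. - (1 / (cpoly ?p (Complex E \<epsilon>) * Lfun \<mu> n (Complex E \<epsilon>))))
    \<longlongrightarrow> - (1 / (of_real (poly (pderiv D) E) * of_real (Lreal n E)))) (at_right 0)"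
    by (intro tendsto_intros Lfun_vertical Dpoly_derivative_Lreal_neg(2)[of n, OF n_pos gap root]) auto
  moreover have "- (1 / (of_real (poly (pderiv D) E) * of_real (Lreal n E))) = complex_of_real (residue_at E)"
    by (simp add: residue_at_def divide_inverse)
  ultimately have "((\<lambda>\<epsilon>. - (1 / (cpoly ?p (Complex E \<epsilon>) * Lfun \<mu> n (Complex E \<epsilon>)))) \<longlongrightarrow> of_real (residue_at E)) (at_right 0)"
    by simp
  then show ?thesis
  proof (rule Lim_transform_eventually)
    show "eventually (\<lambda>\<epsilon>. - (1 / (cpoly ?p (Complex E \<epsilon>) * Lfun \<mu> n (Complex E \<epsilon>)))
      = - (\<i> * of_real \<epsilon>) * (1 / (cpoly D (Complex E \<epsilon>) * Lfun \<mu> n (Complex E \<epsilon>)))) (at_right 0)"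
      using eventually_at_right_less[of 0]
    proof eventually_elim
      case (elim \<epsilon>)
      have "cpoly D (Complex E \<epsilon>) = \<i> * of_real \<epsilon> * cpoly ?p (Complex E \<epsilon>)"
        using cpoly_diff_synthetic_div[of D "Complex E \<epsilon>" E] root by (simp add: Complex_eq)
      then show ?case using elim by simp
    qed
  qed
qed

lemma pole_vertical:
  "((\<lambda>\<epsilon>. - (\<i> * of_real \<epsilon>) * (of_real c / (of_real E' - Complex E \<epsilon>))) \<longlongrightarrow> (if E' = E then of_real c else 0)) (at_right 0)"
proof (cases "E' = E")
  case True
  have "eventually (\<lambda>\<epsilon>. of_real c = - (\<i> * of_real \<epsilon>) * (complex_of_real c / (of_real E' - Complex E \<epsilon>))) (at_right 0)"
    using eventually_at_right_less[of 0] by eventually_elim (simp add: True Complex_eq)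
  from Lim_transform_eventually[OF tendsto_const this] show ?thesis using True by simp
next
  case False
  then have "((\<lambda>\<epsilon>. - (\<i> * of_real \<epsilon>) * (of_real c / (of_real E' - Complex E \<epsilon>)))
    \<longlongrightarrow> - (\<i> * of_real 0) * (of_real c / (of_real E' - of_real E))) (at_right 0)"
    by (intro tendsto_intros Complex_vertical_tendsto) auto
  then show ?thesis using False by simp
qed

text \<open>Subtracting the affine part gives decay at infinity, and subtracting suitable poles
  gives the vertical limits that the gluing theorem demands of the transform of
  \<open>gam\<close>.\<close>

lemma inverse_DL_expansion:
  "\<exists>a b. b > 0 \<and> (\<forall>z. z \<notin> of_real ` (support_hull \<union> poles) \<longrightarrow>
     1 / (cpoly D z * Lfun \<mu> n z) = cauchy_tr \<rho> gam z
       + (\<Sum>E\<in>poles. of_real (residue_at E - gam E * measure \<rho> {E}) / (of_real E - z)) + of_real a + of_real b * z)"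
proof -
  obtain a b where b: "b > 0"
    and ab: "((\<lambda>z. 1 / (cpoly D z * Lfun \<mu> n z) - (of_real a + of_real b * z)) \<longlongrightarrow> 0) at_infinity"
    using inverse_DL_asymp by blast
  let ?A = "typeI \<mu> n" and ?m = "inc n i"
  let ?P = "\<lambda>z. \<Prod>E\<in>poles. z - complex_of_real E"
  \<comment> \<open>The part of each residue that the atom of \<open>gam\<close>
    d\<open>\<rho>\<close> does not account for. At \<open>\<xi>\<close>, where \<open>gam\<close>
    is 0, it is the whole residue.\<close>
  define c where "c E = residue_at E - gam E * measure \<rho> {E}" for E
  define \<kappa> where "\<kappa> = complex_of_real ((-1) ^ n I2 * (typeI_top n I1 * typeI_top n I2))"
  define F where "F z = 1 / (cpoly D z * Lfun \<mu> n z) - (of_real a + of_real b * z)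
    - (\<Sum>E\<in>poles. of_real (c E) / (of_real E - z))" for z
  define Rp where "Rp z = (\<Sum>E\<in>poles. of_real (c E) * - (\<Prod>E'\<in>poles - {E}. z - complex_of_real E'))" for z
  have \<kappa>0: "\<kappa> \<noteq> 0" using typeI_top_neq_0[OF n_pos] by (simp add: \<kappa>_def)
  have DP: "cpoly D z = \<kappa> * ?P z" for z unfolding \<kappa>_def by (rule D_prod)
  have L0: "w \<notin> of_real ` support_hull \<Longrightarrow> Lfun \<mu> n w \<noteq> 0" for w by (rule Lfun_nonzero[of n, OF n_pos])
  have Rp: "?P z * (\<Sum>E\<in>poles. of_real (c E) / (of_real E - z)) = Rp z" if "z \<notin> of_real ` poles" for z
    unfolding Rp_def sum_distrib_left
  proof (rule sum.cong[OF refl])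
    fix E assume E: "E \<in> poles"
    have P: "?P z = (z - of_real E) * (\<Prod>E'\<in>poles - {E}. z - complex_of_real E')" by (rule prod.remove[OF poles_finite E])
    have nz: "of_real E - z \<noteq> 0" using that E by auto
    have "(z - e) * Q * (d / (e - z)) = d * - Q" if "e - z \<noteq> 0" for e Q d :: complex
      using that by (simp add: field_simps)
    from this[OF nz] show "?P z * (of_real (c E) / (of_real E - z)) = of_real (c E) * - (\<Prod>E'\<in>poles - {E}. z - complex_of_real E')"
      unfolding P .
  qed
  have PF: "?P z * F z = 1 / (\<kappa> * Lfun \<mu> n z) - ?P z * (of_real a + of_real b * z) - Rp z"
    if "z \<notin> of_real ` poles" for z
  proof -
    have "?P z \<noteq> 0" using that poles_finite by auto
    then have "?P z * (1 / (cpoly D z * Lfun \<mu> n z)) = 1 / (\<kappa> * Lfun \<mu> n z)" unfolding DP by simp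
    then show ?thesis unfolding F_def right_diff_distrib Rp[OF that] by simp
  qed
  define q where "q k z = (-1) ^ n I2 * (z - of_real \<xi>) * cpoly (?A (other k)) z" for k z
  have q_real: "q k (of_real x) = of_real (refq k x)" for k x by (simp add: q_def refq_def)
  define g where "g k z = 1 / (q k z * sfun n ?m k z)" for k z
  define U where "U k = - (of_real ` Delta \<mu> (other k)) \<inter> (\<lambda>z. q k z * sfun n ?m k z) -` (- {0})" for k
  have qh: "q k holomorphic_on S" for k S unfolding q_def[abs_def] by (intro holomorphic_intros)
  have Uo: "open (U k)" for k
    unfolding U_def
    by (intro continuous_open_preimage holomorphic_on_imp_continuous_on holomorphic_intros sfun_holomorphic qh)
       (auto intro!: closed_injective_linear_image simp: linear_of_real inj_on_def Delta_eq)
  have Us: "of_real ` Delta \<mu> k \<subseteq> U k" for k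
    using sfun_pos[of _ k] refq_pos[of _ k] Delta_disjoint by (fastforce simp: U_def sfun_of_real q_real)
  have sh: "sfun n ?m k holomorphic_on U k" for k
    by (intro holomorphic_on_subset[OF sfun_holomorphic]) (auto simp: U_def)
  have nzU: "w \<in> U k \<Longrightarrow> q k w \<noteq> 0 \<and> sfun n ?m k w \<noteq> 0" for k w by (auto simp: U_def)
  have Rh: "Rp holomorphic_on S" for S unfolding Rp_def[abs_def] by (intro holomorphic_intros)
  have glued: "F z = cauchy_tr \<rho> gam z" if z: "z \<notin> of_real ` (support_hull \<union> poles)" for z
  proof (rule stieltjes_glue[where a="left_end \<mu>" and b="right_end \<mu>" and \<rho>=\<rho> and U=U and g=g and \<gamma>=gam
        and Es=poles and F=F and ?r0.0="\<lambda>z. 1 / (\<kappa> * Lfun \<mu> n z) - ?P z * (of_real a + of_real b * z) - Rp z" and z=z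
        and r="\<lambda>k z. cpoly (typeI \<mu> ?m k) z / (\<kappa> * sfun n ?m k z) - ?P z * (of_real a + of_real b * z) - Rp z",
        folded Delta_eq, folded support_hull_eq])
    show "Delta \<mu> I1 \<inter> Delta \<mu> I2 = {}" using Delta_disjoint[of _ I1] by auto
    show "g k (of_real x) = of_real (gam x)" if "x \<in> Delta \<mu> k" for k x
      by (simp add: g_def sfun_of_real q_real gam_eq[OF that])
    show "g k holomorphic_on U k" for k
      unfolding g_def[abs_def] using nzU by (intro holomorphic_intros qh sh) auto
    show "(\<lambda>z. cpoly (typeI \<mu> ?m k) z / (\<kappa> * sfun n ?m k z) - ?P z * (of_real a + of_real b * z) - Rp z) holomorphic_on U k" for k
      using nzU \<kappa>0 by (intro holomorphic_intros Rh sh) auto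
    show "?P w * F w = ?P w * g k w * cauchy_tr \<rho> (\<lambda>_. 1) w
        + (cpoly (typeI \<mu> ?m k) w / (\<kappa> * sfun n ?m k w) - ?P w * (of_real a + of_real b * w) - Rp w)"
      if w: "w \<in> U k" "w \<notin> of_real ` (support_hull \<union> poles)" for k w
    proof -
      have w': "w \<notin> of_real ` support_hull" "w \<notin> of_real ` poles" using w(2) by auto
      note nz = nzU[OF w(1)]
      have "\<kappa> * ?P w = q k w * cpoly (?A k) w"
        unfolding DP[symmetric] q_def by (cases k) (simp_all add: Dpoly_def algebra_simps del: mult_pCons_left)
      then have P: "?P w = q k w * cpoly (?A k) w / \<kappa>" using \<kappa>0 by (simp add: field_simps)
      \<comment> \<open>\<open>sfun_Mfun\<close> solved for 1 / L_n, which is thereby affine in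
        \<open>Mfun\<close> with coefficients holomorphic near the interval.\<close>
      have "1 / (\<kappa> * Lfun \<mu> n w) = (cpoly (typeI \<mu> ?m k) w + Mfun n i w * cpoly (?A k) w) / (\<kappa> * sfun n ?m k w)"
        using nz L0[OF w'(1)] \<kappa>0 sfun_Mfun[OF w'(1), of k] by (simp add: divide_simps)
      also have "\<dots> = ?P w * g k w * Mfun n i w + cpoly (typeI \<mu> ?m k) w / (\<kappa> * sfun n ?m k w)"
        unfolding P g_def using nz \<kappa>0 by (simp add: field_simps)
      finally show ?thesis unfolding PF[OF w'(2)] Mfun_rho[OF w'(1), symmetric] by simp
    qed
    show "(\<lambda>z. 1 / (\<kappa> * Lfun \<mu> n z) - ?P z * (of_real a + of_real b * z) - Rp z) holomorphic_on - (of_real ` support_hull)"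
      using L0 \<kappa>0 by (intro holomorphic_intros Rh Lfun_holomorphic) auto
    show "?P w * F w = 1 / (\<kappa> * Lfun \<mu> n w) - ?P w * (of_real a + of_real b * w) - Rp w"
      if "w \<notin> of_real ` (support_hull \<union> poles)" for w
      using that by (intro PF) auto
    show "(F \<longlongrightarrow> 0) at_infinity"
    proof -
      have "((\<lambda>z. of_real (c E) / (of_real E - z)) \<longlongrightarrow> (0::complex)) at_infinity" for E
      proof -
        have "((\<lambda>z. of_real (c E) * inverse z * (1 / (of_real E * inverse z - 1))) \<longlongrightarrow> of_real (c E) * 0 * (1 / (complex_of_real E * 0 - 1))) at_infinity"
          by (intro tendsto_intros tendsto_inverse_0) auto
        then have "((\<lambda>z. of_real (c E) * inverse z * (1 / (complex_of_real E * inverse z - 1))) \<longlongrightarrow> 0) at_infinity" by simp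
        then show ?thesis
          by (rule Lim_transform_eventually) (use eventually_not_equal_at_infinity[of 0] in eventually_elim, simp add: divide_simps)
      qed
      then have "((\<lambda>z. \<Sum>E\<in>poles. complex_of_real (c E) / (of_real E - z)) \<longlongrightarrow> (\<Sum>E\<in>poles. (0::complex))) at_infinity"
        by (intro tendsto_sum)
      from tendsto_diff[OF ab this] show ?thesis by (simp add: F_def[abs_def])
    qed
    show "((\<lambda>\<epsilon>. - (\<i> * of_real \<epsilon>) * F (Complex E \<epsilon>)) \<longlongrightarrow> of_real (gam E * measure \<rho> {E})) (at_right 0)"
      if E: "E \<in> poles" for E
    proof -
      have "((\<lambda>\<epsilon>. - (\<i> * of_real \<epsilon>) * (1 / (cpoly D (Complex E \<epsilon>) * Lfun \<mu> n (Complex E \<epsilon>)))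
          - - (\<i> * of_real \<epsilon>) * (of_real a + of_real b * Complex E \<epsilon>)
          - (\<Sum>E'\<in>poles. - (\<i> * of_real \<epsilon>) * (of_real (c E') / (of_real E' - Complex E \<epsilon>))))
        \<longlongrightarrow> of_real (residue_at E) - - (\<i> * of_real 0) * (of_real a + of_real b * of_real E)
          - (\<Sum>E'\<in>poles. if E' = E then of_real (c E') else 0)) (at_right 0)"
        by (intro tendsto_diff tendsto_sum pole_vertical inverse_DL_vertical[OF E]) (intro tendsto_intros Complex_vertical_tendsto)
      moreover have "(\<Sum>E'\<in>poles. if E' = E then complex_of_real (c E') else 0) = of_real (c E)"
        using E poles_finite by simp
      ultimately show ?thesis
        unfolding F_def right_diff_distrib sum_distrib_left by (simp add: c_def)
    qed
  qed (use rho AE_rho Uo Us poles_finite z in auto)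
  show ?thesis
  proof (intro exI conjI allI impI)
    show "b > 0" by (rule b)
    fix z :: complex assume z: "z \<notin> of_real ` (support_hull \<union> poles)"
    show "1 / (cpoly D z * Lfun \<mu> n z) = cauchy_tr \<rho> gam z
       + (\<Sum>E\<in>poles. of_real (residue_at E - gam E * measure \<rho> {E}) / (of_real E - z)) + of_real a + of_real b * z"
    proof -
      have "l = f + s + u + v" if "l - (u + v) - s = f" for l u v s f :: complex
        using that by (auto simp: algebra_simps)
      from this[OF glued[OF z, unfolded F_def c_def]] show ?thesis .
    qed
  qed
qed

text \<open>Passing from \<open>gam\<close> d\<open>\<rho>\<close> to \<open>omega\<close> removes
  the atoms at the zeros, which are precisely the masses deducted from the residues; the full
  \<open>zeta\<close> is restored.\<close>

lemma omega_expansion: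
  "(\<forall>E\<in>poles. zeta \<mu> n \<xi> E \<in> \<real> \<and> Re (zeta \<mu> n \<xi> E) > 0) \<and>
   (\<exists>a b :: real. b > 0 \<and> (\<forall>z. Im z > 0 \<longrightarrow>
      1 / (cpoly D z * Lfun \<mu> n z) =
        (LINT x|omega. of_real (Sref \<mu> n \<xi> x) / (of_real x - z)) +
        (\<Sum>E\<in>poles. zeta \<mu> n \<xi> E / (of_real E - z)) + of_real a + of_real b * z))"
proof
  show "\<forall>E\<in>poles. zeta \<mu> n \<xi> E \<in> \<real> \<and> Re (zeta \<mu> n \<xi> E) > 0"
    using residue_at_pos by (simp add: zeta_eq)
  obtain a b where b: "b > 0" and ab: "\<And>z. z \<notin> of_real ` (support_hull \<union> poles) \<Longrightarrow>
     1 / (cpoly D z * Lfun \<mu> n z) = cauchy_tr \<rho> gam z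
       + (\<Sum>E\<in>poles. of_real (residue_at E - gam E * measure \<rho> {E}) / (of_real E - z)) + of_real a + of_real b * z"
    using inverse_DL_expansion by blast
  have "1 / (cpoly D z * Lfun \<mu> n z) =
        (LINT x|omega. of_real (Sref \<mu> n \<xi> x) / (of_real x - z)) +
        (\<Sum>E\<in>poles. zeta \<mu> n \<xi> E / (of_real E - z)) + of_real a + of_real b * z" if z: "Im z > 0" for z
  proof -
    have zn: "z \<notin> of_real ` (support_hull \<union> poles)" using z by auto
    have "(\<Sum>E\<in>poles. of_real (residue_at E - gam E * measure \<rho> {E}) / (of_real E - z))
      = (\<Sum>E\<in>poles. zeta \<mu> n \<xi> E / (of_real E - z)) - (\<Sum>E\<in>poles. of_real (gam E * measure \<rho> {E}) / (of_real E - z))"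
      by (simp add: sum_subtractf[symmetric] zeta_eq diff_divide_distrib)
    also have "(\<Sum>E\<in>poles. of_real (gam E * measure \<rho> {E}) / (of_real E - z))
      = (\<Sum>E\<in>typeI_zeros \<mu> n. of_real (gam E * measure \<rho> {E}) / (of_real E - z))"
      using poles_finite gam_0[OF xi_not_in_hull] by (intro sum.mono_neutral_right) (auto simp: poles_def)
    finally show ?thesis unfolding ab[OF zn] omega_transform[OF z] by simp
  qed
  then show "\<exists>a b :: real. b > 0 \<and> (\<forall>z. Im z > 0 \<longrightarrow>
      1 / (cpoly D z * Lfun \<mu> n z) =
        (LINT x|omega. of_real (Sref \<mu> n \<xi> x) / (of_real x - z)) +
        (\<Sum>E\<in>poles. zeta \<mu> n \<xi> E / (of_real E - z)) + of_real a + of_real b * z)"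
    using b by blast
qed

text \<open>Absorbing \<open>Sref\<close> into the measure turns the expansion into one with a plain
  Cauchy transform. Positivity of \<open>Sref\<close> on the hull makes this reversible, which the
  uniqueness proof uses.\<close>

lemma Sref_density:
  assumes s: "sets \<omega> = sets borel" and f: "finite_measure \<omega>"
    and null: "emeasure \<omega> (- (Delta \<mu> I1 \<union> Delta \<mu> I2)) = 0"
  shows "finite_borel_measure (density \<omega> (\<lambda>x. ennreal (Sref \<mu> n \<xi> x)))"
    and "cauchy_tr (density \<omega> (\<lambda>x. ennreal (Sref \<mu> n \<xi> x))) (\<lambda>_. 1) z
      = (LINT x|\<omega>. of_real (Sref \<mu> n \<xi> x) / (of_real x - z))"
    and "AE x in density \<omega> (\<lambda>x. ennreal (Sref \<mu> n \<xi> x)). \<bar>x\<bar> \<le> hull_bound"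
    and "density (density \<omega> (\<lambda>x. ennreal (Sref \<mu> n \<xi> x))) (\<lambda>x. ennreal (1 / Sref \<mu> n \<xi> x)) = \<omega>"
proof -
  interpret finite_measure \<omega> by (rule f)
  note [measurable_cong] = s
  have sp: "space \<omega> = UNIV" using sets_eq_imp_space_eq[OF s] by simp
  let ?S = "Sref \<mu> n \<xi>"
  have AE: "AE x in \<omega>. x \<in> support_hull"
    by (rule AE_I'[of "- support_hull"]) (use null in \<open>auto simp: null_sets_def s support_hull_def\<close>)
  obtain B where B: "\<And>x. \<bar>?S x\<bar> \<le> B" using Sref_bounded by blast
  have int: "integrable \<omega> ?S" using B by (intro integrable_const_bound[where B=B]) auto
  have "emeasure (density \<omega> (\<lambda>x. ennreal (?S x))) UNIV = (\<integral>\<^sup>+x. ennreal (?S x) \<partial>\<omega>)"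
    by (subst emeasure_density) (auto simp: s)
  also have "\<dots> = ennreal (LINT x|\<omega>. ?S x)"
    by (rule nn_integral_eq_integral[OF int]) (simp add: Sref_nonneg)
  finally have "finite_measure (density \<omega> (\<lambda>x. ennreal (?S x)))" by (intro finite_measureI) (simp add: sp)
  then show "finite_borel_measure (density \<omega> (\<lambda>x. ennreal (?S x)))"
    by (simp add: finite_borel_measure_def finite_borel_measure_axioms_def s)
  have "cauchy_tr (density \<omega> (\<lambda>x. ennreal (?S x))) (\<lambda>_. 1) z = (LINT x|\<omega>. ?S x *\<^sub>R (of_real 1 / (of_real x - z)))"
    unfolding cauchy_tr_def by (rule integral_density) (auto simp: Sref_nonneg)
  then show "cauchy_tr (density \<omega> (\<lambda>x. ennreal (?S x))) (\<lambda>_. 1) z = (LINT x|\<omega>. of_real (?S x) / (of_real x - z))"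
    by (simp add: scaleR_conv_of_real)
  show "AE x in density \<omega> (\<lambda>x. ennreal (?S x)). \<bar>x\<bar> \<le> hull_bound"
    using AE by (subst AE_density) (auto simp: hull_bound(2))
  have "density (density \<omega> (\<lambda>x. ennreal (?S x))) (\<lambda>x. ennreal (1 / ?S x)) = density \<omega> (\<lambda>x. ennreal (?S x) * ennreal (1 / ?S x))"
    by (rule density_density_eq) auto
  also have "\<dots> = density \<omega> (\<lambda>_. 1)"
  proof (rule density_cong)
    show "AE x in \<omega>. ennreal (?S x) * ennreal (1 / ?S x) = 1"
      using AE
    proof eventually_elim
      case (elim x)
      then obtain k where k: "x \<in> Delta \<mu> k" using in_hull_cases[of x] by blast
      then have "?S x > 0" using refq_pos[OF k] by (simp add: Sref_eq)
      then show ?case by (simp add: ennreal_mult[symmetric])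
    qed
  qed auto
  finally show "density (density \<omega> (\<lambda>x. ennreal (?S x))) (\<lambda>x. ennreal (1 / ?S x)) = \<omega>" by (simp add: density_1)
qed

lemma is_reference_measureD:
  assumes "is_reference_measure \<mu> n \<omega>"
  shows "sets \<omega> = sets borel" "finite_measure \<omega>" "emeasure \<omega> (- (Delta \<mu> I1 \<union> Delta \<mu> I2)) = 0"
    "\<exists>a b. \<forall>z. Im z > 0 \<longrightarrow> 1 / (cpoly D z * Lfun \<mu> n z) =
        (LINT x|\<omega>. of_real (Sref \<mu> n \<xi> x) / (of_real x - z)) +
        (\<Sum>E\<in>poles. zeta \<mu> n \<xi> E / (of_real E - z)) + of_real a + of_real b * z"
proof -
  show "sets \<omega> = sets borel" "finite_measure \<omega>" "emeasure \<omega> (- (Delta \<mu> I1 \<union> Delta \<mu> I2)) = 0"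
    using assms by (auto simp: is_reference_measure_def)
  have "\<xi> \<in> {right_end \<mu> I1<..<left_end \<mu> I2}" using gap by simp
  then show "\<exists>a b. \<forall>z. Im z > 0 \<longrightarrow> 1 / (cpoly D z * Lfun \<mu> n z) =
        (LINT x|\<omega>. of_real (Sref \<mu> n \<xi> x) / (of_real x - z)) +
        (\<Sum>E\<in>poles. zeta \<mu> n \<xi> E / (of_real E - z)) + of_real a + of_real b * z"
    using assms unfolding is_reference_measure_def cpoly_def poles_def by blast
qed

text \<open>Two expansions differ by an affine function that equals a difference of Cauchy
  transforms. Decay along the imaginary axis makes it zero, and measures with equal transforms
  coincide.\<close>

lemma reference_measure_unique:
  assumes 1: "is_reference_measure \<mu> n \<omega>1" and 2: "is_reference_measure \<mu> n \<omega>2"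
  shows "\<omega>1 = \<omega>2"
proof -
  note d1 = is_reference_measureD[OF 1] and d2 = is_reference_measureD[OF 2]
  note N1 = Sref_density[OF d1(1-3)] and N2 = Sref_density[OF d2(1-3)]
  let ?N1 = "density \<omega>1 (\<lambda>x. ennreal (Sref \<mu> n \<xi> x))" and ?N2 = "density \<omega>2 (\<lambda>x. ennreal (Sref \<mu> n \<xi> x))"
  interpret N1: finite_borel_measure ?N1 by (rule N1)
  interpret N2: finite_borel_measure ?N2 by (rule N2)
  obtain a1 b1 where e1: "\<And>z. Im z > 0 \<Longrightarrow> 1 / (cpoly D z * Lfun \<mu> n z) =
        (LINT x|\<omega>1. of_real (Sref \<mu> n \<xi> x) / (of_real x - z)) +
        (\<Sum>E\<in>poles. zeta \<mu> n \<xi> E / (of_real E - z)) + of_real a1 + of_real b1 * z" using d1(4) by blast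
  obtain a2 b2 where e2: "\<And>z. Im z > 0 \<Longrightarrow> 1 / (cpoly D z * Lfun \<mu> n z) =
        (LINT x|\<omega>2. of_real (Sref \<mu> n \<xi> x) / (of_real x - z)) +
        (\<Sum>E\<in>poles. zeta \<mu> n \<xi> E / (of_real E - z)) + of_real a2 + of_real b2 * z" using d2(4) by blast
  let ?a = "a2 - a1" and ?b = "b2 - b1"
  have eq: "cauchy_tr ?N1 (\<lambda>_. 1) z - cauchy_tr ?N2 (\<lambda>_. 1) z = of_real ?a + of_real ?b * z" if "Im z > 0" for z
    using e1[OF that] e2[OF that] unfolding N1(2) N2(2) by (simp add: algebra_simps)
  have "filterlim (\<lambda>y::real. \<i> * of_real y) at_infinity at_top"
    by (rule filterlim_norm_at_top_imp_at_infinity) (simp add: norm_mult filterlim_abs_real)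
  moreover have "((\<lambda>z. cauchy_tr ?N1 (\<lambda>_. 1) z - cauchy_tr ?N2 (\<lambda>_. 1) z) \<longlongrightarrow> 0 - 0) at_infinity"
    by (intro tendsto_diff N1.cauchy_tr_tendsto_0[OF _ N1(3)] N2.cauchy_tr_tendsto_0[OF _ N2(3)]) auto
  ultimately have "((\<lambda>y::real. cauchy_tr ?N1 (\<lambda>_. 1) (\<i> * of_real y) - cauchy_tr ?N2 (\<lambda>_. 1) (\<i> * of_real y)) \<longlongrightarrow> 0) at_top"
    using filterlim_compose by fastforce
  moreover have "eventually (\<lambda>y. cauchy_tr ?N1 (\<lambda>_. 1) (\<i> * of_real y) - cauchy_tr ?N2 (\<lambda>_. 1) (\<i> * of_real y)
    = of_real ?a + of_real ?b * (\<i> * of_real y)) at_top"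
    using eventually_gt_at_top[of 0] by eventually_elim (subst eq, simp_all)
  ultimately have lim: "((\<lambda>y::real. complex_of_real ?a + of_real ?b * (\<i> * of_real y)) \<longlongrightarrow> 0) at_top"
    by (rule Lim_transform_eventually)
  have "((\<lambda>y::real. ?a) \<longlongrightarrow> 0) at_top" using tendsto_Re[OF lim] by simp
  then have a: "?a = 0" by (simp add: tendsto_const_iff)
  have "((\<lambda>y::real. (?b * y) * inverse y) \<longlongrightarrow> 0 * 0) at_top"
    using tendsto_Im[OF lim] by (intro tendsto_mult tendsto_inverse_0_at_top filterlim_ident) simp_all
  then have "((\<lambda>y::real. ?b) \<longlongrightarrow> 0 * 0) at_top"
    by (rule Lim_transform_eventually) (use eventually_gt_at_top[of 0] in eventually_elim, simp)
  then have b: "?b = 0" by (simp add: tendsto_const_iff)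
  have N: "?N1 = ?N2"
    by (rule cauchy_tr_unique[OF N1(1) N2(1)]) (use eq a b in simp)
  have "\<omega>1 = density ?N1 (\<lambda>x. ennreal (1 / Sref \<mu> n \<xi> x))" by (rule N1(4)[symmetric])
  also have "\<dots> = \<omega>2" unfolding N by (rule N2(4))
  finally show ?thesis .
qed

end

context angelesco_edge
begin

text \<open>\<open>omega\<close> is built without reference to \<open>\<xi>\<close>, so the
  expansions for all gap points concern the same measure; uniqueness follows from any one gap
  point.\<close>

lemma reference_measure_eq: "reference_measure \<mu> n = omega"
  unfolding reference_measure_def
proof (rule the_equality)
  have gap: "angelesco_edge_gap \<mu> n i \<rho> \<xi>" if "right_end \<mu> I1 < \<xi>" "\<xi> < left_end \<mu> I2" for \<xi>
    by unfold_locales (use that in auto)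
  show "is_reference_measure \<mu> n omega"
    unfolding is_reference_measure_def
  proof (intro conjI ballI)
    show "sets omega = sets borel" "finite_measure omega" by (simp_all add: finite_omega)
    show "emeasure omega (- (Delta \<mu> I1 \<union> Delta \<mu> I2)) = 0"
      by (rule emeasure_omega_0) (auto simp: zero_free_weight_0 support_hull_def)
    show "emeasure omega {E} = 0" if "E \<in> typeI_zeros \<mu> n" for E
      by (rule emeasure_omega_0) (use that in \<open>auto simp: zero_free_weight_def\<close>)
    fix \<xi> assume "\<xi> \<in> {right_end \<mu> I1<..<left_end \<mu> I2}"
    then interpret G: angelesco_edge_gap \<mu> n i \<rho> \<xi> by (intro gap) auto
    note e = G.omega_expansion[unfolded G.poles_def cpoly_def]
    show "zeta \<mu> n \<xi> E \<in> \<real>" "Re (zeta \<mu> n \<xi> E) > 0" if "E \<in> typeI_zeros \<mu> n \<union> {\<xi>}" for E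
      using e that by blast+
    show "\<exists>a b. 0 < b \<and> (\<forall>z. 0 < Im z \<longrightarrow>
        1 / (poly (map_poly of_real (Dpoly \<mu> n \<xi>)) z * Lfun \<mu> n z) =
        (LINT x|omega. of_real (Sref \<mu> n \<xi> x) / (of_real x - z)) +
        (\<Sum>E\<in>typeI_zeros \<mu> n \<union> {\<xi>}. zeta \<mu> n \<xi> E / (of_real E - z)) + of_real a + of_real b * z)"
      using e by blast
  qed
  fix \<omega> assume \<omega>: "is_reference_measure \<mu> n \<omega>"
  obtain \<xi> where "right_end \<mu> I1 < \<xi>" "\<xi> < left_end \<mu> I2" using ord dense by blast
  then interpret G: angelesco_edge_gap \<mu> n i \<rho> \<xi> by (rule gap)
  show "\<omega> = omega" by (rule G.reference_measure_unique[OF \<omega> \<open>is_reference_measure \<mu> n omega\<close>])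
qed

end

section \<open>Square summable solutions on the tree\<close>

lemma Pi_ix_pos: "Pi_ix Y k > 0"
  by (induction Y arbitrary: k) (simp_all add: inc_def)

lemma mem_subtree_iff: "Y \<in> subtree X \<longleftrightarrow> (\<exists>zs. Y = zs @ X)"
  by (auto simp: subtree_def suffix_def)

lemma subtree_self [simp]: "X \<in> subtree X"
  by (simp add: mem_subtree_iff)

lemma subtree_child: "Y \<in> subtree X \<Longrightarrow> j # Y \<in> subtree X"
  by (auto simp: mem_subtree_iff intro: exI[of _ "j # _"])

lemma subtree_parent: "Y \<in> subtree X \<Longrightarrow> Y \<noteq> X \<Longrightarrow> tl Y \<in> subtree X \<and> Y = hd Y # tl Y"
  by (cases Y) (auto simp: mem_subtree_iff Cons_eq_append_conv)

lemma subtree_neq_root: "Y \<in> subtree X \<Longrightarrow> X \<noteq> [] \<Longrightarrow> Y \<noteq> []"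
  by (auto simp: mem_subtree_iff)

lemma parent_notin_subtree: "X \<noteq> [] \<Longrightarrow> tl X \<notin> subtree X"
  by (metis length_append length_tl length_greater_0_conv mem_subtree_iff diff_less less_one not_add_less2)

primrec level :: "vertex \<Rightarrow> nat \<Rightarrow> vertex set" where
  "level X 0 = {X}"
| "level X (Suc N) = (\<lambda>(j, Y). j # Y) ` (UNIV \<times> level X N)"

lemma mem_level_iff: "Y \<in> level X N \<longleftrightarrow> Y \<in> subtree X \<and> length Y = length X + N"
proof (induction N arbitrary: Y)
  case 0
  show ?case by (auto simp: mem_subtree_iff)
next
  case (Suc N)
  show ?case
  proof
    assume "Y \<in> level X (Suc N)"
    then show "Y \<in> subtree X \<and> length Y = length X + Suc N" using Suc by (auto intro: subtree_child)
  next
    assume Y: "Y \<in> subtree X \<and> length Y = length X + Suc N"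
    then have "Y \<noteq> X" by auto
    then have "tl Y \<in> subtree X" "Y = hd Y # tl Y" using subtree_parent[of Y X] Y by blast+
    moreover from this have "tl Y \<in> level X N" using Y Suc by simp
    ultimately show "Y \<in> level X (Suc N)" by (auto intro!: image_eqI[of _ _ "(hd Y, tl Y)"])
  qed
qed

lemma level_finite: "finite (level X N)"
  by (induction N) (simp_all add: UNIV_side)

lemma sum_level_Suc: "(\<Sum>Y\<in>level X (Suc N). g Y) = (\<Sum>Y\<in>level X N. \<Sum>j\<in>UNIV. g (j # Y))"
proof -
  have "(\<Sum>Y\<in>level X (Suc N). g Y) = (\<Sum>(j, Y)\<in>UNIV \<times> level X N. g (j # Y))"
    unfolding level.simps by (subst sum.reindex) (auto simp: inj_on_def case_prod_unfold)
  also have "\<dots> = (\<Sum>j\<in>UNIV. \<Sum>Y\<in>level X N. g (j # Y))" by (rule sum.cartesian_product[symmetric])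
  also have "\<dots> = (\<Sum>Y\<in>level X N. \<Sum>j\<in>UNIV. g (j # Y))" by (rule sum.swap)
  finally show ?thesis .
qed

definition levels :: "vertex \<Rightarrow> nat \<Rightarrow> vertex set" where
  "levels X K = (\<Union>N<K. level X N)"

lemma levels_finite: "finite (levels X K)"
  by (simp add: levels_def level_finite)

lemma mem_levels_iff: "Y \<in> levels X K \<longleftrightarrow> Y \<in> subtree X \<and> length Y < length X + K"
proof
  assume Y: "Y \<in> subtree X \<and> length Y < length X + K"
  then have "length Y \<ge> length X" by (auto simp: mem_subtree_iff)
  then show "Y \<in> levels X K"
    using Y by (auto simp: levels_def mem_level_iff intro!: bexI[of _ "length Y - length X"])
qed (auto simp: levels_def mem_level_iff)

lemma sum_levels: "(\<Sum>Y\<in>levels X K. g Y) = (\<Sum>N<K. \<Sum>Y\<in>level X N. g Y)"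
proof (induction K)
  case (Suc K)
  have "levels X (Suc K) = levels X K \<union> level X K" by (auto simp: levels_def less_Suc_eq)
  moreover have "levels X K \<inter> level X K = {}" by (auto simp: mem_levels_iff mem_level_iff)
  ultimately show ?case using Suc by (simp add: sum.union_disjoint levels_finite level_finite)
qed (simp add: levels_def)

lemma subset_levels: "finite F \<Longrightarrow> F \<subseteq> subtree X \<Longrightarrow> \<exists>K. F \<subseteq> levels X K"
proof -
  assume F: "finite F" "F \<subseteq> subtree X"
  then obtain K where K: "\<forall>n\<in>length ` F. n < K" using finite_nat_set_iff_bounded by blast
  then have "F \<subseteq> levels X K" using F by (force simp: mem_levels_iff)
  then show ?thesis by blast
qed

context angelesco_system
begin

lemma Wpot_Cons: "Wpot \<mu> (i # Y) = rec_a \<mu> (Pi_ix Y) i"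
  by (simp add: Wpot_def)

lemma Wpot_pos: "Wpot \<mu> Y > 0"
  by (cases Y) (simp_all add: Wpot_def rec_a_pos[OF Pi_ix_pos])

text \<open>The root is excluded because the bound on \<open>rec_a\<close> concerns indices with a
  predecessor.\<close>

lemma Wpot_bounded: "\<exists>C. \<forall>Y j. Y \<noteq> [] \<longrightarrow> Wpot \<mu> (j # Y) \<le> C"
proof -
  obtain C where C: "\<And>n0 i j. (\<forall>k. n0 k > 0) \<Longrightarrow> rec_a \<mu> (inc n0 i) j \<le> C" using rec_a_bounded by blast
  have "Wpot \<mu> (j # Y) \<le> C" if "Y \<noteq> []" for Y j
    using that C[of "Pi_ix (tl Y)" "hd Y" j] Pi_ix_pos by (cases Y) (simp_all add: Wpot_Cons)
  then show ?thesis by blast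
qed

lemma mfac_Cons: "mfac \<mu> (i # Y) = mfac \<mu> Y / sqrt (Wpot \<mu> (i # Y))"
proof -
  have s: "{Z. suffix Z (i # Y)} = insert (i # Y) {Z. suffix Z Y}" by (auto simp: suffix_Cons)
  have "i # Y \<notin> {Z. suffix Z Y}" by (auto dest: suffix_length_le)
  moreover have "finite {Z. suffix Z Y}"
    by (simp flip: set_suffixes_eq)
  ultimately have "mfac \<mu> (i # Y) = Wpot \<mu> (i # Y) powr (- 1 / 2) * mfac \<mu> Y"
    unfolding mfac_def s by (rule prod.insert[rotated])
  also have "Wpot \<mu> (i # Y) powr (- 1 / 2) = 1 / sqrt (Wpot \<mu> (i # Y))"
    using powr_minus[of "Wpot \<mu> (i # Y)" "1 / 2"] powr_half_sqrt[OF less_imp_le[OF Wpot_pos[of "i # Y"]]]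
    unfolding minus_divide_left by (simp only: inverse_eq_divide)
  finally show ?thesis by simp
qed

lemma mfac_pos: "mfac \<mu> Y > 0"
  unfolding mfac_def using Wpot_pos by (intro prod_pos) (simp add: less_imp_neq[symmetric])

text \<open>The Wronskian of f and its conjugate across the edge above \<open>Y\<close>, up to a
  constant factor: the current entering \<open>Y\<close> from its parent.\<close>

definition flux :: "(vertex \<Rightarrow> complex) \<Rightarrow> vertex \<Rightarrow> real" where
  "flux f Y = sqrt (Wpot \<mu> Y) * Im (f (tl Y) * cnj (f Y))"

text \<open>The parameter \<open>\<kappa>\<close> enters the potential at the root only, so that \<open>\<lambda>_. 0\<close> stands for any value
  below another vertex.\<close>

definition generalized_eigenfunction :: "vertex \<Rightarrow> complex \<Rightarrow> (vertex \<Rightarrow> complex) \<Rightarrow> bool" where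
  "generalized_eigenfunction X z f \<longleftrightarrow> (\<forall>Y\<in>subtree X. z * f Y = of_real (Vpot \<mu> (\<lambda>_. 0) Y) * f Y
     + of_real (sqrt (Wpot \<mu> Y)) * f (tl Y) + (\<Sum>j\<in>UNIV. of_real (sqrt (Wpot \<mu> (j # Y))) * f (j # Y)))"

text \<open>The eigenvalue equation times the conjugate of f(Y), imaginary parts taken: the real
  potential drops out.\<close>

lemma flux_step:
  assumes f: "generalized_eigenfunction X z f" and Y: "Y \<in> subtree X"
  shows "flux f Y = Im z * (cmod (f Y))\<^sup>2 + (\<Sum>j\<in>UNIV. flux f (j # Y))"
proof -
  define v w w1 w2 where "v = Vpot \<mu> (\<lambda>_. 0) Y" "w = sqrt (Wpot \<mu> Y)" "w1 = sqrt (Wpot \<mu> (I1 # Y))" "w2 = sqrt (Wpot \<mu> (I2 # Y))"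
  have "z * f Y = of_real v * f Y + of_real w * f (tl Y) + (of_real w1 * f (I1 # Y) + of_real w2 * f (I2 # Y))"
    using f Y by (simp add: generalized_eigenfunction_def sum_side v_w_w1_w2_def)
  then have "Im (z * f Y * cnj (f Y)) = Im ((of_real v * f Y + of_real w * f (tl Y) + (of_real w1 * f (I1 # Y) + of_real w2 * f (I2 # Y))) * cnj (f Y))"
    by simp
  moreover have "z * f Y * cnj (f Y) = z * of_real ((cmod (f Y))\<^sup>2)" by (simp only: mult.assoc complex_norm_square)
  ultimately have "Im z * (cmod (f Y))\<^sup>2 = Im ((of_real v * f Y + of_real w * f (tl Y) + (of_real w1 * f (I1 # Y) + of_real w2 * f (I2 # Y))) * cnj (f Y))"
    by simp
  then show ?thesis unfolding flux_def sum_side v_w_w1_w2_def(2-4)[symmetric] by (simp add: algebra_simps)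
qed

lemma flux_identity:
  assumes f: "generalized_eigenfunction X z f"
  shows "flux f X = Im z * (\<Sum>Y\<in>levels X K. (cmod (f Y))\<^sup>2) + (\<Sum>Y\<in>level X K. flux f Y)"
proof (induction K)
  case 0
  show ?case by (simp add: levels_def)
next
  case (Suc K)
  have "(\<Sum>Y\<in>level X K. flux f Y) = (\<Sum>Y\<in>level X K. Im z * (cmod (f Y))\<^sup>2 + (\<Sum>j\<in>UNIV. flux f (j # Y)))"
    by (intro sum.cong refl flux_step[OF f]) (simp add: mem_level_iff)
  also have "\<dots> = Im z * (\<Sum>Y\<in>level X K. (cmod (f Y))\<^sup>2) + (\<Sum>Y\<in>level X (Suc K). flux f Y)"
    by (simp only: sum.distrib sum_distrib_left sum_level_Suc)
  finally show ?case using Suc by (simp add: sum_levels algebra_simps del: level.simps)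
qed

text \<open>All mass in finitely many levels is paid for by the flux entering at \<open>X\<close>,
  since the outgoing flux is nonnegative.\<close>

lemma positive_flux_ell2:
  assumes f: "generalized_eigenfunction X z f" and z: "Im z > 0" and pos: "\<And>Y. Y \<in> subtree X \<Longrightarrow> flux f Y \<ge> 0"
  shows "(\<lambda>Y. (cmod (f Y))\<^sup>2) summable_on subtree X"
proof (rule nonneg_bdd_above_summable_on)
  show "bdd_above (sum (\<lambda>Y. (cmod (f Y))\<^sup>2) ` {F. F \<subseteq> subtree X \<and> finite F})"
  proof (rule bdd_aboveI2)
    fix F assume "F \<in> {F. F \<subseteq> subtree X \<and> finite F}"
    then obtain K where K: "F \<subseteq> levels X K" using subset_levels by blast
    have "(\<Sum>Y\<in>F. (cmod (f Y))\<^sup>2) \<le> (\<Sum>Y\<in>levels X K. (cmod (f Y))\<^sup>2)"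
      using K by (intro sum_mono2 levels_finite) auto
    also have "(\<Sum>Y\<in>level X K. flux f Y) \<ge> 0" by (intro sum_nonneg pos) (simp add: mem_level_iff)
    then have "(\<Sum>Y\<in>levels X K. (cmod (f Y))\<^sup>2) \<le> flux f X / Im z"
      using flux_identity[OF f, of K] z by (simp add: field_simps)
    finally show "(\<Sum>Y\<in>F. (cmod (f Y))\<^sup>2) \<le> flux f X / Im z" .
  qed
qed simp

text \<open>Without incoming flux, Im z times the mass of the first levels equals minus the flux
  leaving them. With bounded weights that flux is controlled by the masses of two consecutive
  levels, which tend to 0 by summability.\<close>

lemma ell2_eigenfunction_0:
  assumes f: "generalized_eigenfunction X z f" and z: "Im z \<noteq> 0" and X: "X \<noteq> []"
    and sm: "(\<lambda>Y. (cmod (f Y))\<^sup>2) summable_on subtree X" and f0: "f (tl X) = 0" and Y: "Y \<in> subtree X"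
  shows "f Y = 0"
proof -
  define s where "s N = (\<Sum>Y\<in>level X N. (cmod (f Y))\<^sup>2)" for N
  obtain C where C: "\<And>Y j. Y \<noteq> [] \<Longrightarrow> Wpot \<mu> (j # Y) \<le> C" using Wpot_bounded by blast
  define c where "c = sqrt \<bar>C\<bar>"
  have c: "c \<ge> 0" "\<And>Y j. Y \<noteq> [] \<Longrightarrow> sqrt (Wpot \<mu> (j # Y)) \<le> c"
    using C by (auto simp: c_def intro: order_trans[OF _ abs_ge_self])
  have "summable s"
  proof (rule summableI_nonneg_bounded)
    show "0 \<le> s N" for N by (simp add: s_def sum_nonneg)
    show "sum s {..<K} \<le> (\<Sum>\<^sub>\<infinity>Y\<in>subtree X. (cmod (f Y))\<^sup>2)" for K
      unfolding s_def sum_levels[symmetric]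
      by (intro finite_sum_le_infsum sm levels_finite) (auto simp: mem_levels_iff)
  qed
  then have s0: "s \<longlonglongrightarrow> 0" by (rule summable_LIMSEQ_zero)
  have fl: "\<bar>flux f (j # Y)\<bar> \<le> c * ((cmod (f Y))\<^sup>2 + (cmod (f (j # Y)))\<^sup>2)" if "Y \<noteq> []" for j Y
  proof -
    have "\<bar>Im (f Y * cnj (f (j # Y)))\<bar> \<le> cmod (f Y) * cmod (f (j # Y))"
      using abs_Im_le_cmod[of "f Y * cnj (f (j # Y))"] by (simp add: norm_mult)
    also have "\<dots> \<le> (cmod (f Y))\<^sup>2 + (cmod (f (j # Y)))\<^sup>2"
      using sum_squares_bound[of "cmod (f Y)" "cmod (f (j # Y))"]
        mult_nonneg_nonneg[OF norm_ge_zero[of "f Y"] norm_ge_zero[of "f (j # Y)"]] by linarith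
    finally show ?thesis
      unfolding flux_def abs_mult using c(1) c(2)[OF that, of j] Wpot_pos[of "j # Y"]
      by (intro mult_mono) (auto simp: less_imp_le)
  qed
  have bound: "\<bar>\<Sum>Y\<in>level X (Suc N). flux f Y\<bar> \<le> c * (2 * s N + s (Suc N))" for N
  proof -
    have "\<bar>\<Sum>Y\<in>level X (Suc N). flux f Y\<bar> \<le> (\<Sum>Y\<in>level X N. \<Sum>j\<in>UNIV. \<bar>flux f (j # Y)\<bar>)"
      unfolding sum_level_Suc[symmetric, of "\<lambda>Y. \<bar>flux f Y\<bar>"] by (rule sum_abs)
    also have "\<dots> \<le> (\<Sum>Y\<in>level X N. \<Sum>j\<in>UNIV. c * ((cmod (f Y))\<^sup>2 + (cmod (f (j # Y)))\<^sup>2))"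
      by (intro sum_mono fl) (use subtree_neq_root X in \<open>auto simp: mem_level_iff\<close>)
    also have "\<dots> = c * (2 * s N + s (Suc N))"
      unfolding s_def sum_level_Suc sum_side
      by (simp add: sum.distrib sum_distrib_left[symmetric] algebra_simps)
    finally show ?thesis .
  qed
  have X0: "flux f X = 0" by (simp add: flux_def f0)
  obtain K where K: "Y \<in> levels X K" using subset_levels[of "{Y}" X] Y by auto
  have "\<bar>Im z\<bar> * (cmod (f Y))\<^sup>2 \<le> 0"
  proof (rule LIMSEQ_le_const)
    show "(\<lambda>N. c * (2 * s N + s (Suc N))) \<longlonglongrightarrow> 0"
      using tendsto_mult[OF tendsto_const tendsto_add[OF tendsto_mult[OF tendsto_const s0] LIMSEQ_Suc[OF s0]], of c 2] by simp
    show "\<exists>N0. \<forall>N\<ge>N0. \<bar>Im z\<bar> * (cmod (f Y))\<^sup>2 \<le> c * (2 * s N + s (Suc N))"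
    proof (intro exI[of _ K] allI impI)
      fix N assume N: "K \<le> N"
      have "(cmod (f Y))\<^sup>2 \<le> (\<Sum>Y\<in>levels X (Suc N). (cmod (f Y))\<^sup>2)"
        using K N by (intro member_le_sum levels_finite) (auto simp: mem_levels_iff)
      then have "\<bar>Im z\<bar> * (cmod (f Y))\<^sup>2 \<le> \<bar>Im z\<bar> * (\<Sum>Y\<in>levels X (Suc N). (cmod (f Y))\<^sup>2)"
        by (intro mult_left_mono) auto
      also have "\<dots> = \<bar>Im z * (\<Sum>Y\<in>levels X (Suc N). (cmod (f Y))\<^sup>2)\<bar>"
        by (simp add: abs_mult sum_nonneg)
      also have "Im z * (\<Sum>Y\<in>levels X (Suc N). (cmod (f Y))\<^sup>2) = - (\<Sum>Y\<in>level X (Suc N). flux f Y)"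
        using flux_identity[OF f, of "Suc N"] X0 by linarith
      finally show "\<bar>Im z\<bar> * (cmod (f Y))\<^sup>2 \<le> c * (2 * s N + s (Suc N))"
        using bound[of N] by (simp only: abs_minus_cancel)
    qed
  qed
  then show ?thesis using z by (simp add: mult_le_0_iff)
qed

lemma Jop_complex:
  fixes f :: "vertex \<Rightarrow> complex"
  assumes Y: "Y \<in> subtree X" and X: "X \<noteq> []"
  shows "Jop \<mu> \<kappa> X f Y = of_real (Vpot \<mu> (\<lambda>_. 0) Y) * f Y
     + (if Y = X then 0 else of_real (sqrt (Wpot \<mu> Y)) * f (tl Y)) + (\<Sum>j\<in>UNIV. of_real (sqrt (Wpot \<mu> (j # Y))) * f (j # Y))"
  using assms subtree_neq_root[OF Y X] by (simp add: Jop_def Vpot_def scaleR_conv_of_real)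

text \<open>A difference of two preimages vanishes outside the subtree, in particular at the parent
  of \<open>X\<close>; hence it is an eigenfunction without incoming flux. This makes
  \<open>inv_into\<close> in the resolvent a genuine inverse.\<close>

lemma resolvent_inj:
  assumes X: "X \<noteq> []" and z: "Im z \<noteq> 0"
  shows "inj_on (\<lambda>f Y. Jop \<mu> \<kappa> X f Y - z * f Y) (ell2 (subtree X))"
proof (rule inj_onI)
  fix f g :: "vertex \<Rightarrow> complex"
  assume f: "f \<in> ell2 (subtree X)" and g: "g \<in> ell2 (subtree X)"
    and eq: "(\<lambda>Y. Jop \<mu> \<kappa> X f Y - z * f Y) = (\<lambda>Y. Jop \<mu> \<kappa> X g Y - z * g Y)"
  define h where "h Y = f Y - g Y" for Y
  have out: "h Y = 0" if "Y \<notin> subtree X" for Y using f g that by (simp add: h_def ell2_def)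
  note hX = out[OF parent_notin_subtree[OF X]]
  have "generalized_eigenfunction X z h"
    unfolding generalized_eigenfunction_def
  proof
    fix Y assume Y: "Y \<in> subtree X"
    have p: "(if Y = X then 0 else of_real (sqrt (Wpot \<mu> Y)) * f (tl Y)) - (if Y = X then 0 else of_real (sqrt (Wpot \<mu> Y)) * g (tl Y))
      = of_real (sqrt (Wpot \<mu> Y)) * h (tl Y)" using hX by (simp add: h_def algebra_simps)
    have "Jop \<mu> \<kappa> X f Y - z * f Y = Jop \<mu> \<kappa> X g Y - z * g Y" using eq by (rule fun_cong)
    then have "z * h Y = of_real (Vpot \<mu> (\<lambda>_. 0) Y) * h Y
        + ((if Y = X then 0 else of_real (sqrt (Wpot \<mu> Y)) * f (tl Y)) - (if Y = X then 0 else of_real (sqrt (Wpot \<mu> Y)) * g (tl Y)))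
        + (\<Sum>j\<in>UNIV. of_real (sqrt (Wpot \<mu> (j # Y))) * h (j # Y))"
      unfolding Jop_complex[OF Y X] h_def sum_side by algebra
    then show "z * h Y = of_real (Vpot \<mu> (\<lambda>_. 0) Y) * h Y + of_real (sqrt (Wpot \<mu> Y)) * h (tl Y)
        + (\<Sum>j\<in>UNIV. of_real (sqrt (Wpot \<mu> (j # Y))) * h (j # Y))" unfolding p .
  qed
  moreover have "(\<lambda>Y. (cmod (h Y))\<^sup>2) summable_on subtree X"
  proof (rule summable_on_comparison_test)
    show "(\<lambda>Y. 2 * (cmod (f Y))\<^sup>2 + 2 * (cmod (g Y))\<^sup>2) summable_on subtree X"
      using f g by (intro summable_on_add summable_on_cmult_right) (auto simp: ell2_def)
    show "(cmod (h Y))\<^sup>2 \<le> 2 * (cmod (f Y))\<^sup>2 + 2 * (cmod (g Y))\<^sup>2" for Y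
    proof -
      have "(cmod (h Y))\<^sup>2 \<le> (cmod (f Y) + cmod (g Y))\<^sup>2"
        unfolding h_def by (intro power_mono norm_triangle_ineq4) simp
      also have "\<dots> \<le> 2 * (cmod (f Y))\<^sup>2 + 2 * (cmod (g Y))\<^sup>2"
        using sum_squares_bound[of "cmod (f Y)" "cmod (g Y)"] by (simp add: power2_sum)
      finally show ?thesis .
    qed
  qed simp
  ultimately have "h Y = 0" for Y
    using ell2_eigenfunction_0[of X z h, OF _ z X _ hX] out by blast
  then show "f = g" by (auto simp: h_def fun_eq_iff)
qed

definition normalized_L :: "complex \<Rightarrow> vertex \<Rightarrow> complex" where
  "normalized_L z Y = of_real (inverse (mfac \<mu> Y)) * Lfun \<mu> (Pi_ix Y) z"

lemma inverse_mfac_Cons: "inverse (mfac \<mu> (i # Y)) = sqrt (Wpot \<mu> (i # Y)) * inverse (mfac \<mu> Y)"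
  by (simp add: mfac_Cons field_simps)

text \<open>The recurrence for \<open>Lfun\<close> has weight 1 towards the parent and
  \<open>Wpot\<close> towards the children. Division by \<open>mfac\<close> splits this evenly into
  square roots and makes the operator symmetric.\<close>

lemma normalized_L_eigenfunction:
  assumes X: "X \<noteq> []" and z: "Im z \<noteq> 0"
  shows "generalized_eigenfunction X z (normalized_L z)"
  unfolding generalized_eigenfunction_def
proof
  fix Y assume "Y \<in> subtree X"
  then obtain i Z where Y: "Y = i # Z" using subtree_neq_root[OF _ X] by (cases Y) auto
  let ?c = "complex_of_real (inverse (mfac \<mu> Y))"
  have zK: "z \<notin> of_real ` support_hull" using z by auto
  have "z * Lfun \<mu> (Pi_ix Y) z = Lfun \<mu> (Pi_ix Z) z + of_real (Vpot \<mu> (\<lambda>_. 0) Y) * Lfun \<mu> (Pi_ix Y) z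
    + (\<Sum>j\<in>UNIV. of_real (Wpot \<mu> (j # Y)) * Lfun \<mu> (Pi_ix (j # Y)) z)"
    using Lfun_recurrence[of "Pi_ix Z" z i, OF Pi_ix_pos zK] by (simp add: Y Vpot_def Wpot_Cons)
  then have a: "z * (?c * Lfun \<mu> (Pi_ix Y) z) = ?c * Lfun \<mu> (Pi_ix Z) z + of_real (Vpot \<mu> (\<lambda>_. 0) Y) * (?c * Lfun \<mu> (Pi_ix Y) z)
    + (\<Sum>j\<in>UNIV. ?c * (of_real (Wpot \<mu> (j # Y)) * Lfun \<mu> (Pi_ix (j # Y)) z))"
    unfolding sum_distrib_left[symmetric] by algebra
  have b: "?c * Lfun \<mu> (Pi_ix Z) z = of_real (sqrt (Wpot \<mu> Y)) * normalized_L z (tl Y)"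
    unfolding Y inverse_mfac_Cons by (simp add: normalized_L_def)
  have c: "?c * (of_real (Wpot \<mu> (j # Y)) * Lfun \<mu> (Pi_ix (j # Y)) z) = of_real (sqrt (Wpot \<mu> (j # Y))) * normalized_L z (j # Y)" for j
  proof -
    have "complex_of_real (Wpot \<mu> (j # Y)) = of_real (sqrt (Wpot \<mu> (j # Y))) * of_real (sqrt (Wpot \<mu> (j # Y)))"
      using Wpot_pos[of "j # Y"] by (simp flip: of_real_mult)
    then show ?thesis unfolding normalized_L_def inverse_mfac_Cons of_real_mult by algebra
  qed
  show "z * normalized_L z Y = of_real (Vpot \<mu> (\<lambda>_. 0) Y) * normalized_L z Y
     + of_real (sqrt (Wpot \<mu> Y)) * normalized_L z (tl Y) + (\<Sum>j\<in>UNIV. of_real (sqrt (Wpot \<mu> (j # Y))) * normalized_L z (j # Y))"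
    using a unfolding b c normalized_L_def[symmetric] by (simp only: add_ac)
qed

text \<open>The flux through the edge equals its weight \<open>Wpot\<close> times |l|^2 Im M, where
  l is the value at the parent.\<close>

lemma flux_normalized_L_nonneg:
  assumes z: "Im z > 0"
  shows "flux (normalized_L z) (i # Y) \<ge> 0"
proof -
  have L0: "Lfun \<mu> (Pi_ix Y) z \<noteq> 0" using z by (intro Lfun_nonzero Pi_ix_pos) auto
  define l where "l = normalized_L z Y"
  define w where "w = sqrt (Wpot \<mu> (i # Y))"
  have "normalized_L z (i # Y) = - (of_real w * l * Mfun (Pi_ix Y) i z)"
    using L0 unfolding normalized_L_def l_def w_def inverse_mfac_Cons Mfun_def by (simp add: field_simps)
  then have "flux (normalized_L z) (i # Y) = w * Im (- (l * cnj l * of_real w * cnj (Mfun (Pi_ix Y) i z)))"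
    unfolding flux_def w_def[symmetric] by (simp add: l_def[symmetric] mult_ac)
  also have "l * cnj l * of_real w = of_real ((cmod l)\<^sup>2 * w)" by (simp only: complex_norm_square of_real_mult)
  finally have "flux (normalized_L z) (i # Y) = w * ((cmod l)\<^sup>2 * w * Im (Mfun (Pi_ix Y) i z))" by simp
  moreover have "w \<ge> 0" using Wpot_pos[of "i # Y"] by (simp add: w_def less_imp_le)
  moreover have "Im (Mfun (Pi_ix Y) i z) \<ge> 0" using Im_Mfun_pos[of "Pi_ix Y" z i, OF Pi_ix_pos z] by simp
  ultimately show ?thesis by (metis mult_nonneg_nonneg zero_le_power2)
qed

text \<open>The flux has the right sign only in the upper half-plane; the lower one follows by
  conjugation, which preserves absolute values.\<close>

lemma normalized_L_summable:
  assumes X: "X \<noteq> []" and z: "Im z \<noteq> 0"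
  shows "(\<lambda>Y. (cmod (normalized_L z Y))\<^sup>2) summable_on subtree X"
proof -
  have up: "(\<lambda>Y. (cmod (normalized_L w Y))\<^sup>2) summable_on subtree X" if "Im w > 0" for w
  proof (rule positive_flux_ell2[OF normalized_L_eigenfunction[OF X]])
    show "flux (normalized_L w) Y \<ge> 0" if "Y \<in> subtree X" for Y
      using subtree_neq_root[OF that X] flux_normalized_L_nonneg[OF \<open>Im w > 0\<close>] by (cases Y) auto
  qed (use that in auto)
  have "cmod (normalized_L (cnj z) Y) = cmod (normalized_L z Y)" for Y
    by (simp add: normalized_L_def Lfun_eq cform_cnj norm_mult)
  then show ?thesis using up[of z] up[of "cnj z"] z by (cases "Im z > 0") simp_all
qed

text \<open>Cutting the eigenfunction off outside the subtree loses only the parent term at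
  \<open>X\<close>, so the result is a multiple of the resolvent applied to
  \<open>kron X\<close>.\<close>

lemma Green_eq:
  assumes X: "X = i # P" and z: "Im z \<noteq> 0" and Y: "Y \<in> subtree X"
  shows "Green \<mu> \<kappa> Y X z = of_real (mfac \<mu> X / mfac \<mu> Y) * (- Lfun \<mu> (Pi_ix Y) z / Lfun \<mu> (Pi_ix P) z)"
proof -
  have X0: "X \<noteq> []" using X by simp
  have L0: "Lfun \<mu> (Pi_ix P) z \<noteq> 0" using z by (intro Lfun_nonzero Pi_ix_pos) auto
  \<comment> \<open>Normalizes the lost parent term to 1, using sqrt W_X * m_X = m_P.\<close>
  define c where "c = - (of_real (mfac \<mu> X) / Lfun \<mu> (Pi_ix P) z)"
  define u where "u Y = (if Y \<in> subtree X then c * normalized_L z Y else 0)" for Y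
  have u: "u \<in> ell2 (subtree X)"
  proof -
    have "(\<lambda>Y. (cmod c)\<^sup>2 * (cmod (normalized_L z Y))\<^sup>2) summable_on subtree X"
      by (intro summable_on_cmult_right normalized_L_summable X0 z)
    then have "(\<lambda>Y. (cmod (u Y))\<^sup>2) summable_on subtree X"
      by (rule summable_on_cong[THEN iffD1, rotated]) (simp add: u_def norm_mult power_mult_distrib)
    then show ?thesis by (simp add: ell2_def u_def)
  qed
  have "(\<lambda>Y. Jop \<mu> \<kappa> X u Y - z * u Y) = kron X"
  proof
    fix Y
    show "Jop \<mu> \<kappa> X u Y - z * u Y = kron X Y"
    proof (cases "Y \<in> subtree X")
      case True
      have e: "z * normalized_L z Y = of_real (Vpot \<mu> (\<lambda>_. 0) Y) * normalized_L z Y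
        + of_real (sqrt (Wpot \<mu> Y)) * normalized_L z (tl Y) + (\<Sum>j\<in>UNIV. of_real (sqrt (Wpot \<mu> (j # Y))) * normalized_L z (j # Y))"
        using normalized_L_eigenfunction[OF X0 z] True by (simp add: generalized_eigenfunction_def)
      have uY: "u Y = c * normalized_L z Y" "u (j # Y) = c * normalized_L z (j # Y)" for j
        using True subtree_child[OF True] by (simp_all add: u_def)
      have "Jop \<mu> \<kappa> X u Y - z * u Y = (if Y = X then 0 else of_real (sqrt (Wpot \<mu> Y)) * u (tl Y)) - c * (of_real (sqrt (Wpot \<mu> Y)) * normalized_L z (tl Y))"
        unfolding Jop_complex[OF True X0] uY using e unfolding sum_side by algebra
      also have "\<dots> = kron X Y"
      proof (cases "Y = X")
        case False
        then have "u (tl Y) = c * normalized_L z (tl Y)" using subtree_parent[OF True] by (simp add: u_def)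
        then show ?thesis using False by (simp add: kron_def)
      next
        case True
        have "sqrt (Wpot \<mu> X) * inverse (mfac \<mu> P) * mfac \<mu> X = 1"
          using mfac_pos[of P] Wpot_pos[of X] unfolding X mfac_Cons by (simp add: field_simps)
        then have "complex_of_real (sqrt (Wpot \<mu> X)) * of_real (inverse (mfac \<mu> P)) * of_real (mfac \<mu> X) = 1"
          by (metis of_real_mult of_real_1)
        then have "- (c * (of_real (sqrt (Wpot \<mu> X)) * normalized_L z (tl X))) = 1"
          using L0 by (simp add: c_def normalized_L_def X mult_ac)
        then show ?thesis using True by (simp add: kron_def)
      qed
      finally show ?thesis .
    next
      case False
      then show ?thesis by (auto simp: Jop_def u_def kron_def)
    qed
  qed
  then have "resolvent \<mu> \<kappa> X z (kron X) = u"
    unfolding resolvent_def using inv_into_f_f[OF resolvent_inj[OF X0 z, of \<kappa>] u] by simp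
  then have "Green \<mu> \<kappa> Y X z = (\<Sum>\<^sub>\<infinity>Z\<in>subtree X. u Z * cnj (kron Y Z))" by (simp add: Green_def ell2_inner_def)
  also have "\<dots> = (\<Sum>\<^sub>\<infinity>Z\<in>{Y}. u Z * cnj (kron Y Z))"
    by (rule infsum_cong_neutral) (use Y in \<open>auto simp: kron_def\<close>)
  also have "\<dots> = u Y" by (simp add: kron_def)
  also have "\<dots> = of_real (mfac \<mu> X / mfac \<mu> Y) * (- Lfun \<mu> (Pi_ix Y) z / Lfun \<mu> (Pi_ix P) z)"
    using Y by (simp add: u_def c_def normalized_L_def field_simps)
  finally show ?thesis .
qed

end

section \<open>Generalized eigenfunctions\<close>

context angelesco_system
begin

lemma second_kind_mult_ident: "poly (second_kind k (pCons 0 p)) x = x * poly (second_kind k p) x + (LINT t|\<mu> k. poly p t)"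
proof -
  have i: "integrable (\<mu> k) (\<lambda>t. x * poly (synthetic_div p t) x)"
    unfolding poly_synthetic_div_sum by simp
  show ?thesis
    unfolding integral_synthetic_div[symmetric] integral_mult_right_zero[symmetric]
      Bochner_Integration.integral_add[OF i integrable_poly, symmetric]
    by (intro Bochner_Integration.integral_cong refl) (simp add: synthetic_div_pCons)
qed

lemma second_kind_add: "poly (second_kind k (p + q)) x = poly (second_kind k p) x + poly (second_kind k q) x"
  and second_kind_smult: "poly (second_kind k (smult a p)) x = a * poly (second_kind k p) x"
  using second_kind_linear[of k 1 p 1 q x] second_kind_linear[of k a p 0 0 x] by simp_all

text \<open>Multiplying by x changes the second kind polynomials by the zeroth moment, which
  vanishes because the index has size at least 2.\<close>

lemma typeI_0_recurrence:
  assumes n0: "\<And>k. n0 k > 0"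
  shows "x * typeI_0 \<mu> (inc n0 i) x = typeI_0 \<mu> n0 x + rec_b \<mu> n0 i * typeI_0 \<mu> (inc n0 i) x
    + (\<Sum>j\<in>UNIV. rec_a \<mu> (inc n0 i) j * typeI_0 \<mu> (inc (inc n0 i) j) x)"
proof -
  let ?n = "inc n0 i"
  have N: "msize n0 > 0" by (rule msize_pos[of n0 I1, OF n0])
  have rec: "pCons 0 (typeI \<mu> ?n k) = typeI \<mu> n0 k + smult (rec_b \<mu> n0 i) (typeI \<mu> ?n k)
      + (smult (rec_a \<mu> ?n I1) (typeI \<mu> (inc ?n I1) k) + smult (rec_a \<mu> ?n I2) (typeI \<mu> (inc ?n I2) k))" for k
    using typeI_recurrence[of n0 i k, OF n0] by (simp add: sum_side)
  have "(\<Sum>k\<in>UNIV. LINT t|\<mu> k. poly (typeI \<mu> ?n k) t) = pairing \<mu> (typeI \<mu> ?n) 1" by (simp add: pairing_def)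
  also have "\<dots> = 0" using N by (intro typeI_orthogonal) auto
  finally have "x * typeI_0 \<mu> ?n x = (\<Sum>k\<in>UNIV. poly (second_kind k (pCons 0 (typeI \<mu> ?n k))) x)"
    by (simp add: second_kind_mult_ident sum.distrib typeI_0_eq typeI_0_poly_def poly_sum sum_distrib_left)
  also have "\<dots> = typeI_0 \<mu> n0 x + rec_b \<mu> n0 i * typeI_0 \<mu> ?n x
    + (rec_a \<mu> ?n I1 * typeI_0 \<mu> (inc ?n I1) x + rec_a \<mu> ?n I2 * typeI_0 \<mu> (inc ?n I2) x)"
    unfolding rec second_kind_add second_kind_smult
    by (simp add: typeI_0_eq typeI_0_poly_def poly_sum sum_side algebra_simps)
  finally show ?thesis by (simp add: sum_side)
qed

text \<open>For fixed \<open>n\<close> the function is linear in the triple formed by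
  \<open>typeI_0\<close> and both type I components at the second index, and all three satisfy the
  same recurrence.\<close>

lemma sfun_real_recurrence:
  assumes n0: "\<And>k. n0 k > 0"
  shows "x * sfun_real n (inc n0 i) k x = sfun_real n n0 k x + rec_b \<mu> n0 i * sfun_real n (inc n0 i) k x
    + (\<Sum>j\<in>UNIV. rec_a \<mu> (inc n0 i) j * sfun_real n (inc (inc n0 i) j) k x)"
proof -
  let ?m = "inc n0 i"
  have A: "x * poly (typeI \<mu> ?m k) x = poly (typeI \<mu> n0 k) x + rec_b \<mu> n0 i * poly (typeI \<mu> ?m k) x
      + (rec_a \<mu> ?m I1 * poly (typeI \<mu> (inc ?m I1) k) x + rec_a \<mu> ?m I2 * poly (typeI \<mu> (inc ?m I2) k) x)" for k
    using arg_cong[OF typeI_recurrence[of n0 i k, OF n0], of "\<lambda>p. poly p x"] by (simp add: sum_side)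
  note A0 = typeI_0_recurrence[of n0 x i, OF n0, unfolded sum_side]
  have lin: "sfun_real n m k x = poly (typeI \<mu> n k) x * typeI_0 \<mu> m x
      + (poly (typeI \<mu> n (other k)) x * markov (\<mu> (other k)) x - typeI_0 \<mu> n x) * poly (typeI \<mu> m k) x
      - (poly (typeI \<mu> n k) x * markov (\<mu> (other k)) x) * poly (typeI \<mu> m (other k)) x" for m
    by (simp add: sfun_real_def algebra_simps)
  have comm: "x * (a * u + b * v - c * w) = a * (x * u) + b * (x * v) - c * (x * w)" for a b c u v w :: real
    by (simp add: algebra_simps)
  show ?thesis unfolding sum_side lin comm A A0 by (simp add: algebra_simps)
qed

end

locale angelesco_vertex = angelesco_edge \<mu> "Pi_ix P" i \<rho> for \<mu> P i \<rho> +
  fixes \<kappa> :: "side \<Rightarrow> real"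
begin

abbreviation "X \<equiv> i # P"

text \<open>The factor \<open>mfac\<close> at the parent cancels against the one in the bracket,
  leaving the function s_Y on the interval that contains \<open>x\<close>.\<close>

lemma Psi_tilde_eq:
  assumes x: "x \<in> Delta \<mu> k"
  shows "Psi_tilde \<mu> X x Y = mfac \<mu> X / mfac \<mu> Y * sfun_real (Pi_ix P) (Pi_ix Y) k x"
proof -
  let ?g = "\<lambda>k. bracket (Lam \<mu> k x) (Lam0 \<mu> x) P Y + bracket (Lam \<mu> (other k) x) (Lam \<mu> k x) P Y * markov (\<mu> (other k)) x"
  have "Psi_tilde \<mu> X x Y = mfac \<mu> P * mfac \<mu> X * (\<Sum>k\<in>UNIV. indicator (Delta \<mu> k) x * ?g k)"
    by (simp add: Psi_tilde_def mult.commute)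
  also have "(\<Sum>k\<in>UNIV. indicator (Delta \<mu> k) x * ?g k) = ?g k" by (rule sum_indicator_Delta[OF x])
  also have "?g k = inverse (mfac \<mu> P) * inverse (mfac \<mu> Y) * sfun_real (Pi_ix P) (Pi_ix Y) k x"
    unfolding bracket_def Lam_def Lam0_def sfun_real_def by algebra
  finally show ?thesis using mfac_pos[of P] by (simp add: field_simps)
qed

lemma Sfun_eq: "x \<in> Delta \<mu> k \<Longrightarrow> Sfun \<mu> X x = sfun_real (Pi_ix P) (inc (Pi_ix P) i) k x"
  using mfac_pos[of X] by (simp add: Sfun_def Psi_tilde_eq)

lemma Psi_tilde_0: "x \<notin> support_hull \<Longrightarrow> Psi_tilde \<mu> X x Y = 0"
  by (simp add: Psi_tilde_def not_in_hull_Delta)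

lemma Sfun_measurable: "Sfun \<mu> X \<in> borel_measurable borel"
proof -
  have "Sfun \<mu> X = (\<lambda>x. \<Sum>k\<in>UNIV. indicator (Delta \<mu> k) x * sfun_real (Pi_ix P) (inc (Pi_ix P) i) k x)"
  proof
    fix x
    show "Sfun \<mu> X x = (\<Sum>k\<in>UNIV. indicator (Delta \<mu> k) x * sfun_real (Pi_ix P) (inc (Pi_ix P) i) k x)"
    proof (cases "x \<in> support_hull")
      case True
      then obtain k where k: "x \<in> Delta \<mu> k" using in_hull_cases[of x] by blast
      show ?thesis unfolding sum_indicator_Delta[OF k] by (rule Sfun_eq[OF k])
    next
      case False
      then show ?thesis by (simp add: Sfun_def Psi_tilde_0 not_in_hull_Delta)
    qed
  qed
  then show ?thesis by simp
qed

lemma Psi_eq: "Psi \<mu> X x Y = mfac \<mu> X / mfac \<mu> Y * psi (Pi_ix Y) x"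
proof (cases "x \<in> support_hull")
  case True
  then obtain k where k: "x \<in> Delta \<mu> k" using in_hull_cases[of x] by blast
  show ?thesis unfolding Psi_def Sfun_eq[OF k] Psi_tilde_eq[OF k] psi_eq[OF k] by (simp add: field_simps)
next
  case False
  then show ?thesis by (simp add: Psi_def Psi_tilde_0 psi_def not_in_hull_Delta)
qed

lemma Psi_integrable: "integrable \<rho> (\<lambda>x. Psi \<mu> X x Y)"
  unfolding Psi_eq by (intro integrable_mult_right psi_integrable)

lemma msize_subtree: "Y \<in> subtree X \<Longrightarrow> msize (Pi_ix Y) = Suc (msize (Pi_ix P)) + (length Y - length X)"
proof -
  assume "Y \<in> subtree X"
  then obtain zs where Y: "Y = zs @ X" by (auto simp: mem_subtree_iff)
  have "msize (Pi_ix (zs @ X)) = Suc (msize (Pi_ix P)) + length zs" by (induction zs) auto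
  then show ?thesis by (simp add: Y)
qed

lemma Green_cauchy_tr:
  assumes z: "Im z \<noteq> 0" and Y: "Y \<in> subtree X"
  shows "Green \<mu> \<kappa> Y X z = cauchy_tr \<rho> (\<lambda>x. Psi \<mu> X x Y) z"
proof -
  have zK: "z \<notin> of_real ` support_hull" using z by auto
  have "cauchy_tr \<rho> (\<lambda>x. Psi \<mu> X x Y) z = of_real (mfac \<mu> X / mfac \<mu> Y) * cauchy_tr \<rho> (psi (Pi_ix Y)) z"
    unfolding cauchy_tr_def Psi_eq of_real_mult times_divide_eq_right[symmetric] integral_mult_right_zero ..
  then show ?thesis
    unfolding Green_eq[OF refl z Y] using Lfun_quotient_representation[OF _ zK, of "Pi_ix Y"] msize_subtree[OF Y] by simp
qed

text \<open>The diagonal Green function is \<open>Mfun\<close>, so \<open>\<rho>\<close> qualifies;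
  any other candidate has the same transform on the upper half-plane.\<close>

lemma spectral_measure_eq: "spectral_measure \<mu> \<kappa> X = \<rho>"
  unfolding spectral_measure_def
proof (rule the_equality)
  have G: "Green \<mu> \<kappa> X X z = cauchy_tr \<rho> (\<lambda>_. 1) z" if "Im z \<noteq> 0" for z
  proof -
    have zK: "z \<notin> of_real ` support_hull" using that by auto
    show ?thesis unfolding Green_eq[OF refl that subtree_self] using Mfun_rho[OF zK] mfac_pos[of X] by (simp add: Mfun_def)
  qed
  show "is_spectral_measure \<mu> \<kappa> X \<rho>"
    unfolding is_spectral_measure_def using G R.finite_measure_axioms by (simp add: cauchy_tr_def)
  fix \<sigma> assume \<sigma>: "is_spectral_measure \<mu> \<kappa> X \<sigma>"
  then have "finite_borel_measure \<sigma>"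
    by (simp add: is_spectral_measure_def finite_borel_measure_def finite_borel_measure_axioms_def)
  then show "\<sigma> = \<rho>"
  proof (rule cauchy_tr_unique[OF _ rho])
    fix z :: complex assume "Im z > 0"
    then show "cauchy_tr \<sigma> (\<lambda>_. 1) z = cauchy_tr \<rho> (\<lambda>_. 1) z"
      using \<sigma> G[of z] by (simp add: is_spectral_measure_def cauchy_tr_def)
  qed
qed

text \<open>Test functions that vanish at infinity are bounded, which is all that Stieltjes
  inversion asks of them.\<close>

lemma Psi_weak_star_limit:
  assumes Y: "Y \<in> subtree X"
  shows "weak_star_limit (\<lambda>y x. Im (Green \<mu> \<kappa> Y X (Complex x y))) \<rho> (\<lambda>x. pi * Psi \<mu> X x Y)"
  unfolding weak_star_limit_def
proof (intro conjI allI impI)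
  show "integrable \<rho> (\<lambda>x. pi * Psi \<mu> X x Y)" by (intro integrable_mult_right Psi_integrable)
  fix f :: "real \<Rightarrow> real" assume f: "continuous_on UNIV f \<and> (f \<longlongrightarrow> 0) at_infinity"
  have "eventually (\<lambda>x. dist (f x) 0 < 1) at_infinity" using f by (auto dest: tendstoD[where e=1])
  then obtain b where b: "\<And>x. b \<le> \<bar>x\<bar> \<Longrightarrow> \<bar>f x\<bar> < 1" by (auto simp: eventually_at_infinity)
  have "compact (f ` {- \<bar>b\<bar>..\<bar>b\<bar>})" using f by (intro compact_continuous_image) (auto intro: continuous_on_subset)
  then obtain C where C: "\<And>x. x \<in> {- \<bar>b\<bar>..\<bar>b\<bar>} \<Longrightarrow> \<bar>f x\<bar> \<le> C"
    using compact_imp_bounded[of "f ` {- \<bar>b\<bar>..\<bar>b\<bar>}"] unfolding bounded_iff by fastforce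
  have B: "\<bar>f x\<bar> \<le> max C 1" for x
  proof (cases "b \<le> \<bar>x\<bar>")
    case True
    from b[OF this] show ?thesis by simp
  next
    case False
    then have "x \<in> {- \<bar>b\<bar>..\<bar>b\<bar>}" by auto
    from C[OF this] show ?thesis by simp
  qed
  have G: "Im (Green \<mu> \<kappa> Y X (Complex x y)) = Im (cauchy_tr \<rho> (\<lambda>x. Psi \<mu> X x Y) (Complex x y))" if "y > 0" for x y
    using Green_cauchy_tr[OF _ Y, of "Complex x y"] that by simp
  show "integrable lborel (\<lambda>x. f x * Im (Green \<mu> \<kappa> Y X (Complex x y)))" if "y > 0" for y
    unfolding G[OF that] using f B by (intro R.integrable_mult_Im_cauchy_tr[OF Psi_integrable _ _ that, where B="max C 1"]) auto
  have "((\<lambda>y. LINT x|lborel. f x * Im (cauchy_tr \<rho> (\<lambda>x. Psi \<mu> X x Y) (Complex x y))) \<longlongrightarrow> pi * (LINT x|\<rho>. f x * Psi \<mu> X x Y)) (at_right 0)"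
    using f B by (intro R.stieltjes_inversion[OF Psi_integrable, where B="max C 1"]) auto
  also have "pi * (LINT x|\<rho>. f x * Psi \<mu> X x Y) = (LINT x|\<rho>. f x * (pi * Psi \<mu> X x Y))"
    unfolding integral_mult_right_zero[symmetric] by (simp add: mult_ac)
  finally have lim: "((\<lambda>y. LINT x|lborel. f x * Im (cauchy_tr \<rho> (\<lambda>x. Psi \<mu> X x Y) (Complex x y)))
    \<longlongrightarrow> (LINT x|\<rho>. f x * (pi * Psi \<mu> X x Y))) (at_right 0)" .
  show "((\<lambda>y. LINT x|lborel. f x * Im (Green \<mu> \<kappa> Y X (Complex x y))) \<longlongrightarrow> (LINT x|\<rho>. f x * (pi * Psi \<mu> X x Y))) (at_right 0)"
    by (rule Lim_transform_eventually[OF lim]) (use eventually_at_right_less[of 0] in eventually_elim, simp only: G)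
qed

text \<open>At fixed \<open>x\<close> the values are a multiple of s_Y / m_Y, and the factor 1 / m_Y
  symmetrizes the recurrence for s_Y.\<close>

lemma Psi_eigenfunction:
  assumes x: "x \<in> Delta \<mu> k" and Y: "Y \<in> subtree X"
  shows "Jop \<mu> \<kappa> X (Psi \<mu> X x) Y = x * Psi \<mu> X x Y"
proof -
  let ?n = "Pi_ix P"
  obtain j Z where YZ: "Y = j # Z" using subtree_neq_root[OF Y] by (cases Y) auto
  define c where "c = mfac \<mu> X / sfun_real ?n (inc ?n i) k x"
  define h where "h Y = inverse (mfac \<mu> Y) * sfun_real ?n (Pi_ix Y) k x" for Y
  have Psi: "Psi \<mu> X x Y = c * h Y" for Y
    unfolding Psi_eq psi_eq[OF x] by (simp add: c_def h_def field_simps)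
  have rec: "x * sfun_real ?n (Pi_ix Y) k x = sfun_real ?n (Pi_ix Z) k x + Vpot \<mu> \<kappa> Y * sfun_real ?n (Pi_ix Y) k x
     + (\<Sum>j\<in>UNIV. Wpot \<mu> (j # Y) * sfun_real ?n (Pi_ix (j # Y)) k x)"
    using sfun_real_recurrence[of "Pi_ix Z" x ?n j k, OF Pi_ix_pos] by (simp add: YZ Vpot_def Wpot_Cons)
  have hZ: "inverse (mfac \<mu> Y) * sfun_real ?n (Pi_ix Z) k x = sqrt (Wpot \<mu> Y) * h Z"
    unfolding YZ inverse_mfac_Cons by (simp add: h_def)
  have hc: "inverse (mfac \<mu> Y) * (Wpot \<mu> (j # Y) * sfun_real ?n (Pi_ix (j # Y)) k x) = sqrt (Wpot \<mu> (j # Y)) * h (j # Y)" for j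
  proof -
    have "Wpot \<mu> (j # Y) = sqrt (Wpot \<mu> (j # Y)) * sqrt (Wpot \<mu> (j # Y))" using Wpot_pos[of "j # Y"] by simp
    then show ?thesis unfolding h_def inverse_mfac_Cons by algebra
  qed
  have e: "x * h Y = sqrt (Wpot \<mu> Y) * h Z + Vpot \<mu> \<kappa> Y * h Y + (\<Sum>j\<in>UNIV. sqrt (Wpot \<mu> (j # Y)) * h (j # Y))"
    unfolding hZ[symmetric] hc[symmetric] unfolding h_def sum_distrib_left[symmetric]
    using rec by algebra
  \<comment> \<open>By antisymmetry s vanishes when both indices agree, so dropping the parent term
    at \<open>X\<close> costs nothing.\<close>
  have "Y = X \<Longrightarrow> h Z = 0" by (simp add: YZ h_def sfun_real_def)
  then have p: "(if Y = X then 0 else sqrt (Wpot \<mu> Y) *\<^sub>R Psi \<mu> X x (tl Y)) = c * (sqrt (Wpot \<mu> Y) * h Z)"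
    by (simp add: Psi YZ)
  have "Jop \<mu> \<kappa> X (Psi \<mu> X x) Y = Vpot \<mu> \<kappa> Y * (c * h Y) + c * (sqrt (Wpot \<mu> Y) * h Z) + (\<Sum>j\<in>UNIV. sqrt (Wpot \<mu> (j # Y)) * (c * h (j # Y)))"
    unfolding Jop_def p using Y by (simp add: Psi)
  also have "\<dots> = c * (x * h Y)" unfolding e sum_side by (simp add: algebra_simps)
  finally show ?thesis by (simp add: Psi)
qed

text \<open>The total integral is the limit of - z times the transform. For a vertex
  \<open>d\<close> levels below \<open>X\<close> the quotient of forms makes this limit that of
  z^(-d): 1 at \<open>X\<close> and 0 below.\<close>

lemma Psi_integral:
  assumes Y: "Y \<in> subtree X"
  shows "kron X Y = (LINT x|\<rho>. Psi \<mu> X x Y)"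
proof -
  let ?n = "Pi_ix P" and ?m = "Pi_ix Y"
  define d where "d = length Y - length X"
  have sz: "msize ?m = Suc (msize ?n) + d" unfolding d_def by (rule msize_subtree[OF Y])
  have N: "msize ?n > 0" by (rule msize_pos[of ?n I1, OF n_pos])
  have "((\<lambda>z. (z ^ msize ?m * Lfun \<mu> ?m z) / (z ^ msize ?n * Lfun \<mu> ?n z) * inverse z ^ d) \<longlongrightarrow> 1 / 1 * 0 ^ d) at_infinity"
    by (intro tendsto_intros Lfun_asymp tendsto_inverse_0) (use N sz in auto)
  moreover have "eventually (\<lambda>z. (z ^ msize ?m * Lfun \<mu> ?m z) / (z ^ msize ?n * Lfun \<mu> ?n z) * inverse z ^ d
    = - z * cauchy_tr \<rho> (psi ?m) z) at_infinity"
    unfolding eventually_at_infinity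
  proof (intro exI[of _ "hull_bound + 1"] allI impI)
    fix z :: complex assume z: "hull_bound + 1 \<le> norm z"
    have zK: "z \<notin> of_real ` support_hull" using z hull_bound(2) by fastforce
    have z0: "z \<noteq> 0" using z hull_bound(1) by auto
    have "- Lfun \<mu> ?m z / Lfun \<mu> ?n z = cauchy_tr \<rho> (psi ?m) z" using sz by (intro Lfun_quotient_representation zK) simp
    moreover have "(z ^ msize ?m * Lfun \<mu> ?m z) / (z ^ msize ?n * Lfun \<mu> ?n z) * inverse z ^ d = - z * (- Lfun \<mu> ?m z / Lfun \<mu> ?n z)"
      using z0 unfolding sz by (simp add: power_add power_inverse field_simps)
    ultimately show "(z ^ msize ?m * Lfun \<mu> ?m z) / (z ^ msize ?n * Lfun \<mu> ?n z) * inverse z ^ d = - z * cauchy_tr \<rho> (psi ?m) z"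
      by (simp only:)
  qed
  ultimately have "((\<lambda>z. - z * cauchy_tr \<rho> (psi ?m) z) \<longlongrightarrow> 1 / 1 * 0 ^ d) at_infinity" by (rule Lim_transform_eventually)
  moreover have "((\<lambda>z. - z * cauchy_tr \<rho> (psi ?m) z) \<longlongrightarrow> of_real (LINT x|\<rho>. psi ?m x)) at_infinity"
    by (rule R.cauchy_tr_asymp[OF psi_integrable AE_rho_bound])
  ultimately have "1 / 1 * 0 ^ d = complex_of_real (LINT x|\<rho>. psi ?m x)"
    by (rule tendsto_unique[OF trivial_limit_at_infinity])
  then have "complex_of_real (LINT x|\<rho>. psi ?m x) = of_real (0 ^ d)" by simp
  then have int: "(LINT x|\<rho>. psi ?m x) = 0 ^ d" by (simp only: of_real_eq_iff)
  have "d = 0 \<longleftrightarrow> Y = X" using Y by (auto simp: d_def mem_subtree_iff)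
  then show ?thesis
    unfolding Psi_eq integral_mult_right_zero int using mfac_pos[of X] by (simp add: kron_def power_0_left)
qed

lemma Lplus_zeros_eq: "E \<in> typeI_zeros \<mu> (Pi_ix P) \<Longrightarrow> Lplus \<mu> (Pi_ix P) E = of_real (Lreal (Pi_ix P) E)"
  by (intro Lplus_eq typeI_zeros_root)

lemma spectral_measure_formula:
  assumes B: "B \<in> sets borel"
  shows "emeasure \<rho> B = emeasure (density (reference_measure \<mu> (Pi_ix P)) (\<lambda>x. ennreal (Sfun \<mu> X x))) B +
    (\<Sum>E\<in>typeI_zeros \<mu> (Pi_ix P). ennreal (Re (of_real (Qatom \<mu> (Pi_ix X) E) * inverse (Lplus \<mu> (Pi_ix P) E))) * indicator B E)"
proof -
  have Re: "Re (of_real (Qatom \<mu> (Pi_ix X) E) * inverse (Lplus \<mu> (Pi_ix P) E)) = measure \<rho> {E}" if "E \<in> typeI_zeros \<mu> (Pi_ix P)" for E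
    unfolding Lplus_zeros_eq[OF that] rho_atom[OF that] by (simp add: divide_inverse flip: of_real_inverse)
  have s: "(\<Sum>E\<in>typeI_zeros \<mu> (Pi_ix P). ennreal (Re (of_real (Qatom \<mu> (Pi_ix X) E) * inverse (Lplus \<mu> (Pi_ix P) E))) * indicator B E)
    = (\<Sum>E\<in>typeI_zeros \<mu> (Pi_ix P). ennreal (measure \<rho> {E}) * indicator B E)"
    by (intro sum.cong refl) (simp only: Re)
  show ?thesis
    unfolding s reference_measure_eq by (rule emeasure_rho_decomposition[OF B Sfun_measurable Sfun_eq])
qed

lemma Lplus_zeros:
  assumes E: "E \<in> typeI_zeros \<mu> (Pi_ix P)"
  shows "(\<exists>l. l \<noteq> 0 \<and> ((\<lambda>\<epsilon>. Lfun \<mu> (Pi_ix P) (Complex E \<epsilon>)) \<longlongrightarrow> l) (at_right 0)) \<and>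
    of_real (Qatom \<mu> (Pi_ix X) E) * inverse (Lplus \<mu> (Pi_ix P) E) \<in> \<real>\<^sub>\<ge>\<^sub>0"
proof
  show "\<exists>l. l \<noteq> 0 \<and> ((\<lambda>\<epsilon>. Lfun \<mu> (Pi_ix P) (Complex E \<epsilon>)) \<longlongrightarrow> l) (at_right 0)"
    using Lfun_vertical[OF typeI_zeros_root[OF E]] Lreal_zeros_neq_0[OF E] by (intro exI[of _ "of_real (Lreal (Pi_ix P) E)"]) simp
  have "of_real (Qatom \<mu> (Pi_ix X) E) * inverse (Lplus \<mu> (Pi_ix P) E) = complex_of_real (measure \<rho> {E})"
    unfolding Lplus_zeros_eq[OF E] rho_atom[OF E] by (simp add: divide_inverse)
  then show "of_real (Qatom \<mu> (Pi_ix X) E) * inverse (Lplus \<mu> (Pi_ix P) E) \<in> \<real>\<^sub>\<ge>\<^sub>0" by simp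
qed

end

theorem proposition3p3p4:
  fixes \<mu> :: "side \<Rightarrow> real measure" and \<kappa> :: "side \<Rightarrow> real" and X :: vertex
  assumes "angelesco \<mu>"
    and "right_end \<mu> I1 < left_end \<mu> I2"
    and "\<kappa> I1 + \<kappa> I2 = 1"
    and "X \<noteq> tree_root"
  shows
    "(\<forall>E\<in>typeI_zeros \<mu> (Pi_ix (parent X)).
        (\<exists>l. l \<noteq> 0 \<and> ((\<lambda>\<epsilon>. Lfun \<mu> (Pi_ix (parent X)) (Complex E \<epsilon>)) \<longlongrightarrow> l) (at_right 0)) \<and>
        of_real (Qatom \<mu> (Pi_ix X) E) * inverse (Lplus \<mu> (Pi_ix (parent X)) E) \<in> \<real>\<^sub>\<ge>\<^sub>0) \<and>
     (\<forall>B\<in>sets borel.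
        emeasure (spectral_measure \<mu> \<kappa> X) B =
          emeasure (density (reference_measure \<mu> (Pi_ix (parent X))) (\<lambda>x. ennreal (Sfun \<mu> X x))) B +
          (\<Sum>E\<in>typeI_zeros \<mu> (Pi_ix (parent X)).
             ennreal (Re (of_real (Qatom \<mu> (Pi_ix X) E) * inverse (Lplus \<mu> (Pi_ix (parent X)) E))) *
             indicator B E)) \<and>
     (\<forall>Y\<in>subtree X.
        weak_star_limit (\<lambda>y x. Im (Green \<mu> \<kappa> Y X (Complex x y)))
          (spectral_measure \<mu> \<kappa> X) (\<lambda>x. pi * Psi \<mu> X x Y)) \<and>
     (\<forall>x\<in>Delta \<mu> I1 \<union> Delta \<mu> I2. \<forall>Y\<in>subtree X.
        Jop \<mu> \<kappa> X (Psi \<mu> X x) Y = x * Psi \<mu> X x Y) \<and>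
     (\<forall>Y\<in>subtree X.
        integrable (spectral_measure \<mu> \<kappa> X) (\<lambda>x. Psi \<mu> X x Y) \<and>
        kron X Y = (LINT x|spectral_measure \<mu> \<kappa> X. Psi \<mu> X x Y))"
proof -
  interpret angelesco_system \<mu> by unfold_locales (use assms in auto)
  obtain i P where X: "X = i # P" using assms(4) by (cases X) auto
  obtain \<rho> where \<rho>: "finite_borel_measure \<rho>" "AE x in \<rho>. x \<in> support_hull"
    "\<And>z. z \<notin> of_real ` support_hull \<Longrightarrow> Mfun (Pi_ix P) i z = cauchy_tr \<rho> (\<lambda>_. 1) z"
    by (rule Mfun_representation[of "Pi_ix P" i, OF Pi_ix_pos]) blast
  interpret V: angelesco_vertex \<mu> P i \<rho> \<kappa>
    by (intro angelesco_vertex.intro angelesco_edge.intro angelesco_edge_axioms.intro angelesco_system_axioms Pi_ix_pos \<rho>)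
  show ?thesis
    unfolding X list.sel V.spectral_measure_eq
  proof (intro conjI ballI)
    show "\<exists>l. l \<noteq> 0 \<and> ((\<lambda>\<epsilon>. Lfun \<mu> (Pi_ix P) (Complex E \<epsilon>)) \<longlongrightarrow> l) (at_right 0)"
      "of_real (Qatom \<mu> (Pi_ix (i # P)) E) * inverse (Lplus \<mu> (Pi_ix P) E) \<in> \<real>\<^sub>\<ge>\<^sub>0"
      if "E \<in> typeI_zeros \<mu> (Pi_ix P)" for E
      using V.Lplus_zeros[OF that] by simp_all
    show "Jop \<mu> \<kappa> (i # P) (Psi \<mu> (i # P) x) Y = x * Psi \<mu> (i # P) x Y"
      if "x \<in> Delta \<mu> I1 \<union> Delta \<mu> I2" "Y \<in> subtree (i # P)" for x Y
      using that V.Psi_eigenfunction by blast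
  qed (rule V.spectral_measure_formula V.Psi_weak_star_limit V.Psi_integrable V.Psi_integral, assumption?)+
qed

end
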